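(* Let $1\le a<b\le r$ and suppose that \begin{align*} \mu&=(\mu_1,\ldots,\mu_{a-1},\mu_a,\mu_{a+1},\ldots,\mu_{b-1},\mu_b,\mu_{b+1},\ldots,\mu_r), \\ \lambda&=(\mu_1,\ldots,\mu_{a-1},\mu_a+1,\mu_{a+1},\ldots,\mu_{b-1},\mu_b-1,\mu_{b+1},\ldots,\mu_r) \end{align*} are partitions of $n$. If $e \mid \mu_a - \mu_b +b-a+1$, then there exists a non-zero $\mathcal H$-homomorphism $\hat{\Theta}:S^\lambda \rightarrow S^\mu$ with \[\hat{\Theta} = \sum_{A\in \mathcal{T}_0(\lambda,\mu)}f(A)\, \hat{\Theta}_A \] for some $f(A) \in F$.
   Context: $F$ is a field of characteristic $p\ge 0$, $q\in F$ is invertible, $n\ge1$, and $e$ is the least integer $>1$ with $1+q+\dots+q^{e-1}=0$ in $F$, or $e=\infty$ if there is none (in which case $e\mid m$ is false for every positive integer $m$). The symmetric group $\mathfrak S_n$ acts on $\{1,\dots,n\}$ from the right (products are read left to right); $s_i=(i,i+1)$ and $\ell(w)$ is the length of $w$ in the generators $s_i$. $\mathcal H=\mathcal H_{F,q}(\mathfrak S_n)$ is the associative $F$-algebra with basis $\{T_w\mid w\in\mathfrak S_n\}$ and multiplication determined by $T_wT_{s_i}=T_{ws_i}$ if $\ell(ws_i)=\ell(w)+1$ and $T_wT_{s_i}=qT_{ws_i}+(q-1)T_w$ if $\ell(ws_i)=\ell(w)-1$. For a composition $\lambda$ of $n$, the diagram of $\lambda$ is $\{(i,j)\mid i\geq 1,\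 1\le j\le\lambda_i\}$; a $\lambda$-tableau is (unless a type is specified) a filling of it by $1,\dots,n$, on which $\mathfrak S_n$ acts from the right by permuting entries. $\mathfrak t^\lambda$ is the $\lambda$-tableau with $1,\dots,n$ entered in order along the rows, $\mathfrak t_\lambda$ the one with $1,\dots,n$ entered in order down the columns; $w_\lambda$ is defined by $\mathfrak t^\lambda w_\lambda=\mathfrak t_\lambda$. $\mathfrak S_\lambda$ is the row stabilizer of $\mathfrak t^\lambda$, $x_\lambda=\sum_{w\in\mathfrak S_\lambda}T_w$, $y_\lambda=\sum_{w\in\mathfrak S_\lambda}(-q)^{-\ell(w)}T_w$, and $M^\lambda=x_\lambda\mathcal H$. For a partition $\lambda$ with conjugate $\lambda'$, the Specht module is the right $\mathcal H$-module $S^\lambda=x_\lambda T_{w_\lambda}y_{\lambda'}\mathcal H\subseteq M^\lambda$. For compositions $\lambda,\mu$ of $n$, $\mathcal T(\lambda,\mu)$ is the set of $\lambda$-tableaux of type $\mu$ (fillings of the diagram of $\lambda$ with exactly $\mu_i$ entries equal to $i$ for each $i$); $A(a,b)$ is the entry of $A$ in position $(a,b)$. $\mathcal T_0(\lambda,\mu)$ is the subset of semistandard tableaux (entries weakly increasing along rows and strictly increasing down columns). Write $A\sim_r B$ if, for each $i$, row $i$ of $A$ and row $i$ of $B$ contain the same entries with multiplicity. For $A\in\mathcal T(\lambda,\mu)$, $1_A\in\mathfrak S_n$ is the permutation such that $\mathfrak t^\mu 1_A$ is the $\mu$-tableau with increasing rows in which $i$ lies in row $r$ if the position occupied by $i$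 in $\mathfrak t^\lambda$ is occupied by $r$ in $A$. The $\mathcal H$-homomorphism $\Theta_A:M^\lambda\to M^\mu$ is given by $\Theta_A(x_\lambda h)=\big(x_\mu\sum_{A'\sim_rA}T_{1_{A'}}\big)h$ for $h\in\mathcal H$, and $\hat\Theta_A:S^\lambda\to M^\mu$ is its restriction to $S^\lambda$ (for $\lambda$ a partition). *)

theory Defs
  imports
    "HOL-Combinatorics.Combinatorics"
    "HOL-Library.Extended_Nat"
    "HOL-Library.Multiset"
    "HOL-Library.FuncSet"
    "HOL-Library.Function_Algebras"
begin

section \<open>Quantum characteristic\<close>

text \<open>
  In \<^typ>\<open>enat\<close>, divisibility \<^term>\<open>(\<infinity>::enat) dvd enat m\<close> is false for every
  positive \<^term>\<open>m\<close>, and \<^term>\<open>enat k dvd enat m\<close> means \<^term>\<open>k dvd m\<close> if \<^term>\<open>k > 0\<close>;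
  see the two lemmas below.
\<close>

definition quantum_char :: "'f::field \<Rightarrow> enat" where
  "quantum_char q =
     (if \<exists>e>1. (\<Sum>i<e. q ^ i) = 0 then enat (LEAST e. 1 < e \<and> (\<Sum>i<e. q ^ i) = 0) else \<infinity>)"

lemma infinity_dvd_enat: "m > 0 \<Longrightarrow> \<not> (\<infinity>::enat) dvd enat m"
proof
  assume "m > 0" "(\<infinity>::enat) dvd enat m"
  then obtain k where "enat m = \<infinity> * k" by (auto simp: dvd_def)
  moreover have "k = 0 \<or> \<infinity> * k = \<infinity>" by (auto simp: imult_is_infinity)
  ultimately show False using \<open>m > 0\<close> by (auto simp: zero_enat_def)
qed

lemma enat_dvd_enat: "k > 0 \<Longrightarrow> enat k dvd enat m \<longleftrightarrow> k dvd m"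
proof
  assume k: "k > 0" and "enat k dvd enat m"
  then obtain l where l: "enat m = enat k * l" by (auto simp: dvd_def)
  with k show "k dvd m" by (cases l) (auto simp: zero_enat_def)
next
  assume "k dvd m"
  then obtain l where "m = k * l" by (auto simp: dvd_def)
  then have "enat m = enat k * enat l" by simp
  then show "enat k dvd enat m" by (rule dvdI)
qed


section \<open>Symmetric groups, acting from the right\<close>

type_synonym perm = "nat \<Rightarrow> nat"

definition Sym :: "nat \<Rightarrow> perm set" where
  "Sym n = {w. w permutes {1..n}}"

text \<open>Products are read from left to right: first \<^term>\<open>u\<close>, then \<^term>\<open>v\<close>.\<close>

definition pmult :: "perm \<Rightarrow> perm \<Rightarrow> perm" (infixl "\<cdot>" 70) where
  "u \<cdot> v = v \<circ> u"

definition simple_refl :: "nat \<Rightarrow> perm" where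
  "simple_refl i = transpose i (i + 1)"

definition word_perm :: "nat list \<Rightarrow> perm" where
  "word_perm is = foldl (\<lambda>w i. w \<cdot> simple_refl i) id is"

definition word_of :: "nat \<Rightarrow> nat list \<Rightarrow> perm \<Rightarrow> bool" where
  "word_of n is w \<longleftrightarrow> set is \<subseteq> {1..<n} \<and> word_perm is = w"

definition len :: "nat \<Rightarrow> perm \<Rightarrow> nat" where
  "len n w = (LEAST k. \<exists>is. word_of n is w \<and> length is = k)"


section \<open>The Hecke algebra\<close>

text \<open>
  An element is represented by its coefficient function with respect to the basis
  \<open>T\<^sub>w\<close>, extended by zero outside \<^term>\<open>Sym n\<close>.  Sums of elements are the pointwise
  sums of functions; the pointwise product of functions is not used.
\<close>

type_synonym 'f hecke = "perm \<Rightarrow> 'f"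

definition hecke_carrier :: "nat \<Rightarrow> 'f::field hecke set" where
  "hecke_carrier n = {h. \<forall>w. w \<notin> Sym n \<longrightarrow> h w = 0}"

definition hscale :: "'f::field \<Rightarrow> 'f hecke \<Rightarrow> 'f hecke" where
  "hscale c h = (\<lambda>w. c * h w)"

definition T :: "perm \<Rightarrow> 'f::field hecke" where
  "T w = (\<lambda>v. if v = w then 1 else 0)"

definition T_times_simple :: "nat \<Rightarrow> 'f::field \<Rightarrow> perm \<Rightarrow> nat \<Rightarrow> 'f hecke" where
  "T_times_simple n q w i =
     (if len n (w \<cdot> simple_refl i) = len n w + 1 then T (w \<cdot> simple_refl i)
      else hscale q (T (w \<cdot> simple_refl i)) + hscale (q - 1) (T w))"

definition times_simple :: "nat \<Rightarrow> 'f::field \<Rightarrow> 'f hecke \<Rightarrow> nat \<Rightarrow> 'f hecke" where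
  "times_simple n q h i = (\<Sum>w\<in>Sym n. hscale (h w) (T_times_simple n q w i))"

definition reduced_word :: "nat \<Rightarrow> perm \<Rightarrow> nat list" where
  "reduced_word n w = (SOME is. word_of n is w \<and> length is = len n w)"

text \<open>
  The product \<open>h T\<^sub>w\<close> is obtained by multiplying \<open>h\<close> successively by the \<open>T\<^sub>s\<close> along a
  reduced word of \<open>w\<close>, which is forced by the multiplication rule.  By Matsumoto's theorem
  the choice of the reduced word does not matter.
\<close>

definition hmult :: "nat \<Rightarrow> 'f::field \<Rightarrow> 'f hecke \<Rightarrow> 'f hecke \<Rightarrow> 'f hecke" where
  "hmult n q h k = (\<Sum>w\<in>Sym n. hscale (k w) (foldl (times_simple n q) h (reduced_word n w)))"

lemma finite_Sym: "finite (Sym n)"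
  by (simp add: Sym_def finite_permutations)

lemma sum_fun_apply: "(\<Sum>x\<in>A. f x) y = (\<Sum>x\<in>A. f x y)"
  by (induction A rule: infinite_finite_induct) auto

lemma sum_hscale_T:
  assumes "w \<in> Sym n"
  shows "(\<Sum>v\<in>Sym n. hscale (T w v) (g v)) = (g w :: 'f::field hecke)"
proof
  fix u
  have "(\<Sum>v\<in>Sym n. hscale (T w v) (g v)) u = (\<Sum>v\<in>Sym n. if v = w then g v u else 0)"
    unfolding sum_fun_apply by (intro sum.cong) (auto simp: hscale_def T_def)
  then show "(\<Sum>v\<in>Sym n. hscale (T w v) (g v)) u = g w u"
    using assms by (simp add: finite_Sym)
qed

lemma simple_refl_in_Sym:
  assumes "1 \<le> i" "i < n"
  shows "simple_refl i \<in> Sym n"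
  using assms unfolding Sym_def simple_refl_def by (auto intro!: permutes_swap_id)

lemma reduced_word_simple_refl:
  assumes "1 \<le> i" "i < n"
  shows "reduced_word n (simple_refl i) = [i]"
proof -
  have ne: "simple_refl i \<noteq> id"
    unfolding simple_refl_def by (metis Suc_eq_plus1 id_apply n_not_Suc_n transpose_apply_first)
  have 1: "word_of n [i] (simple_refl i)"
    using assms by (auto simp: word_of_def word_perm_def pmult_def)
  have 0: "length is \<noteq> 0" if "word_of n is (simple_refl i)" for "is"
    using that ne by (auto simp: word_of_def word_perm_def)
  have len: "len n (simple_refl i) = 1"
    unfolding len_def
  proof (rule Least_equality)
    show "\<exists>is. word_of n is (simple_refl i) \<and> length is = 1"
      using 1 by (intro exI[of _ "[i]"]) auto
    show "1 \<le> k" if "\<exists>is. word_of n is (simple_refl i) \<and> length is = k" for k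
      using that 0 by (auto simp: Suc_le_eq)
  qed
  have uniq: "is = [i]" if "word_of n is (simple_refl i)" "length is = 1" for "is"
  proof -
    from that(2) obtain j where j: "is = [j]" by (auto simp: length_Suc_conv)
    with that(1) have eq: "transpose j (j + 1) = transpose i (i + 1)"
      by (auto simp: word_of_def word_perm_def pmult_def simple_refl_def)
    have "transpose j (j + 1) i = i + 1" "transpose j (j + 1) (i + 1) = i"
      unfolding eq by simp_all
    then have "i = j"
      by (cases "i = j"; cases "i = j + 1"; cases "i + 1 = j") simp_all
    with j show ?thesis by simp
  qed
  show ?thesis
    unfolding reduced_word_def
  proof (rule some_equality)
    show "word_of n [i] (simple_refl i) \<and> length [i] = len n (simple_refl i)"
      using 1 len by simp
    show "is = [i]" if "word_of n is (simple_refl i) \<and> length is = len n (simple_refl i)" for "is"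
      using that len by (intro uniq) simp_all
  qed
qed

lemma hmult_T_simple_refl:
  assumes "w \<in> Sym n" "1 \<le> i" "i < n"
  shows "hmult n q (T w) (T (simple_refl i)) =
           (if len n (w \<cdot> simple_refl i) = len n w + 1 then T (w \<cdot> simple_refl i)
            else hscale q (T (w \<cdot> simple_refl i)) + hscale (q - 1) (T w))"
  using assms
  by (simp add: hmult_def sum_hscale_T simple_refl_in_Sym reduced_word_simple_refl
      times_simple_def T_times_simple_def)


section \<open>Compositions, diagrams and tableaux\<close>

text \<open>
  Compositions are functions indexed from \<open>1\<close>, with zero parts beyond the last one
  (so trailing zeros are immaterial).
\<close>

definition is_composition :: "nat \<Rightarrow> (nat \<Rightarrow> nat) \<Rightarrow> bool" where
  "is_composition n lam \<longleftrightarrow>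
     lam 0 = 0 \<and> finite {i. lam i \<noteq> 0} \<and> (\<Sum>i | lam i \<noteq> 0. lam i) = n"

definition is_partition :: "nat \<Rightarrow> (nat \<Rightarrow> nat) \<Rightarrow> bool" where
  "is_partition n lam \<longleftrightarrow> is_composition n lam \<and> (\<forall>i\<ge>1. lam (i + 1) \<le> lam i)"

definition diagram :: "(nat \<Rightarrow> nat) \<Rightarrow> (nat \<times> nat) set" where
  "diagram lam = {(i, j). 1 \<le> i \<and> 1 \<le> j \<and> j \<le> lam i}"

definition conjugate :: "(nat \<Rightarrow> nat) \<Rightarrow> nat \<Rightarrow> nat" where
  "conjugate lam j = card {i. (i, j) \<in> diagram lam}"

type_synonym tableau = "nat \<times> nat \<Rightarrow> nat"

text \<open>The entry at a node is its rank in the row reading (column reading) order.\<close>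

definition row_tab :: "(nat \<Rightarrow> nat) \<Rightarrow> tableau" where
  "row_tab lam = (\<lambda>(i, j). card {(k, l) \<in> diagram lam. k < i \<or> (k = i \<and> l \<le> j)})"

definition col_tab :: "(nat \<Rightarrow> nat) \<Rightarrow> tableau" where
  "col_tab lam = (\<lambda>(i, j). card {(k, l) \<in> diagram lam. l < j \<or> (l = j \<and> k \<le> i)})"

definition w_perm :: "nat \<Rightarrow> (nat \<Rightarrow> nat) \<Rightarrow> perm" where
  "w_perm n lam = (THE w. w \<in> Sym n \<and> (\<forall>p\<in>diagram lam. w (row_tab lam p) = col_tab lam p))"

definition row_entries :: "(nat \<Rightarrow> nat) \<Rightarrow> tableau \<Rightarrow> nat \<Rightarrow> nat set" where
  "row_entries lam t i = {t (i, j) | j. (i, j) \<in> diagram lam}"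

definition young_subgroup :: "nat \<Rightarrow> (nat \<Rightarrow> nat) \<Rightarrow> perm set" where
  "young_subgroup n lam =
     {w \<in> Sym n. \<forall>i. w ` row_entries lam (row_tab lam) i = row_entries lam (row_tab lam) i}"

text \<open>
  Tableaux of type \<open>mu\<close>; as \<^term>\<open>mu 0 = 0\<close> for a composition, all entries are positive.
\<close>

definition tableaux :: "(nat \<Rightarrow> nat) \<Rightarrow> (nat \<Rightarrow> nat) \<Rightarrow> tableau set" where
  "tableaux lam mu =
     {A \<in> diagram lam \<rightarrow>\<^sub>E UNIV. \<forall>i. card {p \<in> diagram lam. A p = i} = mu i}"

definition semistandard_tableaux :: "(nat \<Rightarrow> nat) \<Rightarrow> (nat \<Rightarrow> nat) \<Rightarrow> tableau set" where
  "semistandard_tableaux lam mu =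
     {A \<in> tableaux lam mu.
        (\<forall>i j j'. (i, j) \<in> diagram lam \<longrightarrow> (i, j') \<in> diagram lam \<longrightarrow> j < j' \<longrightarrow> A (i, j) \<le> A (i, j')) \<and>
        (\<forall>i i' j. (i, j) \<in> diagram lam \<longrightarrow> (i', j) \<in> diagram lam \<longrightarrow> i < i' \<longrightarrow> A (i, j) < A (i', j))}"

definition row_equiv :: "(nat \<Rightarrow> nat) \<Rightarrow> tableau \<Rightarrow> tableau \<Rightarrow> bool" where
  "row_equiv lam A B \<longleftrightarrow>
     (\<forall>i\<ge>1. image_mset (\<lambda>j. A (i, j)) (mset_set {1..lam i})
          = image_mset (\<lambda>j. B (i, j)) (mset_set {1..lam i}))"


section \<open>Permutation modules, Specht modules and homomorphisms\<close>

definition x_elt :: "nat \<Rightarrow> (nat \<Rightarrow> nat) \<Rightarrow> 'f::field hecke" where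
  "x_elt n lam = (\<Sum>w\<in>young_subgroup n lam. T w)"

definition y_elt :: "nat \<Rightarrow> 'f::field \<Rightarrow> (nat \<Rightarrow> nat) \<Rightarrow> 'f hecke" where
  "y_elt n q lam = (\<Sum>w\<in>young_subgroup n lam. hscale ((- q) powi (- int (len n w))) (T w))"

definition perm_module :: "nat \<Rightarrow> 'f::field \<Rightarrow> (nat \<Rightarrow> nat) \<Rightarrow> 'f hecke set" where
  "perm_module n q lam = {hmult n q (x_elt n lam) h | h. h \<in> hecke_carrier n}"

definition specht_module :: "nat \<Rightarrow> 'f::field \<Rightarrow> (nat \<Rightarrow> nat) \<Rightarrow> 'f hecke set" where
  "specht_module n q lam =
     {hmult n q
        (hmult n q (hmult n q (x_elt n lam) (T (w_perm n lam))) (y_elt n q (conjugate lam))) h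
      | h. h \<in> hecke_carrier n}"

text \<open>
  Homomorphisms of right modules, as functions whose values matter only on the domain
  \<open>V\<close>.  Compatibility with scalars is the case \<open>h = c T\<^sub>1\<close> of the second condition.
\<close>

definition hecke_hom :: "nat \<Rightarrow> 'f::field \<Rightarrow> 'f hecke set \<Rightarrow> 'f hecke set \<Rightarrow> ('f hecke \<Rightarrow> 'f hecke) set" where
  "hecke_hom n q V W =
     {\<phi> \<in> V \<rightarrow> W.
        (\<forall>u\<in>V. \<forall>v\<in>V. \<phi> (u + v) = \<phi> u + \<phi> v) \<and>
        (\<forall>v\<in>V. \<forall>h\<in>hecke_carrier n. \<phi> (hmult n q v h) = hmult n q (\<phi> v) h)}"

text \<open>
  In \<open>one_perm n lam mu A\<close>, the number \<^term>\<open>row_tab lam p\<close> at the node \<open>p\<close> has to lie in row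
  \<^term>\<open>A p\<close> of the \<open>mu\<close>-tableau \<^term>\<open>w \<circ> row_tab mu\<close>, whose rows have to be increasing.
\<close>

definition one_perm :: "nat \<Rightarrow> (nat \<Rightarrow> nat) \<Rightarrow> (nat \<Rightarrow> nat) \<Rightarrow> tableau \<Rightarrow> perm" where
  "one_perm n lam mu A = (THE w. w \<in> Sym n \<and>
     (\<forall>i j j'. (i, j) \<in> diagram mu \<longrightarrow> (i, j') \<in> diagram mu \<longrightarrow> j < j' \<longrightarrow>
        w (row_tab mu (i, j)) < w (row_tab mu (i, j'))) \<and>
     (\<forall>p\<in>diagram lam. row_tab lam p \<in> row_entries mu (w \<circ> row_tab mu) (A p)))"

definition Theta_gen :: "nat \<Rightarrow> 'f::field \<Rightarrow> (nat \<Rightarrow> nat) \<Rightarrow> (nat \<Rightarrow> nat) \<Rightarrow> tableau \<Rightarrow> 'f hecke" where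
  "Theta_gen n q lam mu A =
     hmult n q (x_elt n mu) (\<Sum>A' | A' \<in> tableaux lam mu \<and> row_equiv lam A' A. T (one_perm n lam mu A'))"

text \<open>
  \<open>\<Theta>\<^sub>A (x\<^sub>\<lambda> h) = \<Theta>\<^sub>A (x\<^sub>\<lambda>) h\<close>, where \<^const>\<open>Theta_gen\<close> is the image of the generator; the value
  does not depend on the choice of \<open>h\<close>.
\<close>

definition Theta :: "nat \<Rightarrow> 'f::field \<Rightarrow> (nat \<Rightarrow> nat) \<Rightarrow> (nat \<Rightarrow> nat) \<Rightarrow> tableau \<Rightarrow> 'f hecke \<Rightarrow> 'f hecke" where
  "Theta n q lam mu A = (\<lambda>m\<in>perm_module n q lam.
     THE y. \<exists>h\<in>hecke_carrier n. m = hmult n q (x_elt n lam) h \<and> y = hmult n q (Theta_gen n q lam mu A) h)"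

definition Theta_hat :: "nat \<Rightarrow> 'f::field \<Rightarrow> (nat \<Rightarrow> nat) \<Rightarrow> (nat \<Rightarrow> nat) \<Rightarrow> tableau \<Rightarrow> 'f hecke \<Rightarrow> 'f hecke" where
  "Theta_hat n q lam mu A = restrict (Theta n q lam mu A) (specht_module n q lam)"

end

theory Submission
  imports Defs
begin

text \<open>
  A right coset of the row stabilizer of \<open>\<mu>\<close> is a word of length \<open>n\<close> with \<open>\<mu>\<^sub>i\<close> letters
  \<open>i\<close>: its \<open>p\<close>-th letter is the row in which \<open>p\<close> stands.  So \<open>M\<^sup>\<mu>\<close> is the space of functions on
  these words (\<open>lift\<close>, \<open>x_elt_eq_lift\<close>), the Hecke algebra acts by permuting positions
  (\<open>wact\<close>, \<open>act\<close>), and operators that change letters may commute with this action.  Such are the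
  operators \<open>f\<^sub>i\<close> (\<open>lowering\<close>), which turn one letter \<open>i\<close> into \<open>i + 1\<close>, and the divided powers
  \<open>e\<^sub>i\<^sup>(\<^sup>t\<^sup>)\<close> (\<open>raising\<close>), which turn \<open>t\<close> letters \<open>i + 1\<close> into \<open>i\<close>.

  By a theorem of James, \<open>S\<^sup>\<mu>\<close> is the set of all vectors of \<open>M\<^sup>\<mu>\<close> that every
  \<open>e\<^sub>i\<^sup>(\<^sup>t\<^sup>)\<close> with \<open>t \<ge> 1\<close> annihilates (\<open>kernel_intersection\<close>).  Let \<open>z\<close> be the generator of \<open>S\<^sup>\<lambda>\<close>.
  If \<open>L\<close> is a linear combination of products of the \<open>f\<^sub>i\<close> that maps weight \<open>\<lambda>\<close> to weight \<open>\<mu>\<close>, then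
  \<open>L\<close> is a homomorphism on \<open>S\<^sup>\<lambda>\<close>, and it maps \<open>S\<^sup>\<lambda>\<close> into \<open>S\<^sup>\<mu>\<close> as soon as \<open>L z\<close> is annihilated by the
  \<open>e\<^sub>i\<^sup>(\<^sup>t\<^sup>)\<close>.  For \<open>\<mu> = \<lambda> - \<epsilon>\<^sub>a + \<epsilon>\<^sub>b\<close> this is automatic for dominance reasons, except
  for \<open>e\<^sub>i\<^sup>(\<^sup>1\<^sup>)\<close> with \<open>a \<le> i < b\<close>.

  Put \<open>P = f\<^sub>a\<close> at first, and for \<open>k = a + 1, \<dots>, b - 1\<close> replace \<open>P\<close> by
  \<open>-q [N - 1] P f\<^sub>k + [N] f\<^sub>k P\<close>, where \<open>N = \<lambda>\<^sub>a - \<lambda>\<^sub>k + k - a\<close> and \<open>[N] = 1 + q + \<dots> + q\<^sup>N\<^sup>-\<^sup>1\<close>.  Then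
  \<open>e\<^sub>i P z = 0\<close> for \<open>a \<le> i < b - 1\<close>, while \<open>e\<^sub>b\<^sub>-\<^sub>1 P z\<close> is a multiple of
  \<open>[\<lambda>\<^sub>a + b - 1 - a] - [\<lambda>\<^sub>b]\<close>.  This is a power of \<open>q\<close> times \<open>[\<mu>\<^sub>a - \<mu>\<^sub>b + b - a + 1]\<close>, which vanishes
  by the hypothesis on \<open>e\<close> (\<open>raising_chain\<close>, \<open>chain_singular\<close>).  If \<open>\<lambda>\<close> has equal rows
  \<open>k - 1\<close> and \<open>k\<close>, then \<open>P z\<close> has the factor \<open>[N - 1]\<close> at this stage, which may be zero in \<open>F\<close>; the recursion is
  therefore modified to omit this factor.  The image is non-zero, because its coefficient at one
  particular word is a power of \<open>q\<close> up to sign: the word in which the last node of each of the rows \<open>a, \<dots>, b - 1\<close> of the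
  column tableau has moved down a row (\<open>chain_specht_vec_nonzero\<close>).

  The operator is a linear combination of products \<open>D K\<close> of iterated
  commutators of \<open>f\<^sub>a, \<dots>, f\<^sub>b\<^sub>-\<^sub>1\<close>, one for each set \<open>K\<close> of places at which a new commutator starts
  (\<open>chain_commutator_span\<close>).  Applied to the generator of \<open>M\<^sup>\<lambda>\<close>, \<open>D K\<close> gives the sum of all words in one row
  class of tableaux (\<open>D_formula\<close>), so it is \<open>\<Theta>\<^sub>A\<close> for a single tableau \<open>A\<close>.  This \<open>A\<close> is semistandard
  unless two rows \<open>l\<close> and \<open>l + 1\<close> of \<open>\<lambda>\<close> have the same length and only \<open>l\<close> is in \<open>K\<close>.  In that
  case \<open>f\<^sub>l z = 0\<close>, whence \<open>D K z = - D (K \<union> {l + 1}) z\<close> (\<open>D_flip\<close>), and after finitely many such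
  replacements only semistandard tableaux are left (\<open>commutator_span_semistandard\<close>).
\<close>

(* Elements of the algebra are functions; their sums are to stay sums, and indices keep the form i + 1. *)
declare plus_fun_apply [simp del] zero_fun_apply [simp del] One_nat_def [simp del]

section \<open>Lengths and inversions\<close>

lemma Sym_D:
  assumes "w \<in> Sym n"
  shows "bij w" "inv w (w x) = x" "w (inv w x) = x" "w x = w y \<longleftrightarrow> x = y"
    "inv w x = inv w y \<longleftrightarrow> x = y" "inv w \<in> Sym n"
    "w x \<in> {1..n} \<longleftrightarrow> x \<in> {1..n}" "inv w x \<in> {1..n} \<longleftrightarrow> x \<in> {1..n}"
proof -
  have p: "w permutes {1..n}" using assms by (simp add: Sym_def)
  show "bij w" using p by (rule permutes_bij)
  show "inv w (w x) = x" "w (inv w x) = x" using permutes_inverses[OF p] by auto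
  show "w x = w y \<longleftrightarrow> x = y" using permutes_inj[OF p] by (auto dest: injD)
  have p': "inv w permutes {1..n}" using permutes_inv[OF p] .
  show "inv w x = inv w y \<longleftrightarrow> x = y" using permutes_inj[OF p'] by (auto dest: injD)
  show "inv w \<in> Sym n" using p' by (simp add: Sym_def)
  show "w x \<in> {1..n} \<longleftrightarrow> x \<in> {1..n}" "inv w x \<in> {1..n} \<longleftrightarrow> x \<in> {1..n}"
    using permutes_in_image[OF p] permutes_in_image[OF p'] by auto
qed

lemma Sym_outside: "w \<in> Sym n \<Longrightarrow> x \<notin> {1..n} \<Longrightarrow> w x = x"
  by (auto simp: Sym_def permutes_def)

lemma id_in_Sym [simp]: "id \<in> Sym n"
  by (simp add: Sym_def permutes_id)

lemma pmult_in_Sym: "u \<in> Sym n \<Longrightarrow> v \<in> Sym n \<Longrightarrow> u \<cdot> v \<in> Sym n"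
  by (simp add: Sym_def pmult_def permutes_compose)

lemma simple_refl_in_Sym': "i \<in> {1..<n} \<Longrightarrow> simple_refl i \<in> Sym n"
  by (simp add: simple_refl_in_Sym)

lemma simple_refl_simps [simp]:
  "simple_refl i i = i + 1" "simple_refl i (i + 1) = i" "simple_refl i (Suc i) = i"
  "simple_refl i (simple_refl i x) = x" "simple_refl i \<circ> simple_refl i = id"
  "g \<circ> simple_refl i \<circ> simple_refl i = g"
  "inv (simple_refl i) = simple_refl i"
  by (auto simp: simple_refl_def fun_eq_iff One_nat_def)

lemma simple_refl_other: "x \<noteq> i \<Longrightarrow> x \<noteq> i + 1 \<Longrightarrow> simple_refl i x = x"
  by (simp add: simple_refl_def)

lemma simple_refl_less_iff:
  "simple_refl i y < simple_refl i x \<longleftrightarrow> (y < x \<and> \<not> (y = i \<and> x = i + 1)) \<or> (x = i \<and> y = i + 1)"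
  by (auto simp: simple_refl_def transpose_def)

lemma pmult_refl_refl [simp]: "w \<cdot> simple_refl i \<cdot> simple_refl i = w"
  by (simp add: pmult_def fun_eq_iff)

lemma refl_refl_pmult [simp]: "simple_refl i \<cdot> (simple_refl i \<cdot> w) = w"
  by (simp add: pmult_def fun_eq_iff)

lemma inv_pmult_refl:
  assumes "w \<in> Sym n" "i \<in> {1..<n}"
  shows "inv (w \<cdot> simple_refl i) = inv w \<circ> simple_refl i"
  using assms simple_refl_in_Sym'[OF assms(2)]
  by (simp add: pmult_def o_inv_distrib Sym_D(1))

definition inversions :: "perm \<Rightarrow> (nat \<times> nat) set" where
  "inversions w = {(p, p'). p < p' \<and> w p' < w p}"

lemma inversions_subset:
  assumes "w \<in> Sym n" shows "inversions w \<subseteq> {1..n} \<times> {1..n}"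
proof clarify
  fix p p' assume "(p, p') \<in> inversions w"
  then have *: "p < p'" "w p' < w p" by (auto simp: inversions_def)
  have "p' \<in> {1..n}"
  proof (rule ccontr)
    assume "p' \<notin> {1..n}"
    with * have "p' > n" by auto
    then have "w p' = p'" by (intro Sym_outside[OF assms]) auto
    with * \<open>p' > n\<close> have "w p > n" by simp
    then have "p \<notin> {1..n}" using Sym_D(7)[OF assms, of p] by auto
    then have "w p = p" using Sym_outside[OF assms] by blast
    with * \<open>w p' = p'\<close> show False by simp
  qed
  moreover have "p \<in> {1..n}"
  proof (rule ccontr)
    assume "p \<notin> {1..n}"
    then have "w p = p" using Sym_outside[OF assms] by blast
    with \<open>p \<notin> {1..n}\<close> \<open>p' \<in> {1..n}\<close> * show False by auto
  qed
  ultimately show "p \<in> {1..n} \<and> p' \<in> {1..n}" by simp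
qed

lemma finite_inversions: "w \<in> Sym n \<Longrightarrow> finite (inversions w)"
  by (rule finite_subset[OF inversions_subset]) auto

text \<open>
  In the right-handed convention, \<open>w s\<^sub>i\<close> interchanges the values \<open>i\<close> and \<open>i + 1\<close> of \<open>w\<close>, and
  only the pair of their places changes its status.
\<close>

lemma inversions_pmult_refl:
  assumes w: "w \<in> Sym n" and up: "inv w i < inv w (i + 1)"
  shows "inversions (w \<cdot> simple_refl i) = insert (inv w i, inv w (i + 1)) (inversions w)"
    and "(inv w i, inv w (i + 1)) \<notin> inversions w"
proof -
  have eq: "p = inv w j \<longleftrightarrow> w p = j" for p j using Sym_D[OF w] by metis
  show "inversions (w \<cdot> simple_refl i) = insert (inv w i, inv w (i + 1)) (inversions w)"
  proof (intro set_eqI)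
    fix x :: "nat \<times> nat"
    obtain p p' where x: "x = (p, p')" by (cases x)
    have "w p = i \<Longrightarrow> w p' = i + 1 \<Longrightarrow> p < p'" using up eq by metis
    moreover have "w p' = i \<Longrightarrow> w p = i + 1 \<Longrightarrow> \<not> p < p'" using up eq by (metis not_less_iff_gr_or_eq)
    ultimately show "x \<in> inversions (w \<cdot> simple_refl i) \<longleftrightarrow>
        x \<in> insert (inv w i, inv w (i + 1)) (inversions w)"
      unfolding x by (auto simp: inversions_def pmult_def simple_refl_less_iff eq)
  qed
  show "(inv w i, inv w (i + 1)) \<notin> inversions w"
    using Sym_D(3)[OF w] by (auto simp: inversions_def)
qed

lemma card_inversions_pmult_refl:
  assumes w: "w \<in> Sym n" and i: "i \<in> {1..<n}"
  shows "card (inversions (w \<cdot> simple_refl i)) =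
    (if inv w i < inv w (i + 1) then card (inversions w) + 1 else card (inversions w) - 1)"
    and "\<not> inv w i < inv w (i + 1) \<Longrightarrow> card (inversions w) > 0"
proof -
  have up: "card (inversions (v \<cdot> simple_refl i)) = card (inversions v) + 1"
    if "v \<in> Sym n" "inv v i < inv v (i + 1)" for v
    using inversions_pmult_refl[OF that] finite_inversions[OF that(1)] by simp
  have down: "card (inversions w) = card (inversions (w \<cdot> simple_refl i)) + 1"
    if "\<not> inv w i < inv w (i + 1)"
  proof -
    have "inv w (i + 1) < inv w i" using that Sym_D(5)[OF w, of i "i + 1"] by linarith
    then have "inv (w \<cdot> simple_refl i) i < inv (w \<cdot> simple_refl i) (i + 1)"
      using inv_pmult_refl[OF w i] by simp
    from up[OF _ this] show ?thesis
      using pmult_in_Sym[OF w simple_refl_in_Sym'[OF i]] by simp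
  qed
  show "card (inversions (w \<cdot> simple_refl i)) =
    (if inv w i < inv w (i + 1) then card (inversions w) + 1 else card (inversions w) - 1)"
    using up[OF w] down by auto
  show "\<not> inv w i < inv w (i + 1) \<Longrightarrow> card (inversions w) > 0"
    using down by simp
qed

lemma word_perm_snoc [simp]: "word_perm (ws @ [i]) = word_perm ws \<cdot> simple_refl i"
  by (simp add: word_perm_def)

lemma word_perm_Nil [simp]: "word_perm [] = id"
  by (simp add: word_perm_def)

lemma word_perm_in_Sym: "set ws \<subseteq> {1..<n} \<Longrightarrow> word_perm ws \<in> Sym n"
  by (induction ws rule: rev_induct) (auto intro!: pmult_in_Sym simple_refl_in_Sym)

lemma inversions_id [simp]: "inversions id = {}"
  by (auto simp: inversions_def)

lemma card_inversions_le_length: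
  "set ws \<subseteq> {1..<n} \<Longrightarrow> card (inversions (word_perm ws)) \<le> length ws"
proof (induction ws rule: rev_induct)
  case (snoc i ws)
  then show ?case
    using card_inversions_pmult_refl(1)[OF word_perm_in_Sym, of ws n i] by auto
qed simp

lemma no_inversions_imp_id:
  assumes "w \<in> Sym n" "inversions w = {}" shows "w = id"
proof -
  have sm: "strict_mono w"
  proof (rule strict_monoI)
    fix x y :: nat assume "x < y"
    then have "\<not> w y < w x" using assms(2) by (auto simp: inversions_def)
    moreover have "w x \<noteq> w y" using \<open>x < y\<close> Sym_D(4)[OF assms(1)] by auto
    ultimately show "w x < w y" by simp
  qed
  have "strict_mono (inv w)"
  proof (rule strict_monoI)
    fix x y :: nat assume xy: "x < y"
    show "inv w x < inv w y"
    proof (rule ccontr)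
      assume "\<not> inv w x < inv w y"
      then have "inv w y \<le> inv w x" by simp
      then have "w (inv w y) \<le> w (inv w x)" using sm by (simp add: strict_mono_less_eq)
      then show False using xy Sym_D(3)[OF assms(1)] by simp
    qed
  qed
  then have "x \<le> inv w x" for x by (rule strict_mono_imp_increasing)
  then have "w x \<le> w (inv w x)" for x using sm by (simp add: strict_mono_less_eq)
  then have "w x \<le> x" for x using Sym_D(3)[OF assms(1)] by simp
  moreover have "x \<le> w x" for x using sm by (rule strict_mono_imp_increasing)
  ultimately show ?thesis by (auto simp: fun_eq_iff intro: antisym)
qed

lemma ex_descent:
  assumes "w \<in> Sym n" "inversions w \<noteq> {}"
  obtains i where "i \<in> {1..<n}" "inv w (i + 1) < inv w i"
proof (rule ccontr)
  assume "\<not> thesis"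
  then have up: "\<not> inv w (i + 1) < inv w i" if "i \<in> {1..<n}" for i using that \<open>\<not> thesis\<close> \<open>\<And>i. \<lbrakk>i \<in> {1..<n}; inv w (i + 1) < inv w i\<rbrakk> \<Longrightarrow> thesis\<close> by blast
  have mono: "y \<le> n \<Longrightarrow> inv w x \<le> inv w y" if "x \<le> y" "1 \<le> x" for x y
    using that(1)
  proof (induction y rule: dec_induct)
    case (step m)
    then show ?case using up[of m] that(2) by (force simp: One_nat_def)
  qed simp
  obtain p p' where pp: "(p, p') \<in> inversions w" using assms(2) by auto
  have "p \<in> {1..n}" "p' \<in> {1..n}" using inversions_subset[OF assms(1)] pp by auto
  then have "w p \<in> {1..n}" "w p' \<in> {1..n}" using Sym_D(7)[OF assms(1)] by auto
  moreover have "w p' \<le> w p" using pp by (auto simp: inversions_def)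
  ultimately have "inv w (w p') \<le> inv w (w p)" using mono[of "w p'" "w p"] by auto
  then show False using pp Sym_D(2)[OF assms(1)] by (auto simp: inversions_def)
qed

lemma ex_reduced_word:
  "w \<in> Sym n \<Longrightarrow> \<exists>ws. word_of n ws w \<and> length ws = card (inversions w)"
proof (induction "card (inversions w)" arbitrary: w)
  case 0
  then have "w = id" using no_inversions_imp_id finite_inversions by auto
  moreover have "word_of n [] id" by (simp add: word_of_def)
  ultimately show ?case using 0 by (metis list.size(3))
next
  case (Suc k)
  then have "inversions w \<noteq> {}" by auto
  from ex_descent[OF Suc.prems this] obtain i
    where i: "i \<in> {1..<n}" "inv w (i + 1) < inv w i" .
  let ?v = "w \<cdot> simple_refl i"
  have v: "?v \<in> Sym n" using pmult_in_Sym[OF Suc.prems simple_refl_in_Sym'[OF i(1)]] .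
  have "card (inversions ?v) = k"
    using card_inversions_pmult_refl(1)[OF Suc.prems i(1)] i(2) Suc.hyps(2) by simp
  from Suc.hyps(1)[OF this[symmetric] v] this obtain ws
    where "word_of n ws ?v" "length ws = k" by auto
  then show ?case using i(1) Suc.hyps(2)
    by (intro exI[of _ "ws @ [i]"]) (auto simp: word_of_def)
qed

text \<open>
  Each simple reflection changes the number of inversions by one, and a permutation with an
  inversion has a descent, which can be removed.
\<close>

lemma len_eq_card_inversions: "w \<in> Sym n \<Longrightarrow> len n w = card (inversions w)"
  unfolding len_def
proof (rule Least_equality)
  assume "w \<in> Sym n"
  then show "\<exists>is. word_of n is w \<and> length is = card (inversions w)" by (rule ex_reduced_word)
next
  fix k assume "\<exists>is. word_of n is w \<and> length is = k"
  then show "card (inversions w) \<le> k" using card_inversions_le_length unfolding word_of_def by blast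
qed

definition reduced :: "nat \<Rightarrow> nat list \<Rightarrow> bool" where
  "reduced n ws \<longleftrightarrow> set ws \<subseteq> {1..<n} \<and> length ws = card (inversions (word_perm ws))"

lemma reduced_snoc:
  assumes "reduced n (ws @ [i])"
  shows "reduced n ws" "i \<in> {1..<n}" "word_perm ws \<in> Sym n"
    "inv (word_perm ws) i < inv (word_perm ws) (i + 1)"
proof -
  show i: "i \<in> {1..<n}" and w: "word_perm ws \<in> Sym n"
    using assms word_perm_in_Sym by (auto simp: reduced_def)
  have ws: "set ws \<subseteq> {1..<n}" using assms by (auto simp: reduced_def)
  note card_inversions_pmult_refl[OF w i] card_inversions_le_length[OF ws]
  with assms show "inv (word_perm ws) i < inv (word_perm ws) (i + 1)" "reduced n ws"
    using ws by (auto simp: reduced_def split: if_splits)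
qed

lemma reduced_word:
  assumes "w \<in> Sym n"
  shows "reduced n (reduced_word n w)" "word_perm (reduced_word n w) = w"
    "set (reduced_word n w) \<subseteq> {1..<n}"
proof -
  have "\<exists>ws. word_of n ws w \<and> length ws = len n w"
    using ex_reduced_word[OF assms] len_eq_card_inversions[OF assms] by simp
  from someI_ex[OF this] have "word_of n (reduced_word n w) w" "length (reduced_word n w) = len n w"
    unfolding reduced_word_def by auto
  then show "reduced n (reduced_word n w)" "word_perm (reduced_word n w) = w"
    "set (reduced_word n w) \<subseteq> {1..<n}"
    using len_eq_card_inversions[OF assms] by (auto simp: reduced_def word_of_def)
qed

section \<open>Associativity of the Hecke algebra\<close>

definition hlinear :: "('f::field hecke \<Rightarrow> 'f hecke) \<Rightarrow> bool" where
  "hlinear L \<longleftrightarrow> (\<forall>x y. L (x + y) = L x + L y) \<and> (\<forall>c x. L (hscale c x) = hscale c (L x))"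

lemma hscale_apply: "hscale c x w = c * x w"
  by (simp add: hscale_def)

lemmas fapply = plus_fun_apply zero_fun_apply hscale_apply sum_fun_apply

lemma hscale_simps [simp]:
  "hscale 0 x = 0" "hscale c 0 = 0" "hscale 1 x = x" "hscale c (hscale d x) = hscale (c * d) x"
  by (auto simp: fapply fun_eq_iff)

lemma hscale_add: "hscale c (x + y) = hscale c x + hscale c y"
  by (simp add: fapply fun_eq_iff algebra_simps)

lemma hscale_add_left: "hscale (c + d) x = hscale c x + hscale d x"
  by (simp add: fapply fun_eq_iff algebra_simps)

lemma hscale_sum: "hscale c (\<Sum>a\<in>A. f a) = (\<Sum>a\<in>A. hscale c (f a))"
  by (induction A rule: infinite_finite_induct) (auto simp: hscale_add)

lemma hlinearD:
  assumes "hlinear L"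
  shows "L (x + y) = L x + L y" "L (hscale c x) = hscale c (L x)" "L 0 = 0"
    "L (\<Sum>a\<in>A. f a) = (\<Sum>a\<in>A. L (f a))" "L (- x) = - L x" "L (x - y) = L x - L y"
proof -
  show add: "L (x + y) = L x + L y" for x y using assms by (auto simp: hlinear_def)
  show sc: "L (hscale c x) = hscale c (L x)" for c x using assms by (auto simp: hlinear_def)
  show zero: "L 0 = 0" using sc[of 0 0] by simp
  show "L (\<Sum>a\<in>A. f a) = (\<Sum>a\<in>A. L (f a))"
    by (induction A rule: infinite_finite_induct) (auto simp: add zero)
  show neg: "L (- x) = - L x" for x using sc[of "-1" x] by (simp add: hscale_def fun_Compl_def fun_eq_iff)
  show "L (x - y) = L x - L y" using add[of x "- y"] neg[of y] by simp
qed

lemma hlinear_compose: "hlinear L \<Longrightarrow> hlinear M \<Longrightarrow> hlinear (\<lambda>x. L (M x))"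
  by (simp add: hlinear_def)

text \<open>
  The dual form of the multiplication rule: it is read off at a single coefficient.
\<close>

lemma times_simple_apply:
  assumes d: "d \<in> Sym n" and i: "i \<in> {1..<n}"
  shows "times_simple n q h i d =
    (if inv d (i + 1) < inv d i then h (d \<cdot> simple_refl i) + (q - 1) * h d
     else q * h (d \<cdot> simple_refl i))"
proof -
  let ?s = "simple_refl i"
  have ds: "d \<cdot> ?s \<in> Sym n" using pmult_in_Sym[OF d simple_refl_in_Sym'[OF i]] .
  define A where "A w = (if inv w i < inv w (i + 1) then 1 else q)" for w :: perm
  define B where "B w = (if inv w i < inv w (i + 1) then 0 else q - 1)" for w :: perm
  have Tts: "T_times_simple n q w i d = (if w = d \<cdot> ?s then A w else 0) + (if w = d then B w else 0)"
    if w: "w \<in> Sym n" for w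
  proof -
    have ws: "w \<cdot> ?s \<in> Sym n" using pmult_in_Sym[OF w simple_refl_in_Sym'[OF i]] .
    have "len n (w \<cdot> ?s) = len n w + 1 \<longleftrightarrow> inv w i < inv w (i + 1)"
      using card_inversions_pmult_refl[OF w i]
      by (cases "inv w i < inv w (i + 1)") (auto simp: len_eq_card_inversions w ws)
    moreover have "d = w \<cdot> ?s \<longleftrightarrow> w = d \<cdot> ?s" by (metis pmult_refl_refl)
    ultimately show ?thesis by (auto simp: T_times_simple_def T_def A_def B_def fapply)
  qed
  have "times_simple n q h i d = (\<Sum>w\<in>Sym n. h w * T_times_simple n q w i d)"
    by (simp add: times_simple_def fapply)
  also have "\<dots> = (\<Sum>w\<in>Sym n. (if w = d \<cdot> ?s then h w * A w else 0) + (if w = d then h w * B w else 0))"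
    by (intro sum.cong refl) (simp add: Tts ring_distribs)
  also have "\<dots> = h (d \<cdot> ?s) * A (d \<cdot> ?s) + h d * B d"
    using d ds by (simp add: sum.distrib finite_Sym)
  also have "\<dots> = (if inv d (i + 1) < inv d i then h (d \<cdot> ?s) + (q - 1) * h d else q * h (d \<cdot> ?s))"
    using Sym_D(5)[OF d, of i "i + 1"] by (auto simp: A_def B_def inv_pmult_refl[OF d i])
  finally show ?thesis .
qed

lemma times_simple_outside:
  assumes "d \<notin> Sym n" "i \<in> {1..<n}" shows "times_simple n q h i d = 0"
proof -
  have "T_times_simple n q w i d = 0" if "w \<in> Sym n" for w
    using that assms pmult_in_Sym[OF that simple_refl_in_Sym'[OF assms(2)]]
    by (auto simp: T_times_simple_def T_def fapply)
  then show ?thesis by (simp add: times_simple_def fapply)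
qed

lemma hlinear_times_simple: "hlinear (\<lambda>h. times_simple n q h i)"
  by (auto simp: hlinear_def times_simple_def fun_eq_iff fapply sum.distrib sum_distrib_left
      ring_distribs mult.assoc)

text \<open>
  Left multiplication by \<open>T\<^sub>s\<close>, again in terms of coefficients.
\<close>

definition simple_times :: "nat \<Rightarrow> 'f::field \<Rightarrow> nat \<Rightarrow> 'f hecke \<Rightarrow> 'f hecke" where
  "simple_times n q i h = (\<lambda>d. if d \<in> Sym n
     then if d (i + 1) < d i then h (simple_refl i \<cdot> d) + (q - 1) * h d else q * h (simple_refl i \<cdot> d)
     else 0)"

lemma hlinear_simple_times: "hlinear (simple_times n q i)"
  by (auto simp: hlinear_def simple_times_def fun_eq_iff fapply algebra_simps)

text \<open>
  The usual key to associativity: left and right multiplications by simple generators commute.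
  The only case in which both sides branch differently is \<open>s\<^sub>i d = d s\<^sub>j\<close>.
\<close>

lemma simple_times_commute:
  assumes i: "i \<in> {1..<n}" and j: "j \<in> {1..<n}"
  shows "simple_times n q i (times_simple n q h j) = times_simple n q (simple_times n q i h) j"
proof
  fix d
  let ?s = "simple_refl i" and ?t = "simple_refl j"
  show "simple_times n q i (times_simple n q h j) d = times_simple n q (simple_times n q i h) j d"
  proof (cases "d \<in> Sym n")
    case False
    then show ?thesis using times_simple_outside[OF False j] by (simp add: simple_times_def)
  next
    case d: True
    have s: "?s \<in> Sym n" and t: "?t \<in> Sym n" using i j simple_refl_in_Sym' by auto
    have sd: "?s \<cdot> d \<in> Sym n" and dt: "d \<cdot> ?t \<in> Sym n" using pmult_in_Sym s t d by auto
    have inv_sd: "inv (?s \<cdot> d) = ?s \<circ> inv d"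
      using s d by (simp add: pmult_def o_inv_distrib Sym_D(1))
    have assoc: "?s \<cdot> d \<cdot> ?t = ?s \<cdot> (d \<cdot> ?t)" by (simp add: pmult_def o_assoc)
    note ap = times_simple_apply[OF _ j] 
    have L: "simple_times n q i (times_simple n q h j) d =
      (if d (i + 1) < d i then times_simple n q h j (?s \<cdot> d) + (q - 1) * times_simple n q h j d
       else q * times_simple n q h j (?s \<cdot> d))" using d by (simp add: simple_times_def)
    have R: "times_simple n q (simple_times n q i h) j d =
      (if inv d (j + 1) < inv d j then simple_times n q i h (d \<cdot> ?t) + (q - 1) * simple_times n q i h d
       else q * simple_times n q i h (d \<cdot> ?t))" by (rule ap[OF d])
    have ne: "inv d j \<noteq> inv d (j + 1)" "d i \<noteq> d (i + 1)" using Sym_D(4,5)[OF d] by auto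
    show ?thesis
    proof (cases "{d i, d (i + 1)} = {j, j + 1}")
      case True
      then consider "d i = j" "d (i + 1) = j + 1" | "d i = j + 1" "d (i + 1) = j"
        by (auto simp: doubleton_eq_iff)
      then have eq: "?s \<cdot> d = d \<cdot> ?t \<and> (inv d (j + 1) < inv d j \<longleftrightarrow> d (i + 1) < d i)"
      proof cases
        case 1
        then have inv: "inv d j = i" "inv d (j + 1) = i + 1" using Sym_D(2)[OF d] by metis+
        have "d (?s x) = ?t (d x)" for x
        proof (cases "x = i \<or> x = i + 1")
          case False
          then have "d x \<noteq> j" "d x \<noteq> j + 1" using 1 Sym_D(4)[OF d] by metis+
          then show ?thesis using False by (simp add: simple_refl_other)
        qed (use 1 in auto)
        then show ?thesis using 1 inv by (auto simp: pmult_def fun_eq_iff)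
      next
        case 2
        then have inv: "inv d (j + 1) = i" "inv d j = i + 1" using Sym_D(2)[OF d] by metis+
        have "d (?s x) = ?t (d x)" for x
        proof (cases "x = i \<or> x = i + 1")
          case False
          then have "d x \<noteq> j" "d x \<noteq> j + 1" using 2 Sym_D(4)[OF d] by metis+
          then show ?thesis using False by (simp add: simple_refl_other)
        qed (use 2 in auto)
        then show ?thesis using 2 inv by (auto simp: pmult_def fun_eq_iff)
      qed
      have c1: "inv (?s \<cdot> d) (j + 1) < inv (?s \<cdot> d) j \<longleftrightarrow> \<not> d (i + 1) < d i"
        using eq ne inv_pmult_refl[OF d j] by auto
      have c2: "(d \<cdot> ?t) (i + 1) < (d \<cdot> ?t) i \<longleftrightarrow> \<not> d (i + 1) < d i"
        unfolding conjunct1[OF eq, symmetric] using ne by (auto simp: pmult_def)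
      have "?s \<cdot> d \<cdot> ?t = d" "?s \<cdot> (d \<cdot> ?t) = d" using eq by (metis pmult_refl_refl refl_refl_pmult)+
      then show ?thesis
        unfolding L R ap[OF d] ap[OF sd] using d dt c1 c2 eq
        by (simp add: simple_times_def algebra_simps)
    next
      case False
      have c1: "inv (?s \<cdot> d) (j + 1) < inv (?s \<cdot> d) j \<longleftrightarrow> inv d (j + 1) < inv d j"
      proof -
        have "\<not> (inv d j = i \<and> inv d (j + 1) = i + 1)" "\<not> (inv d j = i + 1 \<and> inv d (j + 1) = i)"
          using False Sym_D(3)[OF d] by (metis insert_commute)+
        then show ?thesis unfolding inv_sd by (auto simp: simple_refl_less_iff)
      qed
      have c2: "(d \<cdot> ?t) (i + 1) < (d \<cdot> ?t) i \<longleftrightarrow> d (i + 1) < d i"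
        using False by (auto simp: simple_refl_less_iff pmult_def doubleton_eq_iff)
      show ?thesis
        unfolding L R ap[OF d] ap[OF sd] using d dt c1 c2 assoc
        by (simp add: simple_times_def algebra_simps)
    qed
  qed
qed


definition hcommuting :: "nat \<Rightarrow> 'f::field \<Rightarrow> ('f hecke \<Rightarrow> 'f hecke) \<Rightarrow> bool" where
  "hcommuting n q L \<longleftrightarrow> hlinear L \<and>
     (\<forall>h. \<forall>i\<in>{1..<n}. L (times_simple n q h i) = times_simple n q (L h) i)"

lemma hcommuting_foldl:
  "hcommuting n q L \<Longrightarrow> set ws \<subseteq> {1..<n} \<Longrightarrow>
    L (foldl (times_simple n q) h ws) = foldl (times_simple n q) (L h) ws"
  by (induction ws arbitrary: h) (auto simp: hcommuting_def)

lemma hcommuting_hmult: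
  assumes "hcommuting n q L"
  shows "L (hmult n q h k) = hmult n q (L h) k"
proof -
  have "hlinear L" using assms by (simp add: hcommuting_def)
  then show ?thesis unfolding hmult_def
    by (simp add: hlinearD hcommuting_foldl[OF assms reduced_word(3)])
qed

lemma hcommuting_compose: "hcommuting n q L \<Longrightarrow> hcommuting n q M \<Longrightarrow> hcommuting n q (\<lambda>x. L (M x))"
  by (auto simp: hcommuting_def hlinear_compose)

lemma simple_times_T:
  assumes w: "w \<in> Sym n" and i: "i \<in> {1..<n}" and up: "w i < w (i + 1)"
  shows "simple_times n q i (T w) = T (simple_refl i \<cdot> w)"
proof
  fix d
  have "simple_refl i \<cdot> d = w \<longleftrightarrow> d = simple_refl i \<cdot> w" by (metis refl_refl_pmult)
  moreover have "simple_refl i \<cdot> w \<in> Sym n" "simple_refl i \<cdot> w \<noteq> w"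
    using pmult_in_Sym[OF simple_refl_in_Sym'[OF i] w] up
    by (auto simp: pmult_def fun_eq_iff intro!: exI[of _ i])
  ultimately show "simple_times n q i (T w) d = T (simple_refl i \<cdot> w) d"
    using up w by (auto simp: simple_times_def T_def pmult_def)
qed

text \<open>
  The left multiplication by \<open>T\<^sub>w\<close>, as a product of operators \<^const>\<open>simple_times\<close> along a reduced
  word.  It permits statements about \<open>T\<^sub>w h\<close> to be reduced to \<open>w = 1\<close>.
\<close>

lemma ex_left_operator:
  "w \<in> Sym n \<Longrightarrow> \<exists>L. hcommuting n q L \<and> L (T id) = (T w :: 'f::field hecke)"
proof (induction "card (inversions (inv w))" arbitrary: w)
  case 0
  then have "inversions (inv w) = {}" using finite_inversions[OF Sym_D(6)[OF 0(2)]] by simp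
  then have "inv w = id" by (rule no_inversions_imp_id[OF Sym_D(6)[OF 0(2)]])
  then have "w = id" using Sym_D(1)[OF 0(2)] by (metis inv_id inv_inv_eq)
  moreover have "hcommuting n q (\<lambda>x. x :: 'f hecke)" by (auto simp: hcommuting_def hlinear_def)
  ultimately show ?case by (intro exI[of _ "\<lambda>x. x"]) auto
next
  case (Suc k)
  have bw: "inv (inv w) = w" using Sym_D(1)[OF Suc.prems] by (rule inv_inv_eq)
  from Suc have "inversions (inv w) \<noteq> {}" by auto
  from ex_descent[OF Sym_D(6)[OF Suc.prems] this] obtain i
    where i: "i \<in> {1..<n}" "w (i + 1) < w i" unfolding bw by blast
  let ?s = "simple_refl i"
  have s: "?s \<in> Sym n" using simple_refl_in_Sym'[OF i(1)] .
  let ?v = "?s \<cdot> w"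
  have v: "?v \<in> Sym n" using pmult_in_Sym[OF s Suc.prems] .
  have "inv ?v = inv w \<cdot> ?s"
    using Sym_D(1)[OF s] Sym_D(1)[OF Suc.prems] by (simp add: pmult_def o_inv_distrib)
  then have "card (inversions (inv ?v)) = k"
    using card_inversions_pmult_refl(1)[OF Sym_D(6)[OF Suc.prems] i(1)] i(2) Suc.hyps(2) bw by simp
  from Suc.hyps(1)[OF this[symmetric] v] obtain L
    where L: "hcommuting n q L" "L (T id) = (T ?v :: 'f hecke)" by auto
  have "hcommuting n q (simple_times n q i)"
    unfolding hcommuting_def using hlinear_simple_times simple_times_commute[OF i(1)] by blast
  with L(1) have "hcommuting n q (\<lambda>x. simple_times n q i (L x))" by (rule hcommuting_compose[rotated])
  moreover have "simple_times n q i (T ?v) = T (?s \<cdot> ?v)"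
    using i by (intro simple_times_T v) (auto simp: pmult_def)
  ultimately show ?case using L(2) by (intro exI[of _ "\<lambda>x. simple_times n q i (L x)"]) simp
qed

lemma times_simple_T:
  assumes w: "w \<in> Sym n" and i: "i \<in> {1..<n}" and up: "inv w i < inv w (i + 1)"
  shows "times_simple n q (T w) i = T (w \<cdot> simple_refl i)"
proof
  fix d
  have ws: "w \<cdot> simple_refl i \<in> Sym n" using pmult_in_Sym[OF w simple_refl_in_Sym'[OF i]] .
  have eq: "d \<cdot> simple_refl i = w \<longleftrightarrow> d = w \<cdot> simple_refl i" by (metis pmult_refl_refl)
  have ne: "w \<cdot> simple_refl i \<noteq> w"
    using inv_pmult_refl[OF w i] up by (auto dest: fun_cong[of _ _ i])
  show "times_simple n q (T w) i d = T (w \<cdot> simple_refl i) d"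
  proof (cases "d \<in> Sym n")
    case True
    then show ?thesis using up unfolding times_simple_apply[OF True i]
      using ne by (auto simp: T_def eq inv_pmult_refl[OF w i])
  qed (use ws times_simple_outside[OF _ i] in \<open>auto simp: T_def\<close>)
qed

lemma foldl_times_simple_T:
  "reduced n ws \<Longrightarrow> foldl (times_simple n q) (T id) ws = T (word_perm ws)"
proof (induction ws rule: rev_induct)
  case (snoc i ws)
  note r = reduced_snoc[OF snoc.prems]
  show ?case using snoc.IH[OF r(1)] times_simple_T[OF r(3,2,4)] by simp
qed simp

lemma hmult_T_id: "k \<in> hecke_carrier n \<Longrightarrow> hmult n q (T id) k = k"
proof
  fix d assume k: "k \<in> hecke_carrier n"
  have "hmult n q (T id) k d = (\<Sum>w\<in>Sym n. if w = d then k w else 0)"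
    unfolding hmult_def fapply
    by (intro sum.cong refl) (simp add: foldl_times_simple_T reduced_word, simp add: T_def)
  then show "hmult n q (T id) k d = k d" using k by (auto simp: finite_Sym hecke_carrier_def)
qed

lemma hmult_add_left: "hmult n q (h + h') k = hmult n q h k + hmult n q h' k"
  and hmult_scale_left: "hmult n q (hscale c h) k = hscale c (hmult n q h k)"
proof -
  have lin: "hlinear (\<lambda>h. foldl (times_simple n q) h ws)" for ws
  proof (induction ws)
    case (Cons i ws)
    show ?case using hlinear_compose[OF Cons hlinear_times_simple] by simp
  qed (simp add: hlinear_def)
  show "hmult n q (h + h') k = hmult n q h k + hmult n q h' k"
    by (simp add: hmult_def hlinearD(1)[OF lin] hscale_add sum.distrib)
  show "hmult n q (hscale c h) k = hscale c (hmult n q h k)"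
    by (simp add: hmult_def hlinearD(2)[OF lin] hscale_sum mult.commute)
qed

lemma hlinear_hmult: "hlinear (\<lambda>h. hmult n q h k)"
  by (simp add: hlinear_def hmult_add_left hmult_scale_left)

lemma hmult_add_right: "hmult n q h (k + k') = hmult n q h k + hmult n q h k'"
  and hmult_scale_right: "hmult n q h (hscale c k) = hscale c (hmult n q h k)"
  by (simp_all add: hmult_def fapply hscale_add_left sum.distrib hscale_sum)

lemma hecke_expand: "h \<in> hecke_carrier n \<Longrightarrow> h = (\<Sum>w\<in>Sym n. hscale (h w) (T w))"
proof
  fix x assume h: "h \<in> hecke_carrier n"
  have "(\<Sum>w\<in>Sym n. hscale (h w) (T w)) x = (\<Sum>w\<in>Sym n. if w = x then h w else 0)"
    unfolding fapply by (intro sum.cong refl) (simp add: T_def)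
  then show "h x = (\<Sum>w\<in>Sym n. hscale (h w) (T w)) x"
    using h by (auto simp: finite_Sym hecke_carrier_def)
qed

lemma T_in_carrier: "w \<in> Sym n \<Longrightarrow> T w \<in> hecke_carrier n"
  by (auto simp: T_def hecke_carrier_def)

lemma times_simple_in_carrier: "i \<in> {1..<n} \<Longrightarrow> times_simple n q h i \<in> hecke_carrier n"
  by (auto simp: hecke_carrier_def times_simple_outside)

lemma carrier_closed:
  "h \<in> hecke_carrier n \<Longrightarrow> k \<in> hecke_carrier n \<Longrightarrow> h + k \<in> hecke_carrier n"
  "h \<in> hecke_carrier n \<Longrightarrow> hscale c h \<in> hecke_carrier n"
  "(\<And>a. a \<in> A \<Longrightarrow> f a \<in> hecke_carrier n) \<Longrightarrow> (\<Sum>a\<in>A. f a) \<in> hecke_carrier n"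
  by (auto simp: hecke_carrier_def fapply)

lemma foldl_times_simple_in_carrier:
  "h \<in> hecke_carrier n \<Longrightarrow> set ws \<subseteq> {1..<n} \<Longrightarrow> foldl (times_simple n q) h ws \<in> hecke_carrier n"
  by (induction ws arbitrary: h) (auto simp: times_simple_in_carrier)

lemma hmult_in_carrier: "h \<in> hecke_carrier n \<Longrightarrow> hmult n q h k \<in> hecke_carrier n"
  unfolding hmult_def
  by (intro carrier_closed foldl_times_simple_in_carrier reduced_word(3))

text \<open>
  For \<open>h = T\<^sub>w\<close>, both sides are images of \<open>k T\<^sub>i\<close> under the left multiplication by \<open>T\<^sub>w\<close>.
\<close>

lemma hmult_times_simple:
  assumes h: "h \<in> hecke_carrier n" and k: "k \<in> hecke_carrier n" and i: "i \<in> {1..<n}"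
  shows "hmult n q h (times_simple n q k i) = times_simple n q (hmult n q h k) i"
proof -
  have T: "hmult n q (T w) (times_simple n q k i) = times_simple n q (hmult n q (T w) k) i"
    if w: "w \<in> Sym n" for w
  proof -
    from ex_left_operator[OF w] obtain L where L: "hcommuting n q L" "L (T id) = (T w :: 'a hecke)"
      by blast
    have mult: "hmult n q (T w) x = L x" if "x \<in> hecke_carrier n" for x
      using hcommuting_hmult[OF L(1), of "T id" x] hmult_T_id[OF that] L(2) by simp
    show ?thesis using L(1) i by (simp add: mult k times_simple_in_carrier hcommuting_def)
  qed
  show ?thesis
    apply (subst (1 2) hecke_expand[OF h])
    by (simp add: hlinearD[OF hlinear_hmult] hlinearD[OF hlinear_times_simple] T)
qed

theorem hmult_assoc:
  assumes h: "h \<in> hecke_carrier n" and k: "k \<in> hecke_carrier n"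
  shows "hmult n q (hmult n q h k) l = hmult n q h (hmult n q k l)"
proof -
  have "hmult n q h (foldl (times_simple n q) x ws) = foldl (times_simple n q) (hmult n q h x) ws"
    if "x \<in> hecke_carrier n" "set ws \<subseteq> {1..<n}" for x ws
    using that
  proof (induction ws arbitrary: x)
    case (Cons i ws)
    then show ?case using hmult_times_simple[OF h Cons.prems(1), of i q]
      by (simp add: times_simple_in_carrier)
  qed simp
  moreover have "hlinear (hmult n q h)"
    by (simp add: hlinear_def hmult_add_right hmult_scale_right)
  ultimately show ?thesis using k reduced_word(3)
    by (simp add: hmult_def[of n q k l] hmult_def[of n q "hmult n q h k" l] hlinearD)
qed

lemma hmult_T_refl_T:
  assumes "w \<in> Sym n" "i \<in> {1..<n}" "w i < w (i + 1)"
  shows "hmult n q (T (simple_refl i)) (T w) = T (simple_refl i \<cdot> w)"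
proof -
  have c: "hcommuting n q (simple_times n q i)"
    unfolding hcommuting_def using hlinear_simple_times simple_times_commute[OF assms(2)] by blast
  have "T (simple_refl i) = simple_times n q i (T id)"
    using simple_times_T[OF id_in_Sym assms(2), of q] by (simp add: pmult_def)
  then show ?thesis
    using hcommuting_hmult[OF c, of "T id" "T w"] hmult_T_id[OF T_in_carrier[OF assms(1)], of q]
      simple_times_T[OF assms, of q] by simp
qed

section \<open>Permutation modules as spaces of words\<close>

definition cnt :: "nat \<Rightarrow> (nat \<Rightarrow> nat) \<Rightarrow> nat \<Rightarrow> nat" where
  "cnt k g i = card {p \<in> {1..k}. g p = i}"

text \<open>
  A word is a function that vanishes off \<open>{1..n}\<close>, so that words are equal if their letters are.
\<close>

definition words :: "nat \<Rightarrow> (nat \<Rightarrow> nat) \<Rightarrow> (nat \<Rightarrow> nat) set" where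
  "words n mu = {g. (\<forall>p. g p = 0 \<longleftrightarrow> p \<notin> {1..n}) \<and> (\<forall>i. cnt n g i = mu i)}"

definition supported :: "(nat \<Rightarrow> nat) set \<Rightarrow> 'f::field hecke \<Rightarrow> bool" where
  "supported A \<phi> \<longleftrightarrow> (\<forall>g. \<phi> g \<noteq> 0 \<longrightarrow> g \<in> A)"

definition ket :: "(nat \<Rightarrow> nat) \<Rightarrow> 'f::field hecke" where
  "ket g = (\<lambda>h. if h = g then 1 else 0)"

text \<open>
  The action of \<open>T\<^sub>i\<close> on coefficient functions of words.  On basis vectors: if \<open>g i < g (i + 1)\<close>, then
  \<open>T\<^sub>i\<close> sends \<open>g\<close> to \<open>g s\<^sub>i\<close>, and if \<open>g i = g (i + 1)\<close>, it multiplies \<open>g\<close> by \<open>q\<close>; the third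
  case follows from the quadratic relation.
\<close>

definition wact :: "'f::field \<Rightarrow> 'f hecke \<Rightarrow> nat \<Rightarrow> 'f hecke" where
  "wact q \<phi> i = (\<lambda>g. if g (i + 1) < g i then \<phi> (g \<circ> simple_refl i) + (q - 1) * \<phi> g
                     else q * \<phi> (g \<circ> simple_refl i))"

definition act :: "nat \<Rightarrow> 'f::field \<Rightarrow> 'f hecke \<Rightarrow> 'f hecke \<Rightarrow> 'f hecke" where
  "act n q \<phi> h = (\<Sum>w\<in>Sym n. hscale (h w) (foldl (wact q) \<phi> (reduced_word n w)))"

lemma hlinear_wact: "hlinear (\<lambda>\<phi>. wact q \<phi> i)"
  by (auto simp: hlinear_def wact_def fun_eq_iff fapply algebra_simps)

lemma hlinear_foldl_wact: "hlinear (\<lambda>\<phi>. foldl (wact q) \<phi> ws)"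
proof (induction ws)
  case (Cons i ws)
  show ?case using hlinear_compose[OF Cons hlinear_wact] by simp
qed (simp add: hlinear_def)

lemma act_add_left: "act n q (\<phi> + \<psi>) h = act n q \<phi> h + act n q \<psi> h"
  and act_scale_left: "act n q (hscale c \<phi>) h = hscale c (act n q \<phi> h)"
  by (simp_all add: act_def hlinearD[OF hlinear_foldl_wact] hscale_add sum.distrib hscale_sum mult.commute)

lemma hlinear_act: "hlinear (\<lambda>\<phi>. act n q \<phi> h)"
  by (simp add: hlinear_def act_add_left act_scale_left)

lemma act_add_right: "act n q \<phi> (h + k) = act n q \<phi> h + act n q \<phi> k"
  and act_scale_right: "act n q \<phi> (hscale c h) = hscale c (act n q \<phi> h)"
  by (simp_all add: act_def fapply hscale_add_left sum.distrib hscale_sum)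

lemma hlinear_act_right: "hlinear (act n q \<phi>)"
  by (simp add: hlinear_def act_add_right act_scale_right)

text \<open>
  Hecke-linear operators on functions of words.  They need not preserve the content of the words;
  this is what makes homomorphisms between different permutation modules.
\<close>

definition wcommuting :: "nat \<Rightarrow> 'f::field \<Rightarrow> ('f hecke \<Rightarrow> 'f hecke) \<Rightarrow> bool" where
  "wcommuting n q L \<longleftrightarrow> hlinear L \<and> (\<forall>\<phi>. \<forall>i\<in>{1..<n}. L (wact q \<phi> i) = wact q (L \<phi>) i)"

lemma wcommuting_hlinear: "wcommuting n q L \<Longrightarrow> hlinear L"
  by (simp add: wcommuting_def)

lemma wcommuting_act:
  assumes "wcommuting n q L" shows "L (act n q \<phi> h) = act n q (L \<phi>) h"
proof -
  have "L (foldl (wact q) \<phi> ws) = foldl (wact q) (L \<phi>) ws" if "set ws \<subseteq> {1..<n}" for ws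
    using that by (induction ws arbitrary: \<phi>) (use assms in \<open>auto simp: wcommuting_def\<close>)
  then show ?thesis
    by (simp add: act_def hlinearD[OF wcommuting_hlinear[OF assms]] reduced_word(3))
qed

lemma supported_0: "supported A 0"
  by (simp add: supported_def fapply)

lemma supported_add: "supported A \<phi> \<Longrightarrow> supported A \<psi> \<Longrightarrow> supported A (\<phi> + \<psi>)"
  by (force simp: supported_def fapply)

lemma supported_hscale: "supported A \<phi> \<Longrightarrow> supported A (hscale c \<phi>)"
  by (auto simp: supported_def fapply)

lemma supported_sum: "(\<And>a. a \<in> B \<Longrightarrow> supported A (f a)) \<Longrightarrow> supported A (\<Sum>a\<in>B. f a)"
  by (induction B rule: infinite_finite_induct) (auto intro: supported_add simp: supported_0)

lemma supported_ket: "g \<in> A \<Longrightarrow> supported A (ket g)"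
  by (auto simp: supported_def ket_def)

lemmas supported_closed = supported_0 supported_add supported_hscale supported_sum supported_ket

lemma finite_words: "finite (words n mu)"
proof -
  have "g p \<in> {i. mu i \<noteq> 0}" if "g \<in> words n mu" "p \<in> {1..n}" for g p
  proof -
    have "finite {x \<in> {1..n}. g x = g p}" by simp
    then have "cnt n g (g p) > 0" using that(2) unfolding cnt_def by (subst card_gt_0_iff) blast
    then show ?thesis using that(1) by (simp add: words_def)
  qed
  moreover have "finite {i. mu i \<noteq> 0}" if g: "g \<in> words n mu" for g
  proof (rule finite_subset)
    show "{i. mu i \<noteq> 0} \<subseteq> g ` {1..n}"
    proof
      fix i assume "i \<in> {i. mu i \<noteq> 0}"
      then have "cnt n g i \<noteq> 0" using g by (simp add: words_def)
      then show "i \<in> g ` {1..n}" by (auto simp: cnt_def)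
    qed
  qed simp
  ultimately show ?thesis
  proof (cases "words n mu = {}")
    case False
    then have fin: "finite {i. mu i \<noteq> 0}" using \<open>\<And>g. g \<in> words n mu \<Longrightarrow> finite {i. mu i \<noteq> 0}\<close> by blast
    have "words n mu \<subseteq> {g. \<forall>p. (p \<in> {1..n} \<longrightarrow> g p \<in> {i. mu i \<noteq> 0}) \<and> (p \<notin> {1..n} \<longrightarrow> g p = 0)}"
      using \<open>\<And>p g. g \<in> words n mu \<Longrightarrow> p \<in> {1..n} \<Longrightarrow> g p \<in> {i. mu i \<noteq> 0}\<close> by (auto simp: words_def)
    then show ?thesis by (rule finite_subset) (intro finite_set_of_finite_funs fin, simp)
  qed simp
qed

lemma words_D:
  assumes "g \<in> words n mu"
  shows "g p = 0 \<longleftrightarrow> p \<notin> {1..n}" "cnt n g i = mu i"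
  using assms by (auto simp: words_def)

lemma expand_kets:
  assumes "supported (words n mu) \<phi>"
  shows "\<phi> = (\<Sum>g\<in>words n mu. hscale (\<phi> g) (ket g))"
proof
  fix x
  have "(\<Sum>g\<in>words n mu. hscale (\<phi> g) (ket g)) x = (\<Sum>g\<in>words n mu. if g = x then \<phi> g else 0)"
    unfolding fapply by (intro sum.cong refl) (simp add: ket_def)
  then show "\<phi> x = (\<Sum>g\<in>words n mu. hscale (\<phi> g) (ket g)) x"
    using assms by (auto simp: finite_words supported_def)
qed

lemma cnt_comp:
  assumes "d \<in> Sym n" shows "cnt n (g \<circ> d) i = cnt n g i"
proof -
  have "bij_betw d {p \<in> {1..n}. (g \<circ> d) p = i} {p \<in> {1..n}. g p = i}"
  proof (rule bij_betwI[where g = "inv d"])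
    show "d \<in> {p \<in> {1..n}. (g \<circ> d) p = i} \<rightarrow> {p \<in> {1..n}. g p = i}"
      using Sym_D(7)[OF assms] by simp
    show "inv d \<in> {p \<in> {1..n}. g p = i} \<rightarrow> {p \<in> {1..n}. (g \<circ> d) p = i}"
      using Sym_D(8,3)[OF assms] by simp
  qed (use Sym_D(2,3)[OF assms] in auto)
  then show ?thesis by (simp add: cnt_def bij_betw_same_card)
qed

lemma words_comp_iff:
  assumes "d \<in> Sym n" shows "g \<circ> d \<in> words n mu \<longleftrightarrow> g \<in> words n mu"
proof -
  have "(\<forall>p. (g \<circ> d) p = 0 \<longleftrightarrow> p \<notin> {1..n}) \<longleftrightarrow> (\<forall>p. g p = 0 \<longleftrightarrow> p \<notin> {1..n})"
    using Sym_D(7,8)[OF assms] Sym_D(3)[OF assms] by (metis comp_apply)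
  then show ?thesis using cnt_comp[OF assms] by (simp add: words_def)
qed

lemma supported_wact:
  assumes "supported (words n mu) \<phi>" "i \<in> {1..<n}"
  shows "supported (words n mu) (wact q \<phi> i)"
proof -
  have "g \<circ> simple_refl i \<in> words n mu \<longleftrightarrow> g \<in> words n mu" for g
    by (rule words_comp_iff[OF simple_refl_in_Sym'[OF assms(2)]])
  then show ?thesis using assms(1) unfolding supported_def wact_def
    by (metis add.right_neutral mult_zero_right)
qed

lemma supported_act:
  assumes "supported (words n mu) \<phi>" shows "supported (words n mu) (act n q \<phi> h)"
proof -
  have "supported (words n mu) (foldl (wact q) \<phi> ws)" if "set ws \<subseteq> {1..<n}" for ws
    using that assms by (induction ws arbitrary: \<phi>) (auto simp: supported_wact)
  then show ?thesis unfolding act_def by (intro supported_closed) (auto simp: reduced_word(3))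
qed

definition start :: "(nat \<Rightarrow> nat) \<Rightarrow> nat \<Rightarrow> nat" where
  "start mu i = sum mu {..<i}"

text \<open>
  The letter at \<open>p\<close> is the row of \<open>p\<close> in \<open>t\<^sup>\<mu>\<close>, so this word generates the permutation module.
\<close>

definition row_word :: "nat \<Rightarrow> (nat \<Rightarrow> nat) \<Rightarrow> nat \<Rightarrow> nat" where
  "row_word n mu p = (if p \<in> {1..n} then LEAST i. p \<le> start mu (Suc i) else 0)"

lemma start_simps [simp]: "start mu 0 = 0" "start mu (Suc i) = start mu i + mu i"
  by (simp_all add: start_def)

lemma start_mono: "i \<le> j \<Longrightarrow> start mu i \<le> start mu j"
  unfolding start_def by (rule sum_mono2) auto

lemma start_le:
  assumes "is_composition n mu" shows "start mu i \<le> n"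
proof -
  have "sum mu {..<i} = sum mu ({..<i} \<inter> {i. mu i \<noteq> 0})"
    by (rule sum.mono_neutral_right) auto
  also have "\<dots> \<le> sum mu {i. mu i \<noteq> 0}"
    using assms by (intro sum_mono2) (auto simp: is_composition_def)
  finally show ?thesis using assms by (simp add: start_def is_composition_def)
qed

lemma ex_start_eq:
  assumes "is_composition n mu" shows "\<exists>m. start mu m = n"
proof -
  have fin: "finite {i. mu i \<noteq> 0}" using assms by (simp add: is_composition_def)
  then obtain m where m: "{i. mu i \<noteq> 0} \<subseteq> {..<m}" by (metis finite_nat_iff_bounded)
  have "sum mu {..<m} = sum mu {i. mu i \<noteq> 0}"
    by (rule sum.mono_neutral_right) (use m in auto)
  then show ?thesis using assms by (auto simp: start_def is_composition_def)
qed

lemma row_word_eq_iff: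
  assumes c: "is_composition n mu" and p: "p \<in> {1..n}"
  shows "row_word n mu p = i \<longleftrightarrow> start mu i < p \<and> p \<le> start mu i + mu i"
proof
  obtain m where m: "start mu m = n" using ex_start_eq[OF c] by blast
  have ex: "p \<le> start mu (Suc m)" using m p by simp
  assume i: "row_word n mu p = i"
  then have L: "i = (LEAST i. p \<le> start mu (Suc i))" using p by (simp add: row_word_def)
  have 1: "p \<le> start mu (Suc i)" unfolding L by (rule LeastI[of "\<lambda>i. p \<le> start mu (Suc i)", OF ex])
  have "start mu i < p"
  proof (cases i)
    case (Suc j)
    then have "\<not> p \<le> start mu (Suc j)" using L not_less_Least[of j "\<lambda>i. p \<le> start mu (Suc i)"] by simp
    then show ?thesis using Suc by simp
  qed (use p in simp)
  with 1 show "start mu i < p \<and> p \<le> start mu i + mu i" by simp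
next
  assume i: "start mu i < p \<and> p \<le> start mu i + mu i"
  have "(LEAST i. p \<le> start mu (Suc i)) = i"
  proof (rule Least_equality)
    fix j assume j: "p \<le> start mu (Suc j)"
    show "i \<le> j"
    proof (rule ccontr)
      assume "\<not> i \<le> j"
      then have "start mu (Suc j) \<le> start mu i" by (intro start_mono) simp
      then show False using i j by simp
    qed
  qed (use i in simp)
  then show "row_word n mu p = i" using p by (simp add: row_word_def)
qed

lemma row_word_pos:
  assumes c: "is_composition n mu" shows "row_word n mu p = 0 \<longleftrightarrow> p \<notin> {1..n}"
proof (cases "p \<in> {1..n}")
  case True
  have "mu 0 = 0" using c by (simp add: is_composition_def)
  then show ?thesis using True row_word_eq_iff[OF c True, of 0] by simp
qed (auto simp: row_word_def)

lemma row_word_mono: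
  assumes c: "is_composition n mu" and "p \<le> p'" "p \<in> {1..n}" "p' \<in> {1..n}"
  shows "row_word n mu p \<le> row_word n mu p'"
proof (rule ccontr)
  assume "\<not> ?thesis"
  then have "start mu (Suc (row_word n mu p')) \<le> start mu (row_word n mu p)" by (intro start_mono) simp
  then show False
    using assms row_word_eq_iff[OF c assms(3), of "row_word n mu p"]
      row_word_eq_iff[OF c assms(4), of "row_word n mu p'"] by simp
qed

lemma row_word_fibre:
  assumes c: "is_composition n mu"
  shows "{p \<in> {1..n}. row_word n mu p = i} = {start mu i <.. start mu i + mu i}"
proof (intro set_eqI)
  fix p
  have "p \<in> {1..n}" if "p \<in> {start mu i <.. start mu i + mu i}"
    using that start_le[OF c, of "Suc i"] by simp
  then show "p \<in> {p \<in> {1..n}. row_word n mu p = i} \<longleftrightarrow> p \<in> {start mu i <.. start mu i + mu i}"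
    using row_word_eq_iff[OF c, of p i] by auto
qed

lemma row_word_in_words:
  assumes c: "is_composition n mu" shows "row_word n mu \<in> words n mu"
  unfolding words_def using row_word_pos[OF c] row_word_fibre[OF c] by (auto simp: cnt_def)

lemma words_composition:
  assumes g: "g \<in> words n mu" shows "is_composition n mu"
proof -
  have sub: "{i. mu i \<noteq> 0} \<subseteq> g ` {1..n}"
  proof
    fix i assume "i \<in> {i. mu i \<noteq> 0}"
    then have "cnt n g i \<noteq> 0" using g by (simp add: words_def)
    then show "i \<in> g ` {1..n}" by (auto simp: cnt_def)
  qed
  have "{p \<in> {1..n}. g p = 0} = {}" using words_D(1)[OF g] by auto
  then have "cnt n g 0 = 0" unfolding cnt_def by (simp only: card.empty)
  then have "mu 0 = 0" using words_D(2)[OF g, of 0] by simp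
  moreover have "sum mu {i. mu i \<noteq> 0} = sum mu (g ` {1..n})"
    by (rule sum.mono_neutral_left) (use sub in auto)
  moreover have "sum mu (g ` {1..n}) = (\<Sum>i\<in>g ` {1..n}. \<Sum>p | p \<in> {1..n} \<and> g p = i. 1)"
    using words_D(2)[OF g] by (simp add: cnt_def)
  moreover have "\<dots> = (\<Sum>p\<in>{1..n}. 1)" by (rule sum.group) auto
  ultimately show ?thesis using finite_subset[OF sub] by (simp add: is_composition_def)
qed

lemma words_orbit:
  assumes g: "g \<in> words n mu"
  obtains d where "d \<in> Sym n" "g = row_word n mu \<circ> inv d"
proof -
  note c = words_composition[OF g]
  have "image_mset g (mset_set {1..n}) = image_mset (row_word n mu) (mset_set {1..n})"
    using words_D(2)[OF g] words_D(2)[OF row_word_in_words[OF c]]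
    by (intro multiset_eqI) (simp add: count_image_mset_eq_card_vimage cnt_def)
  from image_mset_eq_implies_permutes[OF _ this]
  obtain p where p': "p permutes {1..n}" "\<forall>x\<in>{1..n}. g x = row_word n mu (p x)" by blast
  then have p: "p permutes {1..n}" "\<And>x. x \<in> {1..n} \<Longrightarrow> g x = row_word n mu (p x)" by blast+
  have S: "p \<in> Sym n" using p(1) by (simp add: Sym_def)
  have "g x = row_word n mu (p x)" for x
  proof (cases "x \<in> {1..n}")
    case False
    then have "g x = 0" "row_word n mu x = 0" using words_D(1)[OF g] row_word_pos[OF c] by simp_all
    then show ?thesis using Sym_outside[OF S False] by simp
  qed (rule p(2))
  then have "g = row_word n mu \<circ> inv (inv p)" using Sym_D(1)[OF S] by (auto simp: inv_inv_eq)
  then show ?thesis using that Sym_D(6)[OF S] by blast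
qed

text \<open>
  A function on words is a function on right cosets of the Young subgroup; its pull-back to the
  group is an element of the Hecke algebra.  The image consists of the elements whose coefficients
  are constant on these cosets, which is the module \<open>M\<^sup>\<mu>\<close>.
\<close>

definition lift :: "nat \<Rightarrow> (nat \<Rightarrow> nat) \<Rightarrow> 'f::field hecke \<Rightarrow> 'f hecke" where
  "lift n mu \<phi> = (\<lambda>d. if d \<in> Sym n then \<phi> (row_word n mu \<circ> inv d) else 0)"

lemma hlinear_lift: "hlinear (lift n mu)"
  by (auto simp: hlinear_def lift_def fun_eq_iff fapply)

lemma lift_in_carrier: "lift n mu \<phi> \<in> hecke_carrier n"
  by (simp add: lift_def hecke_carrier_def)

lemma lift_inject:
  assumes "supported (words n mu) \<phi>" "supported (words n mu) \<psi>" "lift n mu \<phi> = lift n mu \<psi>"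
  shows "\<phi> = \<psi>"
proof
  fix g
  show "\<phi> g = \<psi> g"
  proof (cases "g \<in> words n mu")
    case True
    then obtain d where d: "d \<in> Sym n" "g = row_word n mu \<circ> inv d" by (rule words_orbit)
    then show ?thesis using fun_cong[OF assms(3), of d] by (simp add: lift_def)
  next
    case False
    then have "\<phi> g = 0" "\<psi> g = 0" using assms(1,2) by (auto simp: supported_def)
    then show ?thesis by simp
  qed
qed

text \<open>
  The places of \<open>i\<close> and \<open>i + 1\<close> are ordered like their rows, unless the rows agree; and then \<open>d\<close> and
  \<open>d s\<^sub>i\<close> lie in the same coset, and both cases of the rule give the factor \<open>q = 1 + (q - 1)\<close>.
\<close>

lemma times_simple_lift:
  assumes c: "is_composition n mu" and i: "i \<in> {1..<n}"
  shows "times_simple n q (lift n mu \<phi>) i = lift n mu (wact q \<phi> i)"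
proof
  fix d
  show "times_simple n q (lift n mu \<phi>) i d = lift n mu (wact q \<phi> i) d"
  proof (cases "d \<in> Sym n")
    case True
    let ?g = "row_word n mu \<circ> inv d"
    have ds: "d \<cdot> simple_refl i \<in> Sym n" using pmult_in_Sym[OF True simple_refl_in_Sym'[OF i]] .
    have in_range: "inv d i \<in> {1..n}" "inv d (i + 1) \<in> {1..n}"
      using i Sym_D(8)[OF True, of i] Sym_D(8)[OF True, of "i + 1"] by auto
    have eq: "row_word n mu \<circ> inv (d \<cdot> simple_refl i) = ?g \<circ> simple_refl i"
      unfolding inv_pmult_refl[OF True i] by (simp add: o_assoc)
    have flat: "?g \<circ> simple_refl i = ?g" if "?g i = ?g (i + 1)"
    proof
      fix x show "(?g \<circ> simple_refl i) x = ?g x"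
        using that simple_refl_other[of x i] by (cases "x = i \<or> x = i + 1") auto
    qed
    have L: "times_simple n q (lift n mu \<phi>) i d =
      (if inv d (i + 1) < inv d i then \<phi> (?g \<circ> simple_refl i) + (q - 1) * \<phi> ?g
       else q * \<phi> (?g \<circ> simple_refl i))"
      unfolding times_simple_apply[OF True i] using True ds by (simp add: lift_def eq del: comp_apply)
    have R: "lift n mu (wact q \<phi> i) d =
      (if ?g (i + 1) < ?g i then \<phi> (?g \<circ> simple_refl i) + (q - 1) * \<phi> ?g
       else q * \<phi> (?g \<circ> simple_refl i))"
      using True by (simp add: lift_def wact_def)
    show ?thesis
    proof (cases "inv d (i + 1) < inv d i")
      case T: True
      then have "?g (i + 1) \<le> ?g i" using row_word_mono[OF c _ in_range(2,1)] by simp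
      then consider "?g (i + 1) < ?g i" | "?g i = ?g (i + 1)" by linarith
      then show ?thesis
      proof cases
        case 2
        then show ?thesis unfolding L R flat[OF 2] using T by (simp add: algebra_simps)
      qed (simp only: L R T if_True)
    next
      case False
      then have "\<not> ?g (i + 1) < ?g i" using row_word_mono[OF c _ in_range] by simp
      with False show ?thesis by (simp only: L R if_False)
    qed
  qed (simp add: lift_def times_simple_outside[OF _ i])
qed

lemma hmult_lift:
  assumes c: "is_composition n mu"
  shows "hmult n q (lift n mu \<phi>) h = lift n mu (act n q \<phi> h)"
proof -
  have "foldl (times_simple n q) (lift n mu \<phi>) ws = lift n mu (foldl (wact q) \<phi> ws)"
    if "set ws \<subseteq> {1..<n}" for ws
    using that by (induction ws arbitrary: \<phi>) (simp_all add: times_simple_lift[OF c])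
  then show ?thesis
    by (simp add: hmult_def act_def hlinearD[OF hlinear_lift] reduced_word(3))
qed

text \<open>
  Inherited from the associativity of the Hecke algebra through the injection \<^const>\<open>lift\<close>.
\<close>

lemma act_assoc:
  assumes \<phi>: "supported (words n mu) \<phi>" and k: "h \<in> hecke_carrier n"
  shows "act n q (act n q \<phi> h) k = act n q \<phi> (hmult n q h k)"
proof (cases "words n mu = {}")
  case True
  then have "\<phi> = 0" using \<phi> by (auto simp: supported_def fun_eq_iff fapply)
  then show ?thesis by (simp add: hlinearD(3)[OF hlinear_act])
next
  case False
  then have c: "is_composition n mu" using words_composition by blast
  show ?thesis
  proof (rule lift_inject[of n mu])
    show "lift n mu (act n q (act n q \<phi> h) k) = lift n mu (act n q \<phi> (hmult n q h k))"
      using hmult_assoc[OF lift_in_carrier k, of q mu \<phi> k] by (simp only: hmult_lift[OF c])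
  qed (intro supported_act \<phi>)+
qed

lemma act_T: "w \<in> Sym n \<Longrightarrow> act n q \<phi> (T w) = foldl (wact q) \<phi> (reduced_word n w)"
  unfolding act_def by (rule sum_hscale_T)

lemma wact_ket:
  assumes "g i < g (i + 1)"
  shows "wact q (ket g) i = ket (g \<circ> simple_refl i)"
proof
  fix h
  have "h \<circ> simple_refl i = g \<longleftrightarrow> h = g \<circ> simple_refl i" by (metis simple_refl_simps(6))
  moreover have "g \<circ> simple_refl i \<noteq> g" using assms by (metis comp_apply less_irrefl simple_refl_simps(1))
  ultimately show "wact q (ket g) i h = ket (g \<circ> simple_refl i) h"
    using assms by (auto simp: wact_def ket_def)
qed

lemma wact_ket_eq:
  assumes "g i = g (i + 1)"
  shows "wact q (ket g) i = hscale q (ket g)"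
proof
  fix h
  have "g \<circ> simple_refl i = g"
  proof
    fix x show "(g \<circ> simple_refl i) x = g x"
      using assms simple_refl_other[of x i] by (cases "x = i \<or> x = i + 1") auto
  qed
  moreover have "h \<circ> simple_refl i = g \<longleftrightarrow> h = g \<circ> simple_refl i" by (metis simple_refl_simps(6))
  ultimately show "wact q (ket g) i h = hscale q (ket g) h"
    using assms by (auto simp: wact_def ket_def fapply)
qed

text \<open>
  Along a reduced word, the letters that are interchanged form an inversion of the final
  permutation, so each step is in the case \<open>g i < g (i + 1)\<close>.
\<close>

lemma foldl_wact_ket:
  assumes "reduced n ws"
    and "\<And>p p'. (p, p') \<in> inversions (word_perm ws) \<Longrightarrow> g p < g p'"
  shows "foldl (wact q) (ket g) ws = ket (g \<circ> inv (word_perm ws))"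
  using assms
proof (induction ws rule: rev_induct)
  case (snoc i ws)
  note r = reduced_snoc[OF snoc.prems(1)]
  note inv = inversions_pmult_refl(1)[OF r(3,4)]
  have "foldl (wact q) (ket g) ws = ket (g \<circ> inv (word_perm ws))"
    using snoc.prems(2) inv by (intro snoc.IH[OF r(1)]) auto
  moreover have "(g \<circ> inv (word_perm ws)) i < (g \<circ> inv (word_perm ws)) (i + 1)"
    using snoc.prems(2) inv by simp
  ultimately have "foldl (wact q) (ket g) (ws @ [i]) = ket (g \<circ> inv (word_perm ws) \<circ> simple_refl i)"
    using wact_ket[of "g \<circ> inv (word_perm ws)" i q] by simp
  then show ?case by (simp only: word_perm_snoc inv_pmult_refl[OF r(3,2)] o_assoc)
qed (simp add: inv_id)

lemma act_ket_T:
  assumes w: "w \<in> Sym n" and "\<And>p p'. p < p' \<Longrightarrow> w p' < w p \<Longrightarrow> g p < g p'"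
  shows "act n q (ket g) (T w) = ket (g \<circ> inv w)"
proof -
  have "foldl (wact q) (ket g) (reduced_word n w) = ket (g \<circ> inv (word_perm (reduced_word n w)))"
    by (rule foldl_wact_ket[OF reduced_word(1)[OF w]])
       (use assms(2) reduced_word(2)[OF w] in \<open>auto simp: inversions_def\<close>)
  then show ?thesis by (simp only: act_T[OF w] reduced_word(2)[OF w])
qed

section \<open>Row readings and Young subgroups\<close>

lemma row_tab_eq:
  assumes c: "is_composition n mu" and ij: "(i, j) \<in> diagram mu"
  shows "row_tab mu (i, j) = start mu i + j"
proof -
  have pos: "1 \<le> k" if "1 \<le> l" "l \<le> mu k" for k l
    using that c by (cases k) (auto simp: is_composition_def)
  have "{(k, l) \<in> diagram mu. k < i \<or> (k = i \<and> l \<le> j)}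
      = (SIGMA k:{..<i}. {1..mu k}) \<union> {i} \<times> {1..j}"
    using ij pos by (auto simp: diagram_def)
  moreover have "card ((SIGMA k:{..<i}. {1..mu k}) \<union> {i} \<times> {1..j}) = start mu i + j"
    by (subst card_Un_disjoint) (auto simp: start_def card_cartesian_product)
  ultimately show ?thesis by (simp add: row_tab_def)
qed

lemma row_tab_in_range:
  assumes c: "is_composition n mu" and ij: "(i, j) \<in> diagram mu"
  shows "row_tab mu (i, j) \<in> {1..n}" "row_word n mu (row_tab mu (i, j)) = i"
proof -
  have "1 \<le> j" "j \<le> mu i" using ij by (auto simp: diagram_def)
  then show r: "row_tab mu (i, j) \<in> {1..n}"
    using row_tab_eq[OF c ij] start_le[OF c, of "Suc i"] by simp
  show "row_word n mu (row_tab mu (i, j)) = i"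
    using row_word_eq_iff[OF c r, of i] row_tab_eq[OF c ij] \<open>1 \<le> j\<close> \<open>j \<le> mu i\<close> by simp
qed

lemma row_tab_surj:
  assumes c: "is_composition n mu" and p: "p \<in> {1..n}"
  shows "(row_word n mu p, p - start mu (row_word n mu p)) \<in> diagram mu"
    "row_tab mu (row_word n mu p, p - start mu (row_word n mu p)) = p"
proof -
  have *: "start mu (row_word n mu p) < p" "p \<le> start mu (row_word n mu p) + mu (row_word n mu p)"
    using row_word_eq_iff[OF c p, of "row_word n mu p"] by auto
  moreover have "row_word n mu p \<noteq> 0" using row_word_pos[OF c] p by simp
  ultimately show d: "(row_word n mu p, p - start mu (row_word n mu p)) \<in> diagram mu"
    by (auto simp: diagram_def)
  show "row_tab mu (row_word n mu p, p - start mu (row_word n mu p)) = p"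
    using row_tab_eq[OF c d] * by simp
qed

lemma row_entries_eq:
  assumes c: "is_composition n mu"
  shows "row_entries mu (row_tab mu) i = {p \<in> {1..n}. row_word n mu p = i}"
proof (intro set_eqI iffI)
  fix p assume "p \<in> row_entries mu (row_tab mu) i"
  then show "p \<in> {p \<in> {1..n}. row_word n mu p = i}"
    using row_tab_in_range[OF c] by (auto simp: row_entries_def)
next
  fix p assume "p \<in> {p \<in> {1..n}. row_word n mu p = i}"
  then show "p \<in> row_entries mu (row_tab mu) i"
    using row_tab_surj[OF c, of p] unfolding row_entries_def by force
qed

lemma young_subgroup_eq:
  assumes c: "is_composition n mu"
  shows "young_subgroup n mu = {w \<in> Sym n. \<forall>p. row_word n mu (w p) = row_word n mu p}"
proof (intro set_eqI iffI)
  fix w assume "w \<in> young_subgroup n mu"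
  then have w: "w \<in> Sym n" and im: "w ` {p \<in> {1..n}. row_word n mu p = i} = {p \<in> {1..n}. row_word n mu p = i}" for i
    using row_entries_eq[OF c] by (auto simp: young_subgroup_def)
  have "row_word n mu (w p) = row_word n mu p" for p
  proof (cases "p \<in> {1..n}")
    case True
    then have "w p \<in> w ` {p' \<in> {1..n}. row_word n mu p' = row_word n mu p}" by blast
    then show ?thesis unfolding im by simp
  qed (simp add: Sym_outside[OF w])
  then show "w \<in> {w \<in> Sym n. \<forall>p. row_word n mu (w p) = row_word n mu p}" using w by simp
next
  fix w assume "w \<in> {w \<in> Sym n. \<forall>p. row_word n mu (w p) = row_word n mu p}"
  then have w: "w \<in> Sym n" and row: "\<And>p. row_word n mu (w p) = row_word n mu p" by auto
  have "w ` {p \<in> {1..n}. row_word n mu p = i} = {p \<in> {1..n}. row_word n mu p = i}" for i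
  proof (intro set_eqI iffI)
    fix p assume p: "p \<in> {p \<in> {1..n}. row_word n mu p = i}"
    have "row_word n mu (inv w p) = i" using row[of "inv w p"] Sym_D(3)[OF w] p by simp
    then show "p \<in> w ` {p \<in> {1..n}. row_word n mu p = i}"
      using p Sym_D(3,8)[OF w] by (intro image_eqI[of _ _ "inv w p"]) auto
  qed (use Sym_D(7)[OF w] row in auto)
  then show "w \<in> young_subgroup n mu" using w row_entries_eq[OF c] by (simp add: young_subgroup_def)
qed

lemma x_elt_eq_lift:
  assumes c: "is_composition n mu"
  shows "x_elt n mu = lift n mu (ket (row_word n mu))"
proof
  fix d
  have fin: "finite (young_subgroup n mu)"
    by (rule finite_subset[OF _ finite_Sym[of n]]) (auto simp: young_subgroup_def)
  have "x_elt n mu d = (\<Sum>w\<in>young_subgroup n mu. if w = d then 1 else 0 :: 'a)"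
    unfolding x_elt_def fapply by (intro sum.cong refl) (simp add: T_def)
  then have x: "x_elt n mu d = (if d \<in> young_subgroup n mu then 1 else 0 :: 'a)"
    using fin by (simp add: if_distrib)
  have "row_word n mu \<circ> inv d = row_word n mu \<longleftrightarrow> (\<forall>p. row_word n mu (d p) = row_word n mu p)"
    if "d \<in> Sym n"
    using Sym_D(2,3)[OF that] by (metis comp_apply ext)
  then show "x_elt n mu d = (lift n mu (ket (row_word n mu)) d :: 'a)"
    unfolding x young_subgroup_eq[OF c] by (auto simp: lift_def ket_def)
qed

section \<open>Raising and lowering operators\<close>

text \<open>
  The divided power \<open>e\<^sub>i\<^sup>(\<^sup>t\<^sup>)\<close> on coefficient functions, restricted to the first \<open>k\<close> letters: the value at \<open>g\<close>
  is the sum over all ways to turn \<open>t\<close> letters \<open>i\<close> of \<open>g\<close> into \<open>i + 1\<close>, weighted by powers of \<open>q\<close> that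
  count the turned letters to the left of each unturned \<open>i\<close>.  The parameter \<open>k\<close> serves for
  inductions on the last letter.
\<close>

primrec raising :: "nat \<Rightarrow> 'f::field \<Rightarrow> nat \<Rightarrow> nat \<Rightarrow> 'f hecke \<Rightarrow> 'f hecke" where
  "raising 0 q i t \<phi> = (\<lambda>g. if t = 0 then \<phi> g else 0)"
| "raising (Suc k) q i t \<phi> = (\<lambda>g. if g (Suc k) = i
     then q ^ t * raising k q i t \<phi> g
       + (case t of 0 \<Rightarrow> 0 | Suc t' \<Rightarrow> raising k q i t' \<phi> (g(Suc k := Suc i)))
     else raising k q i t \<phi> g)"

text \<open>
  The operator \<open>f\<^sub>i\<close>; its weight at a letter counts the letters \<open>i + 1\<close> to the left of it
  (see \<open>lowering_sum\<close>).
\<close>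

primrec lowering :: "nat \<Rightarrow> 'f::field \<Rightarrow> nat \<Rightarrow> 'f hecke \<Rightarrow> 'f hecke" where
  "lowering 0 q i \<phi> = (\<lambda>g. 0)"
| "lowering (Suc k) q i \<phi> = (\<lambda>g.
     (if g (Suc k) = Suc i then q ^ cnt k g (Suc i) * \<phi> (g(Suc k := i)) else 0) + lowering k q i \<phi> g)"

text \<open>
  The words that occur in \<open>raising k q i t \<phi> g\<close> and \<open>lowering k q i \<phi> g\<close>: \<open>t\<close> letters \<open>i\<close> of \<open>g\<close>, at
  places up to \<open>k\<close>, are replaced by \<open>j\<close>.
\<close>

definition moved :: "nat \<Rightarrow> nat \<Rightarrow> nat \<Rightarrow> nat \<Rightarrow> (nat \<Rightarrow> nat) \<Rightarrow> (nat \<Rightarrow> nat) \<Rightarrow> bool" where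
  "moved k i j t g h \<longleftrightarrow>
     (\<forall>p. h p = g p \<or> (p \<in> {1..k} \<and> g p = i \<and> h p = j)) \<and> card {p. h p \<noteq> g p} = t"

lemma moved_refl: "moved k i j 0 g g"
  by (simp add: moved_def)

lemma moved_mono: "moved k i j t g h \<Longrightarrow> k \<le> m \<Longrightarrow> moved m i j t g h"
  unfolding moved_def by (meson atLeastAtMost_iff le_trans)

lemma moved_upd:
  assumes "moved k i j t (g(Suc k := j)) h" "g (Suc k) = i" "i \<noteq> j"
  shows "moved (Suc k) i j (Suc t) g h"
proof -
  have c: "card {p. h p \<noteq> (g(Suc k := j)) p} = t"
    and p: "h p = (g(Suc k := j)) p \<or> (p \<in> {1..k} \<and> (g(Suc k := j)) p = i \<and> h p = j)" for p
    using assms(1) by (auto simp: moved_def)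
  have hk: "h (Suc k) = j" using p[of "Suc k"] by simp
  have "{p. h p \<noteq> g p} = insert (Suc k) {p. h p \<noteq> (g(Suc k := j)) p}"
    using hk assms(2,3) by auto
  moreover have "{p. h p \<noteq> (g(Suc k := j)) p} \<subseteq> {1..k}" using p by blast
  then have "finite {p. h p \<noteq> (g(Suc k := j)) p}" by (rule finite_subset) simp
  ultimately have "card {p. h p \<noteq> g p} = Suc t" using c hk by simp
  moreover have "h x = g x \<or> (x \<in> {1..Suc k} \<and> g x = i \<and> h x = j)" for x
    using p[of x] hk assms(2) by (cases "x = Suc k") auto
  ultimately show ?thesis by (simp add: moved_def)
qed

lemma moved_cnt:
  assumes m: "moved k i j t g h" and "k \<le> m" "i \<noteq> j"
  shows "cnt m g i = cnt m h i + t" "cnt m h j = cnt m g j + t"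
    "l \<noteq> i \<Longrightarrow> l \<noteq> j \<Longrightarrow> cnt m h l = cnt m g l"
proof -
  have p: "h p = g p \<or> (p \<in> {1..k} \<and> g p = i \<and> h p = j)" for p
    using m by (auto simp: moved_def)
  have D: "{p. h p \<noteq> g p} \<subseteq> {1..m}" using p \<open>k \<le> m\<close> by fastforce
  have fin: "finite {p. h p \<noteq> g p}" using D by (rule finite_subset) simp
  have c: "card {p. h p \<noteq> g p} = t" using m by (simp add: moved_def)
  have "{p \<in> {1..m}. g p = i} = {p \<in> {1..m}. h p = i} \<union> {p. h p \<noteq> g p}"
    using p D \<open>i \<noteq> j\<close> by force
  moreover have "{p \<in> {1..m}. h p = i} \<inter> {p. h p \<noteq> g p} = {}" using p \<open>i \<noteq> j\<close> by force
  ultimately show "cnt m g i = cnt m h i + t" unfolding cnt_def using fin c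
    by (simp add: card_Un_disjoint)
  have "{p \<in> {1..m}. h p = j} = {p \<in> {1..m}. g p = j} \<union> {p. h p \<noteq> g p}"
    using p D \<open>i \<noteq> j\<close> by force
  moreover have "{p \<in> {1..m}. g p = j} \<inter> {p. h p \<noteq> g p} = {}" using p \<open>i \<noteq> j\<close> by force
  ultimately show "cnt m h j = cnt m g j + t" unfolding cnt_def using fin c
    by (simp add: card_Un_disjoint)
  assume "l \<noteq> i" "l \<noteq> j"
  then have "{p \<in> {1..m}. h p = l} = {p \<in> {1..m}. g p = l}" using p by force
  then show "cnt m h l = cnt m g l" by (simp add: cnt_def)
qed

lemma moved_outside: "moved k i j t g h \<Longrightarrow> p \<notin> {1..k} \<Longrightarrow> h p = g p"
  by (auto simp: moved_def)

lemma moved_0_iff: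
  assumes "moved k i j t g h" "i > 0" "j > 0" shows "h p = 0 \<longleftrightarrow> g p = 0"
  using assms unfolding moved_def by (metis less_numeral_extra(3))

lemma cnt_Suc: "cnt (Suc k) g i = cnt k g i + (if g (Suc k) = i then 1 else 0)"
proof -
  have "{p \<in> {1..Suc k}. g p = i} = {p \<in> {1..k}. g p = i} \<union> (if g (Suc k) = i then {Suc k} else {})"
    by (auto simp: le_Suc_eq)
  then show ?thesis by (simp add: cnt_def)
qed

lemma cnt_0 [simp]: "cnt 0 g i = 0"
  by (simp add: cnt_def)

lemma cnt_cong: "(\<And>p. p \<in> {1..k} \<Longrightarrow> g p = h p) \<Longrightarrow> cnt k g i = cnt k h i"
  unfolding cnt_def by (rule arg_cong[where f = card]) auto

lemma cnt_upd_outside [simp]: "k < p \<Longrightarrow> cnt k (g(p := c)) i = cnt k g i"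
  by (rule cnt_cong) auto

lemma raising_cong:
  "(\<And>h. moved k i (Suc i) t g h \<Longrightarrow> \<phi> h = \<psi> h) \<Longrightarrow> raising k q i t \<phi> g = raising k q i t \<psi> g"
proof (induction k arbitrary: t g)
  case 0
  then show ?case using moved_refl by auto
next
  case (Suc k)
  have 1: "raising k q i t \<phi> g = raising k q i t \<psi> g"
    by (rule Suc.IH, rule Suc.prems, erule moved_mono) simp
  have 2: "raising k q i t' \<phi> (g(Suc k := Suc i)) = raising k q i t' \<psi> (g(Suc k := Suc i))"
    if "t = Suc t'" "g (Suc k) = i" for t'
  proof (rule Suc.IH)
    fix h assume "moved k i (Suc i) t' (g(Suc k := Suc i)) h"
    then have "moved (Suc k) i (Suc i) (Suc t') g h" by (rule moved_upd) (use that in auto)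
    then show "\<phi> h = \<psi> h" using Suc.prems that(1) by simp
  qed
  show ?case using 1 2 by (auto split: nat.split)
qed

lemma lowering_cong:
  "(\<And>h. moved k (Suc i) i 1 g h \<Longrightarrow> \<phi> h = \<psi> h) \<Longrightarrow> lowering k q i \<phi> g = lowering k q i \<psi> g"
proof (induction k)
  case (Suc k)
  have "lowering k q i \<phi> g = lowering k q i \<psi> g"
    by (rule Suc.IH, rule Suc.prems, erule moved_mono) simp
  moreover have "\<phi> (g(Suc k := i)) = \<psi> (g(Suc k := i))" if "g (Suc k) = Suc i"
    by (rule Suc.prems, unfold One_nat_def, rule moved_upd[OF moved_refl]) (use that in auto)
  ultimately show ?case by simp
qed simp

lemma raising_0 [simp]: "raising k q i 0 \<phi> = \<phi>"
  by (induction k) (auto simp: fun_eq_iff)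

lemma raising_Suc_1: "raising (Suc k) q i 1 \<phi> g =
    (if g (Suc k) = i then q * raising k q i 1 \<phi> g + \<phi> (g(Suc k := Suc i)) else raising k q i 1 \<phi> g)"
  by (simp add: One_nat_def)

lemma hlinear_raising: "hlinear (raising k q i t)"
proof -
  have "raising k q i t (\<phi> + \<psi>) g = raising k q i t \<phi> g + raising k q i t \<psi> g"
    "raising k q i t (hscale c \<phi>) g = c * raising k q i t \<phi> g" for \<phi> \<psi> c g
    by (induction k arbitrary: t g) (auto simp: fapply algebra_simps split: nat.split)
  then show ?thesis by (auto simp: hlinear_def fun_eq_iff fapply)
qed

lemma hlinear_lowering: "hlinear (lowering k q i)"
proof -
  have "lowering k q i (\<phi> + \<psi>) g = lowering k q i \<phi> g + lowering k q i \<psi> g"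
    "lowering k q i (hscale c \<phi>) g = c * lowering k q i \<phi> g" for \<phi> \<psi> c g
    by (induction k arbitrary: g) (auto simp: fapply algebra_simps)
  then show ?thesis by (auto simp: hlinear_def fun_eq_iff fapply)
qed

lemma raising_pointwise:
  "raising k q i t (\<lambda>h. \<phi> h + \<psi> h) g = raising k q i t \<phi> g + raising k q i t \<psi> g"
  "raising k q i t (\<lambda>h. c * \<phi> h) g = c * raising k q i t \<phi> g"
  "raising k q i t (\<lambda>h. 0) g = 0"
  using hlinearD(1)[OF hlinear_raising[of k q i t], of \<phi> \<psi>]
    hlinearD(2)[OF hlinear_raising[of k q i t], of c \<phi>]
    hlinearD(3)[OF hlinear_raising[of k q i t]]
  by (auto simp: fun_eq_iff plus_fun_def hscale_def zero_fun_def)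

lemma lowering_pointwise:
  "lowering k q i (\<lambda>h. \<phi> h + \<psi> h) g = lowering k q i \<phi> g + lowering k q i \<psi> g"
  "lowering k q i (\<lambda>h. c * \<phi> h) g = c * lowering k q i \<phi> g"
  "lowering k q i (\<lambda>h. 0) g = 0"
  using hlinearD(1)[OF hlinear_lowering[of k q i], of \<phi> \<psi>]
    hlinearD(2)[OF hlinear_lowering[of k q i], of c \<phi>]
    hlinearD(3)[OF hlinear_lowering[of k q i]]
  by (auto simp: fun_eq_iff plus_fun_def hscale_def zero_fun_def)

lemma raising_nonzero:
  assumes "raising k q i t \<phi> g \<noteq> 0"
  obtains h where "moved k i (Suc i) t g h" "\<phi> h \<noteq> 0"
  using assms raising_cong[of k i t g \<phi> "\<lambda>h. 0" q] raising_pointwise(3)[of k q i t g] by metis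

lemma lowering_nonzero:
  assumes "lowering k q i \<phi> g \<noteq> 0"
  obtains h where "moved k (Suc i) i 1 g h" "\<phi> h \<noteq> 0"
  using assms lowering_cong[of k i g \<phi> "\<lambda>h. 0" q] lowering_pointwise(3)[of k q i g] by metis

lemma raising_upd:
  "k < p \<Longrightarrow> raising k q i t (\<lambda>h. \<phi> (h(p := c))) g = raising k q i t \<phi> (g(p := c))"
proof (induction k arbitrary: t g)
  case (Suc k)
  then have "p \<noteq> Suc k" by simp
  then have "g(p := c, Suc k := Suc i) = g(Suc k := Suc i, p := c)" by (rule fun_upd_twist)
  moreover have "(g(p := c)) (Suc k) = g (Suc k)" using \<open>p \<noteq> Suc k\<close> by simp
  ultimately show ?case using Suc by (simp split: nat.split del: fun_upd_apply)
qed simp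

lemma lowering_upd:
  "k < p \<Longrightarrow> lowering k q i (\<lambda>h. \<phi> (h(p := c))) g = lowering k q i \<phi> (g(p := c))"
proof (induction k arbitrary: g)
  case (Suc k)
  then have "p \<noteq> Suc k" by simp
  then have "g(p := c, Suc k := i) = g(Suc k := i, p := c)" by (rule fun_upd_twist)
  moreover have "(g(p := c)) (Suc k) = g (Suc k)" "cnt k (g(p := c)) (Suc i) = cnt k g (Suc i)"
    using \<open>p \<noteq> Suc k\<close> Suc.prems by simp_all
  ultimately show ?case using Suc by (simp del: fun_upd_apply)
qed simp

lemma upd_comp_refl:
  "Suc k < j \<Longrightarrow> (g(Suc k := c)) \<circ> simple_refl j = (g \<circ> simple_refl j)(Suc k := c)"
  "j + 1 < Suc k \<Longrightarrow> (g(Suc k := c)) \<circ> simple_refl j = (g \<circ> simple_refl j)(Suc k := c)"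
  by (auto simp: fun_eq_iff simple_refl_def transpose_def)

lemma raising_comp_refl:
  "k < j \<Longrightarrow> raising k q i t (\<lambda>h. \<phi> (h \<circ> simple_refl j)) g = raising k q i t \<phi> (g \<circ> simple_refl j)"
proof (induction k arbitrary: t g)
  case (Suc k)
  have "(g \<circ> simple_refl j) (Suc k) = g (Suc k)" using Suc.prems by (simp add: simple_refl_other)
  then show ?case using Suc
    by (simp add: upd_comp_refl(1) split: nat.split del: fun_upd_apply comp_apply)
qed simp

lemma lowering_comp_refl:
  "k < j \<Longrightarrow> lowering k q i (\<lambda>h. \<phi> (h \<circ> simple_refl j)) g = lowering k q i \<phi> (g \<circ> simple_refl j)"
proof (induction k arbitrary: g)
  case (Suc k)
  have "(g \<circ> simple_refl j) (Suc k) = g (Suc k)" using Suc.prems by (simp add: simple_refl_other)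
  moreover have "cnt k (g \<circ> simple_refl j) (Suc i) = cnt k g (Suc i)"
    using Suc.prems by (intro cnt_cong) (auto simp: simple_refl_other)
  ultimately show ?case using Suc by (simp add: upd_comp_refl(1) del: fun_upd_apply comp_apply)
qed simp

text \<open>
  \<open>T\<^sub>j\<close> acts on letters beyond the reach of the operator.
\<close>

lemma raising_wact_less:
  assumes "k < j"
  shows "raising k q i t (wact q \<phi> j) g = wact q (raising k q i t \<phi>) j g"
proof -
  have out: "h (j + 1) = g (j + 1) \<and> h j = g j" if "moved k i (Suc i) t g h" for h
    using moved_outside[OF that] assms by simp
  show ?thesis
  proof (cases "g (j + 1) < g j")
    case True
    have "raising k q i t (wact q \<phi> j) g =
        raising k q i t (\<lambda>h. \<phi> (h \<circ> simple_refl j) + (q - 1) * \<phi> h) g"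
      by (rule raising_cong, drule out) (use True in \<open>simp add: wact_def\<close>)
    then show ?thesis
      using True by (simp only: raising_pointwise raising_comp_refl[OF assms]) (simp add: wact_def)
  next
    case False
    have "raising k q i t (wact q \<phi> j) g = raising k q i t (\<lambda>h. q * \<phi> (h \<circ> simple_refl j)) g"
      by (rule raising_cong, drule out) (use False in \<open>simp add: wact_def\<close>)
    then show ?thesis
      using False by (simp only: raising_pointwise raising_comp_refl[OF assms]) (simp add: wact_def)
  qed
qed

lemma lowering_wact_less:
  assumes "k < j"
  shows "lowering k q i (wact q \<phi> j) g = wact q (lowering k q i \<phi>) j g"
proof -
  have out: "h (j + 1) = g (j + 1) \<and> h j = g j" if "moved k (Suc i) i 1 g h" for h
    using moved_outside[OF that] assms by simp
  show ?thesis
  proof (cases "g (j + 1) < g j")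
    case True
    have "lowering k q i (wact q \<phi> j) g =
        lowering k q i (\<lambda>h. \<phi> (h \<circ> simple_refl j) + (q - 1) * \<phi> h) g"
      by (rule lowering_cong, drule out) (use True in \<open>simp add: wact_def\<close>)
    then show ?thesis
      using True by (simp only: lowering_pointwise lowering_comp_refl[OF assms]) (simp add: wact_def)
  next
    case False
    have "lowering k q i (wact q \<phi> j) g = lowering k q i (\<lambda>h. q * \<phi> (h \<circ> simple_refl j)) g"
      by (rule lowering_cong, drule out) (use False in \<open>simp add: wact_def\<close>)
    then show ?thesis
      using False by (simp only: lowering_pointwise lowering_comp_refl[OF assms]) (simp add: wact_def)
  qed
qed

text \<open>
  The commutation is local: it is a computation with the two letters that \<open>T\<^sub>j\<close> interchanges, for each
  order relation between them and \<open>i\<close>, \<open>i + 1\<close>.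
\<close>

lemma raising_wact_eq:
  "raising (Suc (Suc k)) q i t (wact q \<phi> (Suc k)) g = wact q (raising (Suc (Suc k)) q i t \<phi>) (Suc k) g"
proof -
  define G where "G x y = g(Suc k := x, Suc (Suc k) := y)" for x y
  define a where "a = g (Suc k)"
  define b where "b = g (Suc (Suc k))"
  have g: "g = G a b" by (simp add: G_def a_def b_def)
  have G: "G x y (Suc k) = x" "G x y (Suc (Suc k)) = y" "G x y (Suc (k + 1)) = y"
    "(G x y)(Suc k := z) = G z y" "(G x y)(Suc (Suc k) := z) = G x z"
    "G x y \<circ> simple_refl (Suc k) = G y x" for x y z
    by (auto simp: G_def fun_eq_iff simple_refl_def transpose_def)
  define V where "V t x y = raising k q i t \<phi> (G x y)" for t x y
  have W: "raising k q i t (wact q \<phi> (Suc k)) (G x y) =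
    (if y < x then V t y x + (q - 1) * V t x y else q * V t y x)" for t x y
    by (subst raising_wact_less) (simp_all add: wact_def G V_def)
  have W0: "wact q \<phi> (Suc k) (G x y) =
    (if y < x then V 0 y x + (q - 1) * V 0 x y else q * V 0 y x)" for x y
    using W[of 0 x y] by simp
  have R: "raising (Suc (Suc k)) q i t \<phi> (G x y) =
    (if y = i then q ^ t * (if x = i then q ^ t * V t x y + (case t of 0 \<Rightarrow> 0 | Suc t' \<Rightarrow> V t' (Suc i) y) else V t x y)
       + (case t of 0 \<Rightarrow> 0 | Suc t' \<Rightarrow> (if x = i then q ^ t' * V t' x (Suc i)
            + (case t' of 0 \<Rightarrow> 0 | Suc t'' \<Rightarrow> V t'' (Suc i) (Suc i)) else V t' x (Suc i)))
     else if x = i then q ^ t * V t x y + (case t of 0 \<Rightarrow> 0 | Suc t' \<Rightarrow> V t' (Suc i) y) else V t x y)" for x y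
    by (simp add: G V_def split: nat.split)
  have L: "raising (Suc (Suc k)) q i t (wact q \<phi> (Suc k)) (G x y) =
    (let U = (\<lambda>t x y. if y < x then V t y x + (q - 1) * V t x y else q * V t y x) in
    (if y = i then q ^ t * (if x = i then q ^ t * U t x y + (case t of 0 \<Rightarrow> 0 | Suc t' \<Rightarrow> U t' (Suc i) y) else U t x y)
       + (case t of 0 \<Rightarrow> 0 | Suc t' \<Rightarrow> (if x = i then q ^ t' * U t' x (Suc i)
            + (case t' of 0 \<Rightarrow> 0 | Suc t'' \<Rightarrow> U t'' (Suc i) (Suc i)) else U t' x (Suc i)))
     else if x = i then q ^ t * U t x y + (case t of 0 \<Rightarrow> 0 | Suc t' \<Rightarrow> U t' (Suc i) y) else U t x y))" for x y
    by (cases t) (simp_all add: G W W0 Let_def split: nat.split)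
  have wR: "wact q (raising (Suc (Suc k)) q i t \<phi>) (Suc k) (G x y) =
    (if y < x then raising (Suc (Suc k)) q i t \<phi> (G y x) + (q - 1) * raising (Suc (Suc k)) q i t \<phi> (G x y)
     else q * raising (Suc (Suc k)) q i t \<phi> (G y x))" for x y
    by (simp add: wact_def G del: raising.simps)
  consider "t = 0" | "t = 1" | t' where "t = Suc (Suc t')" by (metis One_nat_def not0_implies_Suc)
  then have "raising (Suc (Suc k)) q i t (wact q \<phi> (Suc k)) (G a b) =
    wact q (raising (Suc (Suc k)) q i t \<phi>) (Suc k) (G a b)"
  proof cases
    case 1
    then show ?thesis unfolding L wR R by (simp add: Let_def)
  next
    case 2
    then show ?thesis unfolding L wR R
      by (cases "a = i"; cases "b = i"; cases "a = Suc i"; cases "b = Suc i")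
         (simp_all add: Let_def algebra_simps One_nat_def)
  next
    case 3
    then show ?thesis unfolding L wR R
      by (cases "a = i"; cases "b = i"; cases "a = Suc i"; cases "b = Suc i")
         (simp_all add: Let_def algebra_simps)
  qed
  then show ?thesis unfolding g[symmetric] .
qed

lemma lowering_wact_eq:
  "lowering (Suc (Suc k)) q i (wact q \<phi> (Suc k)) g = wact q (lowering (Suc (Suc k)) q i \<phi>) (Suc k) g"
proof -
  define G where "G x y = g(Suc k := x, Suc (Suc k) := y)" for x y
  define a where "a = g (Suc k)"
  define b where "b = g (Suc (Suc k))"
  have g: "g = G a b" by (simp add: G_def a_def b_def)
  have G: "G x y (Suc k) = x" "G x y (Suc (Suc k)) = y" "G x y (Suc (k + 1)) = y"
    "(G x y)(Suc k := z) = G z y" "(G x y)(Suc (Suc k) := z) = G x z"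
    "G x y \<circ> simple_refl (Suc k) = G y x" for x y z
    by (auto simp: G_def fun_eq_iff simple_refl_def transpose_def)
  define V where "V x y = lowering k q i \<phi> (G x y)" for x y
  define c where "c = cnt k g (Suc i)"
  have c: "cnt k (G x y) (Suc i) = c" for x y by (simp add: c_def G_def)
  have W: "lowering k q i (wact q \<phi> (Suc k)) (G x y) =
    (if y < x then V y x + (q - 1) * V x y else q * V y x)" for x y
    by (subst lowering_wact_less) (simp_all add: wact_def G V_def)
  have w: "wact q \<psi> (Suc k) (G x y) =
    (if y < x then \<psi> (G y x) + (q - 1) * \<psi> (G x y) else q * \<psi> (G y x))" for x y \<psi>
    by (simp add: wact_def G)
  have R: "lowering (Suc (Suc k)) q i \<phi> (G x y) =
    (if y = Suc i then q ^ (c + (if x = Suc i then 1 else 0)) * \<phi> (G x i) else 0)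
    + ((if x = Suc i then q ^ c * \<phi> (G i y) else 0) + V x y)" for x y
    by (simp add: G V_def c cnt_Suc)
  have L: "lowering (Suc (Suc k)) q i (wact q \<phi> (Suc k)) (G x y) =
    (if y = Suc i then q ^ (c + (if x = Suc i then 1 else 0)) * wact q \<phi> (Suc k) (G x i) else 0)
    + ((if x = Suc i then q ^ c * wact q \<phi> (Suc k) (G i y) else 0)
      + (if y < x then V y x + (q - 1) * V x y else q * V y x))" for x y
    by (simp add: G W c cnt_Suc)
  have "lowering (Suc (Suc k)) q i (wact q \<phi> (Suc k)) (G a b) =
      wact q (lowering (Suc (Suc k)) q i \<phi>) (Suc k) (G a b)" unfolding L w R
    by (cases "a = i"; cases "b = i"; cases "a = Suc i"; cases "b = Suc i")
       (simp_all add: algebra_simps power_add)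
  then show ?thesis unfolding g[symmetric] .
qed

lemma wact_apply:
  "wact q \<phi> j g = (if g (j + 1) < g j then \<phi> (g \<circ> simple_refl j) + (q - 1) * \<phi> g
     else q * \<phi> (g \<circ> simple_refl j))"
  by (simp add: wact_def)

lemma upd_comp_refl_above:
  assumes "j + 1 < p"
  shows "(g \<circ> simple_refl j)(p := c) = g(p := c) \<circ> simple_refl j" "(g \<circ> simple_refl j) p = g p"
    "(g(p := c)) (j + 1) = g (j + 1)" "(g(p := c)) (1 + j) = g (1 + j)" "(g(p := c)) j = g j"
  using assms by (auto simp: fun_eq_iff simple_refl_def transpose_def)

lemma raising_wact:
  "1 \<le> j \<Longrightarrow> Suc j \<le> k \<Longrightarrow> raising k q i t (wact q \<phi> j) g = wact q (raising k q i t \<phi>) j g"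
proof (induction k arbitrary: t g)
  case (Suc k)
  show ?case
  proof (cases "Suc j = Suc k")
    case True
    with Suc.prems(1) obtain k' where "k = Suc k'" "j = Suc k'" by (cases k) auto
    then show ?thesis using raising_wact_eq[of k' q i t \<phi> g] by simp
  next
    case False
    then have jk: "Suc j \<le> k" using Suc.prems(2) by simp
    define R where "R t = raising k q i t \<phi>" for t
    have IH: "raising k q i t (wact q \<phi> j) h = wact q (R t) j h" for t h
      unfolding R_def by (rule Suc.IH[OF Suc.prems(1) jk])
    have R: "raising (Suc k) q i t \<phi> h = (if h (Suc k) = i then q ^ t * R t h
      + (case t of 0 \<Rightarrow> 0 | Suc t' \<Rightarrow> R t' (h(Suc k := Suc i))) else R t h)" for h
      by (simp add: R_def split: nat.split)
    have "j + 1 < Suc k" using jk by simp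
    note u = upd_comp_refl_above[OF this]
    show ?thesis
      unfolding raising.simps(2)[of _ _ _ _ "wact q \<phi> j"] IH
      unfolding wact_apply R u
      by (cases t) (simp_all add: u algebra_simps del: fun_upd_apply comp_apply)
  qed
qed simp

lemma lowering_wact:
  "1 \<le> j \<Longrightarrow> Suc j \<le> k \<Longrightarrow> lowering k q i (wact q \<phi> j) g = wact q (lowering k q i \<phi>) j g"
proof (induction k arbitrary: g)
  case (Suc k)
  show ?case
  proof (cases "Suc j = Suc k")
    case True
    with Suc.prems(1) obtain k' where "k = Suc k'" "j = Suc k'" by (cases k) auto
    then show ?thesis using lowering_wact_eq[of k' q i \<phi> g] by simp
  next
    case False
    then have jk: "Suc j \<le> k" using Suc.prems(2) by simp
    define R where "R = lowering k q i \<phi>"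
    have IH: "lowering k q i (wact q \<phi> j) h = wact q R j h" for h
      unfolding R_def by (rule Suc.IH[OF Suc.prems(1) jk])
    have R: "lowering (Suc k) q i \<phi> h = (if h (Suc k) = Suc i
      then q ^ cnt k h (Suc i) * \<phi> (h(Suc k := i)) else 0) + R h" for h
      by (simp add: R_def)
    have "j + 1 < Suc k" using jk by simp
    note u = upd_comp_refl_above[OF this]
    have c: "cnt k (g \<circ> simple_refl j) (Suc i) = cnt k g (Suc i)"
      using Suc.prems(1) jk by (intro cnt_comp simple_refl_in_Sym) auto
    show ?thesis
      unfolding lowering.simps(2)[of _ _ _ "wact q \<phi> j"] IH
      unfolding wact_apply R u c
      by (simp add: u algebra_simps del: fun_upd_apply comp_apply)
  qed
qed simp

lemma wcommuting_raising: "wcommuting n q (raising n q i t)"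
  by (auto simp: wcommuting_def hlinear_raising fun_eq_iff intro!: raising_wact)

lemma wcommuting_lowering: "wcommuting n q (lowering n q i)"
  by (auto simp: wcommuting_def hlinear_lowering fun_eq_iff intro!: lowering_wact)

definition qnum :: "'f::field \<Rightarrow> nat \<Rightarrow> 'f" where
  "qnum q m = (\<Sum>i<m. q ^ i)"

lemma qnum_simps [simp]: "qnum q 0 = 0" "qnum q 1 = 1" "qnum q (Suc m) = qnum q m + q ^ m"
    "qnum q (1 + m) = qnum q m + q ^ m" "qnum q (m + 1) = qnum q m + q ^ m"
  by (auto simp: qnum_def One_nat_def)

lemma qnum_Suc': "qnum q (Suc m) = 1 + q * qnum q m"
proof (induction m)
  case (Suc m)
  have "qnum q (Suc (Suc m)) = qnum q (Suc m) + q ^ Suc m" by (rule qnum_simps(3))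
  also have "\<dots> = 1 + q * (qnum q m + q ^ m)" unfolding Suc by (simp add: algebra_simps)
  finally show ?case by simp
qed simp

lemma qnum_add: "qnum q (m + k) = qnum q m + q ^ m * qnum q k"
  by (induction k) (auto simp: algebra_simps power_add)

text \<open>
  The relation \<open>[e, f] = [h]\<close> of quantum \<open>sl\<^sub>2\<close>, in a form without negative powers of \<open>q\<close>; by induction
  on the last letter.
\<close>

lemma raising_lowering_same:
  "raising k q i 1 (lowering k q i \<phi>) g =
    lowering k q i (raising k q i 1 \<phi>) g + (qnum q (cnt k g i) - qnum q (cnt k g (Suc i))) * \<phi> g"
proof (induction k arbitrary: \<phi> g)
  case 0
  show ?case by (simp add: One_nat_def)
next
  case (Suc k)
  let ?e = "raising k q i 1" and ?f = "lowering k q i"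
  have oute: "h (Suc k) = g (Suc k)" if "moved k i (Suc i) 1 g h" for h
    using moved_outside[OF that, of "Suc k"] by simp
  have outf: "h (Suc k) = g (Suc k)" if "moved k (Suc i) i 1 g h" for h
    using moved_outside[OF that, of "Suc k"] by simp
  have E: "raising (Suc k) q i 1 (lowering (Suc k) q i \<phi>) g =
    (if g (Suc k) = i then q * ?e (lowering (Suc k) q i \<phi>) g + lowering (Suc k) q i \<phi> (g(Suc k := Suc i))
     else ?e (lowering (Suc k) q i \<phi>) g)" by (rule raising_Suc_1)
  have F: "lowering (Suc k) q i (raising (Suc k) q i 1 \<phi>) g =
    (if g (Suc k) = Suc i then q ^ cnt k g (Suc i) * raising (Suc k) q i 1 \<phi> (g(Suc k := i)) else 0)
    + ?f (raising (Suc k) q i 1 \<phi>) g" by simp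
  consider "g (Suc k) = i" | "g (Suc k) = Suc i" | "g (Suc k) \<noteq> i" "g (Suc k) \<noteq> Suc i" by blast
  then show ?case
  proof cases
    case 1
    have a: "?e (lowering (Suc k) q i \<phi>) g = ?e (?f \<phi>) g"
      by (rule raising_cong, drule oute) (use 1 in simp)
    have "?f (raising (Suc k) q i 1 \<phi>) g = ?f (\<lambda>h. q * ?e \<phi> h + \<phi> (h(Suc k := Suc i))) g"
      by (rule lowering_cong, drule outf) (use 1 in \<open>simp add: raising_Suc_1 del: raising.simps\<close>)
    then have c: "?f (raising (Suc k) q i 1 \<phi>) g = q * ?f (?e \<phi>) g + ?f \<phi> (g(Suc k := Suc i))"
      by (simp only: lowering_pointwise) (simp add: lowering_upd del: raising.simps)
    have d: "lowering (Suc k) q i \<phi> (g(Suc k := Suc i)) =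
        q ^ cnt k g (Suc i) * \<phi> g + ?f \<phi> (g(Suc k := Suc i))"
      using 1 by (simp add: fun_upd_idem)
    have m: "\<phi> g * (qnum q c + q ^ c) = \<phi> g * (1 + q * qnum q c)" for c
      using qnum_Suc'[of q c] by simp
    show ?thesis
      unfolding E F a c d Suc.IH using 1 m[of "cnt k g i"] m[of "cnt k g (Suc i)"]
      by (simp add: cnt_Suc algebra_simps del: raising.simps lowering.simps)
  next
    case 2
    have "?e (lowering (Suc k) q i \<phi>) g =
        ?e (\<lambda>h. q * q ^ cnt k g (Suc i) * \<phi> (h(Suc k := i)) + ?f \<phi> h) g"
    proof (rule raising_cong)
      fix h assume h: "moved k i (Suc i) 1 g h"
      then have "cnt k h (Suc i) = Suc (cnt k g (Suc i))" using moved_cnt(2)[OF h, of k] by simp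
      then show "lowering (Suc k) q i \<phi> h = q * q ^ cnt k g (Suc i) * \<phi> (h(Suc k := i)) + ?f \<phi> h"
        using oute[OF h] 2 by simp
    qed
    then have a: "?e (lowering (Suc k) q i \<phi>) g =
        q * q ^ cnt k g (Suc i) * ?e \<phi> (g(Suc k := i)) + ?e (?f \<phi>) g"
      by (simp only: raising_pointwise) (simp add: raising_upd del: lowering.simps)
    have b: "?f (raising (Suc k) q i 1 \<phi>) g = ?f (?e \<phi>) g"
      by (rule lowering_cong, drule outf) (use 2 in \<open>simp add: raising_Suc_1 del: raising.simps\<close>)
    have c: "raising (Suc k) q i 1 \<phi> (g(Suc k := i)) = q * ?e \<phi> (g(Suc k := i)) + \<phi> g"
      unfolding raising_Suc_1 using 2 by (simp add: fun_upd_idem)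
    show ?thesis unfolding E F a b c Suc.IH using 2
      by (simp add: cnt_Suc algebra_simps del: raising.simps lowering.simps)
  next
    case 3
    have a: "?e (lowering (Suc k) q i \<phi>) g = ?e (?f \<phi>) g"
      by (rule raising_cong, drule oute) (use 3 in simp)
    have b: "?f (raising (Suc k) q i 1 \<phi>) g = ?f (?e \<phi>) g"
      by (rule lowering_cong, drule outf) (use 3 in \<open>simp add: raising_Suc_1 del: raising.simps\<close>)
    show ?thesis unfolding E F a b Suc.IH using 3 by (simp add: cnt_Suc)
  qed
qed

lemma raising_lowering_other:
  assumes "i \<noteq> j"
  shows "raising k q i 1 (lowering k q j \<phi>) g = lowering k q j (raising k q i 1 \<phi>) g"
proof (induction k arbitrary: \<phi> g)
  case (Suc k)
  let ?e = "raising k q i 1" and ?f = "lowering k q j"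
  have oute: "h (Suc k) = g (Suc k)" if "moved k i (Suc i) 1 g h" for h
    using that moved_outside[of k _ _ _ g h "Suc k"] by auto
  have outf: "h (Suc k) = g (Suc k)" if "moved k (Suc j) j 1 g h" for h
    using that moved_outside[of k _ _ _ g h "Suc k"] by auto
  have E: "raising (Suc k) q i 1 (lowering (Suc k) q j \<phi>) g =
    (if g (Suc k) = i then q * ?e (lowering (Suc k) q j \<phi>) g + lowering (Suc k) q j \<phi> (g(Suc k := Suc i))
     else ?e (lowering (Suc k) q j \<phi>) g)" by (rule raising_Suc_1)
  have F: "lowering (Suc k) q j (raising (Suc k) q i 1 \<phi>) g =
    (if g (Suc k) = Suc j then q ^ cnt k g (Suc j) * raising (Suc k) q i 1 \<phi> (g(Suc k := j)) else 0)
    + ?f (raising (Suc k) q i 1 \<phi>) g" by simp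
  have f1: "?f (raising (Suc k) q i 1 \<phi>) g =
    (if g (Suc k) = i then q * ?f (?e \<phi>) g + ?f \<phi> (g(Suc k := Suc i)) else ?f (?e \<phi>) g)"
  proof (cases "g (Suc k) = i")
    case True
    have "?f (raising (Suc k) q i 1 \<phi>) g = ?f (\<lambda>h. q * ?e \<phi> h + \<phi> (h(Suc k := Suc i))) g"
      by (rule lowering_cong, drule outf) (use True in \<open>simp add: raising_Suc_1 del: raising.simps\<close>)
    then show ?thesis using True
      by (simp only: lowering_pointwise) (simp add: lowering_upd del: raising.simps)
  next
    case False
    have "?f (raising (Suc k) q i 1 \<phi>) g = ?f (?e \<phi>) g"
      by (rule lowering_cong, drule outf) (use False in \<open>simp add: raising_Suc_1 del: raising.simps\<close>)
    then show ?thesis using False by simp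
  qed
  have e1: "(if i = Suc j then q else 1) * ?e (lowering (Suc k) q j \<phi>) g =
    (if g (Suc k) = Suc j then q ^ cnt k g (Suc j) * ?e \<phi> (g(Suc k := j)) else 0)
    + (if i = Suc j then q else 1) * ?e (?f \<phi>) g"
  proof (cases "g (Suc k) = Suc j")
    case True
    let ?c = "if i = Suc j then q else 1"
    have "?c * ?e (lowering (Suc k) q j \<phi>) g = ?e (\<lambda>h. ?c * lowering (Suc k) q j \<phi> h) g"
      by (simp only: raising_pointwise)
    also have "\<dots> = ?e (\<lambda>h. q ^ cnt k g (Suc j) * \<phi> (h(Suc k := j)) + ?c * ?f \<phi> h) g"
    proof (rule raising_cong)
      fix h assume h: "moved k i (Suc i) 1 g h"
      have "cnt k g (Suc j) = cnt k h (Suc j) + (if i = Suc j then 1 else 0)"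
        using moved_cnt(1,3)[OF h, of k] assms by auto
      then show "?c * lowering (Suc k) q j \<phi> h =
          q ^ cnt k g (Suc j) * \<phi> (h(Suc k := j)) + ?c * ?f \<phi> h"
        using oute[OF h] True by (auto simp: algebra_simps power_add)
    qed
    also have "\<dots> = q ^ cnt k g (Suc j) * ?e \<phi> (g(Suc k := j)) + ?c * ?e (?f \<phi>) g"
      by (simp only: raising_pointwise) (simp add: raising_upd del: lowering.simps)
    finally show ?thesis using True by simp
  next
    case False
    have "?e (lowering (Suc k) q j \<phi>) g = ?e (?f \<phi>) g"
      by (rule raising_cong, drule oute) (use False in simp)
    then show ?thesis using False by simp
  qed
  show ?case
  proof (cases "i = Suc j")
    case True
    show ?thesis
    proof (cases "g (Suc k) = i")
      case T: True
      show ?thesis unfolding E F f1 using T True e1 assms Suc.IH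
        by (simp add: raising_Suc_1 del: raising.simps)
    next
      case False
      have "?e (lowering (Suc k) q j \<phi>) g = ?e (?f \<phi>) g"
        by (rule raising_cong, drule oute) (use False True in simp)
      then show ?thesis unfolding E F f1 using False True Suc.IH by simp
    qed
  next
    case False
    then show ?thesis unfolding E F f1 using e1 assms Suc.IH
      by (auto simp: raising_Suc_1 simp del: raising.simps)
  qed
qed simp

lemma lowering_commute:
  assumes "Suc i < j"
  shows "lowering k q i (lowering k q j \<phi>) g = lowering k q j (lowering k q i \<phi>) g"
proof (induction k arbitrary: \<phi> g)
  case (Suc k)
  have *: "lowering k q i' (lowering (Suc k) q j' \<phi>) g =
    (if g (Suc k) = Suc j' then q ^ cnt k g (Suc j') * lowering k q i' \<phi> (g(Suc k := j')) else 0)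
     + lowering k q i' (lowering k q j' \<phi>) g" if ij: "Suc i' < j' \<or> Suc j' < i'" for i' j'
  proof (cases "g (Suc k) = Suc j'")
    case True
    have "lowering k q i' (lowering (Suc k) q j' \<phi>) g =
      lowering k q i' (\<lambda>h. q ^ cnt k g (Suc j') * \<phi> (h(Suc k := j')) + lowering k q j' \<phi> h) g"
    proof (rule lowering_cong)
      fix h assume h: "moved k (Suc i') i' 1 g h"
      show "lowering (Suc k) q j' \<phi> h = q ^ cnt k g (Suc j') * \<phi> (h(Suc k := j')) + lowering k q j' \<phi> h"
        using moved_outside[OF h, of "Suc k"] True moved_cnt(3)[OF h, of k "Suc j'"] ij by auto
    qed
    then show ?thesis using True
      by (simp only: lowering_pointwise) (simp add: lowering_upd)
  next
    case False
    have "lowering k q i' (lowering (Suc k) q j' \<phi>) g = lowering k q i' (lowering k q j' \<phi>) g"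
    proof (rule lowering_cong)
      fix h assume h: "moved k (Suc i') i' 1 g h"
      show "lowering (Suc k) q j' \<phi> h = lowering k q j' \<phi> h"
        using moved_outside[OF h, of "Suc k"] False by auto
    qed
    then show ?thesis using False by simp
  qed
  have "lowering (Suc k) q i (lowering (Suc k) q j \<phi>) g =
    (if g (Suc k) = Suc i then q ^ cnt k g (Suc i) * lowering (Suc k) q j \<phi> (g(Suc k := i)) else 0)
    + lowering k q i (lowering (Suc k) q j \<phi>) g" by simp
  moreover have "lowering (Suc k) q j (lowering (Suc k) q i \<phi>) g =
    (if g (Suc k) = Suc j then q ^ cnt k g (Suc j) * lowering (Suc k) q i \<phi> (g(Suc k := j)) else 0)
    + lowering k q j (lowering (Suc k) q i \<phi>) g" by simp
  ultimately show ?case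
    unfolding *[OF disjI1[OF assms]] *[OF disjI2[OF assms]] using assms Suc.IH by auto
qed simp

lemma lowering_sum:
  "lowering k q i \<phi> g = (\<Sum>p | p \<in> {1..k} \<and> g p = Suc i. q ^ cnt (p - 1) g (Suc i) * \<phi> (g(p := i)))"
proof (induction k)
  case (Suc k)
  have "{p. p \<in> {1..Suc k} \<and> g p = Suc i} =
      {p. p \<in> {1..k} \<and> g p = Suc i} \<union> (if g (Suc k) = Suc i then {Suc k} else {})"
    by (auto simp: le_Suc_eq)
  moreover have "(\<Sum>p \<in> {p. p \<in> {1..k} \<and> g p = Suc i} \<union> {Suc k}. q ^ cnt (p - 1) g (Suc i) * \<phi> (g(p := i)))
    = (\<Sum>p | p \<in> {1..k} \<and> g p = Suc i. q ^ cnt (p - 1) g (Suc i) * \<phi> (g(p := i)))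
      + q ^ cnt k g (Suc i) * \<phi> (g(Suc k := i))"
    by (subst sum.union_disjoint) auto
  ultimately show ?case by (simp add: Suc.IH add.commute del: fun_upd_apply)
qed simp

lemma supported_raising:
  assumes "supported (words n mu) \<phi>" "i > 0"
  shows "supported (words n (mu(i := mu i + t, Suc i := mu (Suc i) - t))) (raising n q i t \<phi>)"
  unfolding supported_def
proof (intro allI impI)
  fix g assume "raising n q i t \<phi> g \<noteq> 0"
  then obtain h where h: "moved n i (Suc i) t g h" "\<phi> h \<noteq> 0" by (rule raising_nonzero)
  then have hw: "h \<in> words n mu" using assms(1) by (simp add: supported_def)
  show "g \<in> words n (mu(i := mu i + t, Suc i := mu (Suc i) - t))"
    using moved_0_iff[OF h(1)] moved_cnt[OF h(1), of n] words_D[OF hw] \<open>i > 0\<close>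
    unfolding words_def by auto
qed

lemma supported_lowering:
  assumes "supported (words n mu) \<phi>" "i > 0"
  shows "supported (words n (mu(i := mu i - 1, Suc i := mu (Suc i) + 1))) (lowering n q i \<phi>)"
  unfolding supported_def
proof (intro allI impI)
  fix g assume "lowering n q i \<phi> g \<noteq> 0"
  then obtain h where h: "moved n (Suc i) i 1 g h" "\<phi> h \<noteq> 0" by (rule lowering_nonzero)
  then have hw: "h \<in> words n mu" using assms(1) by (simp add: supported_def)
  show "g \<in> words n (mu(i := mu i - 1, Suc i := mu (Suc i) + 1))"
    using moved_0_iff[OF h(1)] moved_cnt[OF h(1), of n] words_D[OF hw] \<open>i > 0\<close>
    unfolding words_def by auto
qed

section \<open>Antisymmetrization along column blocks\<close>

lemma wact_quadratic:
  "wact q (wact q \<phi> i) i = hscale (q - 1) (wact q \<phi> i) + hscale q \<phi>"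
proof
  fix g :: "nat \<Rightarrow> nat"
  have flat: "g \<circ> simple_refl i = g" if "g i = g (i + 1)"
  proof
    fix x show "(g \<circ> simple_refl i) x = g x"
      using that simple_refl_other[of x i] by (cases "x = i \<or> x = i + 1") auto
  qed
  have s: "(g \<circ> simple_refl i) i = g (i + 1)" "(g \<circ> simple_refl i) (i + 1) = g i"
    by simp_all
  have s': "(g \<circ> simple_refl i) (1 + i) = g i" using s(2) by (simp only: add.commute)
  consider "g (i + 1) < g i" | "g i < g (i + 1)" | "g i = g (i + 1)" by linarith
  then show "wact q (wact q \<phi> i) i g = (hscale (q - 1) (wact q \<phi> i) + hscale q \<phi>) g"
  proof cases
    case 3
    then show ?thesis by (simp add: wact_apply fapply flat[OF 3] algebra_simps)
  qed (simp_all add: wact_apply s s' fapply algebra_simps del: comp_apply)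
qed

lemma act_T_simple_refl:
  assumes "i \<in> {1..<n}" shows "act n q \<phi> (T (simple_refl i)) = wact q \<phi> i"
  using assms act_T[OF simple_refl_in_Sym'[OF assms], of q \<phi>] reduced_word_simple_refl[of i n] by simp

text \<open>
  The positions \<open>{1..n}\<close> are cut into consecutive blocks of lengths \<open>\<nu>\<^sub>1, \<nu>\<^sub>2, \<dots>\<close>, and \<open>y\<close> is the
  \<open>q\<close>-antisymmetrizer of the blocks.  For \<open>\<nu> = \<lambda>'\<close> the blocks are the columns of the tableau \<open>t\<^sub>\<lambda>\<close>.
\<close>

locale blocks =
  fixes n :: nat and q :: "'f::field" and nu :: "nat \<Rightarrow> nat"
  assumes comp: "is_composition n nu" and q0: "q \<noteq> 0"
begin

abbreviation "blk \<equiv> row_word n nu"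

text \<open>
  The word that runs through \<open>1, 2, 3, \<dots>\<close> in each block.  For \<open>\<nu> = \<lambda>'\<close> its letter at \<open>p\<close> is the row
  of \<open>p\<close> in \<open>t\<^sub>\<lambda>\<close>.
\<close>

definition "col p = (if p \<in> {1..n} then p - start nu (blk p) else 0)"

definition "young = young_subgroup n nu"

abbreviation "y \<equiv> y_elt n q nu"

definition "block_inj = {g :: nat \<Rightarrow> nat. \<forall>p\<in>{1..n}. \<forall>p'\<in>{1..n}. blk p = blk p' \<longrightarrow> g p = g p' \<longrightarrow> p = p'}"

lemma young_iff: "u \<in> young \<longleftrightarrow> u \<in> Sym n \<and> (\<forall>p. blk (u p) = blk p)"
  using young_subgroup_eq[OF comp] by (auto simp: young_def)

lemma young_Sym: "u \<in> young \<Longrightarrow> u \<in> Sym n"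
  by (simp add: young_iff)

lemma finite_young: "finite young"
  by (rule finite_subset[OF _ finite_Sym[of n]]) (auto simp: young_iff)

definition "ycoeff u = (- q) powi (- int (len n u))"

lemma y_eq: "y = (\<Sum>u\<in>young. hscale (ycoeff u) (T u))"
  by (simp add: y_elt_def young_def ycoeff_def)

lemma act_y: "act n q \<phi> y = (\<Sum>u\<in>young. hscale (ycoeff u) (act n q \<phi> (T u)))"
  unfolding y_eq by (simp add: hlinearD[OF hlinear_act_right])

lemma young_refl_mult:
  assumes i: "i \<in> {1..<n}" "blk i = blk (i + 1)" and u: "u \<in> young"
  shows "simple_refl i \<cdot> u \<in> young"
proof -
  have "blk (simple_refl i p) = blk p" for p
    using i(2) simple_refl_other[of p i] by (cases "p = i \<or> p = i + 1") auto
  moreover have "simple_refl i \<cdot> u \<in> Sym n"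
    using pmult_in_Sym[OF simple_refl_in_Sym'[OF i(1)] young_Sym[OF u]] .
  ultimately show ?thesis using u by (auto simp: young_iff pmult_def)
qed

text \<open>
  Applying \<open>s\<^sub>i\<close> to both entries of the inversions of \<open>u\<close> gives the inversions of \<open>s\<^sub>i u\<close> other than the
  pair \<open>(i, i + 1)\<close>.
\<close>

lemma len_refl_mult:
  assumes i: "i \<in> {1..<n}" and u: "u \<in> Sym n" and up: "u i < u (i + 1)"
  shows "len n (simple_refl i \<cdot> u) = len n u + 1"
proof -
  let ?s = "simple_refl i"
  have su: "?s \<cdot> u \<in> Sym n" using pmult_in_Sym[OF simple_refl_in_Sym'[OF i] u] .
  have bij: "bij_betw (map_prod ?s ?s) (inversions u) (inversions (?s \<cdot> u) - {(i, i + 1)})"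
  proof (rule bij_betwI[where g = "map_prod ?s ?s"])
    show "map_prod ?s ?s \<in> inversions u \<rightarrow> inversions (?s \<cdot> u) - {(i, i + 1)}"
    proof (rule Pi_I)
      fix x assume "x \<in> inversions u"
      moreover obtain p p' where x: "x = (p, p')" by (cases x)
      ultimately have pp: "p < p'" "u p' < u p" by (auto simp: inversions_def)
      then have "\<not> (p = i \<and> p' = i + 1)" using up by auto
      then have "?s p < ?s p'" using pp(1) by (simp add: simple_refl_less_iff)
      moreover have "\<not> (?s p = i \<and> ?s p' = i + 1)"
      proof
        assume *: "?s p = i \<and> ?s p' = i + 1"
        have "p = ?s (?s p)" "p' = ?s (?s p')" by simp_all
        then have "p = i + 1" "p' = i" unfolding conjunct1[OF *] conjunct2[OF *] by simp_all
        then show False using pp by simp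
      qed
      ultimately show "map_prod ?s ?s x \<in> inversions (?s \<cdot> u) - {(i, i + 1)}"
        using pp x by (auto simp: inversions_def pmult_def)
    qed
    show "map_prod ?s ?s \<in> inversions (?s \<cdot> u) - {(i, i + 1)} \<rightarrow> inversions u"
    proof (rule Pi_I)
      fix x assume "x \<in> inversions (?s \<cdot> u) - {(i, i + 1)}"
      moreover obtain p p' where x: "x = (p, p')" by (cases x)
      ultimately have ne: "(p, p') \<noteq> (i, i + 1)" and pp: "p < p'" "u (?s p') < u (?s p)" by (auto simp: inversions_def pmult_def)
      then have "?s p < ?s p'" using ne by (simp add: simple_refl_less_iff)
      then show "map_prod ?s ?s x \<in> inversions u" using pp x by (simp add: inversions_def)
    qed
  qed auto
  have "(i, i + 1) \<in> inversions (?s \<cdot> u)" using up by (simp add: inversions_def pmult_def)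
  then have "card (inversions (?s \<cdot> u)) = card (inversions (?s \<cdot> u) - {(i, i + 1)}) + 1"
    using finite_inversions[OF su] by (metis Suc_eq_plus1 card_Suc_Diff1)
  then show ?thesis
    using bij_betw_same_card[OF bij] by (simp add: len_eq_card_inversions u su)
qed

lemma ycoeff_refl_mult:
  assumes "i \<in> {1..<n}" "u \<in> Sym n" "u i < u (i + 1)"
  shows "ycoeff (simple_refl i \<cdot> u) = - ycoeff u / q"
proof -
  have "(- q) powi (- int (len n u) - 1) = (- q) powi (- int (len n u)) / (- q)"
    using q0 by (simp add: power_int_diff)
  moreover have "- int (len n u + 1) = - int (len n u) - 1" by simp
  ultimately show ?thesis unfolding ycoeff_def len_refl_mult[OF assms] by simp
qed

text \<open>
  The left factorization \<open>y = (1 - q\<^sup>-\<^sup>1 T\<^sub>i) y'\<close>, for \<open>i\<close> and \<open>i + 1\<close> in one block.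
\<close>

lemma act_y_factor:
  assumes i: "i \<in> {1..<n}" "blk i = blk (i + 1)" and \<phi>: "supported (words n mu) \<phi>"
  defines "y' \<equiv> \<Sum>u | u \<in> young \<and> u i < u (i + 1). hscale (ycoeff u) (T u)"
  shows "act n q \<phi> y = act n q (\<phi> - hscale (1 / q) (wact q \<phi> i)) y'"
proof -
  let ?s = "simple_refl i"
  let ?up = "{u. u \<in> young \<and> u i < u (i + 1)}"
  have fin: "finite ?up" using finite_young by simp
  \<comment> \<open>The Young subgroup consists of the elements that increase at i and their products with the reflection.\<close>
  have young: "young = ?up \<union> (\<lambda>u. ?s \<cdot> u) ` ?up"
  proof (intro set_eqI iffI)
    fix u assume u: "u \<in> young"
    show "u \<in> ?up \<union> (\<lambda>u. ?s \<cdot> u) ` ?up"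
    proof (cases "u i < u (i + 1)")
      case False
      have "u i \<noteq> u (i + 1)" using Sym_D(4)[OF young_Sym[OF u]] by auto
      with False have "?s \<cdot> u \<in> ?up" using young_refl_mult[OF i u] by (auto simp: pmult_def)
      moreover have "u = ?s \<cdot> (?s \<cdot> u)" by simp
      ultimately show ?thesis by blast
    qed (use u in simp)
  qed (use young_refl_mult[OF i] in auto)
  have disj: "?up \<inter> (\<lambda>u. ?s \<cdot> u) ` ?up = {}" by (auto simp: pmult_def)
  have inj: "inj_on (\<lambda>u. ?s \<cdot> u) ?up" by (rule inj_onI) (metis refl_refl_pmult)
  have step: "act n q \<phi> (T (?s \<cdot> u)) = act n q (wact q \<phi> i) (T u)" if "u \<in> ?up" for u
  proof -
    have u: "u \<in> Sym n" "u i < u (i + 1)" using that young_Sym by auto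
    show ?thesis
      unfolding hmult_T_refl_T[OF u(1) i(1) u(2), of q, symmetric]
        act_assoc[OF \<phi> T_in_carrier[OF simple_refl_in_Sym'[OF i(1)]], symmetric]
        act_T_simple_refl[OF i(1)] ..
  qed
  have "act n q \<phi> y = (\<Sum>u\<in>?up. hscale (ycoeff u) (act n q \<phi> (T u)))
      + (\<Sum>u\<in>?up. hscale (ycoeff (?s \<cdot> u)) (act n q \<phi> (T (?s \<cdot> u))))"
    unfolding act_y by (subst (1) young) (simp add: sum.union_disjoint[OF fin _ disj] fin sum.reindex[OF inj])
  also have "(\<Sum>u\<in>?up. hscale (ycoeff (?s \<cdot> u)) (act n q \<phi> (T (?s \<cdot> u))))
      = (\<Sum>u\<in>?up. hscale (ycoeff u) (act n q (- hscale (1 / q) (wact q \<phi> i)) (T u)))"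
  proof (rule sum.cong[OF refl])
    fix u assume u: "u \<in> ?up"
    then have "ycoeff (?s \<cdot> u) = - ycoeff u / q" using i(1) young_Sym by (intro ycoeff_refl_mult) auto
    then show "hscale (ycoeff (?s \<cdot> u)) (act n q \<phi> (T (?s \<cdot> u)))
        = hscale (ycoeff u) (act n q (- hscale (1 / q) (wact q \<phi> i)) (T u))"
      unfolding step[OF u] hlinearD[OF hlinear_act] by (simp add: fun_eq_iff fapply)
  qed
  also have "(\<Sum>u\<in>?up. hscale (ycoeff u) (act n q \<phi> (T u)))
      + (\<Sum>u\<in>?up. hscale (ycoeff u) (act n q (- hscale (1 / q) (wact q \<phi> i)) (T u)))
      = act n q (\<phi> - hscale (1 / q) (wact q \<phi> i)) y'"
    unfolding y'_def hlinearD[OF hlinear_act_right] diff_conv_add_uminus act_add_left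
    by (simp add: sum.distrib hscale_add)
  finally show ?thesis .
qed

text \<open>
  By the quadratic relation, \<open>T\<^sub>i (1 - q\<^sup>-\<^sup>1 T\<^sub>i) = -(1 - q\<^sup>-\<^sup>1 T\<^sub>i)\<close>.
\<close>

lemma act_y_flip:
  assumes i: "i \<in> {1..<n}" "blk i = blk (i + 1)" and \<phi>: "supported (words n mu) \<phi>"
  shows "act n q (wact q \<phi> i) y = - act n q \<phi> y"
proof -
  have "wact q \<phi> i - hscale (1 / q) (wact q (wact q \<phi> i) i) = - (\<phi> - hscale (1 / q) (wact q \<phi> i))"
    unfolding wact_quadratic using q0 by (simp add: fun_eq_iff fapply field_simps)
  then show ?thesis
    unfolding act_y_factor[OF i \<phi>] act_y_factor[OF i supported_wact[OF \<phi> i(1)]]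
    by (simp only: hlinearD(5)[OF hlinear_act])
qed

lemma act_y_kill:
  assumes i: "i \<in> {1..<n}" "blk i = blk (i + 1)" and \<phi>: "supported (words n mu) \<phi>"
    and eq: "wact q \<phi> i = hscale q \<phi>"
  shows "act n q \<phi> y = 0"
proof -
  have "\<phi> - hscale (1 / q) (hscale q \<phi>) = 0" using q0 by simp
  then show ?thesis unfolding act_y_factor[OF i \<phi>] eq by (simp only: hlinearD(3)[OF hlinear_act])
qed

definition block_sorted :: "(nat \<Rightarrow> nat) \<Rightarrow> bool" where
  "block_sorted g \<longleftrightarrow> (\<forall>p p'. 1 \<le> p \<longrightarrow> p < p' \<longrightarrow> p' \<le> n \<longrightarrow> blk p = blk p' \<longrightarrow> g p < g p')"

text \<open>
  The inversions of \<open>u\<close> lie within blocks, where the letters increase; so \<open>T\<^sub>u\<close> just permutes the letters.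
\<close>

lemma act_ket_y_sorted:
  assumes g: "block_sorted g"
  shows "act n q (ket g) y = (\<Sum>u\<in>young. hscale (ycoeff u) (ket (g \<circ> inv u)))"
  unfolding act_y
proof (rule sum.cong[OF refl])
  fix u assume u: "u \<in> young"
  have "act n q (ket g) (T u) = ket (g \<circ> inv u)"
  proof (rule act_ket_T[OF young_Sym[OF u]])
    fix p p' :: nat assume pp: "p < p'" "u p' < u p"
    then have "(p, p') \<in> inversions u" by (simp add: inversions_def)
    then have r: "p \<in> {1..n}" "p' \<in> {1..n}" using inversions_subset[OF young_Sym[OF u]] by auto
    then have r': "u p \<in> {1..n}" "u p' \<in> {1..n}" using Sym_D(7)[OF young_Sym[OF u]] by auto
    have "blk p \<le> blk p'" using row_word_mono[OF comp _ r] pp by simp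
    moreover have "blk (u p') \<le> blk (u p)" using row_word_mono[OF comp _ r'(2,1)] pp by simp
    ultimately have "blk p = blk p'" using u by (simp add: young_iff)
    then show "g p < g p'" using g pp r by (auto simp: block_sorted_def)
  qed
  then show "hscale (ycoeff u) (act n q (ket g) (T u)) = hscale (ycoeff u) (ket (g \<circ> inv u))" by simp
qed

lemma blk_between:
  assumes "blk p = blk p'" "p \<le> r" "r \<le> p'" "1 \<le> p" "p' \<le> n"
  shows "blk r = blk p"
  using assms row_word_mono[OF comp, of p r] row_word_mono[OF comp, of r p'] by simp

lemma not_sorted_adjacent:
  assumes "\<not> block_sorted g"
  obtains i where "i \<in> {1..<n}" "blk i = blk (i + 1)" "g (i + 1) \<le> g i"
proof (rule ccontr)
  assume "\<not> thesis"
  then have up: "g i < g (i + 1)" if "i \<in> {1..<n}" "blk i = blk (i + 1)" for i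
    using that \<open>\<And>i. \<lbrakk>i \<in> {1..<n}; blk i = blk (i + 1); g (i + 1) \<le> g i\<rbrakk> \<Longrightarrow> thesis\<close> by force
  have "g p < g p'" if p: "1 \<le> p" and "p < p'" "p' \<le> n" "blk p = blk p'" for p p'
    using that(2-)
  proof (induction p')
    case (Suc m)
    have m: "blk m = blk p" using Suc.prems p by (intro blk_between[of p "Suc m"]) auto
    then have "g m < g (Suc m)" using up[of m] Suc.prems p by (simp add: Suc_eq_plus1[symmetric] del: Suc_eq_plus1)
    moreover have "g p < g m" if "p \<noteq> m" using Suc.IH Suc.prems m that by simp
    ultimately show ?case by (cases "p = m") auto
  qed simp
  then show False using assms by (auto simp: block_sorted_def)
qed

lemma block_injD: "g \<in> block_inj \<Longrightarrow> p \<in> {1..n} \<Longrightarrow> p' \<in> {1..n} \<Longrightarrow> blk p = blk p' \<Longrightarrow> g p = g p' \<Longrightarrow> p = p'"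
  unfolding block_inj_def by blast

lemma block_inj_comp:
  assumes "u \<in> young" shows "g \<circ> u \<in> block_inj \<longleftrightarrow> g \<in> block_inj"
proof
  note u = Sym_D[OF young_Sym[OF assms]]
  have b: "blk (u p) = blk p" for p using assms by (simp add: young_iff)
  have b': "blk (inv u p) = blk p" for p using b[of "inv u p"] u(3) by simp
  assume g: "g \<circ> u \<in> block_inj"
  show "g \<in> block_inj" unfolding block_inj_def
  proof (intro CollectI ballI impI)
    fix p p' assume p: "p \<in> {1..n}" "p' \<in> {1..n}" "blk p = blk p'" "g p = g p'"
    have "inv u p = inv u p'"
    proof (rule block_injD[OF g])
      show "inv u p \<in> {1..n}" "inv u p' \<in> {1..n}" using p u(8) by blast+
    qed (simp_all add: b' p(3) u(3) p(4))
    then show "p = p'" using u(5) by simp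
  qed
next
  note u = Sym_D[OF young_Sym[OF assms]]
  have b: "blk (u p) = blk p" for p using assms by (simp add: young_iff)
  assume g: "g \<in> block_inj"
  show "g \<circ> u \<in> block_inj" unfolding block_inj_def
  proof (intro CollectI ballI impI)
    fix p p' assume p: "p \<in> {1..n}" "p' \<in> {1..n}" "blk p = blk p'" "(g \<circ> u) p = (g \<circ> u) p'"
    have "u p = u p'"
    proof (rule block_injD[OF g])
      show "u p \<in> {1..n}" "u p' \<in> {1..n}" using p u(7) by blast+
    qed (use b p in simp_all)
    then show "p = p'" using u(4) by simp
  qed
qed

lemma young_inv: "u \<in> young \<Longrightarrow> inv u \<in> young"
  unfolding young_iff using Sym_D(3,6) by metis

lemma block_sorted_block_inj: "block_sorted g \<Longrightarrow> g \<in> block_inj"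
  unfolding block_inj_def
proof (intro CollectI ballI impI)
  fix p p' assume s: "block_sorted g" and p: "p \<in> {1..n}" "p' \<in> {1..n}" "blk p = blk p'" "g p = g p'"
  have "\<not> p < p'" using s p unfolding block_sorted_def by (metis atLeastAtMost_iff less_irrefl)
  moreover have "\<not> p' < p" using s p unfolding block_sorted_def by (metis atLeastAtMost_iff less_irrefl)
  ultimately show "p = p'" by simp
qed

text \<open>
  Sort the letters in each block.  Every interchange changes the sign (\<open>act_y_flip\<close>), equal adjacent
  letters give zero (\<open>act_y_kill\<close>), and for sorted letters the formula \<open>act_ket_y_sorted\<close> applies.
\<close>

lemma supported_act_ket_y:
  "g \<in> words n mu \<Longrightarrow> supported block_inj (act n q (ket g) y)"
\<comment> \<open>The weights n - p decrease, so sorting an adjacent pair decreases the weighted sum.\<close>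
proof (induction "\<Sum>p\<in>{1..n}. (n - p) * g p" arbitrary: g rule: less_induct)
  case less
  show ?case
  proof (cases "block_sorted g")
    case True
    have "g \<circ> inv u \<in> block_inj" if "u \<in> young" for u
      using block_inj_comp[OF young_inv[OF that]] block_sorted_block_inj[OF True] by simp
    then show ?thesis unfolding act_ket_y_sorted[OF True] by (intro supported_closed) auto
  next
    case False
    then obtain i where i: "i \<in> {1..<n}" "blk i = blk (i + 1)" "g (i + 1) \<le> g i"
      by (rule not_sorted_adjacent)
    show ?thesis
    proof (cases "g (i + 1) = g i")
      case True
      have "act n q (ket g) y = 0"
        by (rule act_y_kill[OF i(1,2) supported_ket[OF less.prems] wact_ket_eq]) (simp add: True)
      then show ?thesis by (simp add: supported_0)
    next
      case False
      define g' where "g' = g \<circ> simple_refl i"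
      have g': "g' i = g (i + 1)" "g' (i + 1) = g i" by (simp_all add: g'_def)
      have g'w: "g' \<in> words n mu"
        unfolding g'_def words_comp_iff[OF simple_refl_in_Sym'[OF i(1)]] by (rule less.prems)
      have "ket g = wact q (ket g') i"
        using wact_ket[of g' i q] False i(3) g' by (simp add: g'_def)
      then have eq: "act n q (ket g) y = - act n q (ket g') y"
        using act_y_flip[OF i(1,2) supported_ket[OF g'w]] by simp
      have split: "(\<Sum>p\<in>{1..n}. f p) = (\<Sum>p\<in>{1..n} - {i, i + 1}. f p) + (f i + f (i + 1))" for f :: "nat \<Rightarrow> nat"
        by (subst sum.subset_diff[of "{i, i + 1}"]) (use i(1) in auto)
      have "(\<Sum>p\<in>{1..n} - {i, i + 1}. (n - p) * g' p) = (\<Sum>p\<in>{1..n} - {i, i + 1}. (n - p) * g p)"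
        by (rule sum.cong) (auto simp: g'_def simple_refl_other)
      moreover have "(n - i) * g (i + 1) + (n - (i + 1)) * g i < (n - i) * g i + (n - (i + 1)) * g (i + 1)"
      proof -
        obtain d where d: "n - i = Suc d" "n - (i + 1) = d" using i(1) by (metis Suc_diff_Suc Suc_eq_plus1 atLeastLessThan_iff)
        show ?thesis unfolding d using False i(3) by simp
      qed
      ultimately have "(\<Sum>p\<in>{1..n}. (n - p) * g' p) < (\<Sum>p\<in>{1..n}. (n - p) * g p)"
        unfolding split[of "\<lambda>p. (n - p) * g' p"] split[of "\<lambda>p. (n - p) * g p"] by (simp add: g')
      from less.hyps[OF this g'w] show ?thesis unfolding eq by (simp add: supported_def)
    qed
  qed
qed

lemma supported_act_y:
  assumes \<phi>: "supported (words n mu) \<phi>"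
  shows "supported block_inj (act n q \<phi> y)"
proof -
  have "act n q \<phi> y = (\<Sum>g\<in>words n mu. hscale (\<phi> g) (act n q (ket g) y))"
    by (subst expand_kets[OF \<phi>]) (simp add: hlinearD[OF hlinear_act])
  then show ?thesis by (auto intro!: supported_closed supported_act_ket_y)
qed

lemma col_start:
  assumes "p \<in> {1..n}"
  shows "start nu (blk p) < p" "p \<le> start nu (blk p) + nu (blk p)" "col p \<ge> 1"
    "p = start nu (blk p) + col p"
  using assms row_word_eq_iff[OF comp assms, of "blk p"] by (auto simp: col_def)

lemma block_sorted_col: "block_sorted col"
  unfolding block_sorted_def
proof (intro allI impI)
  fix p p' :: nat assume p: "1 \<le> p" "p < p'" "p' \<le> n" "blk p = blk p'"
  then have "p = start nu (blk p) + col p" "p' = start nu (blk p) + col p'"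
    using col_start(4)[of p] col_start(4)[of p'] by auto
  then show "col p < col p'" using p(2) by linarith
qed

lemma card_prefix_col:
  assumes k: "k \<le> n"
  shows "card {l \<in> {1..k}. blk l = c \<and> col l \<le> m} = min (card {l \<in> {1..k}. blk l = c}) m"
proof -
  have iff: "blk l = c \<longleftrightarrow> start nu c < l \<and> l \<le> start nu c + nu c" if "l \<in> {1..k}" for l
    using that k by (intro row_word_eq_iff[OF comp]) auto
  define e where "e = min k (start nu c + nu c)"
  have e: "l \<in> {1..k} \<and> blk l = c \<longleftrightarrow> start nu c < l \<and> l \<le> e" for l
  proof (cases "l \<in> {1..k}")
    case True
    then show ?thesis using iff[OF True] by (auto simp: e_def)
  qed (auto simp: e_def)
  have c: "col l = l - start nu c" if "l \<in> {1..k}" "blk l = c" for l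
    using that k by (simp add: col_def)
  have "{l \<in> {1..k}. blk l = c} = {start nu c <.. e}" by (intro set_eqI) (use e in simp)
  moreover have "l \<in> {1..k} \<and> blk l = c \<and> col l \<le> m \<longleftrightarrow> start nu c < l \<and> l \<le> min e (start nu c + m)" for l
    using e[of l] c[of l] by (cases "l \<in> {1..k} \<and> blk l = c") auto
  then have "{l \<in> {1..k}. blk l = c \<and> col l \<le> m} = {start nu c <.. min e (start nu c + m)}"
    by (intro set_eqI) simp
  ultimately show ?thesis by simp
qed

lemma card_by_block:
  "card {l \<in> {1..k}. P l} = (\<Sum>c\<in>blk ` {1..k}. card {l \<in> {1..k}. blk l = c \<and> P l})"
proof -
  have "(\<Sum>c\<in>blk ` {1..k}. \<Sum>l | l \<in> {l \<in> {1..k}. P l} \<and> blk l = c. (1::nat)) = (\<Sum>l\<in>{l \<in> {1..k}. P l}. 1)"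
    by (rule sum.group) auto
  moreover have "{l. l \<in> {l \<in> {1..k}. P l} \<and> blk l = c} = {l \<in> {1..k}. blk l = c \<and> P l}" for c by auto
  ultimately show ?thesis by simp
qed

text \<open>
  A block-injective word has at most \<open>|R|\<close> letters of \<open>R\<close> in each block, and at most as many as there are
  places.  On every prefix, \<^const>\<open>col\<close> attains the smaller of these two bounds in each block.
\<close>

lemma block_inj_dominated:
  assumes x: "x \<in> block_inj" and k: "k \<le> n" and R: "finite R"
  shows "card {l \<in> {1..k}. x l \<in> R} \<le> card {l \<in> {1..k}. col l \<le> card R}"
  unfolding card_by_block[of k "\<lambda>l. x l \<in> R"] card_by_block[of k "\<lambda>l. col l \<le> card R"]
    card_prefix_col[OF k]
proof (rule sum_mono)
  fix c
  have "card {l \<in> {1..k}. blk l = c \<and> x l \<in> R} \<le> card {l \<in> {1..k}. blk l = c}"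
    by (rule card_mono) auto
  moreover have "card {l \<in> {1..k}. blk l = c \<and> x l \<in> R} \<le> card R"
  proof (rule card_inj_on_le[OF _ _ R])
    show "inj_on x {l \<in> {1..k}. blk l = c \<and> x l \<in> R}"
      by (rule inj_onI, rule block_injD[OF x]) (use k in auto)
  qed auto
  ultimately show "card {l \<in> {1..k}. blk l = c \<and> x l \<in> R} \<le> min (card {l \<in> {1..k}. blk l = c}) (card R)"
    by simp
qed

lemma card_letters:
  assumes "g \<in> words n mu" "finite R"
  shows "card {l \<in> {1..n}. g l \<in> R} = sum mu R"
proof -
  have "(\<Sum>c\<in>R. \<Sum>l | l \<in> {l \<in> {1..n}. g l \<in> R} \<and> g l = c. (1::nat)) = (\<Sum>l\<in>{l \<in> {1..n}. g l \<in> R}. 1)"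
    by (rule sum.group) (use assms(2) in auto)
  moreover have "{l. l \<in> {l \<in> {1..n}. g l \<in> R} \<and> g l = c} = {l \<in> {1..n}. g l = c}" if "c \<in> R" for c
    using that by auto
  ultimately show ?thesis using words_D(2)[OF assms(1)] by (simp add: cnt_def)
qed

text \<open>
  The antisymmetrizer kills vectors whose content is not dominated by that of \<^const>\<open>col\<close>, as there are
  no block-injective words of such a content.
\<close>

lemma act_y_eq_0:
  assumes col: "col \<in> words n lam" and \<phi>: "supported (words n mu) \<phi>"
    and R: "finite R" "sum lam {1..card R} < sum mu R"
  shows "act n q \<phi> y = 0"
proof (rule ccontr)
  assume "act n q \<phi> y \<noteq> 0"
  then obtain g where g: "act n q \<phi> y g \<noteq> 0" by (auto simp: fun_eq_iff fapply)
  then have "g \<in> block_inj" "g \<in> words n mu"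
    using supported_act_y[OF \<phi>] supported_act[OF \<phi>] by (auto simp: supported_def)
  then have "sum mu R \<le> card {l \<in> {1..n}. col l \<le> card R}"
    using block_inj_dominated[of g n R] card_letters[of g mu R] R(1) by simp
  also have "{l \<in> {1..n}. col l \<le> card R} = {l \<in> {1..n}. col l \<in> {1..card R}}"
    using col_start(3) by auto
  also have "card \<dots> = sum lam {1..card R}" by (rule card_letters[OF col]) simp
  finally show False using R(2) by simp
qed

lemma ycoeff_id: "ycoeff id = 1"
  by (simp add: ycoeff_def len_eq_card_inversions)

lemma act_col_y_col: "act n q (ket col) y col = 1"
proof -
  have id: "u = id" if u: "u \<in> young" and eq: "col = col \<circ> inv u" for u
  proof
    fix p
    show "u p = id p"
    proof (cases "p \<in> {1..n}")
      case True
      then have "u p \<in> {1..n}" using Sym_D(7)[OF young_Sym[OF u]] by simp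
      moreover have "blk (u p) = blk p" using u by (simp add: young_iff)
      moreover have "col (u p) = col p"
        using fun_cong[OF eq, of "u p"] Sym_D(2)[OF young_Sym[OF u]] by simp
      ultimately show ?thesis
        using block_injD[OF block_sorted_block_inj[OF block_sorted_col], of "u p" p] True by simp
    qed (use Sym_outside[OF young_Sym[OF u]] in simp)
  qed
  have "act n q (ket col) y col = (\<Sum>u\<in>young. ycoeff u * ket (col \<circ> inv u) col)"
    unfolding act_ket_y_sorted[OF block_sorted_col] fapply ..
  also have "\<dots> = (\<Sum>u\<in>young. if u = id then 1 else 0)"
    using id by (intro sum.cong refl) (auto simp: ket_def ycoeff_id inv_id)
  also have "\<dots> = 1" using finite_young by (simp add: young_iff)
  finally show ?thesis .
qed

end

section \<open>Conjugate partitions and Specht modules\<close>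

lemma composition_ge:
  assumes "is_composition n mu" "1 \<le> j" "j \<le> mu i" shows "1 \<le> i"
  using assms by (cases i) (auto simp: is_composition_def)

lemma partition_mono:
  assumes "is_partition n lam" "1 \<le> i" "i \<le> k" shows "lam k \<le> lam i"
  using assms(3)
proof (induction k rule: dec_induct)
  case (step m)
  have "lam (m + 1) \<le> lam m" using assms(1,2) step.hyps by (auto simp: is_partition_def)
  then show ?case using step.IH by (metis Suc_eq_plus1 le_trans)
qed simp

lemma card_diagram:
  assumes c: "is_composition n mu" shows "finite (diagram mu)" "card (diagram mu) = n"
proof -
  have eq: "diagram mu = (SIGMA i:{i. mu i \<noteq> 0}. {1..mu i})"
    using composition_ge[OF c] by (auto simp: diagram_def)
  have fin: "finite {i. mu i \<noteq> 0}" using c by (simp add: is_composition_def)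
  show "finite (diagram mu)" unfolding eq using fin by blast
  show "card (diagram mu) = n" unfolding eq using fin c
    by (subst card_SigmaI) (auto simp: is_composition_def)
qed

lemma diagram_column:
  assumes p: "is_partition n lam" and j: "1 \<le> j"
  shows "{i. (i, j) \<in> diagram lam} = {1..conjugate lam j}"
proof -
  let ?A = "{i. (i, j) \<in> diagram lam}"
  have c: "is_composition n lam" using p by (simp add: is_partition_def)
  have "?A \<subseteq> fst ` diagram lam" by force
  then have fin: "finite ?A" using card_diagram(1)[OF c] finite_surj by blast
  have down: "k \<in> ?A" if "i \<in> ?A" "1 \<le> k" "k \<le> i" for i k
    using that partition_mono[OF p that(2,3)] by (auto simp: diagram_def)
  have "?A = {1..card ?A}"
  proof (cases "?A = {}")
    case False
    define m where "m = Max ?A"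
    have m: "m \<in> ?A" using Max_in[OF fin False] by (simp add: m_def)
    have "?A = {1..m}"
    proof
      show "?A \<subseteq> {1..m}" using Max_ge[OF fin] by (auto simp: m_def diagram_def)
      show "{1..m} \<subseteq> ?A" using down[OF m] by auto
    qed
    then show ?thesis by simp
  qed (simp only: card.empty, simp add: One_nat_def)
  then show ?thesis by (simp add: conjugate_def)
qed

lemma diagram_conjugate:
  assumes p: "is_partition n lam"
  shows "(j, i) \<in> diagram (conjugate lam) \<longleftrightarrow> (i, j) \<in> diagram lam"
proof (cases "1 \<le> j")
  case True
  have "(i, j) \<in> diagram lam \<longleftrightarrow> i \<in> {1..conjugate lam j}"
    using diagram_column[OF p True] by blast
  then show ?thesis using True by (auto simp: diagram_def)
qed (auto simp: diagram_def)

lemma conjugate_composition: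
  assumes p: "is_partition n lam" shows "is_composition n (conjugate lam)"
proof -
  have c: "is_composition n lam" using p by (simp add: is_partition_def)
  have 0: "conjugate lam 0 = 0" by (simp add: conjugate_def diagram_def)
  have sub: "{j. conjugate lam j \<noteq> 0} \<subseteq> {1..lam 1}"
  proof
    fix j assume "j \<in> {j. conjugate lam j \<noteq> 0}"
    then have j: "conjugate lam j \<noteq> 0" by simp
    then have j1: "1 \<le> j" using 0 by (cases j) auto
    then have "1 \<in> {i. (i, j) \<in> diagram lam}" using diagram_column[OF p j1] j by simp
    then show "j \<in> {1..lam 1}" by (simp add: diagram_def)
  qed
  then have fin: "finite {j. conjugate lam j \<noteq> 0}" by (rule finite_subset) simp
  have "bij_betw prod.swap (SIGMA j:{j. conjugate lam j \<noteq> 0}. {1..conjugate lam j}) (diagram lam)"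
  proof (rule bij_betwI[where g = prod.swap])
    have "(i, j) \<in> diagram lam \<longleftrightarrow> 1 \<le> j \<and> i \<in> {1..conjugate lam j}" for i j
      using diagram_conjugate[OF p, of j i] by (auto simp: diagram_def)
    moreover have "1 \<le> j" if "conjugate lam j \<noteq> 0" for j using 0 that by (cases j) auto
    ultimately show "prod.swap \<in> (SIGMA j:{j. conjugate lam j \<noteq> 0}. {1..conjugate lam j}) \<rightarrow> diagram lam"
      "prod.swap \<in> diagram lam \<rightarrow> (SIGMA j:{j. conjugate lam j \<noteq> 0}. {1..conjugate lam j})"
      by (auto simp: Pi_iff)
  qed auto
  from bij_betw_same_card[OF this] have "sum (conjugate lam) {j. conjugate lam j \<noteq> 0} = n"
    using card_diagram(2)[OF c] fin by (simp add: card_SigmaI)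
  then show ?thesis using 0 fin by (simp add: is_composition_def)
qed

lemma col_tab_eq_row_tab:
  assumes p: "is_partition n lam" shows "col_tab lam (i, j) = row_tab (conjugate lam) (j, i)"
proof -
  have "bij_betw prod.swap {(k, l) \<in> diagram lam. l < j \<or> (l = j \<and> k \<le> i)}
      {(k, l) \<in> diagram (conjugate lam). k < j \<or> (k = j \<and> l \<le> i)}"
    by (rule bij_betwI[where g = prod.swap]) (auto simp: diagram_conjugate[OF p])
  from bij_betw_same_card[OF this] show ?thesis by (simp add: col_tab_def row_tab_def)
qed

locale partition_blocks =
  fixes n :: nat and q :: "'f::field" and lam :: "nat \<Rightarrow> nat"
  assumes part: "is_partition n lam" and q_nz: "q \<noteq> 0"
begin

sublocale blocks n q "conjugate lam"
  by standard (simp_all add: conjugate_composition[OF part] q_nz)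

lemma lam_comp: "is_composition n lam"
  using part by (simp add: is_partition_def)

lemma col_tab_props:
  assumes "(i, j) \<in> diagram lam"
  shows "col_tab lam (i, j) \<in> {1..n}" "blk (col_tab lam (i, j)) = j" "col (col_tab lam (i, j)) = i"
    "col_tab lam (i, j) = start (conjugate lam) j + i"
proof -
  have ji: "(j, i) \<in> diagram (conjugate lam)" using assms diagram_conjugate[OF part] by blast
  show e: "col_tab lam (i, j) = start (conjugate lam) j + i"
    unfolding col_tab_eq_row_tab[OF part] by (rule row_tab_eq[OF comp ji])
  show r: "col_tab lam (i, j) \<in> {1..n}" and b: "blk (col_tab lam (i, j)) = j"
    unfolding col_tab_eq_row_tab[OF part] using row_tab_in_range[OF comp ji] by auto
  show "col (col_tab lam (i, j)) = i" using r b e by (simp add: col_def)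
qed

lemma col_blk:
  assumes "p \<in> {1..n}"
  shows "(col p, blk p) \<in> diagram lam" "col_tab lam (col p, blk p) = p"
proof -
  have "(blk p, p - start (conjugate lam) (blk p)) \<in> diagram (conjugate lam)"
    "row_tab (conjugate lam) (blk p, p - start (conjugate lam) (blk p)) = p"
    using row_tab_surj[OF comp assms] by auto
  then show "(col p, blk p) \<in> diagram lam" "col_tab lam (col p, blk p) = p"
    using assms by (auto simp: col_def diagram_conjugate[OF part] col_tab_eq_row_tab[OF part])
qed

lemma col_in_words: "col \<in> words n lam"
proof -
  have "col p = 0 \<longleftrightarrow> p \<notin> {1..n}" for p
    using col_start(3)[of p] by (auto simp: col_def)
  moreover have "cnt n col i = lam i" for i
  proof -
    have d: "(i, j) \<in> diagram lam" if "j \<in> {1..lam i}" for j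
      using that composition_ge[OF lam_comp, of j i] by (auto simp: diagram_def)
    have "bij_betw (\<lambda>j. col_tab lam (i, j)) {1..lam i} {p \<in> {1..n}. col p = i}"
    proof (rule bij_betwI[where g = blk])
      show "(\<lambda>j. col_tab lam (i, j)) \<in> {1..lam i} \<rightarrow> {p \<in> {1..n}. col p = i}"
        using col_tab_props[OF d] by blast
      show "blk \<in> {p \<in> {1..n}. col p = i} \<rightarrow> {1..lam i}"
        using col_blk(1) by (auto simp: diagram_def)
      show "blk (col_tab lam (i, x)) = x" if "x \<in> {1..lam i}" for x using col_tab_props(2)[OF d[OF that]] .
      show "col_tab lam (i, blk y) = y" if "y \<in> {p \<in> {1..n}. col p = i}" for y
        using col_blk(2)[of y] that by auto
    qed
    from bij_betw_same_card[OF this] show ?thesis by (simp add: cnt_def)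
  qed
  ultimately show ?thesis by (simp add: words_def)
qed

lemma w_perm_props:
  shows "w_perm n lam \<in> Sym n" "\<And>p. p \<in> diagram lam \<Longrightarrow> w_perm n lam (row_tab lam p) = col_tab lam p"
proof -
  define nd where "nd x = (row_word n lam x, x - start lam (row_word n lam x))" for x
  define w where "w x = (if x \<in> {1..n} then col_tab lam (nd x) else x)" for x
  have nd: "nd x \<in> diagram lam" "row_tab lam (nd x) = x" if "x \<in> {1..n}" for x
    using row_tab_surj[OF lam_comp that] by (auto simp: nd_def)
  have nd': "nd (row_tab lam p) = p" if "p \<in> diagram lam" for p
  proof -
    obtain i j where p: "p = (i, j)" by (cases p)
    show ?thesis using row_tab_in_range[OF lam_comp that[unfolded p]] row_tab_eq[OF lam_comp that[unfolded p]]
      by (simp add: nd_def p)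
  qed
  have rr: "row_tab lam p \<in> {1..n}" if "p \<in> diagram lam" for p
    using row_tab_in_range(1)[OF lam_comp] that by (cases p) auto
  have cr: "col_tab lam p \<in> {1..n}" "(col (col_tab lam p), blk (col_tab lam p)) = p" if "p \<in> diagram lam" for p
    using col_tab_props that by (cases p; force)+
  have wS: "w \<in> Sym n"
  proof -
    have "bij_betw w {1..n} {1..n}"
    proof (rule bij_betwI[where g = "\<lambda>y. row_tab lam (col y, blk y)"])
      show "w \<in> {1..n} \<rightarrow> {1..n}" using nd(1) cr(1) by (auto simp: w_def simp del: atLeastAtMost_iff)
      show "(\<lambda>y. row_tab lam (col y, blk y)) \<in> {1..n} \<rightarrow> {1..n}" using rr col_blk(1) by blast
      show "row_tab lam (col (w x), blk (w x)) = x" if "x \<in> {1..n}" for x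
        using that nd[OF that] cr(2) by (simp add: w_def del: atLeastAtMost_iff)
      show "w (row_tab lam (col y, blk y)) = y" if "y \<in> {1..n}" for y
        using rr[OF col_blk(1)[OF that]] nd'[OF col_blk(1)[OF that]] col_blk(2)[OF that] by (simp add: w_def)
    qed
    then show ?thesis unfolding Sym_def by (auto simp: w_def intro!: bij_imp_permutes)
  qed
  have wp: "w (row_tab lam p) = col_tab lam p" if "p \<in> diagram lam" for p
    using rr[OF that] nd'[OF that] by (simp add: w_def)
  have "w_perm n lam = w" unfolding w_perm_def
  proof (rule the_equality)
    show "w \<in> Sym n \<and> (\<forall>p\<in>diagram lam. w (row_tab lam p) = col_tab lam p)" using wS wp by blast
    fix v assume v: "v \<in> Sym n \<and> (\<forall>p\<in>diagram lam. v (row_tab lam p) = col_tab lam p)"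
    show "v = w"
    proof
      fix x show "v x = w x"
      proof (cases "x \<in> {1..n}")
        case True
        then show ?thesis using v nd[OF True] by (metis w_def)
      next
        case False
        then show ?thesis using v Sym_outside[of v n x] by (auto simp: w_def)
      qed
    qed
  qed
  then show "w_perm n lam \<in> Sym n" "\<And>p. p \<in> diagram lam \<Longrightarrow> w_perm n lam (row_tab lam p) = col_tab lam p"
    using wS wp by auto
qed

text \<open>
  \<open>w\<^sub>\<lambda>\<close> inverts \<open>p < p'\<close> only if \<open>p\<close> is in a higher row than \<open>p'\<close> of \<open>t\<^sup>\<lambda>\<close>.
\<close>

lemma act_w_perm: "act n q (ket (row_word n lam)) (T (w_perm n lam)) = ket col"
proof -
  let ?w = "w_perm n lam"
  note wS = w_perm_props(1)
  have val: "?w x = col_tab lam (row_word n lam x, x - start lam (row_word n lam x))" if "x \<in> {1..n}" for x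
    using row_tab_surj[OF lam_comp that] w_perm_props(2) by metis
  have "row_word n lam \<circ> inv ?w = col"
  proof
    fix y show "(row_word n lam \<circ> inv ?w) y = col y"
    proof (cases "y \<in> {1..n}")
      case True
      then have x: "inv ?w y \<in> {1..n}" using Sym_D(8)[OF wS] by simp
      have "y = ?w (inv ?w y)" using Sym_D(3)[OF wS] by simp
      then show ?thesis using val[OF x] col_tab_props(3)[OF row_tab_surj(1)[OF lam_comp x]] by simp
    next
      case False
      then have "inv ?w y \<notin> {1..n}" using Sym_D(8)[OF wS] by simp
      then show ?thesis using False unfolding row_word_def col_def comp_apply by (simp only: if_False)
    qed
  qed
  moreover have "act n q (ket (row_word n lam)) (T ?w) = ket (row_word n lam \<circ> inv ?w)"
  proof (rule act_ket_T[OF wS])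
    fix p p' :: nat assume pp: "p < p'" "?w p' < ?w p"
    then have "(p, p') \<in> inversions ?w" by (simp add: inversions_def)
    then have r: "p \<in> {1..n}" "p' \<in> {1..n}" using inversions_subset[OF wS] by auto
    show "row_word n lam p < row_word n lam p'"
    proof (rule ccontr)
      assume "\<not> ?thesis"
      then have eq: "row_word n lam p' = row_word n lam p"
        using row_word_mono[OF lam_comp _ r] pp(1) by simp
      define i where "i = row_word n lam p"
      have d: "(i, p - start lam i) \<in> diagram lam" "(i, p' - start lam i) \<in> diagram lam"
        using row_tab_surj(1)[OF lam_comp r(1)] row_tab_surj(1)[OF lam_comp r(2)] eq by (auto simp: i_def)
      have w: "?w p = start (conjugate lam) (p - start lam i) + i" "?w p' = start (conjugate lam) (p' - start lam i) + i"
        using val[OF r(1)] val[OF r(2)] col_tab_props(4)[OF d(1)] col_tab_props(4)[OF d(2)] eq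
        by (simp_all add: i_def)
      have "start (conjugate lam) (p - start lam i) \<le> start (conjugate lam) (p' - start lam i)"
        using pp(1) by (intro start_mono) simp
      then show False using pp(2) w by simp
    qed
  qed
  ultimately show ?thesis by simp
qed

text \<open>
  The generator \<open>x\<^sub>\<lambda> T\<^bsub>w\<^sub>\<lambda>\<^esub> y\<^bsub>\<lambda>'\<^esub>\<close> of the Specht module, in the model of words.
\<close>

definition "specht_vec = act n q (ket col) y"

lemma supported_row: "supported (words n lam) (ket (row_word n lam))"
  by (intro supported_ket row_word_in_words[OF lam_comp])

lemma supported_col: "supported (words n lam) (ket col)"
  by (intro supported_ket col_in_words)

lemma supported_specht_vec: "supported (words n lam) specht_vec"
  unfolding specht_vec_def by (rule supported_act[OF supported_col])

lemma specht_vec_eq: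
  "act n q specht_vec h = act n q (ket (row_word n lam)) (hmult n q (hmult n q (T (w_perm n lam)) y) h)"
proof -
  have Tc: "T (w_perm n lam) \<in> hecke_carrier n" by (intro T_in_carrier w_perm_props)
  show ?thesis
    unfolding specht_vec_def act_w_perm[symmetric]
    by (simp add: act_assoc[OF supported_row] Tc hmult_in_carrier)
qed

lemma specht_module_eq:
  "specht_module n q lam = {lift n lam (act n q specht_vec h) | h. h \<in> hecke_carrier n}"
  unfolding specht_module_def x_elt_eq_lift[OF lam_comp] hmult_lift[OF lam_comp] act_w_perm
    specht_vec_def ..

lemma specht_vec_col: "specht_vec col = 1"
  unfolding specht_vec_def by (rule act_col_y_col)

text \<open>
  The source of all vanishing statements that hold for reasons of weight.
\<close>

lemma specht_eq_0:
  assumes L: "wcommuting n q L" and \<phi>: "supported (words n mu) (L (ket col))"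
    and R: "finite R" "sum lam {1..card R} < sum mu R"
  shows "L specht_vec = 0"
  unfolding specht_vec_def wcommuting_act[OF L]
  by (rule act_y_eq_0[OF col_in_words \<phi> R])

end

section \<open>Intersections of kernels\<close>

text \<open>
  The words with a prescribed suffix after the first \<open>k\<close> letters.
\<close>

definition agree :: "nat \<Rightarrow> (nat \<Rightarrow> nat) \<Rightarrow> (nat \<Rightarrow> nat) \<Rightarrow> bool" where
  "agree k u g \<longleftrightarrow> (\<forall>p. p \<notin> {1..k} \<longrightarrow> g p = u p)"

lemma agree_Suc: "agree (Suc k) u g \<Longrightarrow> agree k (u(Suc k := g (Suc k))) g"
  by (auto simp: agree_def le_Suc_eq)

lemma agree_SucI: "agree k (u(Suc k := x)) g \<Longrightarrow> agree (Suc k) u g \<and> g (Suc k) = x"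
  by (auto simp: agree_def)

lemma agree_upd: "agree k (u(Suc k := x)) g \<Longrightarrow> agree k (u(Suc k := y)) (g(Suc k := y))"
  by (auto simp: agree_def)

lemma agree_moved: "agree k u g \<Longrightarrow> moved k i j t g h \<Longrightarrow> agree k u h"
  using moved_outside by (fastforce simp: agree_def)

lemma raising_agree_0:
  assumes "agree k u g" "\<And>h. agree k u h \<Longrightarrow> \<phi> h = 0"
  shows "raising k q i t \<phi> g = 0"
proof (rule ccontr)
  assume "raising k q i t \<phi> g \<noteq> 0"
  then obtain h where "moved k i (Suc i) t g h" "\<phi> h \<noteq> 0" by (rule raising_nonzero)
  then show False using assms agree_moved by blast
qed

text \<open>
  The \<open>sl\<^sub>2\<close>-theory behind the kernel intersection: a vector with more letters \<open>i + 1\<close> than \<open>i\<close> cannot be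
  annihilated by all raising operators, unless it is zero.  The statement with \<open>s > 0\<close>, where
  only the powers above \<open>s\<close> vanish, is needed for the induction on \<open>k\<close>: splitting off a last
  letter \<open>i\<close> relates two successive powers.
\<close>

lemma raising_kernel_trivial:
  assumes q: "q \<noteq> 0"
    and "\<And>t g. t > s \<Longrightarrow> agree k u g \<Longrightarrow> raising k q i t \<phi> g = 0"
    and "\<And>g. agree k u g \<Longrightarrow> \<phi> g \<noteq> 0 \<Longrightarrow> cnt k g i = m \<and> cnt k g (Suc i) = m'"
    and "m + s < m'" and "agree k u g"
  shows "\<phi> g = 0"
  using assms(2-)
proof (induction k arbitrary: u s m m' g)
  case 0
  then show ?case by (metis cnt_0 not_less0)
next
  case (Suc k)
  note van = Suc.prems(1) and content = Suc.prems(2) and less = Suc.prems(3)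
  let ?U = "\<lambda>x. u(Suc k := x)"
  have letter: "agree (Suc k) u g" "g (Suc k) = x" if "agree k (?U x) g" for x g
    using agree_SucI[OF that] by auto
  obtain m1 where m1: "m' = Suc m1" using less by (cases m') auto
  have van2: "raising k q i t \<phi> g = 0" if "t > s" "agree k (?U (Suc i)) g" for t g
    using van[OF that(1) letter(1)[OF that(2)]] letter(2)[OF that(2)] by simp
  have content2: "cnt k g i = m \<and> cnt k g (Suc i) = m1" if "agree k (?U (Suc i)) g" "\<phi> g \<noteq> 0" for g
    using content[OF letter(1)[OF that(1)] that(2)] letter(2)[OF that(1)] by (simp add: cnt_Suc m1)
  have van1: "q ^ Suc t * raising k q i (Suc t) \<phi> g + raising k q i t \<phi> (g(Suc k := Suc i)) = 0"
    if "Suc t > s" "agree k (?U i) g" for t g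
    using van[OF that(1) letter(1)[OF that(2)]] letter(2)[OF that(2)] by simp
  have content1: "m \<noteq> 0 \<and> cnt k g i = m - 1 \<and> cnt k g (Suc i) = m'" if "agree k (?U i) g" "\<phi> g \<noteq> 0" for g
    using content[OF letter(1)[OF that(1)] that(2)] letter(2)[OF that(1)] by (auto simp: cnt_Suc)
  have both: "(\<forall>g. agree k (?U i) g \<longrightarrow> \<phi> g = 0) \<and> (\<forall>g. agree k (?U (Suc i)) g \<longrightarrow> \<phi> g = 0)"
  \<comment> \<open>First the words that end in i + 1 vanish, then the recursion for those that end in i has no
     inhomogeneous term.  If m1 = m + s, the order is reversed, with s + 1 and s - 1 in place of s.\<close>
  proof (cases "m + s < m1")
    case True
    have z2: "\<phi> g = 0" if "agree k (?U (Suc i)) g" for g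
      by (rule Suc.IH[OF van2 content2 True that])
    have "\<phi> g = 0" if g: "agree k (?U i) g" for g
    proof (cases "m = 0")
      case True
      then show ?thesis using content1[OF g] by blast
    next
      case False
      show ?thesis
      proof (rule Suc.IH[of s "?U i" "m - 1" m', OF _ _ _ g])
        fix t g assume t: "t > s" and g: "agree k (?U i) g"
        then obtain t' where t': "t = Suc t'" by (cases t) auto
        have "raising k q i t' \<phi> (g(Suc k := Suc i)) = 0"
          by (rule raising_agree_0[OF agree_upd[OF g]]) (rule z2)
        then show "raising k q i t \<phi> g = 0" using van1[of t' g] t g q by (simp add: t')
      next
        fix g assume g: "agree k (?U i) g" "\<phi> g \<noteq> 0"
        show "cnt k g i = m - 1 \<and> cnt k g (Suc i) = m'" using content1[OF g] by blast
      qed (use less in simp)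
    qed
    then show ?thesis using z2 by blast
  next
    case False
    then have m1_eq: "m1 = m + s" using less m1 by simp
    have z1: "\<phi> g = 0" if g: "agree k (?U i) g" for g
    proof (cases "m = 0")
      case True
      then show ?thesis using content1[OF g] by blast
    next
      case False
      show ?thesis
      proof (rule Suc.IH[of "Suc s" "?U i" "m - 1" m', OF _ _ _ g])
        fix t g assume t: "t > Suc s" and g: "agree k (?U i) g"
        then obtain t' where t': "t = Suc t'" by (cases t) auto
        have "raising k q i t' \<phi> (g(Suc k := Suc i)) = 0"
          using t t' by (intro van2[OF _ agree_upd[OF g]]) simp
        then show "raising k q i t \<phi> g = 0" using van1[of t' g] t g q by (simp add: t')
      next
        fix g assume g: "agree k (?U i) g" "\<phi> g \<noteq> 0"
        show "cnt k g i = m - 1 \<and> cnt k g (Suc i) = m'" using content1[OF g] by blast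
      qed (use False m1 m1_eq in simp)
    qed
    have van3: "raising k q i t \<phi> g = 0" if "t \<ge> s" and g: "agree k (?U (Suc i)) g" for t g
    proof -
      have g': "agree k (?U i) (g(Suc k := i))" by (rule agree_upd[OF g])
      have "raising k q i (Suc t) \<phi> (g(Suc k := i)) = 0" by (rule raising_agree_0[OF g' z1])
      moreover have "g(Suc k := i, Suc k := Suc i) = g" using letter(2)[OF g] by auto
      ultimately show ?thesis using van1[OF _ g', of t] that(1) by (simp del: fun_upd_apply)
    qed
    have "\<phi> g = 0" if g: "agree k (?U (Suc i)) g" for g
    proof (cases s)
      case 0
      then show ?thesis using van3[OF _ g, of 0] by simp
    next
      case (Suc s')
      show ?thesis
      proof (rule Suc.IH[of s' "?U (Suc i)" m m1, OF _ _ _ g])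
        fix t g assume "s' < t" "agree k (?U (Suc i)) g"
        then show "raising k q i t \<phi> g = 0" using van3[of t g] Suc by simp
      qed (use Suc m1_eq content2 in \<open>simp_all del: fun_upd_apply\<close>)
    qed
    then show ?thesis using z1 by blast
  qed
  have g: "agree k (?U (g (Suc k))) g" by (rule agree_Suc[OF Suc.prems(4)])
  consider "g (Suc k) = i" | "g (Suc k) = Suc i" | "g (Suc k) \<noteq> i" "g (Suc k) \<noteq> Suc i" by blast
  then show ?case
  proof cases
    case 3
    show ?thesis
    proof (rule Suc.IH[of s "?U (g (Suc k))" m m', OF _ _ less g])
      fix t h assume "s < t" "agree k (?U (g (Suc k))) h"
      then show "raising k q i t \<phi> h = 0" using van[of t h] letter[of "g (Suc k)" h] 3 by simp
    next
      fix h assume "agree k (?U (g (Suc k))) h" "\<phi> h \<noteq> 0"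
      then show "cnt k h i = m \<and> cnt k h (Suc i) = m'"
        using content[of h] letter[of "g (Suc k)" h] 3 by (simp add: cnt_Suc)
    qed
  qed (use both g in auto)
qed

text \<open>
  The order by the last place where the words differ; \<open>key\<close> embeds it into the natural numbers, as
  numbers to a base \<open>B\<close> with the letters as digits.
\<close>

definition colex :: "(nat \<Rightarrow> nat) \<Rightarrow> (nat \<Rightarrow> nat) \<Rightarrow> bool" where
  "colex g h \<longleftrightarrow> (\<exists>p\<ge>1. g p < h p \<and> (\<forall>p'>p. g p' = h p'))"

definition key :: "nat \<Rightarrow> nat \<Rightarrow> (nat \<Rightarrow> nat) \<Rightarrow> nat" where
  "key B k g = (\<Sum>p\<in>{1..k}. g p * B ^ p)"

lemma key_Suc: "key B (Suc k) g = key B k g + g (Suc k) * B ^ Suc k"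
  by (simp add: key_def)

lemma key_less:
  assumes "\<And>p. g p < B" shows "key B k g < B ^ Suc k"
proof (induction k)
  case 0
  have "B > 0" using assms[of 0] by simp
  then show ?case by (simp add: key_def)
next
  case (Suc k)
  have "key B (Suc k) g < (1 + g (Suc k)) * B ^ Suc k" using Suc by (simp add: key_Suc distrib_right)
  also have "\<dots> \<le> B * B ^ Suc k" using assms[of "Suc k"] by (intro mult_right_mono) auto
  finally show ?case by simp
qed

lemma colex_key:
  assumes "colex g h" "\<And>p. g p < B" "\<And>p. p > n \<Longrightarrow> g p = 0 \<and> h p = 0"
  shows "key B n g < key B n h"
proof -
  obtain p where p: "p \<ge> 1" "g p < h p" "\<And>p'. p' > p \<Longrightarrow> g p' = h p'"
    using assms(1) by (auto simp: colex_def)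
  have "p \<le> n" using p(2) assms(3)[of p] by force
  moreover have "p \<le> k \<Longrightarrow> key B k g < key B k h" for k
  proof (induction k rule: dec_induct)
    case base
    obtain m where m: "p = Suc m" using p(1) by (cases p) auto
    have "key B p g < (1 + g p) * B ^ p" using key_less[of g B m, OF assms(2)] by (simp add: key_Suc m distrib_right)
    also have "\<dots> \<le> h p * B ^ p" using p(2) by (intro mult_right_mono) auto
    also have "\<dots> \<le> key B p h" by (simp add: key_Suc m)
    finally show ?case .
  next
    case (step k)
    then show ?case using p(3)[of "Suc k"] by (simp add: key_Suc)
  qed
  ultimately show ?thesis by blast
qed

lemma colex_total:
  assumes "g \<noteq> h" "\<And>p. p \<notin> {1..n} \<Longrightarrow> g p = 0 \<and> h p = 0"
  shows "colex g h \<or> colex h g"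
proof -
  let ?A = "{p. g p \<noteq> h p}"
  have "?A \<subseteq> {1..n}" using assms(2) by force
  then have fin: "finite ?A" by (rule finite_subset) simp
  have ne: "?A \<noteq> {}" using assms(1) by auto
  define p where "p = Max ?A"
  have p: "g p \<noteq> h p" using Max_in[OF fin ne] by (simp add: p_def)
  have "g p' = h p'" if "p' > p" for p' using Max_ge[OF fin, of p'] that by (fastforce simp: p_def)
  moreover have "p \<ge> 1" using p \<open>?A \<subseteq> {1..n}\<close> by auto
  ultimately show ?thesis using p unfolding colex_def by (metis linorder_neqE_nat)
qed

text \<open>
  If \<open>u\<close> is the largest word of \<open>\<phi>\<close>, turning a letter \<open>i\<close> of the suffix into \<open>i + 1\<close> leads to a larger word, at
  which \<open>\<phi>\<close> vanishes.  So on words with the suffix of \<open>u\<close> only the first \<open>k\<close> letters matter.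
\<close>

lemma raising_restrict:
  assumes top: "\<And>h. colex u h \<Longrightarrow> \<phi> h = 0" and g: "agree k u g" and "k \<le> m"
  shows "\<exists>e. raising m q i t \<phi> g = q ^ e * raising k q i t \<phi> g"
  using assms(3)
proof (induction m rule: dec_induct)
  case base
  show ?case by (intro exI[of _ 0]) simp
next
  case (step m)
  then obtain e where e: "raising m q i t \<phi> g = q ^ e * raising k q i t \<phi> g" by blast
  have gm: "g p = u p" if "p > m" for p using g that step.hyps by (auto simp: agree_def)
  show ?case
  proof (cases "g (Suc m) = i")
    case True
    have "raising m q i t' \<phi> (g(Suc m := Suc i)) = 0" for t'
    proof (rule ccontr)
      assume "raising m q i t' \<phi> (g(Suc m := Suc i)) \<noteq> 0"
      then obtain h where h: "moved m i (Suc i) t' (g(Suc m := Suc i)) h" "\<phi> h \<noteq> 0"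
        by (rule raising_nonzero)
      have "h (Suc m) = Suc i" "\<And>p. p > Suc m \<Longrightarrow> h p = u p"
        using moved_outside[OF h(1)] gm by auto
      then have "colex u h" using True gm[of "Suc m"] unfolding colex_def
        by (intro exI[of _ "Suc m"]) auto
      then show False using top h(2) by blast
    qed
    then have "raising (Suc m) q i t \<phi> g = q ^ (t + e) * raising k q i t \<phi> g"
      using True e by (simp add: power_add split: nat.split)
    then show ?thesis by blast
  qed (use e in auto)
qed

text \<open>
  Lattice words: the content of every prefix is a partition.
\<close>

definition ballot :: "nat \<Rightarrow> (nat \<Rightarrow> nat) \<Rightarrow> bool" where
  "ballot n u \<longleftrightarrow> (\<forall>k\<le>n. \<forall>i\<ge>1. cnt k u (Suc i) \<le> cnt k u i)"

lemma cnt_split: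
  assumes "k \<le> n" shows "cnt n g i = cnt k g i + card {p \<in> {k<..n}. g p = i}"
proof -
  have "{p \<in> {1..n}. g p = i} = {p \<in> {1..k}. g p = i} \<union> {p \<in> {k<..n}. g p = i}"
    using assms by auto
  moreover have "card ({p \<in> {1..k}. g p = i} \<union> {p \<in> {k<..n}. g p = i})
      = card {p \<in> {1..k}. g p = i} + card {p \<in> {k<..n}. g p = i}"
    by (rule card_Un_disjoint) auto
  ultimately show ?thesis by (simp add: cnt_def)
qed

text \<open>
  If a prefix of length \<open>k\<close> violated the condition at \<open>i\<close>, \<open>raising_kernel_trivial\<close> would apply to
  the words that share the rest of the leading word with it.
\<close>

lemma leading_word_ballot:
  assumes q: "q \<noteq> 0" and \<phi>: "supported (words n mu) \<phi>"
    and ker: "\<And>i t :: nat. i \<ge> 1 \<Longrightarrow> t \<ge> 1 \<Longrightarrow> raising n q i t \<phi> = 0"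
    and u: "\<phi> u \<noteq> 0" and top: "\<And>h. colex u h \<Longrightarrow> \<phi> h = 0"
  shows "ballot n u"
  unfolding ballot_def
proof (intro allI impI, rule ccontr)
  fix k i :: nat assume k: "k \<le> n" and i: "i \<ge> 1" and "\<not> cnt k u (Suc i) \<le> cnt k u i"
  then have less: "cnt k u i + 0 < cnt k u (Suc i)" by simp
  have "\<phi> u = 0"
  proof (rule raising_kernel_trivial[where \<phi> = \<phi> and g = u and s = 0 and k = k and u = u and i = i,
        OF q _ _ less])
    fix t :: nat and g assume t: "0 < t" and g: "agree k u g"
    obtain e where "raising n q i t \<phi> g = q ^ e * raising k q i t \<phi> g"
      using raising_restrict[where u = u and \<phi> = \<phi> and q = q and i = i and t = t, OF top g k] by blast
    then show "raising k q i t \<phi> g = 0" using ker[OF i, of t] t q by (simp add: fapply)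
  next
    fix g assume g: "agree k u g" "\<phi> g \<noteq> 0"
    have "cnt k g j = cnt k u j" for j
    proof -
      have "cnt n g j = cnt n u j" using \<phi> g(2) u unfolding supported_def by (metis words_D(2))
      moreover have "{p \<in> {k<..n}. g p = j} = {p \<in> {k<..n}. u p = j}"
        using g(1) by (auto simp: agree_def)
      ultimately show ?thesis using cnt_split[OF k, of g j] cnt_split[OF k, of u j] by simp
    qed
    then show "cnt k g i = cnt k u i \<and> cnt k g (Suc i) = cnt k u (Suc i)" by simp
  qed (simp add: agree_def)
  then show False using u by simp
qed

text \<open>
  The Bruhat order on words of the same content.
\<close>

definition dominated :: "nat \<Rightarrow> (nat \<Rightarrow> nat) \<Rightarrow> (nat \<Rightarrow> nat) \<Rightarrow> bool" where
  "dominated n x u \<longleftrightarrow> (\<forall>k\<le>n. \<forall>r. card {l \<in> {1..k}. x l \<le> r} \<le> card {l \<in> {1..k}. u l \<le> r})"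

lemma card_le_Suc:
  "card {l \<in> {1..Suc k}. g l \<le> r} = card {l \<in> {1..k}. g l \<le> r} + (if g (Suc k) \<le> r then 1 else (0::nat))"
proof -
  have "{l \<in> {1..Suc k}. g l \<le> r} = {l \<in> {1..k}. g l \<le> r} \<union> (if g (Suc k) \<le> r then {Suc k} else {})"
    by (auto simp: le_Suc_eq)
  then show ?thesis by simp
qed

lemma card_le_refl:
  assumes "k \<noteq> j" "1 \<le> j"
  shows "card {l \<in> {1..k}. (g \<circ> simple_refl j) l \<le> r} = card {l \<in> {1..k}. g l \<le> r}"
proof (cases "k < j")
  case True
  then have "{l \<in> {1..k}. (g \<circ> simple_refl j) l \<le> r} = {l \<in> {1..k}. g l \<le> r}"
    by (auto simp: simple_refl_other)
  then show ?thesis by simp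
next
  case False
  then have s: "simple_refl j \<in> Sym k" using assms by (intro simple_refl_in_Sym) auto
  have "bij_betw (simple_refl j) {l \<in> {1..k}. (g \<circ> simple_refl j) l \<le> r} {l \<in> {1..k}. g l \<le> r}"
    by (rule bij_betwI[where g = "simple_refl j"]) (use Sym_D(7)[OF s] in \<open>auto simp del: atLeastAtMost_iff\<close>)
  then show ?thesis by (rule bij_betw_same_card)
qed

text \<open>
  The lifting property of the Bruhat order.
\<close>

lemma dominated_refl_up:
  assumes j: "j \<in> {1..<n}" and w: "w (j + 1) < w j" and x: "dominated n x w \<or> dominated n (x \<circ> simple_refl j) w"
  shows "dominated n x (w \<circ> simple_refl j)"
  unfolding dominated_def
proof (intro allI impI)
  fix k r assume k: "k \<le> n"
  let ?c = "\<lambda>(g :: nat \<Rightarrow> nat) k. card {l \<in> {1..k}. g l \<le> r}"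
  show "?c x k \<le> ?c (w \<circ> simple_refl j) k"
  proof (cases "k = j")
    case False
    have j1: "1 \<le> j" using j by simp
    from x have "?c x k \<le> ?c w k"
    proof
      assume "dominated n (x \<circ> simple_refl j) w"
      then have "?c (x \<circ> simple_refl j) k \<le> ?c w k" using k unfolding dominated_def by blast
      then show ?thesis unfolding card_le_refl[OF False j1, of x r] .
    qed (use k in \<open>unfold dominated_def, blast\<close>)
    then show ?thesis unfolding card_le_refl[OF False j1, of w r] .
  next
    case True
    obtain i where i: "j = Suc i" using j by (cases j) auto
    have ws: "?c (w \<circ> simple_refl j) i = ?c w i" "?c (x \<circ> simple_refl j) i = ?c x i"
      "?c (x \<circ> simple_refl j) (Suc j) = ?c x (Suc j)"
      using card_le_refl[of i j w r] card_le_refl[of i j x r] card_le_refl[of "Suc j" j x r] i by auto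
    have ij: "i \<le> n" "Suc j \<le> n" using i j by auto
    from x have le: "?c x i \<le> ?c w i \<and> ?c x (Suc j) \<le> ?c w (Suc j)"
    proof
      assume "dominated n (x \<circ> simple_refl j) w"
      then have "?c (x \<circ> simple_refl j) i \<le> ?c w i" "?c (x \<circ> simple_refl j) (Suc j) \<le> ?c w (Suc j)"
        using ij unfolding dominated_def by blast+
      then show ?thesis unfolding ws(2,3) by blast
    qed (use ij in \<open>unfold dominated_def, blast\<close>)
    have wj: "?c w (Suc j) = ?c w i + (if w j \<le> r then 1 else 0) + (if w (Suc j) \<le> r then 1 else 0)"
      "?c x (Suc j) = ?c x j + (if x (Suc j) \<le> r then 1 else 0)"
      "?c x j = ?c x i + (if x j \<le> r then 1 else 0)"
      unfolding i card_le_Suc by simp_all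
    have wsj: "?c (w \<circ> simple_refl j) j = ?c w i + (if w (Suc j) \<le> r then 1 else 0)"
      unfolding ws(1)[symmetric] using card_le_Suc[of i "w \<circ> simple_refl j" r] by (simp only: i) (simp add: One_nat_def)
    have "w (Suc j) < w j" using w by (metis Suc_eq_plus1)
    then show ?thesis unfolding True wsj using le wj by (auto split: if_splits)
  qed
qed

lemma dominated_imp_colex:
  assumes d: "dominated n x u" and ne: "x \<noteq> u" and xu: "x \<in> words n mu" "u \<in> words n mu"
  shows "colex x u"
proof (rule ccontr)
  assume "\<not> colex x u"
  then have "colex u x" using colex_total[OF ne, of n] words_D(1)[OF xu(1)] words_D(1)[OF xu(2)] by auto
  then obtain p where p: "p \<ge> 1" "u p < x p" "\<And>p'. p' > p \<Longrightarrow> u p' = x p'"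
    by (auto simp: colex_def)
  have pn: "p \<le> n" using p(2) words_D(1)[OF xu(1), of p] by auto
  define r where "r = u p"
  have tot: "card {l \<in> {1..n}. x l \<le> r} = card {l \<in> {1..n}. u l \<le> r}"
  proof -
    have "card {l \<in> {1..n}. g l \<le> r} = (\<Sum>i\<le>r. mu i)" if "g \<in> words n mu" for g
    proof -
      have "(\<Sum>c\<in>{..r}. \<Sum>l | l \<in> {l \<in> {1..n}. g l \<le> r} \<and> g l = c. (1::nat)) = (\<Sum>l\<in>{l \<in> {1..n}. g l \<le> r}. 1)"
        by (rule sum.group) auto
      moreover have "{l. l \<in> {l \<in> {1..n}. g l \<le> r} \<and> g l = c} = {l \<in> {1..n}. g l = c}" if "c \<in> {..r}" for c
        using that by auto
      ultimately show ?thesis using words_D(2)[OF that] by (simp add: cnt_def)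
    qed
    then show ?thesis using xu by simp
  qed
  obtain m where m: "p = Suc m" using p(1) by (cases p) auto
  have un: "{l \<in> {1..n}. g l \<le> r} = {l \<in> {1..p}. g l \<le> r} \<union> {l \<in> {p<..n}. g l \<le> r}" for g :: "nat \<Rightarrow> nat"
    using pn by auto
  have cu: "card ({l \<in> {1..p}. g l \<le> r} \<union> {l \<in> {p<..n}. g l \<le> r})
      = card {l \<in> {1..p}. g l \<le> r} + card {l \<in> {p<..n}. g l \<le> r}" for g :: "nat \<Rightarrow> nat"
    by (rule card_Un_disjoint) auto
  have "{l \<in> {p<..n}. x l \<le> r} = {l \<in> {p<..n}. u l \<le> r}" using p(3) by auto
  then have "card {l \<in> {1..p}. x l \<le> r} = card {l \<in> {1..p}. u l \<le> r}" using tot unfolding un cu by simp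
  then have "card {l \<in> {1..m}. x l \<le> r} = card {l \<in> {1..m}. u l \<le> r} + 1"
    unfolding m card_le_Suc using p(2) by (simp add: r_def m)
  moreover have "card {l \<in> {1..m}. x l \<le> r} \<le> card {l \<in> {1..m}. u l \<le> r}"
    using d pn unfolding dominated_def m by simp
  ultimately show False by simp
qed

context partition_blocks
begin

definition "specht = {act n q specht_vec h | h. h \<in> hecke_carrier n}"

lemma specht_closed:
  "0 \<in> specht" "\<phi> \<in> specht \<Longrightarrow> \<psi> \<in> specht \<Longrightarrow> \<phi> + \<psi> \<in> specht"
  "\<phi> \<in> specht \<Longrightarrow> hscale c \<phi> \<in> specht"
  "\<phi> \<in> specht \<Longrightarrow> h \<in> hecke_carrier n \<Longrightarrow> act n q \<phi> h \<in> specht"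
  "specht_vec \<in> specht"
proof -
  show "0 \<in> specht" unfolding specht_def
    by (intro CollectI exI[of _ 0]) (simp add: hlinearD(3)[OF hlinear_act_right] hecke_carrier_def fapply)
  show "\<phi> + \<psi> \<in> specht" if "\<phi> \<in> specht" "\<psi> \<in> specht"
    using that unfolding specht_def by (auto simp: act_add_right[symmetric] intro: carrier_closed)
  show "hscale c \<phi> \<in> specht" if "\<phi> \<in> specht"
    using that unfolding specht_def by (auto simp: act_scale_right[symmetric] intro: carrier_closed)
  show "act n q \<phi> h \<in> specht" if "\<phi> \<in> specht" "h \<in> hecke_carrier n"
    using that unfolding specht_def
    by (auto simp: act_assoc[OF supported_specht_vec] intro: hmult_in_carrier)
  have "specht_vec = act n q specht_vec (T id)"
    using act_T[OF id_in_Sym, of n q specht_vec] reduced_word[OF id_in_Sym, of n]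
    by (simp add: reduced_def)
  then show "specht_vec \<in> specht" unfolding specht_def using T_in_carrier[OF id_in_Sym] by blast
qed

lemma specht_wact: "\<phi> \<in> specht \<Longrightarrow> i \<in> {1..<n} \<Longrightarrow> wact q \<phi> i \<in> specht"
  using specht_closed(4)[OF _ T_in_carrier[OF simple_refl_in_Sym'], of \<phi> i]
  by (simp only: act_T_simple_refl)

lemma supported_specht: "\<phi> \<in> specht \<Longrightarrow> supported (words n lam) \<phi>"
  by (auto simp: specht_def supported_specht_vec supported_act)

text \<open>
  The image of the generator would have a content with \<open>\<lambda>\<^sub>1 + \<dots> + \<lambda>\<^sub>i + t\<close> letters up to \<open>i\<close>, too many
  for the antisymmetrizer.
\<close>

lemma raising_specht:
  assumes "\<phi> \<in> specht" "i \<ge> 1" "t \<ge> 1" shows "raising n q i t \<phi> = 0"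
proof -
  have "raising n q i t specht_vec = 0"
  proof (rule specht_eq_0[OF wcommuting_raising supported_raising[OF supported_col]])
    have "sum (lam(i := lam i + t, Suc i := lam (Suc i) - t)) {1..i} = sum (\<lambda>l. lam l + (if l = i then t else 0)) {1..i}"
      by (rule sum.cong) auto
    also have "\<dots> = sum lam {1..i} + t" using assms(2) by (simp add: sum.distrib)
    finally show "sum lam {1..card {1..i}} < sum (lam(i := lam i + t, Suc i := lam (Suc i) - t)) {1..i}"
      using assms(3) by simp
  qed (use assms(2) in auto)
  then show ?thesis using assms(1)
    by (auto simp: specht_def wcommuting_act[OF wcommuting_raising] hlinearD(3)[OF hlinear_act])
qed

lemma ballot_antimono:
  assumes "ballot n u" "k \<le> n" "1 \<le> i" "i \<le> j" shows "cnt k u j \<le> cnt k u i"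
  using assms(4)
proof (induction j rule: dec_induct)
  case (step m)
  have "cnt k u (Suc m) \<le> cnt k u m" using assms(1-3) step.hyps by (simp add: ballot_def)
  then show ?case using step.IH by simp
qed simp

lemma cnt_refl_other:
  assumes "k \<noteq> j" "1 \<le> j" shows "cnt k (u \<circ> simple_refl j) i = cnt k u i"
proof (cases "k < j")
  case True
  then show ?thesis by (intro cnt_cong) (auto simp: simple_refl_other)
next
  case False
  then show ?thesis using assms by (intro cnt_comp simple_refl_in_Sym) auto
qed

text \<open>
  If no ascent can be undone, then the number of a letter among its equals does not
  decrease from one place to the next.
\<close>

lemma column_step:
  assumes b: "ballot n u" and j: "j \<in> {1..<n}"
    and no: "u j < u (j + 1) \<Longrightarrow> \<not> ballot n (u \<circ> simple_refl j)" and pos: "\<And>p. p \<in> {1..n} \<Longrightarrow> u p \<ge> 1"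
  shows "cnt j u (u j) \<le> cnt (Suc j) u (u (Suc j))"
proof (cases "u j < u (Suc j)")
  case False
  have "cnt j u (u j) \<le> cnt (Suc j) u (u j)" by (simp add: cnt_Suc)
  also have "\<dots> \<le> cnt (Suc j) u (u (Suc j))"
    using False j pos[of "Suc j"] by (intro ballot_antimono[OF b]) auto
  finally show ?thesis .
next
  case True
  obtain m where m: "j = Suc m" using j by (cases j) auto
  have jn: "j \<le> n" "m \<le> n" "Suc j \<le> n" using j m by auto
  have "u j < u (j + 1)" using True by (metis Suc_eq_plus1)
  from no[OF this] obtain k i where k: "k \<le> n" "1 \<le> i"
    and viol: "cnt k (u \<circ> simple_refl j) i < cnt k (u \<circ> simple_refl j) (Suc i)"
    by (auto simp: ballot_def not_le simp del: Suc_eq_plus1)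
  have "k = j"
  proof (rule ccontr)
    assume "k \<noteq> j"
    then have "cnt k u i < cnt k u (Suc i)" using viol cnt_refl_other j by auto
    then show False using b k by (simp add: ballot_def not_less[symmetric])
  qed
  have "cnt j (u \<circ> simple_refl j) l = cnt m u l + (if u (Suc j) = l then 1 else 0)" for l
    unfolding m cnt_Suc using cnt_refl_other[of m j u l] m by (simp add: One_nat_def)
  then have v: "cnt m u i + (if u (Suc j) = i then 1 else 0) < cnt m u (Suc i) + (if u (Suc j) = Suc i then 1 else 0)"
    using viol \<open>k = j\<close> by simp
  have bm: "cnt m u (Suc i) \<le> cnt m u i" and bj: "cnt (Suc j) u (Suc i) \<le> cnt (Suc j) u i"
    using b k(2) jn by (auto simp: ballot_def)
  have s: "u (Suc j) = Suc i" "cnt m u (Suc i) = cnt m u i" using v bm by (auto split: if_splits)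
  have "u j = i" using bj s True unfolding m by (auto simp: cnt_Suc split: if_splits)
  then show ?thesis using s unfolding m by (simp add: cnt_Suc)
qed

text \<open>
  The only minimal lattice word is \<^const>\<open>col\<close>: place \<open>p\<close> into row \<open>u p\<close> and into column \<open>cu p\<close>, its number
  among the letters equal to it.  By \<open>column_step\<close> the columns are filled one after the other,
  each from top to bottom, and so the result is \<open>t\<^sub>\<lambda>\<close>.
\<close>

lemma no_ascent_imp_col:
  assumes b: "ballot n u" and u: "u \<in> words n lam"
    and no: "\<And>j. j \<in> {1..<n} \<Longrightarrow> u j < u (j + 1) \<Longrightarrow> \<not> ballot n (u \<circ> simple_refl j)"
  shows "u = col"
proof -
  define cu where "cu p = cnt p u (u p)" for p
  have pos: "u p \<ge> 1" if "p \<in> {1..n}" for p using words_D(1)[OF u, of p] that by auto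
  have mono: "p \<le> p' \<Longrightarrow> p' \<le> n \<Longrightarrow> cu p \<le> cu p'" if "1 \<le> p" for p p'
  proof (induction p' rule: dec_induct)
    case (step m)
    have "cu m \<le> cu (Suc m)" unfolding cu_def
      by (rule column_step[OF b]) (use that step no pos in auto)
    then show ?case using step by simp
  qed simp
  have cnt_mono: "cnt p u l \<le> cnt p' u l" if "p \<le> p'" for p p' l
    unfolding cnt_def using that by (intro card_mono) auto
  have cnt_strict: "cnt p u (u p') < cnt p' u (u p')" if "p < p'" for p p'
  proof -
    obtain m where m: "p' = Suc m" using \<open>p < p'\<close> by (cases p') simp_all
    then show ?thesis using cnt_mono[of p m "u p'"] that by (simp add: cnt_Suc m)
  qed
  have row: "u p < u p'" if p: "1 \<le> p" "p < p'" "p' \<le> n" "cu p = cu p'" for p p'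
  proof (rule ccontr)
    assume "\<not> u p < u p'"
    then have "cu p \<le> cnt p u (u p')"
      unfolding cu_def using p pos[of p'] by (intro ballot_antimono[OF b]) auto
    also have "\<dots> < cu p'" unfolding cu_def by (rule cnt_strict[OF p(2)])
    finally show False using p(4) by simp
  qed
  define f where "f p = (u p, cu p)" for p
  have inj: "inj_on f {1..n}"
  proof (rule inj_onI)
    fix p p' assume p: "p \<in> {1..n}" "p' \<in> {1..n}" "f p = f p'"
    then have eq: "u p = u p'" "cu p = cu p'" by (simp_all add: f_def)
    show "p = p'"
    proof (rule ccontr)
      assume "p \<noteq> p'"
      then have "p < p' \<or> p' < p" by linarith
      then have "u p < u p' \<or> u p' < u p" using row[of p p'] row[of p' p] p(1,2) eq(2) by auto
      then show False using eq by simp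
    qed
  qed
  have sub: "f ` {1..n} \<subseteq> diagram lam"
  proof
    fix x assume "x \<in> f ` {1..n}"
    then obtain p where p: "p \<in> {1..n}" "x = f p" by blast
    obtain m where m: "p = Suc m" using p(1) by (cases p) auto
    have "1 \<le> cu p" by (simp add: cu_def m cnt_Suc)
    moreover have "cu p \<le> lam (u p)"
      using cnt_mono[of p n "u p"] p(1) words_D(2)[OF u] by (simp add: cu_def)
    ultimately show "x \<in> diagram lam" using pos[OF p(1)] p(2) by (simp add: f_def diagram_def)
  qed
  have img: "f ` {1..n} = diagram lam"
    by (rule card_subset_eq[OF card_diagram(1)[OF lam_comp] sub])
       (simp add: card_image[OF inj] card_diagram(2)[OF lam_comp])
  have val: "u p = col p" if p: "p \<in> {1..n}" for p
  proof -
    have iff: "cu p' < cu p \<or> (cu p' = cu p \<and> u p' \<le> u p) \<longleftrightarrow> p' \<le> p" if p': "p' \<in> {1..n}" for p'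
    proof
      assume a: "cu p' < cu p \<or> (cu p' = cu p \<and> u p' \<le> u p)"
      show "p' \<le> p"
      proof (rule ccontr)
        assume "\<not> p' \<le> p"
        then have "cu p \<le> cu p'" "cu p = cu p' \<Longrightarrow> u p < u p'" using mono[of p p'] row[of p p'] p p' by auto
        then show False using a by auto
      qed
    next
      assume a: "p' \<le> p"
      then have "cu p' \<le> cu p" "p' \<noteq> p \<Longrightarrow> cu p' = cu p \<Longrightarrow> u p' < u p"
        using mono[of p' p] row[of p' p] p p' by auto
      then show "cu p' < cu p \<or> (cu p' = cu p \<and> u p' \<le> u p)" by (cases "p' = p") auto
    qed
    have "{(k, l) \<in> diagram lam. l < cu p \<or> (l = cu p \<and> k \<le> u p)} = f ` {p' \<in> {1..n}. p' \<le> p}"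
    proof (intro set_eqI iffI)
      fix x assume x: "x \<in> {(k, l) \<in> diagram lam. l < cu p \<or> (l = cu p \<and> k \<le> u p)}"
      then have "x \<in> f ` {1..n}" using img by auto
      then obtain p' where "p' \<in> {1..n}" "x = f p'" by blast
      then show "x \<in> f ` {p' \<in> {1..n}. p' \<le> p}" using x iff[of p'] by (auto simp: f_def)
    next
      fix x assume "x \<in> f ` {p' \<in> {1..n}. p' \<le> p}"
      then obtain p' where "p' \<in> {1..n}" "p' \<le> p" "x = f p'" by blast
      moreover have "f p' \<in> diagram lam" using sub \<open>p' \<in> {1..n}\<close> by blast
      ultimately show "x \<in> {(k, l) \<in> diagram lam. l < cu p \<or> (l = cu p \<and> k \<le> u p)}"
        using iff[of p'] by (auto simp: f_def)
    qed
    moreover have "{p' \<in> {1..n}. p' \<le> p} = {1..p}" using p by auto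
    moreover have "inj_on f {1..p}" using inj p by (auto intro: inj_on_subset)
    ultimately have "col_tab lam (u p, cu p) = p" by (simp add: col_tab_def card_image)
    moreover have "(u p, cu p) \<in> diagram lam" using sub p by (auto simp: f_def)
    ultimately show ?thesis using col_tab_props(3) by metis
  qed
  show ?thesis
  proof
    fix p show "u p = col p"
      using val[of p] words_D(1)[OF u, of p] by (cases "p \<in> {1..n}") (auto simp: col_def)
  qed
qed

lemma words_bounded:
  obtains B where "\<And>g p. g \<in> words n mu \<Longrightarrow> g p < B"
proof -
  have "finite ((\<lambda>(g, p). g p) ` (words n mu \<times> {1..n}))" using finite_words by blast
  then obtain B where B: "\<forall>x \<in> (\<lambda>(g, p). g p) ` (words n mu \<times> {1..n}). x < B"
    by (metis finite_nat_set_iff_bounded)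
  have "g p < Suc B" if g: "g \<in> words n mu" for g p
  proof (cases "p \<in> {1..n}")
    case True
    then have "g p < B" using B g by auto
    then show ?thesis by simp
  qed (use words_D(1)[OF g, of p] in simp)
  then show ?thesis using that by blast
qed

text \<open>
  The vectors \<open>z T\<^sub>d\<close> with \<open>d\<close> given by a standard tableau, found by going from \<open>col\<close> upwards in steps
  \<open>T\<^sub>j\<close>.  The Bruhat order, rather than \<^const>\<open>colex\<close>, is what a step \<open>T\<^sub>j\<close> is compatible with.
\<close>

lemma ex_specht_leading:
  assumes "ballot n u" "u \<in> words n lam"
  shows "\<exists>\<phi>\<in>specht. \<phi> u \<noteq> 0 \<and> (\<forall>x. \<phi> x \<noteq> 0 \<longrightarrow> dominated n x u)"
proof -
  obtain B where B: "\<And>g p. g \<in> words n lam \<Longrightarrow> g p < B" using words_bounded by blast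
  show ?thesis using assms
  proof (induction "key B n u" arbitrary: u rule: less_induct)
    case less
    show ?case
    proof (cases "u = col")
      case True
      have "dominated n x col" if "specht_vec x \<noteq> 0" for x
      proof -
        have x: "x \<in> block_inj" "x \<in> words n lam"
          using that supported_act_y[OF supported_col] supported_specht_vec
          by (auto simp: supported_def specht_vec_def)
        have "card {l \<in> {1..k}. x l \<le> r} \<le> card {l \<in> {1..k}. col l \<le> r}" if "k \<le> n" for k r
        proof -
          have "x l \<ge> 1" if "l \<in> {1..k}" for l
            using words_D(1)[OF x(2), of l] that \<open>k \<le> n\<close> by auto
          then have "{l \<in> {1..k}. x l \<le> r} = {l \<in> {1..k}. x l \<in> {1..r}}" by auto
          then show ?thesis using block_inj_dominated[OF x(1) that, of "{1..r}"] by simp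
        qed
        then show ?thesis by (simp add: dominated_def)
      qed
      then show ?thesis using True specht_closed(5) specht_vec_col by (intro bexI[of _ specht_vec]) auto
    next
      case False
      then obtain j where j: "j \<in> {1..<n}" "u j < u (j + 1)" "ballot n (u \<circ> simple_refl j)"
        using no_ascent_imp_col[OF less.prems] by blast
      define w where "w = u \<circ> simple_refl j"
      have w: "w j = u (j + 1)" "w (j + 1) = u j" "u = w \<circ> simple_refl j" by (simp_all add: w_def)
      have ww: "w \<in> words n lam"
        unfolding w_def words_comp_iff[OF simple_refl_in_Sym'[OF j(1)]] by (rule less.prems(2))
      have "w p' = u p'" if "p' > j + 1" for p'
        using that by (simp add: w_def simple_refl_other)
      moreover have "w (j + 1) < u (j + 1)" using j(2) w(2) by simp
      ultimately have "colex w u" unfolding colex_def by (intro exI[of _ "j + 1"]) simp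
      then have "key B n w < key B n u"
        using words_D(1)[OF ww] words_D(1)[OF less.prems(2)] by (intro colex_key B[OF ww]) auto
      from less.hyps[OF this j(3)[folded w_def] ww] obtain \<phi> where
        \<phi>: "\<phi> \<in> specht" "\<phi> w \<noteq> 0" "\<And>x. \<phi> x \<noteq> 0 \<Longrightarrow> dominated n x w" by blast
      have "wact q \<phi> j u = q * \<phi> w" using j(2) by (simp add: wact_apply w_def)
      then have "wact q \<phi> j u \<noteq> 0" using \<phi>(2) q_nz by simp
      moreover have "dominated n x u" if "wact q \<phi> j x \<noteq> 0" for x
      proof -
        have "\<phi> x \<noteq> 0 \<or> \<phi> (x \<circ> simple_refl j) \<noteq> 0" using that by (auto simp: wact_apply split: if_splits)
        then have "dominated n x w \<or> dominated n (x \<circ> simple_refl j) w" using \<phi>(3) by blast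
        then show ?thesis unfolding w(3) by (intro dominated_refl_up[OF j(1)]) (use w j(2) in simp)
      qed
      ultimately show ?thesis using specht_wact[OF \<phi>(1) j(1)] by blast
    qed
  qed
qed

text \<open>
  The leading word of a vector in the kernel is a lattice word, so a multiple of a vector of the
  Specht module has the same leading term.  The difference is in the kernel again and has a smaller
  leading word.
\<close>

theorem kernel_intersection:
  assumes "supported (words n lam) \<phi>"
    and "\<And>i t. i \<ge> 1 \<Longrightarrow> t \<ge> 1 \<Longrightarrow> raising n q i t \<phi> = 0"
  shows "\<phi> \<in> specht"
proof -
  obtain B where B: "\<And>g p. g \<in> words n lam \<Longrightarrow> g p < B" using words_bounded by blast
  have out: "p \<notin> {1..n} \<Longrightarrow> g p = 0" if "g \<in> words n lam" for g p using words_D(1)[OF that] by simp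
  have ck: "key B n g < key B n h" if "colex g h" "g \<in> words n lam" "h \<in> words n lam" for g h
    by (rule colex_key[OF that(1) B[OF that(2)]]) (use out that in auto)
  have "\<phi> \<in> specht" if "supported (words n lam) \<phi>"
    "\<And>i t. i \<ge> 1 \<Longrightarrow> t \<ge> 1 \<Longrightarrow> raising n q i t \<phi> = 0" "\<And>g. \<phi> g \<noteq> 0 \<Longrightarrow> key B n g < K" for K \<phi>
    using that
  proof (induction K arbitrary: \<phi> rule: less_induct)
    case (less K)
    show ?case
    proof (cases "\<phi> = 0")
      case False
      let ?S = "{g. \<phi> g \<noteq> 0}"
      have sub: "?S \<subseteq> words n lam" using less.prems(1) by (auto simp: supported_def)
      have fin: "finite ?S" using sub finite_words by (rule finite_subset)
      have ne: "?S \<noteq> {}" using False by (auto simp: fun_eq_iff fapply)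
      have "Max (key B n ` ?S) \<in> key B n ` ?S" using fin ne by (intro Max_in) auto
      then obtain u where u: "\<phi> u \<noteq> 0" "key B n u = Max (key B n ` ?S)" by auto
      have max: "key B n g \<le> key B n u" if "\<phi> g \<noteq> 0" for g
        unfolding u(2) using fin that by (intro Max_ge) auto
      have uw: "u \<in> words n lam" using sub u(1) by blast
      have top: "\<phi> h = 0" if "colex u h" for h
      proof (rule ccontr)
        assume h: "\<phi> h \<noteq> 0"
        then have "h \<in> words n lam" using sub by blast
        then show False using ck[OF that uw] max[OF h] by simp
      qed
      have "ballot n u" by (rule leading_word_ballot[OF q_nz less.prems(1,2) u(1) top])
      then obtain \<psi> where \<psi>: "\<psi> \<in> specht" "\<psi> u \<noteq> 0" "\<And>x. \<psi> x \<noteq> 0 \<Longrightarrow> dominated n x u"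
        using ex_specht_leading uw by blast
      define c where "c = \<phi> u / \<psi> u"
      define \<phi>' where "\<phi>' = \<phi> + hscale (- c) \<psi>"
      have "\<phi>' \<in> specht"
      proof (rule less.IH[of "key B n u"])
        show "key B n u < K" by (rule less.prems(3)[OF u(1)])
        show "supported (words n lam) \<phi>'"
          unfolding \<phi>'_def by (intro supported_closed less.prems(1) supported_specht \<psi>(1))
        show "raising n q i t \<phi>' = 0" if "i \<ge> 1" "t \<ge> 1" for i t
          unfolding \<phi>'_def hlinearD[OF hlinear_raising]
          by (simp add: less.prems(2)[OF that] raising_specht[OF \<psi>(1) that])
        fix g assume g: "\<phi>' g \<noteq> 0"
        have "\<phi>' u = 0" using \<psi>(2) by (simp add: \<phi>'_def c_def fapply)
        then have gu: "g \<noteq> u" using g by blast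
        have gw: "g \<in> words n lam" using g \<open>supported (words n lam) \<phi>'\<close> by (auto simp: supported_def)
        have "\<phi> g \<noteq> 0 \<or> \<psi> g \<noteq> 0" using g by (auto simp: \<phi>'_def fapply)
        then show "key B n g < key B n u"
        proof
          assume "\<phi> g \<noteq> 0"
          then have "\<not> colex u g" using top by blast
          then have "colex g u" using colex_total[OF gu, of n] out[OF gw] out[OF uw] by blast
          then show ?thesis by (rule ck[OF _ gw uw])
        next
          assume "\<psi> g \<noteq> 0"
          then show ?thesis using dominated_imp_colex[OF \<psi>(3) gu gw uw] ck[OF _ gw uw] by blast
        qed
      qed
      then have "\<phi>' + hscale c \<psi> \<in> specht" by (intro specht_closed \<psi>(1))
      moreover have "\<phi>' + hscale c \<psi> = \<phi>" by (simp add: \<phi>'_def fun_eq_iff fapply)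
      ultimately show ?thesis by simp
    qed (simp add: specht_closed)
  qed
  moreover have "\<exists>K. \<forall>g. \<phi> g \<noteq> 0 \<longrightarrow> key B n g < K"
  proof -
    have "finite (key B n ` words n lam)" using finite_words by blast
    then obtain K where "\<forall>x\<in>key B n ` words n lam. x < K" by (metis finite_nat_set_iff_bounded)
    then show ?thesis using assms(1) by (auto simp: supported_def)
  qed
  ultimately show ?thesis using assms by blast
qed

end

section \<open>A singular vector\<close>

definition letter_count :: "nat \<Rightarrow> 'f::field hecke \<Rightarrow> nat \<Rightarrow> nat \<Rightarrow> bool" where
  "letter_count n v l c \<longleftrightarrow> (\<forall>g. v g \<noteq> 0 \<longrightarrow> cnt n g l = c)"

lemma letter_count_add: "letter_count n u l c \<Longrightarrow> letter_count n v l c \<Longrightarrow> letter_count n (u + v) l c"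
  by (force simp: letter_count_def fapply)

lemma letter_count_hscale: "letter_count n v l c \<Longrightarrow> letter_count n (hscale x v) l c"
  by (force simp: letter_count_def fapply)

lemma letter_count_lowering:
  assumes "letter_count n v l c"
  shows "letter_count n (lowering n q i v) l (if l = i then c - 1 else if l = Suc i then c + 1 else c)"
  unfolding letter_count_def
proof (intro allI impI)
  fix g assume "lowering n q i v g \<noteq> 0"
  then obtain h where h: "moved n (Suc i) i 1 g h" "v h \<noteq> 0" by (rule lowering_nonzero)
  then show "cnt n g l = (if l = i then c - 1 else if l = Suc i then c + 1 else c)"
    using moved_cnt[OF h(1), of n] assms by (auto simp: letter_count_def)
qed

lemma lowering_commute':
  "Suc i < j \<or> Suc j < i \<Longrightarrow> lowering n q i (lowering n q j v) = lowering n q j (lowering n q i v)"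
  using lowering_commute[of i j n q v] lowering_commute[of j i n q v] by (auto simp: fun_eq_iff)

lemma raising_lowering_other':
  "i \<noteq> j \<Longrightarrow> raising n q i 1 (lowering n q j v) = lowering n q j (raising n q i 1 v)"
  by (rule ext) (rule raising_lowering_other)

lemma raising_lowering_weight:
  assumes "letter_count n v i x" "letter_count n v (Suc i) y"
  shows "raising n q i 1 (lowering n q i v) =
    lowering n q i (raising n q i 1 v) + hscale (qnum q x - qnum q y) v"
proof
  fix g
  show "raising n q i 1 (lowering n q i v) g =
    (lowering n q i (raising n q i 1 v) + hscale (qnum q x - qnum q y) v) g"
    unfolding raising_lowering_same fapply
    using assms by (cases "v g = 0") (auto simp: letter_count_def)
qed

text \<open>
  A segment of rows \<open>a, \<dots>, b\<close> of a partition, where a node is to be removed from row \<open>a\<close>.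
\<close>

locale lowering_chain =
  fixes n :: nat and q :: "'f::field" and lam :: "nat \<Rightarrow> nat" and a b :: nat
  assumes dec: "\<And>k. a \<le> k \<Longrightarrow> k < b \<Longrightarrow> lam (Suc k) \<le> lam k"
    and dec_a: "lam (Suc a) < lam a" and pos: "\<And>k. a \<le> k \<Longrightarrow> k < b \<Longrightarrow> 1 \<le> lam k"
begin

abbreviation "f \<equiv> lowering n q"
abbreviation "e l \<equiv> raising n q l 1"

text \<open>
  The axial distance between the last nodes of rows \<open>a\<close> and \<open>k\<close>.
\<close>

definition "axial k = lam a - lam k + (k - a)"

definition "flat k \<longleftrightarrow> lam (k - 1) = lam k"

text \<open>
  After \<open>m\<close> steps, the pair \<open>(P, A)\<close> of operators for \<open>k = a + 1 + m\<close>; both move one letter from \<open>a\<close> to \<open>k\<close>.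
  \<open>P\<close> is the operator of interest.  If rows \<open>k - 1\<close> and \<open>k\<close> have the same length, then \<open>P v\<close> is
  \<open>[N - 1]\<close> times \<open>A v\<close> on the vectors of interest, and the next step continues with \<open>A\<close> in
  place of \<open>P\<close>, in order not to multiply by a quantum integer that may vanish.
\<close>

primrec chain :: "nat \<Rightarrow> ('f hecke \<Rightarrow> 'f hecke) \<times> ('f hecke \<Rightarrow> 'f hecke)" where
  "chain 0 = (f a, f a)"
| "chain (Suc m) = (let k = Suc a + m; P = fst (chain m); A = (if flat k then snd (chain m) else P);
     s = (if flat k then 1 else qnum q (axial k - 1))
   in (\<lambda>v. hscale (- q * s) (P (f k v)) + hscale (qnum q (axial k)) (f k (A v)), \<lambda>v. f k (A v)))"

definition "P k = fst (chain (k - Suc a))"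
definition "A k = snd (chain (k - Suc a))"
text \<open>
  The operator that \<open>f\<^bsub>k-1\<^esub>\<close> was applied to last: \<open>A k = f\<^bsub>k-1\<^esub> (Y k)\<close>.
\<close>

definition "Y k = (if k = Suc a then \<lambda>v. v else if flat (k - 1) then A (k - 1) else P (k - 1))"

lemma P_base: "P (Suc a) = f a" and A_base: "A (Suc a) = f a" and Y_base: "Y (Suc a) = (\<lambda>v. v)"
  by (simp_all add: P_def A_def Y_def)

lemma chain_step:
  assumes "Suc a \<le> k"
  shows "P (Suc k) v = hscale (- q * (if flat k then 1 else qnum q (axial k - 1))) (P k (f k v))
      + hscale (qnum q (axial k)) (f k (Y (Suc k) v))"
    "A (Suc k) v = f k (Y (Suc k) v)"
    "Y (Suc k) = (if flat k then A k else P k)"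
proof -
  have k: "Suc k - Suc a = Suc (k - Suc a)" "Suc a + (k - Suc a) = k" using assms by auto
  show Y: "Y (Suc k) = (if flat k then A k else P k)" using assms by (simp add: Y_def)
  show "P (Suc k) v = hscale (- q * (if flat k then 1 else qnum q (axial k - 1))) (P k (f k v))
      + hscale (qnum q (axial k)) (f k (Y (Suc k) v))"
    unfolding Y unfolding P_def[of "Suc k"] k(1) chain.simps k(2)
    by (simp add: Let_def P_def A_def)
  show "A (Suc k) v = f k (Y (Suc k) v)"
    unfolding Y unfolding A_def[of "Suc k"] k(1) chain.simps k(2)
    by (simp add: Let_def P_def A_def)
qed

lemma chain_hlinear:
  assumes "Suc a \<le> k" shows "hlinear (P k) \<and> hlinear (A k) \<and> hlinear (Y k)"
  using assms
proof (induction k rule: dec_induct)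
  case base
  show ?case by (simp add: P_base A_base Y_base hlinear_lowering, simp add: hlinear_def)
next
  case (step k)
  then have Y: "hlinear (Y (Suc k))" by (simp add: chain_step(3))
  have A: "hlinear (A (Suc k))"
    using hlinear_compose[of "f k" "Y (Suc k)", OF hlinear_lowering Y] by (simp add: hlinear_def chain_step(2)[OF step.hyps(1)])
  have PF: "hlinear (P k)" using step.IH by blast
  have "hlinear (P (Suc k))"
    unfolding hlinear_def chain_step(1)[OF step.hyps(1)] hlinearD(1,2)[OF PF] hlinearD(1,2)[OF Y]
      hlinearD(1,2)[OF hlinear_lowering]
    by (simp add: hscale_add add.assoc add.left_commute mult.commute)
  then show ?case using A Y by blast
qed

lemma chain_commute_f:
  assumes "Suc a \<le> k"
  shows "(\<forall>l>k. f l (P k v) = P k (f l v) \<and> f l (A k v) = A k (f l v)) \<and> (\<forall>l\<ge>k. f l (Y k v) = Y k (f l v))"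
  using assms
proof (induction k arbitrary: v rule: dec_induct)
  case base
  show ?case by (simp add: P_base A_base Y_base lowering_commute')
next
  case (step k)
  have Y: "f l (Y (Suc k) v) = Y (Suc k) (f l v)" if "l \<ge> Suc k" for l v
    using step.IH[of v] that by (simp add: chain_step(3)[OF step.hyps(1)])
  have FY: "f l (f k (Y (Suc k) v)) = f k (Y (Suc k) (f l v))" if "l > Suc k" for l v
    using that by (simp add: lowering_commute'[of l k] Y)
  have "f l (P k (f k v)) = P k (f k (f l v))" if "l > Suc k" for l v
    using step.IH[of "f k v"] that by (simp add: lowering_commute'[of l k])
  then show ?case using Y FY
    by (simp add: chain_step(1,2)[OF step.hyps(1)] hlinearD[OF hlinear_lowering])
qed

lemma chain_commute_e:
  assumes "Suc a \<le> k"
  shows "(\<forall>l\<ge>k. e l (P k v) = P k (e l v) \<and> e l (A k v) = A k (e l v)) \<and> (\<forall>l\<ge>k. e l (Y k v) = Y k (e l v))"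
  using assms
proof (induction k arbitrary: v rule: dec_induct)
  case base
  show ?case by (simp add: P_base A_base Y_base raising_lowering_other')
next
  case (step k)
  have Y: "e l (Y (Suc k) v) = Y (Suc k) (e l v)" if "l \<ge> Suc k" for l v
    using step.IH[of v] that by (simp add: chain_step(3)[OF step.hyps(1)])
  have FY: "e l (f k (Y (Suc k) v)) = f k (Y (Suc k) (e l v))" if "l \<ge> Suc k" for l v
    using that by (simp add: raising_lowering_other' Y)
  have "e l (P k (f k v)) = P k (f k (e l v))" if "l \<ge> Suc k" for l v
    using step.IH[of "f k v"] that by (simp add: raising_lowering_other')
  then show ?case using Y FY
    by (simp add: chain_step(1,2)[OF step.hyps(1)] hlinearD[OF hlinear_raising])
qed

lemma chain_letter_count:
  assumes "Suc a \<le> k" "letter_count n v l c" "l \<ge> k"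
  shows "letter_count n (P k v) l (if l = k then c + 1 else c) \<and>
    letter_count n (A k v) l (if l = k then c + 1 else c)"
  using assms
proof (induction k arbitrary: v c rule: dec_induct)
  case base
  then show ?case using letter_count_lowering[OF base(1), of q a] by (auto simp: P_base A_base)
next
  case (step k)
  have kl: "k \<le> l" "l \<noteq> k" using step.prems by auto
  have Y: "letter_count n (Y (Suc k) v) l c"
    using step.IH[OF step.prems(1) kl(1)] kl(2) by (simp add: chain_step(3)[OF step.hyps(1)])
  have FY: "letter_count n (f k (Y (Suc k) v)) l (if l = Suc k then c + 1 else c)"
    using letter_count_lowering[OF Y, of q k] kl(2) by simp
  have "letter_count n (f k v) l (if l = Suc k then c + 1 else c)"
    using letter_count_lowering[OF step.prems(1), of q k] kl(2) by simp
  from step.IH[OF this kl(1)] have "letter_count n (P k (f k v)) l (if l = Suc k then c + 1 else c)"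
    using kl(2) by simp
  then show ?case using FY
    by (simp add: chain_step(1,2)[OF step.hyps(1)] letter_count_add letter_count_hscale)
qed

text \<open>
  What the construction of \<open>P k v\<close> uses about \<open>v\<close>.  The generator \<open>z\<close> satisfies this with
  \<open>w = \<lambda>\<^sub>k\<close>, but the recursion also meets \<open>f\<^sub>k z\<close>, which has a letter \<open>k\<close> less; so the number \<open>w\<close> of
  letters \<open>k\<close> is a parameter.
\<close>

definition level :: "nat \<Rightarrow> nat \<Rightarrow> 'f hecke \<Rightarrow> bool" where
  "level k w v \<longleftrightarrow> (\<forall>l. a \<le> l \<longrightarrow> l < k \<longrightarrow> letter_count n v l (lam l)) \<and> letter_count n v k w \<and>
     (\<forall>l. a \<le> l \<longrightarrow> l < k \<longrightarrow> e l v = 0) \<and>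
     (\<forall>l. a \<le> l \<longrightarrow> Suc l < k \<longrightarrow> lam l = lam (Suc l) \<longrightarrow> f l v = 0)"

lemma level_Suc:
  assumes "level (Suc k) w v" "a \<le> k"
  shows "level k (lam k) v" "level k (lam k - 1) (f k v)"
proof -
  show "level k (lam k) v" using assms by (auto simp: level_def)
  have "letter_count n (f k v) l (lam l)" if "a \<le> l" "l < k" for l
    using letter_count_lowering[of n v l "lam l" q k] assms that by (auto simp: level_def)
  moreover have "letter_count n (f k v) k (lam k - 1)"
    using letter_count_lowering[of n v k "lam k" q k] assms by (auto simp: level_def)
  moreover have "e l (f k v) = 0" if "a \<le> l" "l < k" for l
    using assms that by (simp add: level_def raising_lowering_other' hlinearD(3)[OF hlinear_lowering])
  moreover have "f l (f k v) = 0" if "a \<le> l" "Suc l < k" "lam l = lam (Suc l)" for l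
    using assms that by (simp add: level_def lowering_commute'[of l k] hlinearD(3)[OF hlinear_lowering])
  ultimately show "level k (lam k - 1) (f k v)" by (simp add: level_def)
qed

lemma lam_le: "a \<le> k \<Longrightarrow> k \<le> b \<Longrightarrow> lam k \<le> lam a"
proof (induction k rule: dec_induct)
  case (step k)
  then show ?case using dec[of k] by simp
qed simp

text \<open>
  By induction on \<open>k\<close>, from \<open>[e\<^sub>i, f\<^sub>i] = [h\<^sub>i]\<close> and the fact that \<open>e\<^sub>i\<close> commutes with the other \<open>f\<^sub>j\<close>.
  In \<open>e\<^sub>k P\<^bsub>k+1\<^esub> v\<close> both terms of the recursion are multiples of \<open>Y\<^bsub>k+1\<^esub> v\<close>, and their
  coefficients add up to a difference of two quantum integers (\<open>final\<close> in the proof).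
  In \<open>e\<^bsub>k-1\<^esub> P\<^bsub>k+1\<^esub> v\<close> both terms are multiples of \<open>Y\<^sub>k f\<^sub>k v\<close>, and the coefficients of the recursion are
  chosen such that they cancel.
\<close>

lemma raising_chain:
  assumes "Suc a \<le> k" "k \<le> b" "level k w v"
  shows "e (k - 1) (P k v) = hscale (qnum q (lam a + (k - 1 - a)) - qnum q w) (Y k v)"
    and "\<And>l. a \<le> l \<Longrightarrow> Suc l < k \<Longrightarrow> e l (P k v) = 0"
    and "\<And>l. Suc a < k \<Longrightarrow> f (k - 1) v = 0 \<Longrightarrow> a \<le> l \<Longrightarrow> Suc l < k \<Longrightarrow> e l (A k v) = 0"
    and "Suc a < k \<Longrightarrow> e (k - 1) (A k v) = hscale (qnum q (lam (k - 1) + 1) - qnum q w) (Y k v)"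
proof -
  have "e (k - 1) (P k v) = hscale (qnum q (lam a + (k - 1 - a)) - qnum q w) (Y k v) \<and>
    (\<forall>l. a \<le> l \<longrightarrow> Suc l < k \<longrightarrow> e l (P k v) = 0) \<and>
    (\<forall>l. Suc a < k \<longrightarrow> f (k - 1) v = 0 \<longrightarrow> a \<le> l \<longrightarrow> Suc l < k \<longrightarrow> e l (A k v) = 0) \<and>
    (Suc a < k \<longrightarrow> e (k - 1) (A k v) = hscale (qnum q (lam (k - 1) + 1) - qnum q w) (Y k v))"
    using assms
  proof (induction k arbitrary: w v rule: dec_induct)
    case base
    have "e a (f a v) = f a (e a v) + hscale (qnum q (lam a) - qnum q w) v"
      using base by (intro raising_lowering_weight) (auto simp: level_def)
    then show ?case using base
      by (simp add: P_base Y_base level_def hlinearD(3)[OF hlinear_lowering])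
  next
    case (step k)
    have ak: "Suc a \<le> k" "a \<le> k" "k \<le> b" "k < b" using step by auto
    define L where "L = lam k"
    define N where "N = axial k"
    note lev = level_Suc[OF step.prems(2) ak(2), folded L_def]
    note IHv = step.IH[OF ak(3) lev(1)]
    note IHf = step.IH[OF ak(3) lev(2)]
    note lin = chain_hlinear[OF ak(1)] and cf = chain_commute_f[OF ak(1)] and ce = chain_commute_e[OF ak(1)]
    have L1: "1 \<le> L" using pos ak by (simp add: L_def)
    have La: "L \<le> lam a" using lam_le ak by (simp add: L_def)
    have N1: "1 \<le> N" using ak by (simp add: N_def axial_def)
    have LN: "lam a + (k - a) = L + N" "lam a + (k - 1 - a) = L - 1 + N" "lam a + (k - 1 - a) = L + (N - 1)"
      using La L1 ak unfolding N_def axial_def L_def[symmetric] by auto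
    have wk: "letter_count n v k L" "letter_count n v (Suc k) w"
      using step.prems(2) ak by (auto simp: level_def L_def)
    have ev: "e k v = 0" using step.prems(2) ak by (simp add: level_def)
    have zero: "P k 0 = 0" "A k 0 = 0" "Y k 0 = 0" "f k 0 = 0" "\<And>l. e l 0 = 0"
      using lin by (auto simp: hlinearD(3) hlinear_lowering hlinear_raising)
    have efv: "e k (f k v) = hscale (qnum q L - qnum q w) v"
      unfolding raising_lowering_weight[OF wk] by (simp add: ev zero)
    have ePf: "e k (P k (f k v)) = hscale (qnum q L - qnum q w) (P k v)"
      using ce efv lin by (simp add: hlinearD(2))
    have YX: "Y (Suc k) = (if flat k then A k else P k)" by (rule chain_step(3)[OF ak(1)])
    have efY: "e k (f k (Y (Suc k) v)) = hscale (qnum q (L + 1) - qnum q w) (Y (Suc k) v)"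
    proof -
      have "letter_count n (Y (Suc k) v) k (L + 1)" "letter_count n (Y (Suc k) v) (Suc k) w"
        using chain_letter_count[OF ak(1) wk(1)] chain_letter_count[OF ak(1) wk(2)] by (auto simp: YX)
      moreover have "e k (Y (Suc k) v) = 0" using ce ev zero by (simp add: YX)
      ultimately show ?thesis by (simp add: raising_lowering_weight zero)
    qed
    have eA: "e k (A (Suc k) v) = hscale (qnum q (L + 1) - qnum q w) (Y (Suc k) v)"
      unfolding chain_step(2)[OF ak(1)] by (rule efY)
    have qN: "qnum q N = 1 + q * qnum q (N - 1)" using N1 qnum_Suc'[of q "N - 1"] by simp
    have yf: "f k (Y k v) = Y k (f k v)" using cf by simp
    have ek1: "Suc (k - 1) = k" using ak by simp
    have P1: "e (k - 1) (P k (f k v)) = hscale (qnum q (L - 1 + N) - qnum q (L - 1)) (Y k (f k v))"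
      using IHf unfolding LN(2) by blast
    have final: "- q * qnum q (N - 1) * (qnum q L - qnum q w) + qnum q N * (qnum q (L + 1) - qnum q w)
        = qnum q (L + N) - qnum q w"
      unfolding qN qnum_add[of q L N] by (simp add: qN algebra_simps)
    show ?case
    proof (cases "flat k")
      case False
      have YP: "Y (Suc k) = P k" using False YX by simp
      have PS: "P (Suc k) v = hscale (- q * qnum q (N - 1)) (P k (f k v)) + hscale (qnum q N) (f k (P k v))"
        using chain_step(1)[OF ak(1), of v] False by (simp add: YP N_def)
      have AS: "A (Suc k) v = f k (P k v)" using chain_step(2)[OF ak(1), of v] by (simp add: YP)
      have 1: "e k (P (Suc k) v) = hscale (qnum q (L + N) - qnum q w) (P k v)"
        unfolding PS hlinearD[OF hlinear_raising] ePf efY[unfolded YP] hscale_simps hscale_add_left[symmetric] final ..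
      have eP: "e (k - 1) (P k v) = hscale (qnum q (L + (N - 1)) - qnum q L) (Y k v)"
        using IHv unfolding LN(3) by blast
      have efP: "e l (f k (P k v)) = f k (e l (P k v))" if "l < k" for l
        using that by (simp add: raising_lowering_other')
      have 2: "e l (P (Suc k) v) = 0" if l: "a \<le> l" "Suc l < Suc k" for l
      proof (cases "l = k - 1")
        case True
        have "e l (P (Suc k) v) = hscale (- q * qnum q (N - 1) * (qnum q (L - 1 + N) - qnum q (L - 1))
            + qnum q N * (qnum q (L + (N - 1)) - qnum q L)) (Y k (f k v))"
          unfolding True PS hlinearD[OF hlinear_raising] P1
          using efP[of "k - 1"] ak eP
          by (simp add: hlinearD[OF hlinear_lowering] yf, simp add: fun_eq_iff fapply algebra_simps)
        also have "- q * qnum q (N - 1) * (qnum q (L - 1 + N) - qnum q (L - 1))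
            + qnum q N * (qnum q (L + (N - 1)) - qnum q L) = 0"
        proof -
          have "q ^ L = q * q ^ (L - 1)" using L1 by (cases L) auto
          then show ?thesis by (simp add: qnum_add)
        qed
        finally show ?thesis by simp
      next
        case False
        then have l': "Suc l < k" using l by simp
        then have "e l (P k (f k v)) = 0" "e l (P k v) = 0" using IHf IHv l by blast+
        then show ?thesis unfolding PS hlinearD[OF hlinear_raising] using efP[of l] l' by (simp add: zero)
      qed
      have 3: "e l (A (Suc k) v) = 0" if fv: "f k v = 0" and l: "a \<le> l" "Suc l < Suc k" for l
      proof (cases "l = k - 1")
        case True
        then show ?thesis unfolding AS using efP[of l] ak eP fv
          by (simp add: hlinearD[OF hlinear_lowering] yf zero)
      next
        case False
        then have l': "Suc l < k" using l by simp
        then have "e l (P k v) = 0" using IHv l by blast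
        then show ?thesis unfolding AS using efP[of l] l' by (simp add: zero)
      qed
      show ?thesis using 1 2 3 eA LN(1) by (simp add: YP L_def)
    next
      case True
      have eq: "lam (k - 1) = L" using True by (simp add: flat_def L_def)
      then have ka: "Suc a < k" using dec_a ak by (cases "k = Suc a") (auto simp: L_def)
      then have k2: "Suc a \<le> k - 1" "Suc (k - 1) = k" by auto
      have YA: "Y (Suc k) = A k" using True YX by simp
      have fv1: "f (k - 1) v = 0" using step.prems(2) ka eq k2 by (simp add: level_def L_def)
      have dN: "axial (k - 1) = N - 1" using eq k2 ka by (simp add: N_def axial_def L_def)
      \<comment> \<open>Here the common factor appears that A k omits, as f (k - 1) v = 0 removes one term of the recursion.\<close>
      have PA: "P k v = hscale (qnum q (N - 1)) (A k v)"
        using chain_step(1,2)[OF k2(1), of v] chain_hlinear[OF k2(1)]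
        unfolding k2(2) fv1 dN by (simp add: hlinearD(3))
      have PS: "P (Suc k) v = hscale (- q) (P k (f k v)) + hscale (qnum q N) (f k (A k v))"
        using chain_step(1)[OF ak(1), of v] True by (simp add: YA N_def)
      have AS: "A (Suc k) v = f k (A k v)" using chain_step(2)[OF ak(1), of v] by (simp add: YA)
      have 1: "e k (P (Suc k) v) = hscale (qnum q (L + N) - qnum q w) (A k v)"
        unfolding PS hlinearD[OF hlinear_raising] ePf efY[unfolded YA] PA hscale_simps hscale_add_left[symmetric]
          final[symmetric] by (simp add: mult.commute mult.left_commute)
      have eA1: "e (k - 1) (A k v) = hscale (q ^ L) (Y k v)"
        using IHv ka unfolding eq by simp
      have efA: "e l (f k (A k v)) = f k (e l (A k v))" if "l < k" for l
        using that by (simp add: raising_lowering_other')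
      have eA0: "e l (A k v) = 0" if "a \<le> l" "Suc l < k" for l
        using IHv ka fv1 that by blast
      have 2: "e l (P (Suc k) v) = 0" if l: "a \<le> l" "Suc l < Suc k" for l
      proof (cases "l = k - 1")
        case T: True
        have "e l (P (Suc k) v) = hscale (- q * (qnum q (L - 1 + N) - qnum q (L - 1))
            + qnum q N * q ^ L) (Y k (f k v))"
          unfolding T PS hlinearD[OF hlinear_raising] P1
          using efA[of "k - 1"] ak eA1
          by (simp add: hlinearD[OF hlinear_lowering] yf, simp add: fun_eq_iff fapply algebra_simps)
        also have "- q * (qnum q (L - 1 + N) - qnum q (L - 1)) + qnum q N * q ^ L = 0"
        proof -
          have "q ^ L = q * q ^ (L - 1)" using L1 by (cases L) auto
          then show ?thesis by (simp add: qnum_add)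
        qed
        finally show ?thesis by simp
      next
        case False
        then have l': "Suc l < k" using l by simp
        then have "e l (P k (f k v)) = 0" using IHf l by blast
        then show ?thesis unfolding PS hlinearD[OF hlinear_raising]
          using efA[of l] l' eA0[OF l(1) l'] by (simp add: zero)
      qed
      have 3: "e l (A (Suc k) v) = 0" if fv: "f k v = 0" and l: "a \<le> l" "Suc l < Suc k" for l
      proof (cases "l = k - 1")
        case T: True
        then show ?thesis unfolding AS using efA[of l] ak eA1 fv
          by (simp add: hlinearD[OF hlinear_lowering] yf zero)
      next
        case False
        then have l': "Suc l < k" using l by simp
        then show ?thesis unfolding AS using efA[of l] eA0[OF l(1) l'] by (simp add: zero)
      qed
      show ?thesis using 1 2 3 eA LN(1) by (simp add: YA L_def)
    qed
  qed
  then show "e (k - 1) (P k v) = hscale (qnum q (lam a + (k - 1 - a)) - qnum q w) (Y k v)"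
    and "\<And>l. a \<le> l \<Longrightarrow> Suc l < k \<Longrightarrow> e l (P k v) = 0"
    and "\<And>l. Suc a < k \<Longrightarrow> f (k - 1) v = 0 \<Longrightarrow> a \<le> l \<Longrightarrow> Suc l < k \<Longrightarrow> e l (A k v) = 0"
    and "Suc a < k \<Longrightarrow> e (k - 1) (A k v) = hscale (qnum q (lam (k - 1) + 1) - qnum q w) (Y k v)"
    by blast+
qed

theorem chain_singular:
  assumes "a < b" "level b w v" "qnum q (lam a + (b - 1 - a)) = qnum q w" "a \<le> l" "l < b"
  shows "e l (P b v) = 0"
proof (cases "Suc l < b")
  case True
  then show ?thesis using raising_chain(2)[of b w v l] assms by simp
next
  case False
  then have "l = b - 1" using assms(4,5) by simp
  moreover have "e (b - 1) (P b v) = 0" using raising_chain(1)[of b w v] assms by simp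
  ultimately show ?thesis by simp
qed

end

section \<open>The singular vector does not vanish\<close>

context lowering_chain
begin

lemma chain_closed:
  assumes "Suc a \<le> k"
    and add: "\<And>u v. Q u \<Longrightarrow> Q v \<Longrightarrow> Q (u + v)" and scale: "\<And>c v. Q v \<Longrightarrow> Q (hscale c v)"
    and low: "\<And>l v. a \<le> l \<Longrightarrow> l < k \<Longrightarrow> Q v \<Longrightarrow> Q (f l v)"
    and "Q v"
  shows "Q (P k v)" "Q (A k v)"
proof -
  have "j \<le> k \<Longrightarrow> Q v \<Longrightarrow> Q (P j v) \<and> Q (A j v)" if "Suc a \<le> j" for j v
    using that
  proof (induction j arbitrary: v rule: dec_induct)
    case base
    then show ?case using low[of a v] by (simp add: P_base A_base)
  next
    case (step j)
    have "Q (f j v)" using low[of j v] step by simp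
    then have "Q (P j (f j v))" using step.IH[of "f j v"] step.prems by simp
    moreover have "Q (f j (Y (Suc j) v))"
      using low[of j] step by (simp add: chain_step(3))
    ultimately show ?case using add scale by (simp add: chain_step(1,2)[OF step.hyps(1)])
  qed
  then show "Q (P k v)" "Q (A k v)" using assms by blast+
qed

end

text \<open>
  The numbers \<open>a\<close> and \<open>b\<close> are as in the theorem, for the larger partition \<open>\<lambda>\<close>.  The condition on \<open>b\<close> says
  that a node can be added to row \<open>b\<close>.
\<close>

locale carter_payne = partition_blocks n q lam + lowering_chain n q lam a b
  for n :: nat and q :: "'f::field" and lam :: "nat \<Rightarrow> nat" and a b :: nat +
  assumes a1: "1 \<le> a" and ab: "a < b" and last: "lam b < lam (b - 1)"
begin

text \<open>
  The span of the images of the antisymmetrizer on all contents at once, so that it is closed under the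
  operators \<open>f\<^sub>i\<close>.
\<close>

inductive_set yspan :: "'f hecke set" where
  base: "supported (words n mu) \<psi> \<Longrightarrow> act n q \<psi> y \<in> yspan"
| add: "\<phi> \<in> yspan \<Longrightarrow> \<psi> \<in> yspan \<Longrightarrow> \<phi> + \<psi> \<in> yspan"
| scale: "\<phi> \<in> yspan \<Longrightarrow> hscale c \<phi> \<in> yspan"

lemma yspan_lowering: "\<phi> \<in> yspan \<Longrightarrow> 1 \<le> i \<Longrightarrow> f i \<phi> \<in> yspan"
proof (induction rule: yspan.induct)
  case (base mu \<psi>)
  show ?case unfolding wcommuting_act[OF wcommuting_lowering]
    by (rule yspan.base[OF supported_lowering[OF base.hyps]]) (use base.prems in simp)
qed (simp_all add: hlinearD[OF hlinear_lowering] yspan.add yspan.scale)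

lemma yspan_block_inj: "\<phi> \<in> yspan \<Longrightarrow> supported block_inj \<phi>"
  by (induction rule: yspan.induct) (auto intro: supported_act_y supported_add supported_hscale)

definition "letter_columns w i = blk ` {p \<in> {1..n}. w p = i}"

lemma letter_columns_col:
  assumes "1 \<le> i" shows "letter_columns col i = {1..lam i}"
proof (intro set_eqI iffI)
  fix c assume "c \<in> letter_columns col i"
  then show "c \<in> {1..lam i}" using col_blk(1) by (fastforce simp: letter_columns_def diagram_def)
next
  fix c assume "c \<in> {1..lam i}"
  then have d: "(i, c) \<in> diagram lam" using assms by (simp add: diagram_def)
  then show "c \<in> letter_columns col i"
    unfolding letter_columns_def using col_tab_props[OF d] by (intro image_eqI[of _ _ "col_tab lam (i, c)"]) auto
qed

definition corner :: "nat \<Rightarrow> nat" where "corner i = col_tab lam (i, lam i)"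

lemma corner_props:
  assumes "a \<le> i" "i < b"
  shows "corner i \<in> {1..n}" "blk (corner i) = lam i" "col (corner i) = i" "(i, lam i) \<in> diagram lam"
proof -
  show d: "(i, lam i) \<in> diagram lam" using pos[OF assms] assms a1 by (simp add: diagram_def)
  show "corner i \<in> {1..n}" "blk (corner i) = lam i" "col (corner i) = i"
    unfolding corner_def using col_tab_props[OF d] by auto
qed

lemma eq_corner:
  assumes "p \<in> {1..n}" "col p = i" "blk p = lam i" shows "p = corner i"
  using col_blk(2)[OF assms(1)] assms(2,3) by (simp add: corner_def)

text \<open>
  The word of \<open>t\<^sub>\<lambda>\<close>, except that the last nodes of the rows in \<open>U\<close> carry the letter of the next row.  The
  coefficient of \<open>P z\<close> at the word for \<open>U = {a..<b}\<close> will be computed.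
\<close>

definition shifted_word :: "nat set \<Rightarrow> nat \<Rightarrow> nat" where
  "shifted_word U = (\<lambda>p. if p \<in> corner ` U then Suc (col p) else col p)"

text \<open>
  Vectors for which the rows from \<open>a\<close> to \<open>k - 1\<close> still fill exactly the columns of \<open>\<lambda>\<close>.
\<close>

definition adapted :: "nat \<Rightarrow> 'f hecke \<Rightarrow> bool" where
  "adapted k \<Phi> \<longleftrightarrow> \<Phi> \<in> yspan \<and> (\<forall>w. \<Phi> w \<noteq> 0 \<longrightarrow> (\<forall>i. a \<le> i \<longrightarrow> i < k \<longrightarrow> letter_columns w i = {1..lam i}))"

lemma letter_columns_moved:
  assumes "moved n (Suc l) l 1 g h" "i \<noteq> l"
  shows "letter_columns h i \<subseteq> letter_columns g i" "i \<noteq> Suc l \<Longrightarrow> letter_columns h i = letter_columns g i"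
proof -
  have p: "h p = g p \<or> (g p = Suc l \<and> h p = l)" for p using assms(1) by (auto simp: moved_def)
  have "{p \<in> {1..n}. h p = i} \<subseteq> {p \<in> {1..n}. g p = i}" using p assms(2) by force
  then show "letter_columns h i \<subseteq> letter_columns g i" unfolding letter_columns_def by (rule image_mono)
  assume "i \<noteq> Suc l"
  then have "{p \<in> {1..n}. h p = i} = {p \<in> {1..n}. g p = i}" using p assms(2) by force
  then show "letter_columns h i = letter_columns g i" by (simp add: letter_columns_def)
qed

lemma adapted_lowering:
  assumes "adapted (Suc k) \<Phi>" "a \<le> k" shows "adapted k (f k \<Phi>)"
  unfolding adapted_def
proof (intro conjI allI impI)
  show "f k \<Phi> \<in> yspan" using assms a1 by (auto simp: adapted_def intro: yspan_lowering)
  fix w i assume "f k \<Phi> w \<noteq> 0" and i: "a \<le> i" "i < k"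
  then obtain h where h: "moved n (Suc k) k 1 w h" "\<Phi> h \<noteq> 0" using lowering_nonzero by metis
  have "letter_columns h i = letter_columns w i" using letter_columns_moved(2)[OF h(1)] i by simp
  moreover have "letter_columns h i = {1..lam i}" using assms(1) h(2) i by (simp add: adapted_def)
  ultimately show "letter_columns w i = {1..lam i}" by simp
qed

lemma shifted_word_props:
  assumes U: "U \<subseteq> {a..<b}" and p: "p \<in> {1..n}" and k: "shifted_word U p = Suc k"
  shows "(k \<in> U \<and> p = corner k) \<or> (col p = Suc k \<and> p \<notin> corner ` U)"
proof (cases "p \<in> corner ` U")
  case True
  then obtain i where i: "i \<in> U" "p = corner i" by blast
  then have "col p = i" using corner_props(3)[of i] U by auto
  then show ?thesis using True k i by (simp add: shifted_word_def)
qed (use k in \<open>simp add: shifted_word_def\<close>)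

lemma shifted_word_corner: "i \<in> U \<Longrightarrow> U \<subseteq> {a..<b} \<Longrightarrow> shifted_word U (corner i) = Suc i"
  using corner_props(3)[of i] by (auto simp: shifted_word_def)

lemma corner_notin:
  assumes "U \<subseteq> {a..<b}" "k \<notin> U" "col p = k" shows "p \<notin> corner ` U"
  using assms corner_props(3) by fastforce

text \<open>
  Of all letters \<open>k + 1\<close> that may be turned back into \<open>k\<close>, only the one at the last node of row \<open>k\<close>
  contributes: otherwise column \<open>\<lambda>\<^sub>k\<close> would contain no letter \<open>k\<close>.
\<close>

lemma lowering_shifted_word:
  assumes U: "U \<subseteq> {a..<b}" and kU: "k \<in> U" and next1: "Suc k \<in> U \<or> lam (Suc k) < lam k"
    and prev: "k - 1 \<in> U \<Longrightarrow> k \<noteq> a \<Longrightarrow> lam (k - 1) \<noteq> lam k"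
    and supp: "\<And>w. \<Psi> w \<noteq> 0 \<Longrightarrow> {1..lam k} \<subseteq> letter_columns w k"
  shows "f k \<Psi> (shifted_word U) =
    q ^ (lam (Suc k) - (if Suc k \<in> U then 1 else 0)) * \<Psi> (shifted_word (U - {k}))"
proof -
  let ?x = "shifted_word U"
  have k: "a \<le> k" "k < b" "1 \<le> k" using U kU a1 by auto
  note ck = corner_props[OF k(1,2)]
  have lamk: "1 \<le> lam k" using pos k by simp
  have dk: "lam (Suc k) \<le> lam k" using dec k by simp
  have zero: "\<Psi> (?x(p := k)) = 0" if p: "p \<in> {1..n}" "?x p = Suc k" "p \<noteq> corner k" for p
  proof (rule ccontr)
    assume "\<Psi> (?x(p := k)) \<noteq> 0"
    then have "lam k \<in> letter_columns (?x(p := k)) k" using supp[of "?x(p := k)"] lamk by auto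
    then obtain p' where p': "p' \<in> {1..n}" "(?x(p := k)) p' = k" "blk p' = lam k"
      by (auto simp: letter_columns_def)
    have "p' = p"
    proof (rule ccontr)
      assume "p' \<noteq> p"
      then have x: "?x p' = k" using p'(2) by simp
      then have "?x p' = Suc (k - 1)" using k by simp
      from shifted_word_props[OF U p'(1) this] show False
      proof
        assume h: "k - 1 \<in> U \<and> p' = corner (k - 1)"
        then have "a \<le> k - 1" "k - 1 < b" using U by auto
        then have "lam (k - 1) = lam k" "k \<noteq> a" using corner_props(2)[of "k - 1"] h p'(3) k by auto
        then show False using prev h by blast
      next
        assume h: "col p' = Suc (k - 1) \<and> p' \<notin> corner ` U"
        then have "p' = corner k" using eq_corner[OF p'(1) _ p'(3)] k by simp
        then show False using h kU by blast
      qed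
    qed
    then have bp: "blk p = lam k" using p'(3) by simp
    from shifted_word_props[OF U p(1,2)] p(3) have c: "col p = Suc k" "p \<notin> corner ` U" by auto
    then have "(Suc k, lam k) \<in> diagram lam" using col_blk(1)[OF p(1)] bp by simp
    then have eq: "lam (Suc k) = lam k" using dk by (simp add: diagram_def)
    then have "p = corner (Suc k)" using eq_corner[OF p(1) c(1)] bp by simp
    then show False using c(2) next1 eq by auto
  qed
  have xk: "?x (corner k) = Suc k" using shifted_word_corner kU U by blast
  have upd: "?x(corner k := k) = shifted_word (U - {k})"
  proof
    fix p
    have "p \<in> corner ` U \<longleftrightarrow> p \<in> corner ` (U - {k}) \<or> p = corner k" using kU by auto
    moreover have "corner k \<notin> corner ` (U - {k})" using U ck(3) by (intro corner_notin[of _ k]) auto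
    ultimately show "(?x(corner k := k)) p = shifted_word (U - {k}) p"
      using ck(3) by (auto simp: shifted_word_def)
  qed
  \<comment> \<open>Every other letter k + 1 is to the left of that node, which is in the rightmost column concerned.\<close>
  have exponent: "cnt (corner k - 1) ?x (Suc k) = lam (Suc k) - (if Suc k \<in> U then 1 else 0)"
  proof -
    have less: "p < corner k" if p: "p \<in> {1..n}" "col p = Suc k" "p \<notin> corner ` U" for p
    proof -
      have d: "(Suc k, blk p) \<in> diagram lam" using col_blk(1)[OF p(1)] p(2) by simp
      have "blk p < lam k"
      proof (cases "Suc k \<in> U")
        case True
        have "blk p \<noteq> lam (Suc k)" using eq_corner[OF p(1,2)] p(3) True by blast
        then show ?thesis using d dk by (simp add: diagram_def)
      qed (use d next1 in \<open>auto simp: diagram_def\<close>)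
      then show ?thesis using row_word_mono[OF comp _ ck(1) p(1)] ck(2) by force
    qed
    have "{p \<in> {1..corner k - 1}. ?x p = Suc k} = {p \<in> {1..n}. col p = Suc k} - corner ` U"
    proof (intro set_eqI iffI)
      fix p assume p: "p \<in> {p \<in> {1..corner k - 1}. ?x p = Suc k}"
      then have r: "p \<in> {1..n}" "p \<noteq> corner k" using ck(1) by auto
      then show "p \<in> {p \<in> {1..n}. col p = Suc k} - corner ` U"
        using shifted_word_props[OF U r(1), of k] p by auto
    next
      fix p assume p: "p \<in> {p \<in> {1..n}. col p = Suc k} - corner ` U"
      then have "p < corner k" using less by blast
      then show "p \<in> {p \<in> {1..corner k - 1}. ?x p = Suc k}" using p by (auto simp: shifted_word_def)
    qed
    also have "\<dots> = {p \<in> {1..n}. col p = Suc k} - (if Suc k \<in> U then {corner (Suc k)} else {})"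
    proof (cases "Suc k \<in> U")
      case True
      have "p = corner (Suc k)" if "p \<in> corner ` U" "col p = Suc k" for p
        using that corner_props(3) U by fastforce
      then show ?thesis using True by auto
    next
      case False
      then show ?thesis using corner_notin[OF U False] by auto
    qed
    also have "card \<dots> = lam (Suc k) - (if Suc k \<in> U then 1 else 0)"
    proof -
      have "card {p \<in> {1..n}. col p = Suc k} = lam (Suc k)"
        using words_D(2)[OF col_in_words, of "Suc k"] by (simp add: cnt_def)
      moreover have "corner (Suc k) \<in> {p \<in> {1..n}. col p = Suc k}" if "Suc k \<in> U"
        using corner_props[of "Suc k"] U that by auto
      ultimately show ?thesis by (simp add: card_Diff_subset One_nat_def)
    qed
    finally show ?thesis by (simp add: cnt_def)
  qed
  have "f k \<Psi> ?x = (\<Sum>p | p \<in> {1..n} \<and> ?x p = Suc k. if p = corner k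
      then q ^ cnt (corner k - 1) ?x (Suc k) * \<Psi> (?x(corner k := k)) else 0)"
    unfolding lowering_sum by (rule sum.cong) (use zero in auto)
  also have "\<dots> = q ^ cnt (corner k - 1) ?x (Suc k) * \<Psi> (?x(corner k := k))"
    using ck(1) xk by (subst sum.delta) auto
  finally show ?thesis unfolding exponent upd .
qed

text \<open>
  If also the last node of row \<open>k - 1\<close>, just above, is shifted, then every column that contains a letter
  \<open>k + 1\<close> contains a \<open>k\<close> already, and a second one is excluded in an image of the
  antisymmetrizer.
\<close>

lemma flat_vanish:
  assumes U: "U \<subseteq> {a..<b}" and k: "k \<in> U" "k - 1 \<in> U" "a < k" "lam (k - 1) = lam k"
    and \<Psi>: "\<Psi> \<in> yspan"
  shows "f k \<Psi> (shifted_word U) = 0"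
  unfolding lowering_sum
proof (rule sum.neutral, intro ballI)
  let ?x = "shifted_word U"
  fix p assume p: "p \<in> {p. p \<in> {1..n} \<and> ?x p = Suc k}"
  then have pn: "p \<in> {1..n}" and xp: "?x p = Suc k" by auto
  have kb: "a \<le> k" "k < b" "1 \<le> k" using U k(1) a1 by auto
  have bp: "1 \<le> blk p" "blk p \<le> lam k"
  proof -
    from shifted_word_props[OF U pn xp] show "blk p \<le> lam k"
    proof
      assume "k \<in> U \<and> p = corner k"
      then show ?thesis using corner_props(2)[OF kb(1,2)] by simp
    next
      assume "col p = Suc k \<and> p \<notin> corner ` U"
      then have "blk p \<le> lam (Suc k)" using col_blk(1)[OF pn] by (simp add: diagram_def)
      then show ?thesis using dec[OF kb(1,2)] by simp
    qed
    show "1 \<le> blk p" using col_blk(1)[OF pn] by (simp add: diagram_def)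
  qed
  obtain p' where p': "p' \<in> {1..n}" "blk p' = blk p" "?x p' = k"
  proof (cases "blk p = lam k")
    case True
    have "k - 1 < b" "a \<le> k - 1" using kb k(3) by auto
    note c = corner_props[OF this(2,1)]
    show ?thesis
      by (rule that[of "corner (k - 1)"]) (use c True k(4) shifted_word_corner[OF k(2) U] kb in auto)
  next
    case False
    have d: "(k, blk p) \<in> diagram lam" using bp kb by (simp add: diagram_def)
    note c = col_tab_props[OF d]
    have "col_tab lam (k, blk p) \<notin> corner ` U"
    proof
      assume "col_tab lam (k, blk p) \<in> corner ` U"
      then obtain i where i: "i \<in> U" "col_tab lam (k, blk p) = corner i" by blast
      then have "i = k" using corner_props(3)[of i] U c(3) by auto
      then show False using i(2) corner_props(2)[OF kb(1,2)] c(2) False by simp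
    qed
    then show ?thesis using c by (intro that[of "col_tab lam (k, blk p)"]) (auto simp: shifted_word_def)
  qed
  have ne: "p' \<noteq> p" using p'(3) xp by auto
  have "?x(p := k) \<notin> block_inj"
  proof
    assume "?x(p := k) \<in> block_inj"
    from block_injD[OF this p'(1) pn p'(2)] show False using ne p'(3) by simp
  qed
  then have "\<Psi> (?x(p := k)) = 0" using yspan_block_inj[OF \<Psi>] by (auto simp: supported_def)
  then show "q ^ cnt (p - 1) ?x (Suc k) * \<Psi> (?x(p := k)) = 0" by simp
qed

text \<open>
  The coefficient is a unit at every step.  For rows of equal length only the term \<open>-q P f\<^sub>k\<close> survives
  (\<open>flat_vanish\<close>).  Otherwise both terms of the recursion contribute, with coefficients
  proportional to \<open>-[N - 1]\<close> and \<open>[N]\<close>, whose sum is \<open>q\<^sup>N\<^sup>-\<^sup>1\<close>.  The set \<open>S\<close> is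
  there since in the term \<open>P f\<^sub>k\<close> the node of row \<open>k\<close> is shifted before \<open>P\<close> is evaluated.
\<close>

lemma chain_shifted_word:
  assumes "Suc a \<le> k" "k \<le> b"
  shows "\<exists>u. u \<noteq> 0 \<and> (\<forall>\<Phi> S. adapted k \<Phi> \<longrightarrow> S \<subseteq> {k..<b} \<longrightarrow> k \<in> S \<or> lam k < lam (k - 1) \<longrightarrow>
    P k \<Phi> (shifted_word (S \<union> {a..<k})) =
      u * q ^ (lam k - (if k \<in> S then 1 else 0)) * \<Phi> (shifted_word S))"
  using assms
proof (induction k rule: dec_induct)
  case base
  have "P (Suc a) \<Phi> (shifted_word (S \<union> {a..<Suc a})) =
      1 * q ^ (lam (Suc a) - (if Suc a \<in> S then 1 else 0)) * \<Phi> (shifted_word S)"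
    if "adapted (Suc a) \<Phi>" "S \<subseteq> {Suc a..<b}" for \<Phi> S
  proof -
    have "f a \<Phi> (shifted_word (insert a S)) =
        q ^ (lam (Suc a) - (if Suc a \<in> insert a S then 1 else 0)) * \<Phi> (shifted_word (insert a S - {a}))"
      by (rule lowering_shifted_word) (use that ab dec_a in \<open>auto simp: adapted_def\<close>)
    moreover have "insert a S - {a} = S" "S \<union> {a..<Suc a} = insert a S" using that(2) by auto
    ultimately show ?thesis by (simp add: P_base)
  qed
  then show ?case by (intro exI[of _ 1]) auto
next
  case (step k)
  have kb: "k < b" "a < k" "a \<le> k" "Suc a \<le> k" using step by auto
  from step.IH[OF less_imp_le[OF kb(1)]] obtain u where u: "u \<noteq> 0" and IH: "\<And>\<Phi> S. adapted k \<Phi> \<Longrightarrow> S \<subseteq> {k..<b} \<Longrightarrow> k \<in> S \<or> lam k < lam (k - 1) \<Longrightarrow>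
    P k \<Phi> (shifted_word (S \<union> {a..<k})) = u * q ^ (lam k - (if k \<in> S then 1 else 0)) * \<Phi> (shifted_word S)"
    by blast
  define N where "N = axial k"
  have N1: "1 \<le> N" using kb by (simp add: N_def axial_def)
  have lamk: "1 \<le> lam k" using pos kb by simp
  define u' where "u' = (if flat k then - u * q ^ lam k else u * q ^ lam k * q ^ (N - 1))"
  have "P (Suc k) \<Phi> (shifted_word (S \<union> {a..<Suc k})) =
      u' * q ^ (lam (Suc k) - (if Suc k \<in> S then 1 else 0)) * \<Phi> (shifted_word S)"
    if \<Phi>: "adapted (Suc k) \<Phi>" and S: "S \<subseteq> {Suc k..<b}" and S1: "Suc k \<in> S \<or> lam (Suc k) < lam (Suc k - 1)" for \<Phi> S
  proof -
    define U where "U = S \<union> {a..<Suc k}"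
    define E where "E = lam (Suc k) - (if Suc k \<in> S then 1 else 0)"
    have U: "U \<subseteq> {a..<b}" using S kb by (auto simp: U_def)
    have Uk: "U = insert k S \<union> {a..<k}" "U - {k} = S \<union> {a..<k}" "Suc k \<in> U \<longleftrightarrow> Suc k \<in> S" "k \<in> U" "k - 1 \<in> U"
      using S kb by (auto simp: U_def)
    have colk: "{1..lam k} \<subseteq> letter_columns w k" if "\<Phi> w \<noteq> 0" for w
      using \<Phi> that kb by (simp add: adapted_def)
    have k1: "k - 1 \<notin> insert k S" using S kb by force
    have "f k \<Phi> (shifted_word (insert k S)) = q ^ (lam (Suc k) - (if Suc k \<in> insert k S then 1 else 0)) * \<Phi> (shifted_word (insert k S - {k}))"
      by (rule lowering_shifted_word) (use S S1 kb colk k1 in auto)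
    moreover have "insert k S - {k} = S" using S by auto
    ultimately have fk: "f k \<Phi> (shifted_word (insert k S)) = q ^ E * \<Phi> (shifted_word S)" by (simp add: E_def)
    have "P k (f k \<Phi>) (shifted_word U) = u * q ^ (lam k - 1) * f k \<Phi> (shifted_word (insert k S))"
    proof -
      have "insert k S \<subseteq> {k..<b}" using S kb by force
      then show ?thesis
        unfolding Uk(1) using IH[OF adapted_lowering[OF \<Phi> kb(3)], of "insert k S"] by simp
    qed
    then have first: "P k (f k \<Phi>) (shifted_word U) = u * q ^ (lam k - 1) * (q ^ E * \<Phi> (shifted_word S))"
      unfolding fk .
    have qk: "q ^ lam k = q * q ^ (lam k - 1)" using lamk by (cases "lam k") auto
    show ?thesis
    proof (cases "flat k")
      case True
      have "A k \<Phi> \<in> yspan"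
        by (rule chain_closed(2)[OF kb(4)])
           (use \<Phi> a1 in \<open>auto simp: adapted_def intro: yspan.add yspan.scale yspan_lowering\<close>)
      then have "f k (A k \<Phi>) (shifted_word U) = 0"
        using True kb(2) by (intro flat_vanish[OF U Uk(4,5)]) (simp_all add: flat_def)
      then have "f k (Y (Suc k) \<Phi>) (shifted_word U) = 0"
        unfolding chain_step(3)[OF kb(4)] using True by simp
      then have "P (Suc k) \<Phi> (shifted_word U) = - q * P k (f k \<Phi>) (shifted_word U)"
        unfolding chain_step(1)[OF kb(4)] fapply using True by simp
      then show ?thesis unfolding U_def[symmetric] E_def[symmetric] first u'_def using True
        by (simp add: qk)
    next
      case False
      have less: "lam k < lam (k - 1)"
      proof -
        have "lam (Suc (k - 1)) \<le> lam (k - 1)" by (rule dec) (use kb in auto)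
        then show ?thesis using False kb by (simp add: flat_def)
      qed
      have "{1..lam k} \<subseteq> letter_columns w k" if "P k \<Phi> w \<noteq> 0" for w
      proof -
        have "\<forall>w. P k \<Phi> w \<noteq> 0 \<longrightarrow> {1..lam k} \<subseteq> letter_columns w k"
        proof (rule chain_closed(1)[OF kb(4)])
          show "\<forall>w. (u + v) w \<noteq> 0 \<longrightarrow> {1..lam k} \<subseteq> letter_columns w k"
            if "\<forall>w. u w \<noteq> 0 \<longrightarrow> {1..lam k} \<subseteq> letter_columns w k" "\<forall>w. v w \<noteq> 0 \<longrightarrow> {1..lam k} \<subseteq> letter_columns w k" for u v :: "'f hecke"
          proof (intro allI impI)
            fix w assume "(u + v) w \<noteq> 0"
            then have "u w \<noteq> 0 \<or> v w \<noteq> 0" by (auto simp: fapply)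
            then show "{1..lam k} \<subseteq> letter_columns w k" using that by blast
          qed
          show "\<forall>w. hscale c v w \<noteq> 0 \<longrightarrow> {1..lam k} \<subseteq> letter_columns w k"
            if "\<forall>w. v w \<noteq> 0 \<longrightarrow> {1..lam k} \<subseteq> letter_columns w k" for c and v :: "'f hecke"
            using that by (simp add: fapply)
          show "\<forall>w. f l v w \<noteq> 0 \<longrightarrow> {1..lam k} \<subseteq> letter_columns w k"
            if l: "a \<le> l" "l < k" "\<forall>w. v w \<noteq> 0 \<longrightarrow> {1..lam k} \<subseteq> letter_columns w k" for l v
          proof (intro allI impI)
            fix w assume "f l v w \<noteq> 0"
            then obtain h where h: "moved n (Suc l) l 1 w h" "v h \<noteq> 0" using lowering_nonzero by metis
            have "letter_columns h k \<subseteq> letter_columns w k" by (rule letter_columns_moved(1)[OF h(1)]) (use l in simp)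
            then show "{1..lam k} \<subseteq> letter_columns w k" using l(3) h(2) by blast
          qed
        qed (use colk in blast)
        then show ?thesis using that by blast
      qed
      then have "f k (P k \<Phi>) (shifted_word U) = q ^ (lam (Suc k) - (if Suc k \<in> U then 1 else 0)) * P k \<Phi> (shifted_word (U - {k}))"
        by (intro lowering_shifted_word[OF U Uk(4)]) (use S1 Uk less in auto)
      moreover have "adapted k \<Phi>" using \<Phi> by (simp add: adapted_def)
      then have "P k \<Phi> (shifted_word (S \<union> {a..<k})) = u * q ^ lam k * \<Phi> (shifted_word S)"
      proof -
        have "S \<subseteq> {k..<b}" "k \<notin> S" using S by force+
        then show ?thesis using IH[OF \<open>adapted k \<Phi>\<close>, of S] less by simp
      qed
      ultimately have second: "f k (Y (Suc k) \<Phi>) (shifted_word U) = q ^ E * (u * q ^ lam k * \<Phi> (shifted_word S))"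
        unfolding chain_step(3)[OF kb(4)] using False Uk by (simp add: E_def)
      have N: "qnum q N = qnum q (N - 1) + q ^ (N - 1)" using N1 by (cases N) auto
      show ?thesis unfolding U_def[symmetric] E_def[symmetric] chain_step(1)[OF kb(4)] fapply first second u'_def
        using False by (simp add: N_def[symmetric] N qk algebra_simps)
    qed
  qed
  moreover have "u' \<noteq> 0" using u q_nz by (simp add: u'_def)
  ultimately show ?case by blast
qed

lemma specht_vec_yspan: "specht_vec \<in> yspan"
  unfolding specht_vec_def by (rule yspan.base[OF supported_col])

text \<open>
  The generator is supported on permutations of \<^const>\<open>col\<close> within the columns.
\<close>

lemma adapted_specht_vec: "adapted k specht_vec"
  unfolding adapted_def
proof (intro conjI allI impI)
  fix w i assume w: "specht_vec w \<noteq> 0" and i: "a \<le> i" "i < k"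
  have "\<exists>u\<in>young. w = col \<circ> inv u"
  proof (rule ccontr)
    assume "\<not> ?thesis"
    then have "specht_vec w = 0"
      unfolding specht_vec_def act_ket_y_sorted[OF block_sorted_col] fapply
      by (intro sum.neutral) (auto simp: ket_def)
    then show False using w by simp
  qed
  then obtain u where u: "u \<in> young" "w = col \<circ> inv u" by blast
  note iu = young_inv[OF u(1)]
  have "letter_columns w i = letter_columns col i"
  proof (intro set_eqI iffI)
    fix c assume "c \<in> letter_columns w i"
    then obtain p where "p \<in> {1..n}" "col (inv u p) = i" "c = blk p" by (auto simp: letter_columns_def u(2))
    then show "c \<in> letter_columns col i" unfolding letter_columns_def
      using iu Sym_D(8)[OF young_Sym[OF u(1)], of p] by (intro image_eqI[of _ _ "inv u p"]) (auto simp: young_iff)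
  next
    fix c assume "c \<in> letter_columns col i"
    then obtain p where "p \<in> {1..n}" "col p = i" "c = blk p" by (auto simp: letter_columns_def)
    then show "c \<in> letter_columns w i" unfolding letter_columns_def
      using u Sym_D(7,2)[OF young_Sym[OF u(1)]] by (intro image_eqI[of _ _ "u p"]) (auto simp: young_iff)
  qed
  then show "letter_columns w i = {1..lam i}" using letter_columns_col i a1 by simp
qed (rule specht_vec_yspan)

theorem chain_specht_vec_nonzero: "P b specht_vec \<noteq> 0"
proof -
  have "Suc a \<le> b" using ab by simp
  from chain_shifted_word[OF this] obtain u where u: "u \<noteq> 0" and
    ev: "\<And>\<Phi> S. adapted b \<Phi> \<Longrightarrow> S \<subseteq> {b..<b} \<Longrightarrow> b \<in> S \<or> lam b < lam (b - 1) \<Longrightarrow>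
      P b \<Phi> (shifted_word (S \<union> {a..<b})) = u * q ^ (lam b - (if b \<in> S then 1 else 0)) * \<Phi> (shifted_word S)"
    by blast
  have "shifted_word {} = col" by (simp add: shifted_word_def)
  then have "P b specht_vec (shifted_word {a..<b}) = u * q ^ lam b"
    using ev[OF adapted_specht_vec, of "{}"] last by (simp add: specht_vec_col)
  then have "P b specht_vec (shifted_word {a..<b}) \<noteq> 0" using u q_nz by simp
  then show ?thesis by (auto simp: fapply)
qed

text \<open>
  The image would have \<open>\<lambda>\<^sub>1 + \<dots> + \<lambda>\<^sub>l + 1\<close> letters in \<open>{1, \<dots>, l - 1, l + 1}\<close>, too many for \<open>l\<close> letters in the
  columns of \<open>\<lambda>\<close>.
\<close>

lemma lowering_specht_vec_flat:
  assumes "1 \<le> l" "lam l = lam (Suc l)" shows "f l specht_vec = 0"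
proof (rule specht_eq_0[OF wcommuting_lowering supported_lowering[OF supported_col]])
  let ?R = "insert (Suc l) {1..<l}"
  let ?mu = "lam(l := lam l - 1, Suc l := lam (Suc l) + 1)"
  have "sum ?mu {1..<l} = sum lam {1..<l}" by (rule sum.cong) auto
  then have "sum ?mu ?R = lam (Suc l) + 1 + sum lam {1..<l}" by simp
  moreover have "card ?R = l" using assms(1) by simp
  moreover have "{1..l} = insert l {1..<l}" using assms(1) by auto
  then have "sum lam {1..l} = lam l + sum lam {1..<l}" by simp
  ultimately show "sum lam {1..card ?R} < sum ?mu ?R" using assms(2) by simp
qed (use assms in auto)

lemma level_specht_vec: "level b (lam b) specht_vec"
proof -
  have "letter_count n specht_vec l (lam l)" for l
    using supported_specht_vec by (auto simp: letter_count_def supported_def words_D(2))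
  then show ?thesis unfolding level_def
    using a1 by (auto intro!: raising_specht specht_closed lowering_specht_vec_flat)
qed

end

section \<open>Homomorphisms given by tableaux\<close>

text \<open>
  This identifies the tableaux of type \<open>\<mu>\<close> with the words of content \<open>\<mu>\<close>.
\<close>

definition reading :: "nat \<Rightarrow> (nat \<Rightarrow> nat) \<Rightarrow> tableau \<Rightarrow> nat \<Rightarrow> nat" where
  "reading n lam A p = (if p \<in> {1..n} then A (row_word n lam p, p - start lam (row_word n lam p)) else 0)"

lemma reading_row_tab:
  assumes "is_composition n lam" "d \<in> diagram lam"
  shows "reading n lam A (row_tab lam d) = A d"
proof -
  obtain i j where d: "d = (i, j)" by (cases d)
  show ?thesis using row_tab_in_range[OF assms(1) assms(2)[unfolded d]] row_tab_eq[OF assms(1) assms(2)[unfolded d]]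
    by (simp add: reading_def d)
qed

lemma bij_row_tab:
  assumes c: "is_composition n lam" shows "bij_betw (row_tab lam) (diagram lam) {1..n}"
proof (rule bij_betwI[where g = "\<lambda>p. (row_word n lam p, p - start lam (row_word n lam p))"])
  show "row_tab lam \<in> diagram lam \<rightarrow> {1..n}" using row_tab_in_range(1)[OF c] by auto
  show "(\<lambda>p. (row_word n lam p, p - start lam (row_word n lam p))) \<in> {1..n} \<rightarrow> diagram lam"
    using row_tab_surj(1)[OF c] by blast
  show "(row_word n lam (row_tab lam x), row_tab lam x - start lam (row_word n lam (row_tab lam x))) = x"
    if "x \<in> diagram lam" for x
    using row_tab_in_range(2)[OF c] row_tab_eq[OF c] that by (cases x) auto
  show "row_tab lam (row_word n lam y, y - start lam (row_word n lam y)) = y" if "y \<in> {1..n}" for y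
    by (rule row_tab_surj(2)[OF c that])
qed

lemma cnt_reading:
  assumes c: "is_composition n lam"
  shows "cnt n (reading n lam A) i = card {d \<in> diagram lam. A d = i}"
proof -
  have "bij_betw (row_tab lam) {d \<in> diagram lam. A d = i} {p \<in> {1..n}. reading n lam A p = i}"
  proof (rule bij_betw_subset[OF bij_row_tab[OF c], THEN bij_betw_cong[THEN iffD1, rotated]])
    show "{d \<in> diagram lam. A d = i} \<subseteq> diagram lam" by auto
    show "row_tab lam ` {d \<in> diagram lam. A d = i} = {p \<in> {1..n}. reading n lam A p = i}"
    proof (intro set_eqI iffI)
      fix p assume "p \<in> row_tab lam ` {d \<in> diagram lam. A d = i}"
      then show "p \<in> {p \<in> {1..n}. reading n lam A p = i}"
        using reading_row_tab[OF c] bij_betw_apply[OF bij_row_tab[OF c]] by auto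
    next
      fix p assume p: "p \<in> {p \<in> {1..n}. reading n lam A p = i}"
      then have s: "(row_word n lam p, p - start lam (row_word n lam p)) \<in> diagram lam"
        "row_tab lam (row_word n lam p, p - start lam (row_word n lam p)) = p"
        using row_tab_surj[OF c, of p] by auto
      have "A (row_word n lam p, p - start lam (row_word n lam p)) = i"
        using p by (auto simp: reading_def split: if_splits)
      then show "p \<in> row_tab lam ` {d \<in> diagram lam. A d = i}"
        using s by (intro image_eqI[of _ _ "(row_word n lam p, p - start lam (row_word n lam p))"]) auto
    qed
  qed simp
  then show ?thesis by (simp add: cnt_def bij_betw_same_card)
qed

lemma reading_in_words:
  assumes c: "is_composition n lam" and m: "is_composition n mu" and A: "A \<in> tableaux lam mu"
  shows "reading n lam A \<in> words n mu"
proof -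
  have cnt: "cnt n (reading n lam A) i = mu i" for i
    using A cnt_reading[OF c] by (simp add: tableaux_def)
  moreover have "reading n lam A p \<noteq> 0" if "p \<in> {1..n}" for p
  proof
    assume "reading n lam A p = 0"
    then have "p \<in> {p \<in> {1..n}. reading n lam A p = 0}" using that by blast
    moreover have "finite {p \<in> {1..n}. reading n lam A p = 0}" by simp
    ultimately have "cnt n (reading n lam A) 0 > 0" unfolding cnt_def by (subst card_gt_0_iff) blast
    then show False using cnt[of 0] m by (simp add: is_composition_def)
  qed
  moreover have "reading n lam A p = 0" if "p \<notin> {1..n}" for p using that unfolding reading_def by (simp only: if_False)
  ultimately show ?thesis unfolding words_def by blast
qed

definition tableau_of :: "(nat \<Rightarrow> nat) \<Rightarrow> (nat \<Rightarrow> nat) \<Rightarrow> tableau" where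
  "tableau_of lam g = restrict (\<lambda>d. g (row_tab lam d)) (diagram lam)"

lemma reading_tableau_of:
  assumes c: "is_composition n lam" and g: "\<And>p. p \<notin> {1..n} \<Longrightarrow> g p = 0"
  shows "reading n lam (tableau_of lam g) = g"
proof
  fix p show "reading n lam (tableau_of lam g) p = g p"
  proof (cases "p \<in> {1..n}")
    case True
    then show ?thesis using row_tab_surj[OF c True] by (simp add: reading_def tableau_of_def)
  next
    case False
    then show ?thesis using g[OF False] unfolding reading_def by (simp only: if_False)
  qed
qed

lemma tableau_of_reading:
  assumes c: "is_composition n lam" and A: "A \<in> extensional (diagram lam)"
  shows "tableau_of lam (reading n lam A) = A"
proof
  fix d show "tableau_of lam (reading n lam A) d = A d"
  proof (cases "d \<in> diagram lam")
    case True
    then show ?thesis by (simp add: tableau_of_def reading_row_tab[OF c])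
  next
    case False
    then show ?thesis by (simp add: tableau_of_def extensional_arb[OF A])
  qed
qed

lemma tableau_of_in_tableaux:
  assumes c: "is_composition n lam" and g: "g \<in> words n mu"
  shows "tableau_of lam g \<in> tableaux lam mu"
proof -
  have "reading n lam (tableau_of lam g) = g"
    by (rule reading_tableau_of[OF c]) (use words_D(1)[OF g] in blast)
  then have "card {d \<in> diagram lam. tableau_of lam g d = i} = mu i" for i
    using cnt_reading[OF c, of "tableau_of lam g" i] words_D(2)[OF g, of i] by simp
  then show ?thesis by (simp add: tableaux_def tableau_of_def)
qed

text \<open>
  Numbers the places of \<open>g\<close> by their letters, and equal letters from left to right.  Its inverse
  is the permutation \<open>1\<^sub>A\<close> for the tableau \<open>A\<close> with reading \<open>g\<close>.
\<close>

definition standardization :: "nat \<Rightarrow> (nat \<Rightarrow> nat) \<Rightarrow> (nat \<Rightarrow> nat) \<Rightarrow> perm" where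
  "standardization n mu g p = (if p \<in> {1..n} then start mu (g p) + cnt p g (g p) else p)"

lemma cnt_less:
  assumes "p < p'" "g p' = i" shows "cnt p g i < cnt p' g i"
proof -
  obtain m where m: "p' = Suc m" using assms(1) by (cases p') simp_all
  have "cnt p g i \<le> cnt m g i" unfolding cnt_def using assms(1) m by (intro card_mono) auto
  then show ?thesis using assms(2) by (simp add: m cnt_Suc)
qed

lemma standardization_props:
  assumes c: "is_composition n mu" and g: "g \<in> words n mu"
  defines "v \<equiv> standardization n mu g"
  shows "v \<in> Sym n" "row_word n mu \<circ> v = g"
    "\<And>p p'. p \<in> {1..n} \<Longrightarrow> p' \<in> {1..n} \<Longrightarrow> p < p' \<Longrightarrow> g p = g p' \<Longrightarrow> v p < v p'"
proof -
  have bd: "1 \<le> cnt p g (g p)" "cnt p g (g p) \<le> mu (g p)" if p: "p \<in> {1..n}" for p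
  proof -
    obtain m where m: "p = Suc m" using p by (cases p) auto
    show "1 \<le> cnt p g (g p)" by (simp add: m cnt_Suc)
    have "cnt p g (g p) \<le> cnt n g (g p)" unfolding cnt_def using p by (intro card_mono) auto
    then show "cnt p g (g p) \<le> mu (g p)" using words_D(2)[OF g] by simp
  qed
  have vp: "v p = start mu (g p) + cnt p g (g p)" if "p \<in> {1..n}" for p
    using that by (simp add: v_def standardization_def)
  have r: "v p \<in> {1..n}" if p: "p \<in> {1..n}" for p
  proof -
    have "v p \<le> start mu (Suc (g p))" "1 \<le> v p" using vp[OF p] bd[OF p] by auto
    moreover have "start mu (Suc (g p)) \<le> n" by (rule start_le[OF c])
    ultimately show ?thesis unfolding atLeastAtMost_iff by linarith
  qed
  have row: "row_word n mu (v p) = g p" if p: "p \<in> {1..n}" for p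
    using row_word_eq_iff[OF c r[OF p], of "g p"] vp[OF p] bd[OF p] by simp
  show mono: "v p < v p'" if p: "p \<in> {1..n}" "p' \<in> {1..n}" "p < p'" "g p = g p'" for p p'
    using vp[OF p(1)] vp[OF p(2)] cnt_less[OF p(3), of g "g p'"] p(4) by simp
  have inj: "inj_on v {1..n}"
  proof (rule inj_onI)
    fix p p' assume p: "p \<in> {1..n}" "p' \<in> {1..n}" "v p = v p'"
    then have e: "g p = g p'" using row by metis
    have "\<not> p < p'" using mono[OF p(1,2)] e p(3) by auto
    moreover have "\<not> p' < p" using mono[OF p(2,1)] e p(3) by auto
    ultimately show "p = p'" by simp
  qed
  have "v ` {1..n} = {1..n}" by (rule endo_inj_surj) (use r inj in auto)
  then have "bij_betw v {1..n} {1..n}" using inj by (simp add: bij_betw_def)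
  then show "v \<in> Sym n" unfolding Sym_def by (auto simp: v_def standardization_def intro!: bij_imp_permutes)
  show "row_word n mu \<circ> v = g"
  proof
    fix p show "(row_word n mu \<circ> v) p = g p"
    proof (cases "p \<in> {1..n}")
      case False
      then have "v p = p" unfolding v_def standardization_def by (simp only: if_False)
      then show ?thesis using False row_word_pos[OF c, of p] words_D(1)[OF g, of p] by simp
    qed (simp add: row)
  qed
qed

lemma row_tab_row:
  assumes c: "is_composition n mu" and s: "s \<in> {1..n}"
  shows "s \<in> row_entries mu (row_tab mu) i \<longleftrightarrow> row_word n mu s = i"
  using row_entries_eq[OF c, of i] s by simp

text \<open>
  \<open>1\<^sub>A\<close> is defined by a description; the proof shows that the inverse of the standardization of the reading of \<open>A\<close>
  is the only permutation that fits it.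
\<close>

lemma one_perm_props:
  assumes c: "is_composition n lam" and m: "is_composition n mu" and A: "A \<in> tableaux lam mu"
  shows "one_perm n lam mu A \<in> Sym n" "row_word n mu \<circ> inv (one_perm n lam mu A) = reading n lam A"
    "\<And>s s'. s < s' \<Longrightarrow> s \<in> {1..n} \<Longrightarrow> s' \<in> {1..n} \<Longrightarrow> row_word n mu s = row_word n mu s' \<Longrightarrow>
      one_perm n lam mu A s < one_perm n lam mu A s'"
proof -
  define g where "g = reading n lam A"
  have gw: "g \<in> words n mu" unfolding g_def by (rule reading_in_words[OF c m A])
  define v where "v = standardization n mu g"
  note V = standardization_props[OF m gw, folded v_def]
  define cond where "cond w \<longleftrightarrow> w \<in> Sym n \<and>
     (\<forall>i j j'. (i, j) \<in> diagram mu \<longrightarrow> (i, j') \<in> diagram mu \<longrightarrow> j < j' \<longrightarrow>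
        w (row_tab mu (i, j)) < w (row_tab mu (i, j'))) \<and>
     (\<forall>p\<in>diagram lam. row_tab lam p \<in> row_entries mu (w \<circ> row_tab mu) (A p))" for w
  have cond_iff: "cond w \<longleftrightarrow> w \<in> Sym n \<and>
     (\<forall>s s'. s \<in> {1..n} \<longrightarrow> s' \<in> {1..n} \<longrightarrow> s < s' \<longrightarrow> row_word n mu s = row_word n mu s' \<longrightarrow> w s < w s') \<and>
     row_word n mu \<circ> inv w = g" for w
  proof (cases "w \<in> Sym n")
    case w: True
    have 1: "(\<forall>i j j'. (i, j) \<in> diagram mu \<longrightarrow> (i, j') \<in> diagram mu \<longrightarrow> j < j' \<longrightarrow>
        w (row_tab mu (i, j)) < w (row_tab mu (i, j'))) \<longleftrightarrow>
      (\<forall>s s'. s \<in> {1..n} \<longrightarrow> s' \<in> {1..n} \<longrightarrow> s < s' \<longrightarrow> row_word n mu s = row_word n mu s' \<longrightarrow> w s < w s')"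
      (is "?L \<longleftrightarrow> ?R")
    proof
      assume L: ?L
      show ?R
      proof (intro allI impI)
        fix s s' assume s: "s \<in> {1..n}" "s' \<in> {1..n}" "s < s'" "row_word n mu s = row_word n mu s'"
        define i where "i = row_word n mu s"
        have d: "(i, s - start mu i) \<in> diagram mu" "row_tab mu (i, s - start mu i) = s"
          "(i, s' - start mu i) \<in> diagram mu" "row_tab mu (i, s' - start mu i) = s'"
          using row_tab_surj[OF m s(1)] row_tab_surj[OF m s(2)] s(4) by (auto simp: i_def)
        have "start mu i < s" using row_word_eq_iff[OF m s(1), of i] by (simp add: i_def)
        then have "s - start mu i < s' - start mu i" using s(3) by simp
        then show "w s < w s'" using L d by metis
      qed
    next
      assume R: ?R
      show ?L
      proof (intro allI impI)
        fix i j j' assume d: "(i, j) \<in> diagram mu" "(i, j') \<in> diagram mu" "j < j'"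
        show "w (row_tab mu (i, j)) < w (row_tab mu (i, j'))"
          using R row_tab_in_range[OF m d(1)] row_tab_in_range[OF m d(2)] row_tab_eq[OF m d(1)] row_tab_eq[OF m d(2)] d(3)
          by simp
      qed
    qed
    have im: "row_entries mu (w \<circ> row_tab mu) i = w ` row_entries mu (row_tab mu) i" for i
      by (auto simp: row_entries_def)
    have mem: "row_tab lam d \<in> row_entries mu (w \<circ> row_tab mu) i \<longleftrightarrow> row_word n mu (inv w (row_tab lam d)) = i"
      if d: "d \<in> diagram lam" for d i
    proof -
      have x: "row_tab lam d \<in> {1..n}" using bij_betw_apply[OF bij_row_tab[OF c] d] .
      have "row_tab lam d \<in> w ` row_entries mu (row_tab mu) i \<longleftrightarrow> inv w (row_tab lam d) \<in> row_entries mu (row_tab mu) i"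
        using Sym_D(2,3)[OF w] by (metis image_iff)
      then show ?thesis unfolding im using row_tab_row[OF m, of "inv w (row_tab lam d)" i] Sym_D(8)[OF w] x by simp
    qed
    have 2: "(\<forall>d\<in>diagram lam. row_tab lam d \<in> row_entries mu (w \<circ> row_tab mu) (A d)) \<longleftrightarrow> row_word n mu \<circ> inv w = g"
    proof
      assume L: "\<forall>d\<in>diagram lam. row_tab lam d \<in> row_entries mu (w \<circ> row_tab mu) (A d)"
      show "row_word n mu \<circ> inv w = g"
      proof
        fix p show "(row_word n mu \<circ> inv w) p = g p"
        proof (cases "p \<in> {1..n}")
          case True
          note s = row_tab_surj[OF c True]
          show ?thesis using bspec[OF L s(1)] mem[OF s(1)] s(2) True by (simp add: g_def reading_def)
        next
          case False
          then have "inv w p \<notin> {1..n}" using Sym_D(8)[OF w] by simp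
          then show ?thesis using False row_word_pos[OF m] words_D(1)[OF gw] by (metis comp_apply)
        qed
      qed
    next
      assume R: "row_word n mu \<circ> inv w = g"
      show "\<forall>d\<in>diagram lam. row_tab lam d \<in> row_entries mu (w \<circ> row_tab mu) (A d)"
      proof
        fix d assume d: "d \<in> diagram lam"
        show "row_tab lam d \<in> row_entries mu (w \<circ> row_tab mu) (A d)"
          unfolding mem[OF d] using fun_cong[OF R, of "row_tab lam d"] reading_row_tab[OF c d] by (simp add: g_def)
      qed
    qed
    show ?thesis unfolding cond_def 1 2 using w by blast
  qed (simp add: cond_def)
  have iv: "inv (inv v) = v" using Sym_D(1)[OF V(1)] by (rule inv_inv_eq)
  have good: "cond (inv v)"
    unfolding cond_iff iv
  proof (intro conjI allI impI)
    show "inv v \<in> Sym n" using Sym_D(6)[OF V(1)] .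
    show "row_word n mu \<circ> v = g" by (rule V(2))
    fix s s' assume s: "s \<in> {1..n}" "s' \<in> {1..n}" "s < s'" "row_word n mu s = row_word n mu s'"
    have gs: "g (inv v s) = row_word n mu s" "g (inv v s') = row_word n mu s'"
      using fun_cong[OF V(2), of "inv v s"] fun_cong[OF V(2), of "inv v s'"] Sym_D(3)[OF V(1)] by auto
    have rs: "inv v s \<in> {1..n}" "inv v s' \<in> {1..n}" using s Sym_D(8)[OF V(1)] by blast+
    show "inv v s < inv v s'"
    proof (rule ccontr)
      assume n: "\<not> inv v s < inv v s'"
      have "inv v s \<noteq> inv v s'" using s(3) Sym_D(5)[OF V(1)] by simp
      then have "v (inv v s') < v (inv v s)" using n gs s(4) by (intro V(3) rs) auto
      then show False using s(3) Sym_D(3)[OF V(1)] by simp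
    qed
  qed
  have uniq: "w = inv v" if w: "cond w" for w
  proof -
    have wS: "w \<in> Sym n" and inc: "\<And>s s'. s \<in> {1..n} \<Longrightarrow> s' \<in> {1..n} \<Longrightarrow> s < s' \<Longrightarrow> row_word n mu s = row_word n mu s' \<Longrightarrow> w s < w s'"
      and rw: "row_word n mu \<circ> inv w = g" using w unfolding cond_iff by blast+
    have "inv w p = v p" for p
    proof (cases "p \<in> {1..n}")
      case p: True
      define s where "s = inv w p"
      define i where "i = g p"
      have s: "s \<in> {1..n}" "w s = p" "row_word n mu s = i"
        using p Sym_D(8)[OF wS] Sym_D(3)[OF wS] fun_cong[OF rw, of p] by (auto simp: s_def i_def simp del: atLeastAtMost_iff)
      have st: "start mu i < s" "s \<le> start mu i + mu i" using row_word_eq_iff[OF m s(1), of i] s(3) by auto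
      have "{p' \<in> {1..p}. g p' = i} = w ` {start mu i <.. s}"
      proof (intro set_eqI iffI)
        fix p' assume p': "p' \<in> {p' \<in> {1..p}. g p' = i}"
        then have pn: "p' \<in> {1..n}" using p by auto
        have s': "inv w p' \<in> {1..n}" "row_word n mu (inv w p') = i"
          using Sym_D(8)[OF wS] pn fun_cong[OF rw, of p'] p' by (auto simp del: atLeastAtMost_iff)
        have "\<not> s < inv w p'"
        proof
          assume "s < inv w p'"
          then have "w s < w (inv w p')" using s s' by (intro inc) auto
          then show False using s(2) Sym_D(3)[OF wS] p' by auto
        qed
        moreover have "start mu i < inv w p'" using row_word_eq_iff[OF m s'(1), of i] s'(2) by simp
        ultimately show "p' \<in> w ` {start mu i <.. s}"
          using Sym_D(3)[OF wS] by (intro image_eqI[of _ _ "inv w p'"]) auto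
      next
        fix p' assume "p' \<in> w ` {start mu i <.. s}"
        then obtain s' where s': "start mu i < s'" "s' \<le> s" "p' = w s'" by auto
        have sn: "s' \<in> {1..n}" using s' s(1) by auto
        have rs': "row_word n mu s' = i" using row_word_eq_iff[OF m sn, of i] s' st by auto
        have "p' \<le> p" using inc[OF sn s(1)] rs' s s' by (cases "s' = s") auto
        moreover have "p' \<in> {1..n}" using s'(3) sn Sym_D(7)[OF wS] by simp
        moreover have "g p' = i" using fun_cong[OF rw, of p'] Sym_D(2)[OF wS] s'(3) rs' by simp
        ultimately show "p' \<in> {p' \<in> {1..p}. g p' = i}" by auto
      qed
      moreover have "inj_on w {start mu i <.. s}" using Sym_D(4)[OF wS] by (auto intro: inj_onI)
      ultimately have "cnt p g i = s - start mu i" by (simp add: cnt_def card_image)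
      then show ?thesis using st p by (simp add: v_def standardization_def i_def s_def)
    next
      case False
      then show ?thesis using Sym_outside[OF Sym_D(6)[OF wS] False] unfolding v_def standardization_def by (simp only: if_False)
    qed
    then have "inv w = v" by blast
    then show ?thesis using Sym_D(1)[OF wS] by (metis inv_inv_eq)
  qed
  have "one_perm n lam mu A = inv v"
    unfolding one_perm_def cond_def[symmetric] using good uniq by (rule the_equality)
  then have C: "cond (one_perm n lam mu A)" using good by simp
  show "one_perm n lam mu A \<in> Sym n" "row_word n mu \<circ> inv (one_perm n lam mu A) = reading n lam A"
    "\<And>s s'. s < s' \<Longrightarrow> s \<in> {1..n} \<Longrightarrow> s' \<in> {1..n} \<Longrightarrow> row_word n mu s = row_word n mu s' \<Longrightarrow>
      one_perm n lam mu A s < one_perm n lam mu A s'"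
    using C[unfolded cond_iff] by (auto simp: g_def)
qed

text \<open>
  As \<open>1\<^sub>A\<close> is increasing on the rows of \<open>t\<^sup>\<mu>\<close>, it inverts only pairs of places with increasing letters.
\<close>

lemma act_row_one_perm:
  assumes c: "is_composition n lam" and m: "is_composition n mu" and A: "A \<in> tableaux lam mu"
  shows "act n q (ket (row_word n mu)) (T (one_perm n lam mu A)) = ket (reading n lam A)"
proof -
  let ?w = "one_perm n lam mu A"
  note W = one_perm_props[OF c m A]
  have "act n q (ket (row_word n mu)) (T ?w) = ket (row_word n mu \<circ> inv ?w)"
  proof (rule act_ket_T[OF W(1)])
    fix p p' :: nat assume pp: "p < p'" "?w p' < ?w p"
    then have "(p, p') \<in> inversions ?w" by (simp add: inversions_def)
    then have r: "p \<in> {1..n}" "p' \<in> {1..n}" using inversions_subset[OF W(1)] by auto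
    have "row_word n mu p \<noteq> row_word n mu p'" using W(3)[OF pp(1) r] pp(2) by auto
    then show "row_word n mu p < row_word n mu p'" using row_word_mono[OF m _ r] pp(1) by simp
  qed
  then show ?thesis unfolding W(2) .
qed

lemma finite_tableaux:
  assumes c: "is_composition n lam" and m: "is_composition n mu"
  shows "finite (tableaux lam mu)" "inj_on (reading n lam) (tableaux lam mu)"
proof -
  have ext: "tableau_of lam (reading n lam A) = A" if "A \<in> tableaux lam mu" for A
    by (rule tableau_of_reading[OF c]) (use that in \<open>auto simp: tableaux_def PiE_def\<close>)
  show inj: "inj_on (reading n lam) (tableaux lam mu)" by (rule inj_onI) (metis ext)
  have "reading n lam ` tableaux lam mu \<subseteq> words n mu" using reading_in_words[OF c m] by blast
  then have "finite (reading n lam ` tableaux lam mu)" using finite_words by (rule finite_subset)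
  then show "finite (tableaux lam mu)" using inj by (rule finite_imageD)
qed

text \<open>
  In the model of words, the image of the generator under \<open>\<Theta>\<^sub>A\<close> is the sum of all words in the row class of \<open>A\<close>.
\<close>

lemma Theta_gen_eq_lift:
  assumes c: "is_composition n lam" and m: "is_composition n mu"
  shows "Theta_gen n q lam mu A = lift n mu (\<lambda>w. if w \<in> words n mu \<and> row_equiv lam (tableau_of lam w) A then 1 else 0)"
proof -
  let ?S = "{A'. A' \<in> tableaux lam mu \<and> row_equiv lam A' A}"
  have fin: "finite ?S" using finite_tableaux(1)[OF c m] by simp
  have "act n q (ket (row_word n mu)) (\<Sum>A'\<in>?S. T (one_perm n lam mu A')) = (\<Sum>A'\<in>?S. ket (reading n lam A'))"
    unfolding hlinearD(4)[OF hlinear_act_right] by (rule sum.cong) (auto simp: act_row_one_perm[OF c m])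
  also have "\<dots> = (\<lambda>w. if w \<in> words n mu \<and> row_equiv lam (tableau_of lam w) A then 1 else 0)"
  proof
    fix w
    show "(\<Sum>A'\<in>?S. ket (reading n lam A')) w = (if w \<in> words n mu \<and> row_equiv lam (tableau_of lam w) A then 1 else 0)"
    proof (cases "w \<in> words n mu")
      case True
      have rw: "reading n lam (tableau_of lam w) = w"
        by (rule reading_tableau_of[OF c]) (use words_D(1)[OF True] in blast)
      have eq: "w = reading n lam A' \<longleftrightarrow> A' = tableau_of lam w" if "A' \<in> ?S" for A'
        using tableau_of_reading[OF c, of A'] that rw by (auto simp: tableaux_def PiE_def)
      have "(\<Sum>A'\<in>?S. ket (reading n lam A')) w = (\<Sum>A'\<in>?S. if A' = tableau_of lam w then 1 else 0)"
        unfolding fapply by (rule sum.cong) (auto simp: ket_def eq)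
      then show ?thesis using True tableau_of_in_tableaux[OF c True] fin by simp
    next
      case False
      have "(\<Sum>A'\<in>?S. ket (reading n lam A')) w = 0"
        unfolding fapply using False reading_in_words[OF c m] by (intro sum.neutral) (auto simp: ket_def)
      then show ?thesis using False by simp
    qed
  qed
  finally show ?thesis unfolding Theta_gen_def x_elt_eq_lift[OF m] hmult_lift[OF m] by simp
qed

text \<open>
  A Hecke-linear operator with the right value at the generator is \<open>\<Theta>\<^sub>A\<close>; in particular, \<open>\<Theta>\<^sub>A\<close> is well
  defined.
\<close>

lemma Theta_lift:
  assumes c: "is_composition n lam" and m: "is_composition n mu"
    and L: "wcommuting n q L" and gen: "Theta_gen n q lam mu A = lift n mu (L (ket (row_word n lam)))"
    and h: "h \<in> hecke_carrier n"
  shows "Theta n q lam mu A (lift n lam (act n q (ket (row_word n lam)) h)) =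
    lift n mu (L (act n q (ket (row_word n lam)) h))"
proof -
  let ?r = "ket (row_word n lam)"
  have supp: "supported (words n lam) ?r" by (intro supported_ket row_word_in_words[OF c])
  have mem: "lift n lam (act n q ?r h) \<in> perm_module n q lam"
    unfolding perm_module_def x_elt_eq_lift[OF c] hmult_lift[OF c] using h by blast
  have "(THE y. \<exists>k\<in>hecke_carrier n. lift n lam (act n q ?r h) = hmult n q (x_elt n lam) k \<and>
      y = hmult n q (Theta_gen n q lam mu A) k) = lift n mu (L (act n q ?r h))"
  proof (rule the_equality)
    show "\<exists>k\<in>hecke_carrier n. lift n lam (act n q ?r h) = hmult n q (x_elt n lam) k \<and>
        lift n mu (L (act n q ?r h)) = hmult n q (Theta_gen n q lam mu A) k"
      unfolding gen x_elt_eq_lift[OF c] hmult_lift[OF c] hmult_lift[OF m] wcommuting_act[OF L] using h by blast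
    fix z assume "\<exists>k\<in>hecke_carrier n. lift n lam (act n q ?r h) = hmult n q (x_elt n lam) k \<and>
        z = hmult n q (Theta_gen n q lam mu A) k"
    then obtain k where k: "lift n lam (act n q ?r h) = lift n lam (act n q ?r k)"
      "z = lift n mu (act n q (L ?r) k)"
      unfolding gen x_elt_eq_lift[OF c] hmult_lift[OF c] hmult_lift[OF m] by blast
    have "act n q ?r h = act n q ?r k"
      by (rule lift_inject[OF supported_act[OF supp] supported_act[OF supp] k(1)])
    then show "z = lift n mu (L (act n q ?r h))" using k(2) wcommuting_act[OF L, of ?r k] by simp
  qed
  then show ?thesis unfolding Theta_def using mem by simp
qed

section \<open>Products of commutators and their tableaux\<close>

lemma wcommuting_compose: "wcommuting n q L \<Longrightarrow> wcommuting n q M \<Longrightarrow> wcommuting n q (\<lambda>v. L (M v))"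
  by (auto simp: wcommuting_def hlinear_compose)

lemma wact_linear:
  "wact q (u + v) i = wact q u i + wact q v i" "wact q (hscale c v) i = hscale c (wact q v i)"
  "wact q (u - v) i = wact q u i - wact q v i"
  using hlinearD(1,2,6)[OF hlinear_wact[of q i]] by auto

lemma wcommuting_add: "wcommuting n q L \<Longrightarrow> wcommuting n q M \<Longrightarrow> wcommuting n q (\<lambda>v. L v + M v)"
  by (auto simp: wcommuting_def hlinear_def wact_linear hscale_add algebra_simps)

lemma wcommuting_scale: "wcommuting n q L \<Longrightarrow> wcommuting n q (\<lambda>v. hscale c (L v))"
  by (auto simp: wcommuting_def hlinear_def wact_linear hscale_add algebra_simps)

lemma wcommuting_diff: "wcommuting n q L \<Longrightarrow> wcommuting n q M \<Longrightarrow> wcommuting n q (\<lambda>v. L v - M v)"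
  using wcommuting_add[of n q L "\<lambda>v. hscale (- 1) (M v)"] wcommuting_scale[of n q M "- 1"]
  by (simp add: hscale_def fun_diff_def plus_fun_def)

context lowering_chain
begin

text \<open>
  The product of iterated commutators that corresponds to \<open>K\<close>, shifted to start at \<open>0\<close>: at each \<open>k\<close> in \<open>K\<close> a
  new factor begins with \<open>f\<^sub>k\<close>; at the other \<open>k\<close> the last factor \<open>X\<close> is replaced by \<open>f\<^sub>k X - X f\<^sub>k\<close> (\<open>f\<^sub>k\<close> commutes
  with all earlier factors).
\<close>

primrec comm :: "nat set \<Rightarrow> nat \<Rightarrow> 'f hecke \<Rightarrow> 'f hecke" where
  "comm K 0 = f a"
| "comm K (Suc m) = (if Suc a + m \<in> K then (\<lambda>v. comm K m (f (Suc a + m) v))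
     else (\<lambda>v. f (Suc a + m) (comm K m v) - comm K m (f (Suc a + m) v)))"

definition "D K k = comm K (k - Suc a)"

lemma D_base: "D K (Suc a) = f a"
  by (simp add: D_def)

lemma D_step:
  assumes "Suc a \<le> k"
  shows "D K (Suc k) = (if k \<in> K then (\<lambda>v. D K k (f k v)) else (\<lambda>v. f k (D K k v) - D K k (f k v)))"
proof -
  have k: "Suc k - Suc a = Suc (k - Suc a)" "Suc a + (k - Suc a) = k" using assms by auto
  show ?thesis unfolding D_def k(1) comm.simps k(2) ..
qed

lemma D_cong:
  assumes "Suc a \<le> k" "K \<inter> {Suc a..<k} = K' \<inter> {Suc a..<k}" shows "D K k = D K' k"
  using assms
proof (induction k rule: dec_induct)
  case (step k)
  have "K \<inter> {Suc a..<k} = K' \<inter> {Suc a..<k}" using step.prems step.hyps by fastforce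
  moreover have "k \<in> K \<longleftrightarrow> k \<in> K'" using step.prems step.hyps by fastforce
  ultimately show ?case unfolding D_step[OF step.hyps(1)] by (simp only: step.IH)
qed (simp only: D_base)

lemma D_wcommuting:
  assumes "Suc a \<le> k" shows "wcommuting n q (D K k)"
  using assms
proof (induction k rule: dec_induct)
  case (step k)
  have 1: "wcommuting n q (\<lambda>v. D K k (f k v))"
    by (rule wcommuting_compose[of n q "D K k" "f k", OF step.IH wcommuting_lowering])
  have 2: "wcommuting n q (\<lambda>v. f k (D K k v))"
    by (rule wcommuting_compose[of n q "f k" "D K k", OF wcommuting_lowering step.IH])
  show ?case using 1 wcommuting_diff[OF 2 1] by (simp add: D_step[OF step.hyps(1)])
qed (simp add: D_base wcommuting_lowering)

inductive commutator_span :: "nat \<Rightarrow> ('f hecke \<Rightarrow> 'f hecke) \<Rightarrow> bool" for k where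
  base: "K \<subseteq> {Suc a..<k} \<Longrightarrow> commutator_span k (D K k)"
| add: "commutator_span k L \<Longrightarrow> commutator_span k M \<Longrightarrow> commutator_span k (\<lambda>v. L v + M v)"
| scale: "commutator_span k L \<Longrightarrow> commutator_span k (\<lambda>v. hscale c (L v))"

lemma commutator_span_right:
  assumes "commutator_span k L" "Suc a \<le> k" shows "commutator_span (Suc k) (\<lambda>v. L (f k v))"
  using assms
proof (induction rule: commutator_span.induct)
  case (base K)
  have "D (insert k K) (Suc k) = (\<lambda>v. D K k (f k v))"
    using D_cong[of k "insert k K" K] base by (simp add: D_step)
  moreover have "commutator_span (Suc k) (D (insert k K) (Suc k))" by (rule commutator_span.base) (use base in auto)
  ultimately show ?case by simp
next
  case (add L M)
  then show ?case by (intro commutator_span.add[of _ "\<lambda>v. L (f k v)" "\<lambda>v. M (f k v)"]) auto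
next
  case (scale L c)
  then show ?case by (intro commutator_span.scale[of _ "\<lambda>v. L (f k v)"]) auto
qed

lemma commutator_span_left:
  assumes "commutator_span k L" "Suc a \<le> k" shows "commutator_span (Suc k) (\<lambda>v. f k (L v))"
  using assms
proof (induction rule: commutator_span.induct)
  case (base K)
  have "k \<notin> K" using base by auto
  then have eq: "(\<lambda>v. D K (Suc k) v + D K k (f k v)) = (\<lambda>v. f k (D K k v))"
    using base by (auto simp: D_step)
  have "commutator_span (Suc k) (D K (Suc k))" by (rule commutator_span.base) (use base in auto)
  moreover have "commutator_span (Suc k) (\<lambda>v. D K k (f k v))" by (rule commutator_span_right[OF commutator_span.base]) (use base in auto)
  ultimately show ?case unfolding eq[symmetric] by (rule commutator_span.add)
next
  case (add L M)
  then show ?case unfolding hlinearD(1)[OF hlinear_lowering]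
    by (intro commutator_span.add[of _ "\<lambda>v. f k (L v)" "\<lambda>v. f k (M v)"]) auto
next
  case (scale L c)
  then show ?case unfolding hlinearD(2)[OF hlinear_lowering]
    by (intro commutator_span.scale[of _ "\<lambda>v. f k (L v)"]) auto
qed

text \<open>
  The span is closed under \<open>L \<mapsto> L f\<^sub>k\<close> and \<open>L \<mapsto> f\<^sub>k L\<close> by the definition of the commutators.
\<close>

lemma chain_commutator_span:
  assumes "Suc a \<le> k" shows "commutator_span k (P k) \<and> commutator_span k (A k)"
  using assms
proof (induction k rule: dec_induct)
  case base
  have "commutator_span (Suc a) (D {} (Suc a))" by (rule commutator_span.base) simp
  then show ?case by (simp add: P_base A_base D_base)
next
  case (step k)
  have "commutator_span k (Y (Suc k))" using step.IH by (simp add: chain_step(3)[OF step.hyps(1)])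
  then have Y: "commutator_span (Suc k) (\<lambda>v. f k (Y (Suc k) v))" using step.hyps(1) by (rule commutator_span_left)
  have "commutator_span (Suc k) (\<lambda>v. P k (f k v))" using step.IH step.hyps(1) by (intro commutator_span_right) auto
  then have "commutator_span (Suc k) (\<lambda>v. hscale (- q * (if flat k then 1 else qnum q (axial k - 1))) (P k (f k v))
      + hscale (qnum q (axial k)) (f k (Y (Suc k) v)))"
    using Y by (intro commutator_span.add[of _ "\<lambda>v. hscale _ (P k (f k v))" "\<lambda>v. hscale _ (f k (Y (Suc k) v))"] commutator_span.scale) 
  moreover have "P (Suc k) = (\<lambda>v. hscale (- q * (if flat k then 1 else qnum q (axial k - 1))) (P k (f k v))
      + hscale (qnum q (axial k)) (f k (Y (Suc k) v)))"
    using chain_step(1)[OF step.hyps(1)] by blast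
  moreover have "A (Suc k) = (\<lambda>v. f k (Y (Suc k) v))" using chain_step(2)[OF step.hyps(1)] by blast
  ultimately show ?case using Y by simp
qed

lemma commutator_span_wcommuting: "commutator_span k L \<Longrightarrow> Suc a \<le> k \<Longrightarrow> wcommuting n q L"
  by (induction rule: commutator_span.induct) (auto intro: D_wcommuting wcommuting_add wcommuting_scale)

lemma D_supported:
  assumes "Suc a \<le> k" "1 \<le> a" "supported (words n nu) v"
  shows "supported (words n (nu(a := nu a - 1, k := nu k + 1))) (D K k v)"
  using assms
proof (induction k arbitrary: v nu rule: dec_induct)
  case base
  then have "0 < a" by simp
  show ?case unfolding D_base by (rule supported_lowering[OF base(2) \<open>0 < a\<close>])
next
  case (step k)
  let ?nu = "nu(a := nu a - 1, Suc k := nu (Suc k) + 1)"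
  have ak: "k \<noteq> a" "Suc k \<noteq> a" "1 \<le> k" using step by auto
  have R: "supported (words n ?nu) (D K k (f k v))"
  proof (cases "nu k = 0")
    case True
    have "f k v = 0"
    proof
      fix g show "f k v g = 0 g"
      proof (rule ccontr)
        assume "f k v g \<noteq> 0 g"
        then have "f k v g \<noteq> 0" by (simp add: fapply)
        then obtain h where h: "moved n (Suc k) k 1 g h" "v h \<noteq> 0" by (rule lowering_nonzero)
        have "cnt n h k = 0" using step.prems(2) h(2) True by (auto simp: supported_def words_D(2))
        then show False using moved_cnt(2)[OF h(1), of n] by simp
      qed
    qed
    then show ?thesis
      using hlinearD(3)[OF wcommuting_hlinear[OF D_wcommuting[OF step.hyps(1)]]] by (simp add: supported_0)
  next
    case False
    have "supported (words n (nu(k := nu k - 1, Suc k := nu (Suc k) + 1))) (f k v)"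
      using ak by (intro supported_lowering step.prems) simp
    note IH = step.IH[OF step.prems(1) this]
    have "(nu(k := nu k - 1, Suc k := nu (Suc k) + 1))
        (a := (nu(k := nu k - 1, Suc k := nu (Suc k) + 1)) a - 1,
         k := (nu(k := nu k - 1, Suc k := nu (Suc k) + 1)) k + 1) = ?nu"
      using False ak by (auto simp: fun_eq_iff)
    then show ?thesis using IH by (simp only:)
  qed
  have "supported (words n ((nu(a := nu a - 1, k := nu k + 1))(k := (nu(a := nu a - 1, k := nu k + 1)) k - 1,
      Suc k := (nu(a := nu a - 1, k := nu k + 1)) (Suc k) + 1))) (f k (D K k v))"
    using ak by (intro supported_lowering step.IH step.prems) simp
  moreover have "(nu(a := nu a - 1, k := nu k + 1))(k := (nu(a := nu a - 1, k := nu k + 1)) k - 1,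
      Suc k := (nu(a := nu a - 1, k := nu k + 1)) (Suc k) + 1) = ?nu"
    using ak by (auto simp: fun_eq_iff)
  ultimately have Lf: "supported (words n ?nu) (f k (D K k v))" by (simp only:)
  have "supported (words n ?nu) (f k (D K k v) - D K k (f k v))"
    using supported_add[OF Lf supported_hscale[OF R, of "- 1"]]
    by (simp add: hscale_def fun_diff_def plus_fun_def)
  then show ?case using R unfolding D_step[OF step.hyps(1)]
    by (cases "k \<in> K") (simp_all only: if_True if_False not_False_eq_True)
qed

lemma commutator_span_supported:
  "commutator_span k L \<Longrightarrow> Suc a \<le> k \<Longrightarrow> 1 \<le> a \<Longrightarrow> supported (words n nu) v \<Longrightarrow>
    supported (words n (nu(a := nu a - 1, k := nu k + 1))) (L v)"
  by (induction rule: commutator_span.induct) (auto intro: D_supported supported_add supported_hscale)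

text \<open>
  Since \<open>f\<^sub>l v = 0\<close>, the operator \<open>D K (l + 1)\<close>, which applies \<open>f\<^sub>l\<close> first, annihilates \<open>v\<close>.  So only one term
  of the next commutator remains, and it is the product in which \<open>l + 1\<close> starts a new factor.  The
  later \<open>f\<^sub>k\<close> commute with \<open>f\<^sub>l\<close>.
\<close>

lemma D_flip:
  assumes "l \<in> K" "Suc l \<notin> K" "Suc a \<le> l" "Suc (Suc l) \<le> k" "f l v = 0"
  shows "D K k v = - D (insert (Suc l) K) k v"
  using assms(4,5)
proof (induction k arbitrary: v rule: dec_induct)
  case base
  let ?K = "insert (Suc l) K"
  have al: "Suc a \<le> l" "Suc a \<le> Suc l" using assms(3) by auto
  have lin: "hlinear (D K j)" if "Suc a \<le> j" for j using wcommuting_hlinear[OF D_wcommuting[OF that]] .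
  have "D K (Suc l) v = 0"
    using assms(1) base hlinearD(3)[OF lin[OF al(1)]] by (simp add: D_step[OF al(1)])
  moreover have "D ?K (Suc l) = D K (Suc l)" by (rule D_cong) (use al in auto)
  ultimately show ?case
    using assms(2) by (simp add: D_step[OF al(2)] hlinearD(3)[OF hlinear_lowering])
next
  case (step k)
  have ak: "Suc a \<le> k" using step.hyps assms(3) by simp
  have "f l (f k v) = f k (f l v)" using step.hyps by (intro lowering_commute') simp
  then have "f l (f k v) = 0" using step.prems by (simp add: hlinearD(3)[OF hlinear_lowering])
  note 1 = step.IH[OF this] and 2 = step.IH[OF step.prems]
  have "k \<in> insert (Suc l) K \<longleftrightarrow> k \<in> K" using step.hyps by auto
  note lin = hlinearD(5)[OF hlinear_lowering]
  show ?case
  proof (cases "k \<in> K")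
    case True
    then show ?thesis by (simp only: D_step[OF ak] 1 \<open>k \<in> insert (Suc l) K \<longleftrightarrow> k \<in> K\<close> if_True)
  next
    case False
    then show ?thesis
      by (simp only: D_step[OF ak] 1 2 lin \<open>k \<in> insert (Suc l) K \<longleftrightarrow> k \<in> K\<close> if_False minus_diff_minus)
  qed
qed

end

text \<open>
  At the first letter \<open>i + 1\<close> the power of \<open>q\<close> is one.
\<close>

lemma lowering_single:
  assumes "p0 \<in> {1..k}" "g p0 = Suc i" "\<And>p. p \<in> {1..k} \<Longrightarrow> g p = Suc i \<Longrightarrow> p \<noteq> p0 \<Longrightarrow> \<phi> (g(p := i)) = 0"
    and "\<And>p. 1 \<le> p \<Longrightarrow> p < p0 \<Longrightarrow> g p \<noteq> Suc i"
  shows "lowering k q i \<phi> g = \<phi> (g(p0 := i))"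
proof -
  have "{p \<in> {1..p0 - 1}. g p = Suc i} = {}" using assms(4) by auto
  then have c: "cnt (p0 - 1) g (Suc i) = 0" unfolding cnt_def by (simp only: card.empty)
  have "lowering k q i \<phi> g = (\<Sum>p | p \<in> {1..k} \<and> g p = Suc i. if p = p0 then \<phi> (g(p0 := i)) else 0)"
    unfolding lowering_sum by (rule sum.cong) (use assms(3) c in auto)
  also have "\<dots> = \<phi> (g(p0 := i))" using assms(1,2) by (subst sum.delta) auto
  finally show ?thesis .
qed

lemma lowering_zero:
  assumes "\<And>p. p \<in> {1..k} \<Longrightarrow> g p = Suc i \<Longrightarrow> \<phi> (g(p := i)) = 0"
  shows "lowering k q i \<phi> g = 0"
  unfolding lowering_sum by (rule sum.neutral) (use assms in auto)

context carter_payne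
begin

abbreviation "row \<equiv> row_word n lam"

text \<open>
  In the places of row \<open>i\<close> of \<open>t\<^sup>\<lambda>\<close>, the word \<open>w\<close> has one letter \<open>x\<close> and otherwise letters \<open>i\<close>; for \<open>x = i\<close> this
  says that the row is unchanged.
\<close>

definition one_off :: "nat \<Rightarrow> nat \<Rightarrow> (nat \<Rightarrow> nat) \<Rightarrow> bool" where
  "one_off i x w \<longleftrightarrow> (\<exists>p\<in>{1..n}. row p = i \<and> w p = x \<and> (\<forall>p'\<in>{1..n}. row p' = i \<longrightarrow> p' \<noteq> p \<longrightarrow> w p' = i))"

text \<open>
  Row \<open>i\<close> loses a letter if \<open>i\<close> is \<open>a\<close> or in \<open>K\<close>: the factor of \<open>D K k\<close> that starts with \<open>f\<^sub>i\<close> turns one letter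
  \<open>i\<close> into the number with which the next factor starts, or into \<open>k\<close> if it is the last factor.
\<close>

definition successor :: "nat set \<Rightarrow> nat \<Rightarrow> nat \<Rightarrow> nat" where
  "successor K k i = (if i \<in> insert a K \<and> i < k then LEAST j. i < j \<and> (j \<in> K \<or> k \<le> j) else i)"

text \<open>
  The words that \<open>D K k\<close> produces, as far as the rows before \<open>k\<close> are concerned.
\<close>

definition chain_word :: "nat set \<Rightarrow> nat \<Rightarrow> (nat \<Rightarrow> nat) \<Rightarrow> bool" where
  "chain_word K k w \<longleftrightarrow> (\<forall>p. p \<notin> {1..n} \<longrightarrow> w p = 0) \<and> (\<forall>i. 1 \<le> i \<longrightarrow> i < k \<longrightarrow> one_off i (successor K k i) w)"

definition restore :: "nat \<Rightarrow> (nat \<Rightarrow> nat) \<Rightarrow> nat \<Rightarrow> nat" where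
  "restore k w p = (if row p < k then row p else w p)"

text \<open>
  The vectors to which \<open>D K k\<close> is applied: in the supporting words, the rows before \<open>k\<close> are those of
  \<open>t\<^sup>\<lambda>\<close>, and later rows have no letters below \<open>k\<close>.
\<close>

definition row_fixed :: "nat \<Rightarrow> 'f hecke \<Rightarrow> bool" where
  "row_fixed k \<Phi> \<longleftrightarrow> (\<forall>w. \<Phi> w \<noteq> 0 \<longrightarrow> (\<forall>p. (row p < k \<longrightarrow> w p = row p) \<and> (k \<le> row p \<longrightarrow> k \<le> w p)))"

lemma row_fixedD:
  assumes "row_fixed k \<Phi>" "\<Phi> w \<noteq> 0"
  shows "row p < k \<Longrightarrow> w p = row p" "k \<le> row p \<Longrightarrow> k \<le> w p"
  using assms by (auto simp: row_fixed_def)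

lemma row_fixed_Suc: "row_fixed (Suc k) \<Phi> \<Longrightarrow> row_fixed k \<Phi>"
  unfolding row_fixed_def by (metis Suc_leI le_neq_implies_less less_SucI order_refl Suc_leD)

lemma row_out: "p \<notin> {1..n} \<Longrightarrow> row p = 0"
  using row_word_pos[OF lam_comp] by simp

lemma row_in: "p \<in> {1..n} \<Longrightarrow> 1 \<le> row p"
  using row_word_pos[OF lam_comp, of p] by simp

lemma row_pos_in: "1 \<le> row p \<Longrightarrow> p \<in> {1..n}"
  using row_out[of p] by force

lemma successor_props:
  assumes K: "K \<subseteq> {Suc a..<b}" and i: "i \<in> insert a K" "i < k"
  shows "i < successor K k i" "successor K k i \<le> k"
    "successor K k i = k \<longleftrightarrow> (\<forall>j\<in>K. i < j \<longrightarrow> k \<le> j)"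
    "\<And>j. j \<in> K \<Longrightarrow> i < j \<Longrightarrow> successor K k i \<le> j"
    "successor K k i \<in> K \<or> successor K k i = k"
proof -
  let ?Q = "\<lambda>j. i < j \<and> (j \<in> K \<or> k \<le> j)"
  have s: "successor K k i = (LEAST j. ?Q j)" using i by (simp add: successor_def)
  have ex: "?Q k" using i by simp
  have Q: "?Q (successor K k i)" unfolding s by (rule LeastI[of ?Q, OF ex])
  show "i < successor K k i" using Q by blast
  show le: "successor K k i \<le> k" unfolding s by (rule Least_le[of ?Q, OF ex])
  show lej: "successor K k i \<le> j" if "j \<in> K" "i < j" for j
    unfolding s by (rule Least_le[of ?Q]) (use that in simp)
  show "successor K k i = k \<longleftrightarrow> (\<forall>j\<in>K. i < j \<longrightarrow> k \<le> j)"
    using lej Q le by (metis le_antisym)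
  show "successor K k i \<in> K \<or> successor K k i = k" using Q le by auto
qed

lemma successor_le: "K \<subseteq> {Suc a..<b} \<Longrightarrow> i \<le> k \<Longrightarrow> successor K k i \<le> k"
  using successor_props(2)[of K i k] by (cases "i \<in> insert a K \<and> i < k") (auto simp: successor_def)

lemma successor_Suc:
  assumes K: "K \<subseteq> {Suc a..<b}" and i: "i < k"
  shows "successor K (Suc k) i = (if k \<notin> K \<and> successor K k i = k then Suc k else successor K k i)"
proof (cases "i \<in> insert a K")
  case True
  have 1: "i < Suc k" using i by simp
  note S = successor_props[OF K True i] and S' = successor_props[OF K True 1]
  show ?thesis
  proof (cases "k \<notin> K \<and> successor K k i = k")
    case T: True
    then have "\<forall>j\<in>K. i < j \<longrightarrow> Suc k \<le> j" using S(3) by (metis Suc_leI le_neq_implies_less)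
    then show ?thesis using S'(3) T by simp
  next
    case False
    have sK: "successor K k i \<in> K" using False S(5) by auto
    then have "successor K (Suc k) i \<le> successor K k i" using S'(4) S(1) by blast
    moreover have "successor K k i \<le> successor K (Suc k) i"
      using S'(5) S(2,4) S'(1) by (metis le_SucI)
    ultimately show ?thesis using False by auto
  qed
next
  case False
  then show ?thesis using i by (auto simp: successor_def)
qed

lemma successor_self: "Suc a \<le> k \<Longrightarrow> successor K (Suc k) k = (if k \<in> K then Suc k else k)"
  unfolding successor_def by (auto intro: Least_equality)

lemma ex_last:
  assumes K: "K \<subseteq> {Suc a..<b}" and k: "Suc a \<le> k"
  obtains i where "a \<le> i" "i < k" "i \<in> insert a K" "successor K k i = k"
    "\<And>i'. i' < k \<Longrightarrow> successor K k i' = k \<Longrightarrow> i' = i"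
proof -
  define S where "S = {i \<in> insert a K. i < k}"
  have fin: "finite S" by (rule finite_subset[of _ "{..<k}"]) (auto simp: S_def)
  have ne: "S \<noteq> {}" using k by (auto simp: S_def)
  define i where "i = Max S"
  have i: "i \<in> S" using Max_in[OF fin ne] by (simp add: i_def)
  have max: "j \<le> i" if "j \<in> S" for j using Max_ge[OF fin that] by (simp add: i_def)
  have i': "i \<in> insert a K" "i < k" using i by (auto simp: S_def)
  have "\<forall>j\<in>K. i < j \<longrightarrow> k \<le> j" using max by (force simp: S_def)
  then have "successor K k i = k" using successor_props(3)[OF K i'] by blast
  moreover have "i' = i" if "i' < k" "successor K k i' = k" for i'
  proof -
    have m: "i' \<in> insert a K" using that by (auto simp: successor_def split: if_splits)
    then have "i' \<le> i" using max that by (simp add: S_def)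
    moreover have "\<not> i' < i"
    proof
      assume "i' < i"
      then have "i \<in> K" using i' m K by auto
      then show False using successor_props(3)[OF K m that(1)] that(2) \<open>i' < i\<close> i'(2) by auto
    qed
    ultimately show ?thesis by simp
  qed
  moreover have "a \<le> i" using i' K by auto
  ultimately show ?thesis using that i' by blast
qed

lemma lowering_row_fixed:
  assumes \<Phi>: "row_fixed (Suc k) \<Phi>" and k: "1 \<le> k"
  shows "f k \<Phi> w = (if (\<forall>p. row p < k \<longrightarrow> w p = row p) \<and> one_off k (Suc k) w then \<Phi> (restore (Suc k) w) else 0)"
proof (cases "(\<forall>p. row p < k \<longrightarrow> w p = row p) \<and> one_off k (Suc k) w")
  case True
  then obtain p0 where p0: "p0 \<in> {1..n}" "row p0 = k" "w p0 = Suc k"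
    "\<And>p'. p' \<in> {1..n} \<Longrightarrow> row p' = k \<Longrightarrow> p' \<noteq> p0 \<Longrightarrow> w p' = k" by (auto simp: one_off_def)
  have low: "w p = row p" if "row p < Suc k" "p \<noteq> p0" for p
    using that True p0(4)[of p] k row_pos_in[of p] by (cases "row p = k") auto
  have "f k \<Phi> w = \<Phi> (w(p0 := k))"
  proof (rule lowering_single[where \<phi>=\<Phi> and g=w and ?p0.0=p0 and k=n and i=k and q=q, OF p0(1,3)])
    fix p assume p: "p \<in> {1..n}" "w p = Suc k" "p \<noteq> p0"
    have "Suc k \<le> row p" using low[of p] p by force
    then show "\<Phi> (w(p := k)) = 0" using row_fixedD(2)[where \<Phi>=\<Phi> and w="w(p := k)" and p=p, OF \<Phi>] by fastforce
  next
    fix p assume p: "1 \<le> p" "p < p0"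
    then have "row p \<le> k" using row_word_mono[OF lam_comp, of p p0] p0(1,2) by simp
    then show "w p \<noteq> Suc k" using low[of p] p by simp
  qed
  moreover have "w(p0 := k) = restore (Suc k) w"
    using low p0(2) by (auto simp: restore_def fun_eq_iff)
  ultimately show ?thesis using True by simp
next
  case False
  have "f k \<Phi> w = 0"
  proof (rule lowering_zero, rule ccontr)
    fix p assume p: "p \<in> {1..n}" "w p = Suc k" and nz: "\<Phi> (w(p := k)) \<noteq> 0"
    note F = row_fixedD[where \<Phi>=\<Phi> and w="w(p := k)", OF \<Phi> nz]
    have rp: "row p = k"
    proof -
      have "\<not> Suc k \<le> row p" using F(2)[of p] by auto
      then have "(w(p := k)) p = row p" by (intro F(1)) simp
      then show ?thesis by (simp only: fun_upd_same)
    qed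
    have other: "w p' = row p'" if "row p' < Suc k" "p' \<noteq> p" for p' using F(1)[of p'] that by simp
    have "w p' = row p'" if "row p' < k" for p' using other[of p'] that rp by (cases "p' = p") simp_all
    moreover have "w p' = k" if "row p' = k" "p' \<noteq> p" for p' using other[of p'] that by simp
    ultimately have "(\<forall>p. row p < k \<longrightarrow> w p = row p) \<and> one_off k (Suc k) w"
      unfolding one_off_def using p rp by blast
    then show False using False by blast
  qed
  with False show ?thesis by (simp only: if_False)
qed

lemma row_fixed_lowering:
  assumes "row_fixed (Suc k) \<Phi>" "1 \<le> k" shows "row_fixed k (f k \<Phi>)"
  unfolding row_fixed_def
proof (intro allI impI)
  fix w p assume nz: "f k \<Phi> w \<noteq> 0"
  then have c: "\<forall>p. row p < k \<longrightarrow> w p = row p" "one_off k (Suc k) w" "\<Phi> (restore (Suc k) w) \<noteq> 0"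
    unfolding lowering_row_fixed[OF assms] by (auto split: if_splits)
  have "k \<le> w p" if "k \<le> row p"
  proof (cases "row p = k")
    case True
    then have "w p = k \<or> w p = Suc k"
      using c(2) row_pos_in[of p] assms(2) unfolding one_off_def by metis
    then show ?thesis by auto
  next
    case False
    then show ?thesis using row_fixedD(2)[where \<Phi>=\<Phi> and w="restore (Suc k) w" and p=p, OF assms(1) c(3)] that by (simp add: restore_def)
  qed
  then show "(row p < k \<longrightarrow> w p = row p) \<and> (k \<le> row p \<longrightarrow> k \<le> w p)" using c(1) by blast
qed

lemma one_off_cong:
  assumes "\<And>p. p \<in> {1..n} \<Longrightarrow> row p = i \<Longrightarrow> w p = w' p" shows "one_off i x w \<longleftrightarrow> one_off i x w'"
  unfolding one_off_def using assms by (metis (no_types, lifting))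

lemma one_off_letter:
  assumes "one_off i x w" "p \<in> {1..n}" "row p = i" shows "w p = x \<or> w p = i"
  using assms unfolding one_off_def by metis

lemma one_off_self: "one_off i i w \<Longrightarrow> p \<in> {1..n} \<Longrightarrow> row p = i \<Longrightarrow> w p = i"
  using one_off_letter by blast

lemma row_nonempty:
  assumes "1 \<le> i" "i < b" obtains p where "p \<in> {1..n}" "row p = i"
proof -
  have "1 \<le> lam i"
  proof (cases "a \<le> i")
    case False
    then have "lam a \<le> lam i" using partition_mono[OF part assms(1), of a] by simp
    then show ?thesis using pos[of a] ab by simp
  qed (use pos assms in simp)
  then have "(i, 1) \<in> diagram lam" using assms by (simp add: diagram_def)
  then show ?thesis using that row_tab_in_range[OF lam_comp] by blast
qed

text \<open>
  By induction on \<open>k\<close>.  For \<open>k\<close> not in \<open>K\<close>, the term \<open>f\<^sub>k (D K k)\<close> lives on two kinds of words: a letter \<open>k + 1\<close>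
  may stand in the row \<open>i\<close> with \<open>successor K k i = k\<close>, or in row \<open>k\<close> itself.  The words of the second
  kind form the term \<open>D K k (f\<^sub>k)\<close>, so the commutator consists of the words of the first kind.  All powers
  of \<open>q\<close> are trivial because \<open>t\<^sup>\<lambda>\<close> is read by rows.
\<close>

lemma D_formula:
  assumes "Suc a \<le> k" "k \<le> b" and K: "K \<subseteq> {Suc a..<b}" and "row_fixed k \<Phi>"
  shows "D K k \<Phi> w = (if chain_word K k w then \<Phi> (restore k w) else 0)"
  using assms(1,2,4)
proof (induction k arbitrary: \<Phi> w rule: dec_induct)
  case base
  have s: "successor K (Suc a) i = (if i = a then Suc a else i)" if "i < Suc a" for i
  proof (cases "i = a")
    case True
    have "(LEAST j. a < j \<and> (j \<in> K \<or> Suc a \<le> j)) = Suc a" by (rule Least_equality) auto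
    then show ?thesis using True by (simp add: successor_def)
  next
    case False
    then have "i \<notin> insert a K" using that K by auto
    then show ?thesis using False by (simp add: successor_def)
  qed
  have "chain_word K (Suc a) w \<longleftrightarrow> (\<forall>p. row p < a \<longrightarrow> w p = row p) \<and> one_off a (Suc a) w"
  proof
    assume c: "chain_word K (Suc a) w"
    have "one_off a (Suc a) w" using c a1 s[of a] by (auto simp: chain_word_def)
    moreover have "w p = row p" if p: "row p < a" for p
    proof (cases "p \<in> {1..n}")
      case True
      then have "one_off (row p) (successor K (Suc a) (row p)) w"
        using c p row_in by (simp add: chain_word_def)
      then show ?thesis using s[of "row p"] p one_off_self[OF _ True] by simp
    qed (use c row_out in \<open>simp add: chain_word_def\<close>)
    ultimately show "(\<forall>p. row p < a \<longrightarrow> w p = row p) \<and> one_off a (Suc a) w" by blast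
  next
    assume c: "(\<forall>p. row p < a \<longrightarrow> w p = row p) \<and> one_off a (Suc a) w"
    have "one_off i (successor K (Suc a) i) w" if i: "1 \<le> i" "i < Suc a" for i
    proof (cases "i = a")
      case False
      have ib: "i < b" using i ab by simp
      from row_nonempty[OF i(1) ib] obtain p where "p \<in> {1..n}" "row p = i" .
      then show ?thesis using c i False s[of i] unfolding one_off_def by auto
    qed (use c s[of a] in simp)
    moreover have "w p = 0" if "p \<notin> {1..n}" for p using c row_out[OF that] a1 by force
    ultimately show "chain_word K (Suc a) w" by (simp add: chain_word_def)
  qed
  then show ?case unfolding D_base using lowering_row_fixed[OF base(2) a1] by simp
next
  case (step k)
  have kb: "Suc a \<le> k" "k < b" "1 \<le> k" "k \<le> b" using step a1 by auto
  note \<Phi> = step.prems(2)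
  have \<Phi>k: "row_fixed k \<Phi>" by (rule row_fixed_Suc[OF \<Phi>])
  have rsrs: "restore (Suc k) (restore k w) = restore (Suc k) w" for w
    by (auto simp: restore_def fun_eq_iff)
  have restore_same: "row p < k \<Longrightarrow> restore k w p = row p" for w p by (simp add: restore_def)
  have Df: "D K k (f k \<Phi>) w = (if chain_word K k w \<and> one_off k (Suc k) w then \<Phi> (restore (Suc k) w) else 0)" for w
  proof -
    have "one_off k (Suc k) (restore k w) \<longleftrightarrow> one_off k (Suc k) w"
      by (rule one_off_cong) (simp add: restore_def)
    then show ?thesis
      unfolding step.IH[OF kb(4) row_fixed_lowering[OF \<Phi> kb(3)]] lowering_row_fixed[OF \<Phi> kb(3)] rsrs
      by (simp add: restore_same)
  qed
  show ?case
  proof (cases "k \<in> K")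
    case True
    have "successor K (Suc k) i = successor K k i" if "i < k" for i using successor_Suc[OF K that] True by simp
    moreover have "successor K (Suc k) k = Suc k" using successor_self[OF kb(1)] True by simp
    ultimately have "chain_word K (Suc k) w \<longleftrightarrow> chain_word K k w \<and> one_off k (Suc k) w"
      using kb(3) by (auto simp: chain_word_def less_Suc_eq)
    then show ?thesis using True by (simp add: D_step[OF kb(1)] Df)
  next
    case kK: False
    obtain i0 where i0: "a \<le> i0" "i0 < k" "successor K k i0 = k"
      and i0_uniq: "\<And>i'. i' < k \<Longrightarrow> successor K k i' = k \<Longrightarrow> i' = i0"
      by (rule ex_last[OF K kb(1)]) blast
    have sk: "successor K (Suc k) k = k" using successor_self[OF kb(1)] kK by simp
    have si: "successor K (Suc k) i = (if i = i0 then Suc k else successor K k i)" if "i < k" for i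
    proof (cases "i = i0")
      case True
      then show ?thesis unfolding successor_Suc[OF K that] using kK i0(3) by simp
    next
      case False
      then have "successor K k i \<noteq> k" using i0_uniq[OF that] by blast
      then show ?thesis unfolding successor_Suc[OF K that] using False by simp
    qed
    \<comment> \<open>Q p: turning the letter k + 1 at p into k leads to a word on which D K k is non-zero.\<close>
    define Q where "Q p \<longleftrightarrow> p \<in> {1..n} \<and> w p = Suc k \<and> row p \<le> k \<and> chain_word K k (w(p := k)) \<and>
      (\<forall>p'\<in>{1..n}. row p' = k \<longrightarrow> p' \<noteq> p \<longrightarrow> w p' = k)" for p
    have letters: "w' p \<le> k" if "chain_word K k w'" "p \<in> {1..n}" "row p < k" for w' p
    proof -
      have "one_off (row p) (successor K k (row p)) w'" using that row_in by (simp add: chain_word_def)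
      from one_off_letter[OF this that(2)] have "w' p = successor K k (row p) \<or> w' p = row p" by simp
      then show ?thesis using successor_le[OF K, of "row p" k] that(3) by auto
    qed
    have small: "w p' \<le> k" if "Q p" "p' \<in> {1..n}" "row p' \<le> k" "p' \<noteq> p" for p p'
    proof (cases "row p' = k")
      case False
      then show ?thesis using letters[of "w(p := k)" p'] that by (auto simp: Q_def)
    qed (use that in \<open>auto simp: Q_def\<close>)
    have restore_Q: "restore k (w(p := k)) = restore (Suc k) w" if "Q p" for p
    proof
      fix p' show "restore k (w(p := k)) p' = restore (Suc k) w p'"
      proof (cases "row p' = k")
        case True
        then have "p' \<in> {1..n}" using kb row_pos_in by simp
        then have "(w(p := k)) p' = k" using that True by (auto simp: Q_def)
        then show ?thesis using True by (simp add: restore_def)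
      next
        case False
        then show ?thesis using that by (auto simp: restore_def Q_def)
      qed
    qed
    have summand: "D K k \<Phi> (w(p := k)) = (if Q p then \<Phi> (restore (Suc k) w) else 0)"
      if p: "p \<in> {1..n}" "w p = Suc k" for p
    proof (cases "Q p")
      case True
      then show ?thesis unfolding step.IH[OF kb(4) \<Phi>k] restore_Q[OF True] by (simp add: Q_def)
    next
      case False
      have "D K k \<Phi> (w(p := k)) = 0"
      proof (rule ccontr)
        assume "D K k \<Phi> (w(p := k)) \<noteq> 0"
        then have c: "chain_word K k (w(p := k))" "\<Phi> (restore k (w(p := k))) \<noteq> 0"
          unfolding step.IH[OF kb(4) \<Phi>k] by (auto split: if_splits)
        have "\<not> Suc k \<le> row p" using row_fixedD(2)[where \<Phi>=\<Phi> and w="restore k (w(p := k))" and p=p, OF \<Phi> c(2)] by (auto simp: restore_def)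
        moreover have "w p' = k" if "p' \<in> {1..n}" "row p' = k" "p' \<noteq> p" for p'
          using row_fixedD(1)[where \<Phi>=\<Phi> and w="restore k (w(p := k))" and p=p', OF \<Phi> c(2)] that by (auto simp: restore_def)
        ultimately have "Q p" using p c(1) by (auto simp: Q_def)
        then show False using False by blast
      qed
      then show ?thesis using False by simp
    qed
    have fD: "f k (D K k \<Phi>) w = (if \<exists>p. Q p then \<Phi> (restore (Suc k) w) else 0)"
    proof (cases "\<exists>p. Q p")
      case True
      then obtain p0 where p0: "Q p0" by blast
      then have p0': "p0 \<in> {1..n}" "w p0 = Suc k" "row p0 \<le> k" by (auto simp: Q_def)
      have "f k (D K k \<Phi>) w = D K k \<Phi> (w(p0 := k))"
      proof (rule lowering_single[where \<phi>="D K k \<Phi>" and g=w and ?p0.0=p0 and k=n and i=k and q=q, OF p0'(1,2)])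
        fix p assume p: "p \<in> {1..n}" "w p = Suc k" "p \<noteq> p0"
        have "\<not> Q p" using small[OF p0 p(1) _ p(3)] p(2) by (auto simp: Q_def)
        then show "D K k \<Phi> (w(p := k)) = 0" using summand[OF p(1,2)] by simp
      next
        fix p assume p: "1 \<le> p" "p < p0"
        then have pn: "p \<in> {1..n}" using p0'(1) by simp
        have "row p \<le> k" using row_word_mono[OF lam_comp _ pn p0'(1)] p p0'(3) by simp
        then show "w p \<noteq> Suc k" using small[OF p0 pn] p by force
      qed
      then show ?thesis using summand[OF p0'(1,2)] p0 True by auto
    next
      case False
      have "f k (D K k \<Phi>) w = 0" by (rule lowering_zero) (use summand False in auto)
      then show ?thesis using False by simp
    qed
    have block_eq: "one_off i x w \<longleftrightarrow> one_off i x (w(p := k))" if "row p \<noteq> i" for i x p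
      by (rule one_off_cong) (use that in auto)
    have Q_iff: "(\<exists>p. Q p) \<longleftrightarrow> chain_word K (Suc k) w \<or> (chain_word K k w \<and> one_off k (Suc k) w)"
    proof
      assume "\<exists>p. Q p"
      then obtain p where Q: "Q p" by blast
      then have pw: "p \<in> {1..n}" "w p = Suc k" "row p \<le> k" and c: "chain_word K k (w(p := k))"
        and kk: "\<And>p'. p' \<in> {1..n} \<Longrightarrow> row p' = k \<Longrightarrow> p' \<noteq> p \<Longrightarrow> w p' = k" by (auto simp: Q_def)
      have out: "w p' = 0" if "p' \<notin> {1..n}" for p'
        using c that pw(1) unfolding chain_word_def by (metis fun_upd_other)
      show "chain_word K (Suc k) w \<or> (chain_word K k w \<and> one_off k (Suc k) w)"
      proof (cases "row p = k")
        case True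
        have "one_off k (Suc k) w" unfolding one_off_def using pw True kk by blast
        moreover have "chain_word K k w"
          unfolding chain_word_def using out c block_eq[of p] True by (auto simp: chain_word_def)
        ultimately show ?thesis by blast
      next
        case False
        then have rp: "row p < k" "1 \<le> row p" using pw(3) row_in[OF pw(1)] by auto
        have o: "one_off (row p) (successor K k (row p)) (w(p := k))" using c rp by (simp add: chain_word_def)
        have "successor K k (row p) = k"
          using one_off_letter[OF o pw(1)] rp by simp
        then have ri: "row p = i0" using i0_uniq rp by blast
        have oo: "one_off (row p) (Suc k) w"
        proof -
          obtain p1 where p1: "p1 \<in> {1..n}" "row p1 = row p" "(w(p := k)) p1 = k"
            "\<And>p'. p' \<in> {1..n} \<Longrightarrow> row p' = row p \<Longrightarrow> p' \<noteq> p1 \<Longrightarrow> (w(p := k)) p' = row p"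
            using o \<open>successor K k (row p) = k\<close> by (auto simp: one_off_def)
          have "p1 = p" using p1(4)[of p] pw(1) rp by fastforce
          then show ?thesis unfolding one_off_def using pw p1(4) by (intro bexI[of _ p]) auto
        qed
        have "one_off i (successor K (Suc k) i) w" if i: "1 \<le> i" "i < Suc k" for i
        proof (cases "i = k")
          case True
          have "\<And>p'. p' \<in> {1..n} \<Longrightarrow> row p' = k \<Longrightarrow> w p' = k" using kk False by blast
          moreover obtain p' where "p' \<in> {1..n}" "row p' = k" using row_nonempty kb by blast
          ultimately show ?thesis unfolding True sk one_off_def by blast
        next
          case False
          then have ik: "i < k" using i by simp
          show ?thesis
          proof (cases "i = i0")
            case True
            then show ?thesis using oo ri si[OF ik] by simp
          next
            case n: False
            then show ?thesis using si[OF ik] c block_eq[of p i] ri i ik by (simp add: chain_word_def)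
          qed
        qed
        then have "chain_word K (Suc k) w" using out by (simp add: chain_word_def)
        then show ?thesis by blast
      qed
    next
      assume "chain_word K (Suc k) w \<or> (chain_word K k w \<and> one_off k (Suc k) w)"
      then show "\<exists>p. Q p"
      proof
        assume c: "chain_word K k w \<and> one_off k (Suc k) w"
        then obtain p where p: "p \<in> {1..n}" "row p = k" "w p = Suc k"
          "\<And>p'. p' \<in> {1..n} \<Longrightarrow> row p' = k \<Longrightarrow> p' \<noteq> p \<Longrightarrow> w p' = k" by (auto simp: one_off_def)
        have "chain_word K k (w(p := k))"
          using c block_eq[of p] p(1,2) by (auto simp: chain_word_def)
        then show ?thesis using p by (auto simp: Q_def)
      next
        assume c: "chain_word K (Suc k) w"
        have i01: "1 \<le> i0" using i0(1) a1 by simp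
        have "one_off i0 (Suc k) w" using c i0 i01 si[OF i0(2)] by (auto simp: chain_word_def)
        then obtain p where p: "p \<in> {1..n}" "row p = i0" "w p = Suc k"
          "\<And>p'. p' \<in> {1..n} \<Longrightarrow> row p' = i0 \<Longrightarrow> p' \<noteq> p \<Longrightarrow> w p' = i0" by (auto simp: one_off_def)
        have kk: "w p' = k" if "p' \<in> {1..n}" "row p' = k" for p'
        proof -
          have "one_off k (successor K (Suc k) k) w" using c kb(3) unfolding chain_word_def by blast
          then have "one_off k k w" using sk by simp
          from one_off_self[OF this that] show ?thesis .
        qed
        have "one_off i (successor K k i) (w(p := k))" if i: "1 \<le> i" "i < k" for i
        proof (cases "i = i0")
          case True
          show ?thesis unfolding True i0(3) one_off_def using p by (intro bexI[of _ p]) auto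
        next
          case False
          have "one_off i (successor K k i) w" using c i si[OF i(2)] False by (auto simp: chain_word_def)
          then show ?thesis using block_eq[of p i] p(2) False by simp
        qed
        moreover have "(w(p := k)) p' = 0" if "p' \<notin> {1..n}" for p'
          using c that p(1) by (auto simp: chain_word_def)
        ultimately have "chain_word K k (w(p := k))" by (simp add: chain_word_def)
        then show ?thesis using p kk i0(2) by (auto simp: Q_def)
      qed
    qed
    have excl: "\<not> (chain_word K (Suc k) w \<and> one_off k (Suc k) w)"
    proof
      assume c: "chain_word K (Suc k) w \<and> one_off k (Suc k) w"
      then have "one_off k (successor K (Suc k) k) w" using c kb(3) unfolding chain_word_def by blast
      then have "one_off k k w" using sk by simp
      moreover obtain p where "p \<in> {1..n}" "row p = k" "w p = Suc k" using c by (auto simp: one_off_def)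
      ultimately show False using one_off_self by fastforce
    qed
    show ?thesis unfolding D_step[OF kb(1)] using kK fD Df Q_iff excl by auto
  qed
qed

end

section \<open>The image in terms of semistandard tableaux\<close>

lemma image_mset_one_off:
  assumes S: "finite S" and s: "s0 \<in> S"
  shows "image_mset u (mset_set S) = image_mset (\<lambda>j. if j = s0 then x else i) (mset_set S) \<longleftrightarrow>
    (\<exists>j0\<in>S. u j0 = x \<and> (\<forall>j\<in>S. j \<noteq> j0 \<longrightarrow> u j = i))"
proof -
  have split: "image_mset g (mset_set S) = add_mset (g j0) (image_mset g (mset_set (S - {j0})))"
    if "j0 \<in> S" for g :: "'a \<Rightarrow> 'b" and j0
    using mset_set.remove[OF S that] by simp
  have const: "image_mset g (mset_set (S - {j0})) = replicate_mset (card S - 1) i"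
    if "j0 \<in> S" "\<And>j. j \<in> S \<Longrightarrow> j \<noteq> j0 \<Longrightarrow> g j = i" for g :: "'a \<Rightarrow> 'b" and j0
  proof -
    have "image_mset g (mset_set (S - {j0})) = image_mset (\<lambda>_. i) (mset_set (S - {j0}))"
      using that(2) S by (intro image_mset_cong) auto
    then show ?thesis using that(1) S by (simp add: image_mset_const_eq)
  qed
  have rhs: "image_mset (\<lambda>j. if j = s0 then x else i) (mset_set S) = add_mset x (replicate_mset (card S - 1) i)"
    unfolding split[OF s] using const[OF s, of "\<lambda>j. if j = s0 then x else i"] by simp
  show ?thesis unfolding rhs
  proof
    assume e: "image_mset u (mset_set S) = add_mset x (replicate_mset (card S - 1) i)"
    then have "x \<in># image_mset u (mset_set S)" by simp
    then obtain j0 where j0: "j0 \<in> S" "u j0 = x" using S by auto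
    have "image_mset u (mset_set (S - {j0})) = replicate_mset (card S - 1) i"
      using e split[OF j0(1), of u] j0(2) by simp
    then have r: "u ` (S - {j0}) \<subseteq> {i}" using S
      by (metis (no_types, lifting) finite_Diff finite_set_mset_mset_set set_image_mset set_mset_replicate_mset_subset empty_subsetI order_refl)
    show "\<exists>j0\<in>S. u j0 = x \<and> (\<forall>j\<in>S. j \<noteq> j0 \<longrightarrow> u j = i)" using j0 r by blast
  next
    assume "\<exists>j0\<in>S. u j0 = x \<and> (\<forall>j\<in>S. j \<noteq> j0 \<longrightarrow> u j = i)"
    then obtain j0 where j0: "j0 \<in> S" "u j0 = x" "\<And>j. j \<in> S \<Longrightarrow> j \<noteq> j0 \<Longrightarrow> u j = i" by blast
    show "image_mset u (mset_set S) = add_mset x (replicate_mset (card S - 1) i)"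
      unfolding split[OF j0(1)] using const[OF j0(1), of u] j0(2,3) by simp
  qed
qed

lemma image_mset_const_iff:
  assumes "finite S"
  shows "image_mset u (mset_set S) = image_mset (\<lambda>_. i) (mset_set S) \<longleftrightarrow> (\<forall>j\<in>S. u j = i)"
proof
  assume e: "image_mset u (mset_set S) = image_mset (\<lambda>_. i) (mset_set S)"
  show "\<forall>j\<in>S. u j = i"
  proof
    fix j assume "j \<in> S"
    then have "u j \<in># image_mset u (mset_set S)" using assms by simp
    then show "u j = i" unfolding e using assms by auto
  qed
qed (use assms in \<open>auto intro: image_mset_cong\<close>)

context carter_payne
begin

definition "target = lam(a := lam a - 1, b := lam b + 1)"

text \<open>
  The word class of \<open>D_formula\<close> as a tableau with increasing rows: the exceptional letter of a row is
  at its end.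
\<close>

definition target_tab :: "nat set \<Rightarrow> tableau" where
  "target_tab K = (\<lambda>(i, j)\<in>diagram lam. if j = lam i then successor K b i else i)"

lemma row_fixed_row: "row_fixed b (ket row)"
  by (auto simp: row_fixed_def ket_def)

lemma D_row:
  assumes K: "K \<subseteq> {Suc a..<b}"
  shows "D K b (ket row) w = (if chain_word K b w \<and> restore b w = row then 1 else 0)"
  using D_formula[OF _ order_refl K row_fixed_row, of w] ab by (simp add: ket_def)

lemma row_positions:
  "(\<forall>p\<in>{1..n}. row p = i \<longrightarrow> R p) \<longleftrightarrow> (\<forall>j\<in>{1..lam i}. R (row_tab lam (i, j)))" if "1 \<le> i"
proof
  assume L: "\<forall>p\<in>{1..n}. row p = i \<longrightarrow> R p"
  show "\<forall>j\<in>{1..lam i}. R (row_tab lam (i, j))"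
  proof
    fix j assume "j \<in> {1..lam i}"
    then have "(i, j) \<in> diagram lam" using that by (simp add: diagram_def)
    from row_tab_in_range[OF lam_comp this] show "R (row_tab lam (i, j))" using L by blast
  qed
next
  assume L: "\<forall>j\<in>{1..lam i}. R (row_tab lam (i, j))"
  show "\<forall>p\<in>{1..n}. row p = i \<longrightarrow> R p"
  proof (intro ballI impI)
    fix p assume p: "p \<in> {1..n}" "row p = i"
    note s = row_tab_surj[OF lam_comp p(1), unfolded p(2)]
    then have "p - start lam i \<in> {1..lam i}" by (simp add: diagram_def)
    then have "R (row_tab lam (i, p - start lam i))" using L by blast
    then show "R p" using s(2) by simp
  qed
qed

lemma row_positions_ex:
  "(\<exists>p\<in>{1..n}. row p = i \<and> R p) \<longleftrightarrow> (\<exists>j\<in>{1..lam i}. R (row_tab lam (i, j)))" if "1 \<le> i"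
  using row_positions[OF that, of "\<lambda>p. \<not> R p"] by blast

lemma row_tab_inj:
  assumes "1 \<le> i" "j \<in> {1..lam i}" "j' \<in> {1..lam i}"
  shows "row_tab lam (i, j) = row_tab lam (i, j') \<longleftrightarrow> j = j'"
proof -
  have "(i, j) \<in> diagram lam" "(i, j') \<in> diagram lam" using assms by (auto simp: diagram_def)
  then show ?thesis by (simp add: row_tab_eq[OF lam_comp])
qed

lemma one_off_iff_tab:
  assumes i: "1 \<le> i"
  shows "one_off i x w \<longleftrightarrow> (\<exists>j\<in>{1..lam i}. w (row_tab lam (i, j)) = x \<and>
    (\<forall>j'\<in>{1..lam i}. j' \<noteq> j \<longrightarrow> w (row_tab lam (i, j')) = i))"
proof -
  have "one_off i x w \<longleftrightarrow> (\<exists>j\<in>{1..lam i}. w (row_tab lam (i, j)) = x \<and>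
     (\<forall>p'\<in>{1..n}. row p' = i \<longrightarrow> (p' \<noteq> row_tab lam (i, j) \<longrightarrow> w p' = i)))"
    unfolding one_off_def by (rule row_positions_ex[OF i])
  also have "\<dots> \<longleftrightarrow> (\<exists>j\<in>{1..lam i}. w (row_tab lam (i, j)) = x \<and>
     (\<forall>j'\<in>{1..lam i}. row_tab lam (i, j') \<noteq> row_tab lam (i, j) \<longrightarrow> w (row_tab lam (i, j')) = i))"
    unfolding row_positions[OF i] ..
  also have "\<dots> \<longleftrightarrow> (\<exists>j\<in>{1..lam i}. w (row_tab lam (i, j)) = x \<and>
    (\<forall>j'\<in>{1..lam i}. j' \<noteq> j \<longrightarrow> w (row_tab lam (i, j')) = i))"
    by (intro bex_cong conj_cong ball_cong refl) (simp only: row_tab_inj[OF i])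
  finally show ?thesis .
qed

lemma lam_pos: assumes "1 \<le> i" "i < b" shows "1 \<le> lam i"
proof -
  from row_nonempty[OF assms] obtain p where p: "p \<in> {1..n}" "row p = i" .
  from row_tab_surj(1)[OF lam_comp p(1)] show ?thesis using p(2) by (auto simp: diagram_def)
qed

text \<open>
  Both sides prescribe the letters of each row with multiplicity.
\<close>

lemma chain_word_iff_row_equiv:
  assumes w: "\<And>p. p \<notin> {1..n} \<Longrightarrow> w p = 0"
  shows "chain_word K b w \<and> restore b w = row \<longleftrightarrow> row_equiv lam (tableau_of lam w) (target_tab K)"
proof -
  let ?row_i = "\<lambda>i. image_mset (\<lambda>j. tableau_of lam w (i, j)) (mset_set {1..lam i})
    = image_mset (\<lambda>j. target_tab K (i, j)) (mset_set {1..lam i})"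
  have L: "image_mset (\<lambda>j. tableau_of lam w (i, j)) (mset_set {1..lam i})
      = image_mset (\<lambda>j. w (row_tab lam (i, j))) (mset_set {1..lam i})"
    and R: "image_mset (\<lambda>j. target_tab K (i, j)) (mset_set {1..lam i})
      = image_mset (\<lambda>j. if j = lam i then successor K b i else i) (mset_set {1..lam i})"
    if "1 \<le> i" for i
    by (rule image_mset_cong; use that in \<open>simp add: tableau_of_def target_tab_def diagram_def\<close>)+
  have low: "?row_i i \<longleftrightarrow> one_off i (successor K b i) w" if i: "1 \<le> i" "i < b" for i
    unfolding L[OF i(1)] R[OF i(1)] one_off_iff_tab[OF i(1)]
    by (rule image_mset_one_off) (use lam_pos[OF i] in auto)
  have high: "?row_i i \<longleftrightarrow> (\<forall>p\<in>{1..n}. row p = i \<longrightarrow> w p = i)" if i: "1 \<le> i" "b \<le> i" for i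
  proof -
    have s: "(\<lambda>j. if j = lam i then successor K b i else i) = (\<lambda>_. i)"
      using i(2) by (auto simp: successor_def)
    show ?thesis unfolding L[OF i(1)] R[OF i(1)] row_positions[OF i(1)] s
      by (rule image_mset_const_iff) simp
  qed
  have res: "restore b w = row \<longleftrightarrow> (\<forall>i\<ge>1. b \<le> i \<longrightarrow> (\<forall>p\<in>{1..n}. row p = i \<longrightarrow> w p = i))"
  proof
    assume e: "restore b w = row"
    show "\<forall>i\<ge>1. b \<le> i \<longrightarrow> (\<forall>p\<in>{1..n}. row p = i \<longrightarrow> w p = i)"
    proof (intro allI impI ballI)
      fix i p assume "b \<le> i" "row p = i"
      then show "w p = i" using fun_cong[OF e, of p] by (simp add: restore_def)
    qed
  next
    assume h: "\<forall>i\<ge>1. b \<le> i \<longrightarrow> (\<forall>p\<in>{1..n}. row p = i \<longrightarrow> w p = i)"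
    show "restore b w = row"
    proof
      fix p show "restore b w p = row p"
      proof (cases "row p < b")
        case False
        then have "1 \<le> row p" using a1 ab by simp
        then have "p \<in> {1..n}" by (rule row_pos_in)
        then have "w p = row p" using h \<open>1 \<le> row p\<close> False by (metis not_less)
        then show ?thesis by (simp add: restore_def)
      qed (simp add: restore_def)
    qed
  qed
  have "chain_word K b w \<longleftrightarrow> (\<forall>i\<ge>1. i < b \<longrightarrow> ?row_i i)"
    unfolding chain_word_def using w low by blast
  moreover have "restore b w = row \<longleftrightarrow> (\<forall>i\<ge>1. b \<le> i \<longrightarrow> ?row_i i)"
    unfolding res using high by blast
  ultimately show ?thesis unfolding row_equiv_def by (meson not_less)
qed

lemma D_row_words:
  assumes K: "K \<subseteq> {Suc a..<b}" and w: "chain_word K b w" "restore b w = row"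
  shows "w \<in> words n target"
proof -
  have "D K b (ket row) w \<noteq> 0" unfolding D_row[OF K] using w by simp
  moreover have "supported (words n target) (D K b (ket row))"
    unfolding target_def by (rule D_supported[OF _ a1 supported_row]) (use ab in simp)
  ultimately show ?thesis unfolding supported_def by blast
qed

text \<open>
  The content is obtained from the operator: \<open>D K b\<close> has the right effect on contents, and the reading of
  the tableau occurs in its image.  This also shows that \<open>\<mu>\<close> is a composition of \<open>n\<close>.
\<close>

lemma target_tab_in_tableaux:
  assumes K: "K \<subseteq> {Suc a..<b}"
  shows "is_composition n target" "target_tab K \<in> tableaux lam target"
proof -
  let ?w = "reading n lam (target_tab K)"
  have ext: "target_tab K \<in> extensional (diagram lam)" by (simp add: target_tab_def)
  have t: "tableau_of lam ?w = target_tab K" by (rule tableau_of_reading[OF lam_comp ext])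
  have out: "?w p = 0" if "p \<notin> {1..n}" for p using that unfolding reading_def by (simp only: if_False)
  have "row_equiv lam (tableau_of lam ?w) (target_tab K)" unfolding t row_equiv_def by blast
  then have "chain_word K b ?w \<and> restore b ?w = row"
    using chain_word_iff_row_equiv[of ?w K] out by blast
  then have w: "?w \<in> words n target" using D_row_words[OF K] by blast
  show "is_composition n target" by (rule words_composition[OF w])
  show "target_tab K \<in> tableaux lam target" using tableau_of_in_tableaux[OF lam_comp w] unfolding t .
qed

lemma target_comp: "is_composition n target"
  by (rule target_tab_in_tableaux(1)[of "{}"]) simp

lemma Theta_gen_target_tab:
  assumes K: "K \<subseteq> {Suc a..<b}"
  shows "Theta_gen n q lam target (target_tab K) = lift n target (D K b (ket row))"
proof -
  have "(\<lambda>w. if w \<in> words n target \<and> row_equiv lam (tableau_of lam w) (target_tab K) then 1 else 0)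
    = D K b (ket row)"
  proof
    fix w
    have "w \<in> words n target \<and> row_equiv lam (tableau_of lam w) (target_tab K) \<longleftrightarrow>
      chain_word K b w \<and> restore b w = row"
    proof
      assume h: "w \<in> words n target \<and> row_equiv lam (tableau_of lam w) (target_tab K)"
      then have "w p = 0" if "p \<notin> {1..n}" for p using words_D(1) that by blast
      from chain_word_iff_row_equiv[of w, OF this] h show "chain_word K b w \<and> restore b w = row" by blast
    next
      assume h: "chain_word K b w \<and> restore b w = row"
      then have "w p = 0" if "p \<notin> {1..n}" for p using that unfolding chain_word_def by blast
      from chain_word_iff_row_equiv[of w K, OF this] h D_row_words[OF K]
      show "w \<in> words n target \<and> row_equiv lam (tableau_of lam w) (target_tab K)" by blast
    qed
    then show "(if w \<in> words n target \<and> row_equiv lam (tableau_of lam w) (target_tab K) then 1 else 0)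
      = D K b (ket row) w" unfolding D_row[OF K] by (simp only:)
  qed
  then show ?thesis unfolding Theta_gen_eq_lift[OF lam_comp target_comp] by (simp only:)
qed

text \<open>
  The sets for which the tableau is semistandard: in a column, the entry \<open>successor K b i\<close> at the end of row
  \<open>i\<close> would fail to be smaller than the entry below it just if the next row has the same length and
  keeps its letters.
\<close>

definition flat_closed :: "nat set \<Rightarrow> bool" where
  "flat_closed K \<longleftrightarrow> K \<subseteq> {Suc a..<b} \<and> (\<forall>l\<in>K. Suc l < b \<longrightarrow> lam l = lam (Suc l) \<longrightarrow> Suc l \<in> K)"

lemma successor_ge: "K \<subseteq> {Suc a..<b} \<Longrightarrow> i \<le> successor K b i"
  using successor_props(1)[of K i b] by (cases "i \<in> insert a K \<and> i < b") (auto simp: successor_def)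

lemma target_tab_semistandard:
  assumes K: "flat_closed K"
  shows "target_tab K \<in> semistandard_tableaux lam target"
proof -
  have Ks: "K \<subseteq> {Suc a..<b}" using K by (simp add: flat_closed_def)
  have col: "target_tab K (i, j) < target_tab K (i', j)"
    if d: "(i, j) \<in> diagram lam" "(i', j) \<in> diagram lam" and ii: "i < i'" for i i' j
  proof -
    have v': "i' \<le> target_tab K (i', j)" using d(2) successor_ge[OF Ks] by (simp add: target_tab_def)
    show ?thesis
    proof (cases "j = lam i \<and> i \<in> insert a K \<and> i < b")
      case False
      then have "target_tab K (i, j) = i"
        using d(1) unfolding target_tab_def successor_def by (simp only: restrict_apply prod.case if_True) argo
      then show ?thesis using v' ii by simp
    next
      case True
      have j: "j = lam i" using True by blast
      have i1: "1 \<le> i" "lam i \<le> lam i'" using d unfolding j by (simp_all add: diagram_def)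
      have eq: "lam m = lam i" if "i \<le> m" "m \<le> i'" for m
      proof (rule le_antisym)
        show "lam m \<le> lam i" by (rule partition_mono[OF part i1(1) that(1)])
        have "1 \<le> m" using i1(1) that(1) by linarith
        from partition_mono[OF part this that(2)] show "lam i \<le> lam m" using i1(2) by linarith
      qed
      have "i' < b"
      proof (rule ccontr)
        assume "\<not> i' < b"
        then have "lam b = lam i" "lam (b - 1) = lam i" using True by (intro eq; linarith)+
        then show False using last by linarith
      qed
      have "i \<noteq> a"
      proof
        assume "i = a"
        then show False using eq[of "Suc a"] ii dec_a by simp
      qed
      then have iK: "i \<in> K" using True by simp
      have "m \<in> K" if "i \<le> m" "m \<le> i'" for m
        using that
      proof (induction m rule: dec_induct)
        case (step m)
        then have m: "m \<in> K" "lam m = lam (Suc m)" "Suc m < b"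
          using eq[of m] eq[of "Suc m"] \<open>i' < b\<close> by auto
        then show ?case using K unfolding flat_closed_def by blast
      qed (rule iK)
      then have i'K: "i' \<in> K" using ii by simp
      have "successor K b i \<le> i'" using successor_props(4)[OF Ks, of i b i'] True i'K ii by blast
      moreover have "i' < successor K b i'" using successor_props(1)[OF Ks, of i' b] i'K \<open>i' < b\<close> by blast
      moreover have "lam i' = j" using eq[of i'] ii j by simp
      moreover have "target_tab K (i, j) = successor K b i" "target_tab K (i', j) = successor K b i'"
        using d j \<open>lam i' = j\<close> by (simp_all add: target_tab_def)
      ultimately show ?thesis by linarith
    qed
  qed
  have "target_tab K (i, j) \<le> target_tab K (i, j')"
    if d: "(i, j) \<in> diagram lam" "(i, j') \<in> diagram lam" and jj: "j < j'" for i j j'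
  proof -
    have "j < lam i" using d jj by (simp add: diagram_def)
    then have "target_tab K (i, j) = i" using d by (simp add: target_tab_def)
    then show ?thesis using d successor_ge[OF Ks] by (simp add: target_tab_def)
  qed
  then show ?thesis using col target_tab_in_tableaux(2)[OF Ks] unfolding semistandard_tableaux_def by blast
qed

lemma lowering_specht_flat:
  assumes "1 \<le> l" "lam l = lam (Suc l)" "v \<in> specht" shows "f l v = 0"
proof -
  obtain h where "v = act n q specht_vec h" using assms(3) by (auto simp: specht_def)
  then show ?thesis
    using wcommuting_act[OF wcommuting_lowering, of n q l specht_vec h] lowering_specht_vec_flat[OF assms(1,2)]
      hlinearD(3)[OF hlinear_act] by simp
qed

text \<open>
  Repeated application of \<open>D_flip\<close>; each step enlarges \<open>K\<close> by a row of the segment.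
\<close>

lemma ex_flat_closed:
  assumes "K \<subseteq> {Suc a..<b}"
  shows "\<exists>K' s. flat_closed K' \<and> (\<forall>v\<in>specht. D K b v = hscale s (D K' b v))"
  using assms
proof (induction "card ({Suc a..<b} - K)" arbitrary: K rule: less_induct)
  case less
  show ?case
  proof (cases "flat_closed K")
    case True
    then show ?thesis by (intro exI[of _ K] exI[of _ 1]) (simp add: hscale_def)
  next
    case False
    then obtain l where l: "l \<in> K" "Suc l < b" "lam l = lam (Suc l)" "Suc l \<notin> K"
      using less.prems by (auto simp: flat_closed_def)
    have la: "Suc a \<le> l" using l(1) less.prems by auto
    let ?K = "insert (Suc l) K"
    have K: "?K \<subseteq> {Suc a..<b}" using less.prems l(2) la by auto
    have "card ({Suc a..<b} - ?K) < card ({Suc a..<b} - K)"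
    proof (rule psubset_card_mono)
      have "Suc l \<in> {Suc a..<b} - K" using l(2,4) la by simp
      then show "{Suc a..<b} - ?K \<subset> {Suc a..<b} - K" by blast
    qed simp
    from less.hyps[OF this K] obtain K' s
      where K': "flat_closed K'" and eq: "\<forall>v\<in>specht. D ?K b v = hscale s (D K' b v)"
      by (elim exE conjE) (rule that)
    have "D K b v = hscale (- s) (D K' b v)" if v: "v \<in> specht" for v
    proof -
      have "f l v = 0" using lowering_specht_flat[OF _ l(3) v] la by simp
      then have "D K b v = - D ?K b v" 
        using l(2) la by (intro D_flip[OF l(1,4)]) auto
      then show ?thesis using bspec[OF eq v] by (simp add: hscale_def fun_eq_iff fapply)
    qed
    then show ?thesis using K' by blast
  qed
qed

lemma specht_module_lift: "specht_module n q lam = lift n lam ` specht"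
  unfolding specht_module_eq specht_def by blast

lemma finite_semistandard: "finite (semistandard_tableaux lam target)"
  by (rule finite_subset[OF _ finite_tableaux(1)[OF lam_comp target_comp]]) (auto simp: semistandard_tableaux_def)

lemma Theta_hat_target_tab:
  assumes K: "K \<subseteq> {Suc a..<b}" and v: "v \<in> specht"
  shows "Theta_hat n q lam target (target_tab K) (lift n lam v) = lift n target (D K b v)"
proof -
  obtain h where h: "h \<in> hecke_carrier n" "v = act n q specht_vec h" using v by (auto simp: specht_def)
  let ?h = "hmult n q (hmult n q (T (w_perm n lam)) y) h"
  have hc: "?h \<in> hecke_carrier n"
    by (intro hmult_in_carrier T_in_carrier w_perm_props h(1))
  have wc: "wcommuting n q (D K b)" using ab by (intro D_wcommuting) simp
  have "Theta n q lam target (target_tab K) (lift n lam (act n q (ket row) ?h)) = lift n target (D K b (act n q (ket row) ?h))"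
    by (rule Theta_lift[where L="D K b", OF lam_comp target_comp wc Theta_gen_target_tab[OF K] hc])
  moreover have "v = act n q (ket row) ?h" unfolding h(2) by (rule specht_vec_eq)
  moreover have "lift n lam v \<in> specht_module n q lam" unfolding specht_module_lift using v by blast
  ultimately show ?thesis unfolding Theta_hat_def by simp
qed

lemma commutator_span_semistandard:
  assumes "commutator_span b L"
  shows "\<exists>c. \<forall>v\<in>specht. lift n target (L v) =
    (\<Sum>A\<in>semistandard_tableaux lam target. hscale (c A) (Theta_hat n q lam target A (lift n lam v)))"
  using assms
proof (induction rule: commutator_span.induct)
  case (base K)
  from ex_flat_closed[OF base] obtain K' s where K': "flat_closed K'"
    and eq: "\<And>v. v \<in> specht \<Longrightarrow> D K b v = hscale s (D K' b v)" by blast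
  have sub: "K' \<subseteq> {Suc a..<b}" using K' by (simp add: flat_closed_def)
  show ?case
  proof (intro exI[of _ "\<lambda>A. if A = target_tab K' then s else 0"] ballI)
    fix v assume v: "v \<in> specht"
    let ?g = "\<lambda>A. Theta_hat n q lam target A (lift n lam v)"
    have "(\<Sum>A\<in>semistandard_tableaux lam target. hscale (if A = target_tab K' then s else 0) (?g A))
      = (\<Sum>A\<in>semistandard_tableaux lam target. if A = target_tab K' then hscale s (?g A) else 0)"
      by (rule sum.cong) (auto simp: hscale_def fun_eq_iff fapply)
    also have "\<dots> = hscale s (?g (target_tab K'))"
      using finite_semistandard target_tab_semistandard[OF K'] by simp
    also have "\<dots> = lift n target (D K b v)"
      unfolding Theta_hat_target_tab[OF sub v] eq[OF v] by (rule hlinearD(2)[OF hlinear_lift, symmetric])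
    finally show "lift n target (D K b v) = (\<Sum>A\<in>semistandard_tableaux lam target.
        hscale (if A = target_tab K' then s else 0) (?g A))" by simp
  qed
next
  case (add L M)
  then obtain c d where
    c: "\<And>v. v \<in> specht \<Longrightarrow> lift n target (L v) =
      (\<Sum>A\<in>semistandard_tableaux lam target. hscale (c A) (Theta_hat n q lam target A (lift n lam v)))" and
    d: "\<And>v. v \<in> specht \<Longrightarrow> lift n target (M v) =
      (\<Sum>A\<in>semistandard_tableaux lam target. hscale (d A) (Theta_hat n q lam target A (lift n lam v)))" by blast
  show ?case
    by (intro exI[of _ "\<lambda>A. c A + d A"] ballI)
      (simp add: hlinearD(1)[OF hlinear_lift] c d hscale_add_left sum.distrib)
next
  case (scale L s)
  then obtain c where
    c: "\<And>v. v \<in> specht \<Longrightarrow> lift n target (L v) =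
      (\<Sum>A\<in>semistandard_tableaux lam target. hscale (c A) (Theta_hat n q lam target A (lift n lam v)))" by blast
  show ?case
    by (intro exI[of _ "\<lambda>A. s * c A"] ballI)
      (simp add: hlinearD(2)[OF hlinear_lift] c hscale_sum)
qed

lemma sum_target:
  "sum lam {1..i} = sum target {1..i} + (if a \<le> i \<and> i < b then 1 else 0)"
proof (induction i)
  case (Suc i)
  have "1 \<le> lam a" using pos[of a] ab by simp
  then show ?case using Suc.IH ab a1 unfolding target_def by (auto simp: less_Suc_eq le_Suc_eq One_nat_def)
qed (use a1 in simp)

text \<open>
  By weight, the image under \<open>e\<^sub>i\<^sup>(\<^sup>t\<^sup>)\<close> can be non-zero only if \<open>t = 1\<close> and \<open>a \<le> i < b\<close>: otherwise it would have
  more than \<open>\<lambda>\<^sub>1 + \<dots> + \<lambda>\<^sub>i\<close> letters up to \<open>i\<close>.  The remaining cases are \<open>chain_singular\<close>.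
\<close>

lemma chain_specht_vec_in_specht:
  assumes mu: "is_partition n target" and axial: "qnum q (lam a + (b - 1 - a)) = qnum q (lam b)"
  shows "P b specht_vec \<in> partition_blocks.specht n q target"
proof -
  interpret M: partition_blocks n q target by unfold_locales (rule mu, rule q_nz)
  have ob: "commutator_span b (P b)" using chain_commutator_span[of b] ab by simp
  have wc: "wcommuting n q (P b)" by (rule commutator_span_wcommuting[OF ob]) (use ab in simp)
  have sup: "supported (words n target) (P b v)" if "supported (words n lam) v" for v
    unfolding target_def by (rule commutator_span_supported[OF ob _ a1 that]) (use ab in simp)
  have "raising n q i t (P b specht_vec) = 0" if it: "1 \<le> i" "1 \<le> t" for i t
  proof (cases "t = 1 \<and> a \<le> i \<and> i < b")
    case True
    then show ?thesis using chain_singular[OF ab level_specht_vec axial, of i] by simp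
  next
    case False
    show ?thesis
    proof (rule specht_eq_0[where L="\<lambda>v. raising n q i t (P b v)"])
      show "wcommuting n q (\<lambda>v. raising n q i t (P b v))" by (rule wcommuting_compose[OF wcommuting_raising wc])
      show "supported (words n (target(i := target i + t, Suc i := target (Suc i) - t))) (raising n q i t (P b (ket col)))"
        by (rule supported_raising[OF sup[OF supported_col]]) (use it in simp)
      show "finite {1..i}" by simp
      obtain m where m: "i = Suc m" using it by (cases i) auto
      have "sum (target(i := target i + t, Suc i := target (Suc i) - t)) {1..m} = sum target {1..m}"
        by (rule sum.cong) (auto simp: m)
      then have "sum (target(i := target i + t, Suc i := target (Suc i) - t)) {1..i} = sum target {1..i} + t"
        unfolding m by simp
      then show "sum lam {1..card {1..i}} < sum (target(i := target i + t, Suc i := target (Suc i) - t)) {1..i}"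
        using sum_target[of i] False it by (auto split: if_splits)
    qed
  qed
  then show ?thesis by (intro M.kernel_intersection sup supported_specht_vec)
qed

text \<open>
  The operator \<open>P b\<close> commutes with the Hecke algebra, so it maps the whole Specht module of \<open>\<lambda>\<close> into that of
  \<open>\<mu>\<close> as soon as it does so with the generator.
\<close>

theorem semistandard_hom:
  assumes mu: "is_partition n target" and axial: "qnum q (lam a + (b - 1 - a)) = qnum q (lam b)"
  shows "\<exists>\<Theta> f. \<Theta> \<in> hecke_hom n q (specht_module n q lam) (specht_module n q target) \<and>
    (\<exists>v\<in>specht_module n q lam. \<Theta> v \<noteq> 0) \<and>
    (\<forall>v\<in>specht_module n q lam.
      \<Theta> v = (\<Sum>A\<in>semistandard_tableaux lam target. hscale (f A) (Theta_hat n q lam target A v)))"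
proof -
  interpret M: partition_blocks n q target by unfold_locales (rule mu, rule q_nz)
  have ob: "commutator_span b (P b)" using chain_commutator_span[of b] ab by simp
  have wc: "wcommuting n q (P b)" by (rule commutator_span_wcommuting[OF ob]) (use ab in simp)
  note lin = wcommuting_hlinear[OF wc]
  have sup: "supported (words n target) (P b v)" if "supported (words n lam) v" for v
    unfolding target_def by (rule commutator_span_supported[OF ob _ a1 that]) (use ab in simp)
  have Mspecht: "specht_module n q target = lift n target ` M.specht"
    unfolding M.specht_module_eq M.specht_def by blast
  from commutator_span_semistandard[OF ob] obtain c where c: "\<And>v. v \<in> specht \<Longrightarrow> lift n target (P b v) =
    (\<Sum>A\<in>semistandard_tableaux lam target. hscale (c A) (Theta_hat n q lam target A (lift n lam v)))" by blast
  define \<Theta> where "\<Theta> v = (\<Sum>A\<in>semistandard_tableaux lam target. hscale (c A) (Theta_hat n q lam target A v))" for v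
  have \<Theta>: "\<Theta> (lift n lam v) = lift n target (P b v)" if "v \<in> specht" for v
    unfolding \<Theta>_def using c[OF that] by (rule sym)
  have in_M: "P b v \<in> M.specht" if v: "v \<in> specht" for v
  proof -
    obtain h where h: "h \<in> hecke_carrier n" "v = act n q specht_vec h" using v unfolding specht_def by blast
    show ?thesis unfolding h(2) wcommuting_act[OF wc]
      by (rule M.specht_closed(4)[OF chain_specht_vec_in_specht[OF mu axial] h(1)])
  qed
  have "\<Theta> \<in> hecke_hom n q (specht_module n q lam) (specht_module n q target)"
    unfolding hecke_hom_def specht_module_lift Mspecht
  proof (intro CollectI conjI ballI Pi_I)
    fix x assume "x \<in> lift n lam ` specht"
    then obtain u where u: "u \<in> specht" "x = lift n lam u" by blast
    show "\<Theta> x \<in> lift n target ` M.specht" unfolding u(2) \<Theta>[OF u(1)] using in_M[OF u(1)] by blast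
    show "\<Theta> (x + z) = \<Theta> x + \<Theta> z" if z: "z \<in> lift n lam ` specht" for z
    proof -
      obtain w where w: "w \<in> specht" "z = lift n lam w" using z by blast
      have "x + z = lift n lam (u + w)" unfolding u(2) w(2) by (rule hlinearD(1)[OF hlinear_lift, symmetric])
      then have "\<Theta> (x + z) = lift n target (P b (u + w))"
        by (simp only: \<Theta>[OF specht_closed(2)[OF u(1) w(1)]])
      then show ?thesis
        by (simp only: u(2) w(2) \<Theta>[OF u(1)] \<Theta>[OF w(1)] hlinearD(1)[OF lin] hlinearD(1)[OF hlinear_lift])
    qed
    show "\<Theta> (hmult n q x h) = hmult n q (\<Theta> x) h" if h: "h \<in> hecke_carrier n" for h
      unfolding u(2) \<Theta>[OF u(1)] hmult_lift[OF lam_comp] hmult_lift[OF target_comp]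
        \<Theta>[OF specht_closed(4)[OF u(1) h]] wcommuting_act[OF wc] ..
  qed
  moreover have "\<Theta> (lift n lam specht_vec) \<noteq> 0"
  proof
    assume "\<Theta> (lift n lam specht_vec) = 0"
    then have "lift n target (P b specht_vec) = lift n target 0"
      unfolding \<Theta>[OF specht_closed(5)] hlinearD(3)[OF hlinear_lift] .
    then have "P b specht_vec = 0" by (rule lift_inject[OF sup[OF supported_specht_vec] supported_0])
    then show False using chain_specht_vec_nonzero by contradiction
  qed
  moreover have "lift n lam specht_vec \<in> specht_module n q lam"
    unfolding specht_module_lift using specht_closed(5) by blast
  ultimately show ?thesis
    by (intro exI[of _ \<Theta>] exI[of _ c]) (auto simp: \<Theta>_def)
qed

end

section \<open>Existence of the homomorphism\<close>

text \<open>
  \<open>[e k] = [e] (1 + q\<^sup>e + \<dots>)\<close>, here by induction on \<open>k\<close>.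
\<close>

lemma quantum_char_dvd:
  assumes "quantum_char q dvd enat m" "0 < m" shows "qnum q m = 0"
proof -
  have ex: "\<exists>e>1. (\<Sum>i<e. q ^ i) = 0"
  proof (rule ccontr)
    assume "\<not> ?thesis"
    then have "quantum_char q = \<infinity>" unfolding quantum_char_def by (simp only: if_False)
    then show False using assms infinity_dvd_enat by simp
  qed
  define e where "e = (LEAST e. 1 < e \<and> (\<Sum>i<e. q ^ i) = 0)"
  have e: "1 < e" "qnum q e = 0" unfolding e_def qnum_def using LeastI_ex[OF ex] by auto
  have "quantum_char q = enat e" unfolding quantum_char_def e_def using ex by (simp only: if_True)
  then obtain k where k: "m = e * k" using assms(1) enat_dvd_enat[of e m] e(1) by auto
  have "qnum q (e * k) = 0" for k
  proof (induction k)
    case (Suc k)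
    then show ?case using qnum_add[of q e "e * k"] e(2) by simp
  qed simp
  then show ?thesis using k by simp
qed

text \<open>
  With the truncated subtraction, the new composition would have \<open>n + 1\<close> nodes.  So the hypotheses of the
  theorem force \<open>\<mu>\<^sub>b > 0\<close>.
\<close>

lemma not_composition_truncated:
  assumes c: "is_composition n mu" and pos: "mu b = 0" and "a \<noteq> b" shows "\<not> is_composition n (mu(a := mu a + 1, b := mu b - 1))"
proof
  let ?lam = "mu(a := mu a + 1, b := mu b - 1)"
  assume l: "is_composition n ?lam"
  have eq: "?lam = mu(a := mu a + 1)" using pos assms(3) by (auto simp: fun_eq_iff)
  have "diagram ?lam = insert (a, mu a + 1) (diagram mu)"
  proof -
    have "a \<noteq> 0" using l assms(3) by (auto simp: is_composition_def split: if_splits)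
    then show ?thesis unfolding eq by (auto simp: diagram_def le_Suc_eq split: if_splits)
  qed
  moreover have "(a, mu a + 1) \<notin> diagram mu" by (simp add: diagram_def)
  ultimately have "card (diagram ?lam) = Suc (card (diagram mu))" using card_diagram(1)[OF c] by simp
  then show False using card_diagram(2)[OF c] card_diagram(2)[OF l] by simp
qed

theorem theorem4p1p1:
  fixes q :: "'f::field" and n r a b :: nat and lam mu :: "nat \<Rightarrow> nat"
  assumes "q \<noteq> 0" and "n \<ge> 1"
    and "1 \<le> a" and "a < b" and "b \<le> r"
    and "\<forall>i>r. mu i = 0"
    and "lam = mu(a := mu a + 1, b := mu b - 1)"
    and "is_partition n mu" and "is_partition n lam"
    and "quantum_char q dvd enat (mu a - mu b + (b - a) + 1)"
  shows "\<exists>\<Theta> f. \<Theta> \<in> hecke_hom n q (specht_module n q lam) (specht_module n q mu) \<and>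
           (\<exists>v\<in>specht_module n q lam. \<Theta> v \<noteq> 0) \<and>
           (\<forall>v\<in>specht_module n q lam.
              \<Theta> v = (\<Sum>A\<in>semistandard_tableaux lam mu. hscale (f A) (Theta_hat n q lam mu A v)))"
proof -
  note lam = assms(7) and ab = assms(4) and mu = assms(8)
  have mub: "1 \<le> mu b"
  proof (rule ccontr)
    assume "\<not> 1 \<le> mu b"
    then have "mu b = 0" by simp
    then show False using not_composition_truncated[of n mu b a] mu assms(9) ab unfolding lam is_partition_def by blast
  qed
  have la: "lam a = mu a + 1" and lb: "lam b = mu b - 1" using ab by (simp_all add: lam)
  have lo: "lam k = mu k" if "k \<noteq> a" "k \<noteq> b" for k using that by (simp add: lam)
  have le: "lam k \<le> mu k" if "k \<noteq> a" for k using lo[of k] lb that by (cases "k = b") auto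
  have ge: "mu k \<le> lam k" if "k \<noteq> b" for k using lo[of k] la that by (cases "k = a") auto
  interpret carter_payne n q lam a b
  proof
    show "is_partition n lam" by (rule assms(9))
    show "q \<noteq> 0" "1 \<le> a" "a < b" by (rule assms(1) assms(3) assms(4))+
    show "lam (Suc k) \<le> lam k" if "a \<le> k" "k < b" for k
      using partition_mono[OF assms(9), of k "Suc k"] that assms(3) by simp
    show "lam (Suc a) < lam a" using le[of "Suc a"] partition_mono[OF mu assms(3), of "Suc a"] la by simp
    show "1 \<le> lam k" if k: "a \<le> k" "k < b" for k
      using partition_mono[OF mu, of k b] ge[of k] k assms(3) mub by simp
    show "lam b < lam (b - 1)"
    proof -
      have "b - 1 \<noteq> b" "1 \<le> b - 1" "b - 1 \<le> b" using ab assms(3) by linarith+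
      from ge[OF this(1)] partition_mono[OF mu this(2,3)] show ?thesis using lb mub by linarith
    qed
  qed
  have target: "target = mu" unfolding target_def using la lb lo mub ab by (auto simp: fun_eq_iff)
  have "qnum q (mu a - mu b + (b - a) + 1) = 0" by (rule quantum_char_dvd[OF assms(10)]) simp
  moreover have "lam a + (b - 1 - a) = lam b + (mu a - mu b + (b - a) + 1)"
    using la lb mub ab partition_mono[OF mu assms(3), of b] by simp
  ultimately have axial: "qnum q (lam a + (b - 1 - a)) = qnum q (lam b)" by (simp only: qnum_add)  simp
  show ?thesis using semistandard_hom[unfolded target, OF mu axial] .
qed

end
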